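(* In $\mathsf{THS}$, let $\mathbb{R}$ be a fixed field of real numbers. There exists a unique surjective ring homomorphism $\mathrm{st}:\mathbb{Q}_b\to\mathbb{R}$, and its kernel is $\mu(0)$.
   Context: $\mathsf{THS}$ is a first-order class theory in the language $\{\in\}$; sets are classes belonging to classes; it has axioms of extensionality, class comprehension for arbitrary formulas, set formation ($\emptyset$, $x\cup\{y\}$), $\in$-induction for set formulas, (Thin) every thin class is contained in a set, (Comp) for thin $X$ and set $u\subseteq\bigcup X$ there is a set $x\subseteq X$ with $u\subseteq\bigcup x$, (Exp) for thin $X$ there is thin $P$ with $\forall y\exists p\in P(y\cap X=p\cap X)$, Choice for classes with thin domain, dependent choices along $\mathbb{SN}$, and transfer of set formulas to $\mathbb{S}$. Here a class is small iff all its subclasses are sets, thin iff all its subsets are small; $\mathbb{SN}$ is the smallest class containing $\emptyset$ closed under $n\mapsto n\cup\{n\}$; $\mathbb{S}$ (standard sets) is the smallest class containing $\emptyset$ closed under $(a,b)\mapsto a\cup\{b\}$. $\mathbb{Q}$ is the field of all rationals (built from all natural numbers, i.e. transitive sets linearly ordered by $\in$); $\mathbb{SQ}=\mathbb{Q}\cap\mathbb{S}$ (a subfield). $\mathbb{Q}_b=\{x\in\mathbb{Q}:\exists r\in\mathbb{SQ}\,(|x|<r)\}$ (a subring) and $\mu(0)=\{\alpha\in\mathbb{Q}_b:\forall r\in\mathbb{SQ}(r>0\to|\alpha|<r)\}$. A field of real numbers is a class $\langle R;+,\cdot,\le\rangle$ satisfying the axioms of a linearly ordered field in which every bounded above subclass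 has a supremum. *)

theory Defs
  imports "HOL-Algebra.RingHom"
begin

text \<open>Variables are natural numbers. In \<^term>\<open>sat m D e \<phi>\<close> every quantifier ranges over \<^term>\<open>D\<close>.
  With \<^term>\<open>D = UNIV\<close> the quantifiers range over all classes; with \<^term>\<open>D\<close> the collection of all
  sets, \<open>\<phi>\<close> is read as a set formula; with \<^term>\<open>D\<close> the collection of standard sets, as
  the relativization of that set formula.\<close>

datatype fm = Mem nat nat | Eq nat nat | Neg fm | Conj fm fm | All nat fm

primrec sat :: "('c \<Rightarrow> 'c \<Rightarrow> bool) \<Rightarrow> 'c set \<Rightarrow> (nat \<Rightarrow> 'c) \<Rightarrow> fm \<Rightarrow> bool" where
  "sat m D e (Mem i j) \<longleftrightarrow> m (e i) (e j)"
| "sat m D e (Eq i j) \<longleftrightarrow> e i = e j"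
| "sat m D e (Neg \<phi>) \<longleftrightarrow> \<not> sat m D e \<phi>"
| "sat m D e (Conj \<phi> \<psi>) \<longleftrightarrow> sat m D e \<phi> \<and> sat m D e \<psi>"
| "sat m D e (All i \<phi>) \<longleftrightarrow> (\<forall>x\<in>D. sat m D (e(i := x)) \<phi>)"

text \<open>The elements of the type \<open>'c\<close> are the classes of a structure for the language of
  membership. HOL sets of type \<open>'c set\<close> serve only as names for collections of elements of the
  structure; every quantification over classes ranges over \<open>'c\<close>.\<close>

locale class_structure =
  fixes mem :: "'c \<Rightarrow> 'c \<Rightarrow> bool"  (infix \<open>\<epsilon>\<close> 50)
begin

definition elts :: "'c \<Rightarrow> 'c set" where
  "elts X = {x. x \<epsilon> X}"

definition V :: "'c set" where
  "V = {x. \<exists>Y. x \<epsilon> Y}"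

definition small :: "'c \<Rightarrow> bool" where
  "small X \<longleftrightarrow> (\<forall>Y. elts Y \<subseteq> elts X \<longrightarrow> Y \<in> V)"

definition thin :: "'c \<Rightarrow> bool" where
  "thin X \<longleftrightarrow> (\<forall>y\<in>V. elts y \<subseteq> elts X \<longrightarrow> small y)"

text \<open>The axioms make the descriptions below proper whenever the arguments are sets; pairs of
  proper classes are never used.\<close>

definition emp :: 'c where
  "emp = (THE z. elts z = {})"

definition adj :: "'c \<Rightarrow> 'c \<Rightarrow> 'c" where
  "adj x y = (THE z. elts z = insert y (elts x))"

definition suc :: "'c \<Rightarrow> 'c" where
  "suc n = adj n n"

definition upair :: "'c \<Rightarrow> 'c \<Rightarrow> 'c" where
  "upair x y = adj (adj emp x) y"

definition pair :: "'c \<Rightarrow> 'c \<Rightarrow> 'c" where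
  "pair x y = upair (upair x x) (upair x y)"

definition SN :: "'c set" where
  "SN = \<Inter> {elts X | X. emp \<epsilon> X \<and> (\<forall>n. n \<epsilon> X \<longrightarrow> suc n \<epsilon> X)}"

definition S :: "'c set" where
  "S = \<Inter> {elts X | X. emp \<epsilon> X \<and> (\<forall>a b. a \<epsilon> X \<and> b \<epsilon> X \<longrightarrow> adj a b \<epsilon> X)}"

definition fun_on :: "'c \<Rightarrow> 'c set \<Rightarrow> bool" where
  "fun_on F D \<longleftrightarrow>
     (\<forall>p\<in>elts F. \<exists>x\<in>D. \<exists>y\<in>V. p = pair x y) \<and>
     (\<forall>x\<in>D. \<exists>!y. y \<in> V \<and> pair x y \<epsilon> F)"

definition app :: "'c \<Rightarrow> 'c \<Rightarrow> 'c" where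
  "app F x = (THE y. y \<in> V \<and> pair x y \<epsilon> F)"

definition fun_into :: "'c \<Rightarrow> 'c set \<Rightarrow> 'c set \<Rightarrow> bool" where
  "fun_into F D C \<longleftrightarrow> fun_on F D \<and> (\<forall>x\<in>D. app F x \<in> C)"

end

locale THS = class_structure mem
  for mem :: "'c \<Rightarrow> 'c \<Rightarrow> bool"  (infix \<open>\<epsilon>\<close> 50) +
  assumes extensionality:
    "elts X = elts Y \<Longrightarrow> X = Y"
  and comprehension:
    "\<exists>X. \<forall>x. x \<epsilon> X \<longleftrightarrow> x \<in> V \<and> sat (\<epsilon>) UNIV (e(v := x)) \<phi>"
  and empty_set:
    "\<exists>z\<in>V. elts z = {}"
  and adjunction:
    "\<lbrakk>x \<in> V; y \<in> V\<rbrakk> \<Longrightarrow> \<exists>z\<in>V. elts z = insert y (elts x)"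
  and mem_induction:
    "\<lbrakk>range e \<subseteq> V;
      \<forall>x\<in>V. (\<forall>y\<in>elts x. sat (\<epsilon>) V (e(v := y)) \<phi>) \<longrightarrow> sat (\<epsilon>) V (e(v := x)) \<phi>\<rbrakk>
     \<Longrightarrow> \<forall>x\<in>V. sat (\<epsilon>) V (e(v := x)) \<phi>"
  and Thin:
    "thin X \<Longrightarrow> \<exists>y\<in>V. elts X \<subseteq> elts y"
  and Comp:
    "\<lbrakk>thin X; u \<in> V; elts u \<subseteq> \<Union> (elts ` elts X)\<rbrakk>
     \<Longrightarrow> \<exists>x\<in>V. elts x \<subseteq> elts X \<and> elts u \<subseteq> \<Union> (elts ` elts x)"
  and Exp:
    "thin X \<Longrightarrow> \<exists>P. thin P \<and> (\<forall>y\<in>V. \<exists>p\<in>elts P. elts y \<inter> elts X = elts p \<inter> elts X)"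
  and Choice:
    "\<lbrakk>elts D = {x\<in>V. \<exists>y\<in>V. pair x y \<epsilon> R}; thin D\<rbrakk>
     \<Longrightarrow> \<exists>F. elts F \<subseteq> elts R \<and> fun_on F (elts D)"
  and dependent_choice:
    "\<lbrakk>\<forall>x\<in>elts X. \<exists>y\<in>elts X. pair x y \<epsilon> R; a \<epsilon> X\<rbrakk>
     \<Longrightarrow> \<exists>F. fun_into F SN (elts X) \<and> app F emp = a \<and>
             (\<forall>n\<in>SN. pair (app F n) (app F (suc n)) \<epsilon> R)"
  and transfer:
    "range e \<subseteq> S \<Longrightarrow> sat (\<epsilon>) V e \<phi> \<longleftrightarrow> sat (\<epsilon>) S e \<phi>"

context class_structure
begin

definition N :: "'c set" where
  "N = {n\<in>V. (\<forall>x\<in>elts n. elts x \<subseteq> elts n) \<and>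
             irreflp_on (elts n) (\<epsilon>) \<and> transp_on (elts n) (\<epsilon>) \<and> totalp_on (elts n) (\<epsilon>)}"

text \<open>Iteration must be witnessed by a function that is a \<^emph>\<open>set\<close>: the natural numbers need not
  be standard, and the recursion equations do not determine a proper class of pairs uniquely.\<close>

definition iter :: "('c \<Rightarrow> 'c) \<Rightarrow> 'c \<Rightarrow> 'c \<Rightarrow> 'c" where
  "iter g a n = (THE k. k \<in> V \<and> (\<exists>f\<in>V. fun_on f (elts (suc n)) \<and> pair emp a \<epsilon> f \<and>
     (\<forall>i\<in>elts n. \<forall>v\<in>V. pair i v \<epsilon> f \<longrightarrow> pair (suc i) (g v) \<epsilon> f) \<and> pair n k \<epsilon> f))"

definition nadd :: "'c \<Rightarrow> 'c \<Rightarrow> 'c"  (infixl \<open>+\<^sub>N\<close> 65) where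
  "m +\<^sub>N n = iter suc m n"

definition nmul :: "'c \<Rightarrow> 'c \<Rightarrow> 'c"  (infixl \<open>*\<^sub>N\<close> 70) where
  "m *\<^sub>N n = iter (\<lambda>k. k +\<^sub>N m) emp n"

definition nle :: "'c \<Rightarrow> 'c \<Rightarrow> bool"  (infix \<open>\<le>\<^sub>N\<close> 50) where
  "m \<le>\<^sub>N n \<longleftrightarrow> m \<epsilon> n \<or> m = n"

definition ndvd :: "'c \<Rightarrow> 'c \<Rightarrow> bool" where
  "ndvd d n \<longleftrightarrow> (\<exists>k\<in>N. d *\<^sub>N k = n)"

definition ncoprime :: "'c \<Rightarrow> 'c \<Rightarrow> bool" where
  "ncoprime m n \<longleftrightarrow> (\<forall>d\<in>N. ndvd d m \<and> ndvd d n \<longrightarrow> d = suc emp)"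

text \<open>The triple \<^term>\<open>rat a b c\<close> represents $(a-b)/c$. Each rational number is coded by its unique
  representative in lowest terms in which \<open>a\<close> or \<open>b\<close> is zero, so that it is a set (the
  equivalence classes of fractions are proper classes).\<close>

definition rat :: "'c \<Rightarrow> 'c \<Rightarrow> 'c \<Rightarrow> 'c" where
  "rat a b c = pair (pair a b) c"

definition Q :: "'c set" where
  "Q = {rat a b c | a b c. a \<in> N \<and> b \<in> N \<and> c \<in> N \<and> c \<noteq> emp \<and>
          (a = emp \<or> b = emp) \<and> ncoprime (a +\<^sub>N b) c}"

definition qpos :: "'c \<Rightarrow> 'c" where
  "qpos q = (THE a. a \<in> N \<and> (\<exists>b\<in>N. \<exists>c\<in>N. q = rat a b c))"

definition qneg :: "'c \<Rightarrow> 'c" where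
  "qneg q = (THE b. b \<in> N \<and> (\<exists>a\<in>N. \<exists>c\<in>N. q = rat a b c))"

definition qden :: "'c \<Rightarrow> 'c" where
  "qden q = (THE c. c \<in> N \<and> (\<exists>a\<in>N. \<exists>b\<in>N. q = rat a b c))"

text \<open>The element of \<^term>\<open>Q\<close> with value $(a-b)/c$:\<close>

definition reduce :: "'c \<Rightarrow> 'c \<Rightarrow> 'c \<Rightarrow> 'c" where
  "reduce a b c = (THE q. q \<in> Q \<and>
     a *\<^sub>N qden q +\<^sub>N qneg q *\<^sub>N c = b *\<^sub>N qden q +\<^sub>N qpos q *\<^sub>N c)"

definition qzero :: 'c where
  "qzero = rat emp emp (suc emp)"

definition qone :: 'c where
  "qone = rat (suc emp) emp (suc emp)"

definition qadd :: "'c \<Rightarrow> 'c \<Rightarrow> 'c" where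
  "qadd p q = reduce (qpos p *\<^sub>N qden q +\<^sub>N qpos q *\<^sub>N qden p)
                     (qneg p *\<^sub>N qden q +\<^sub>N qneg q *\<^sub>N qden p)
                     (qden p *\<^sub>N qden q)"

definition qmul :: "'c \<Rightarrow> 'c \<Rightarrow> 'c" where
  "qmul p q = reduce (qpos p *\<^sub>N qpos q +\<^sub>N qneg p *\<^sub>N qneg q)
                     (qpos p *\<^sub>N qneg q +\<^sub>N qneg p *\<^sub>N qpos q)
                     (qden p *\<^sub>N qden q)"

definition qle :: "'c \<Rightarrow> 'c \<Rightarrow> bool"  (infix \<open>\<le>\<^sub>Q\<close> 50) where
  "p \<le>\<^sub>Q q \<longleftrightarrow> qpos p *\<^sub>N qden q +\<^sub>N qneg q *\<^sub>N qden p \<le>\<^sub>N qpos q *\<^sub>N qden p +\<^sub>N qneg p *\<^sub>N qden q"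

definition qless :: "'c \<Rightarrow> 'c \<Rightarrow> bool"  (infix \<open><\<^sub>Q\<close> 50) where
  "p <\<^sub>Q q \<longleftrightarrow> p \<le>\<^sub>Q q \<and> p \<noteq> q"

definition qabs :: "'c \<Rightarrow> 'c" where
  "qabs q = (if qzero \<le>\<^sub>Q q then q else rat (qneg q) (qpos q) (qden q))"

definition SQ :: "'c set" where
  "SQ = Q \<inter> S"

definition Qb :: "'c set" where
  "Qb = {x\<in>Q. \<exists>r\<in>SQ. qabs x <\<^sub>Q r}"

definition mu0 :: "'c set" where
  "mu0 = {\<alpha>\<in>Qb. \<forall>r\<in>SQ. qzero <\<^sub>Q r \<longrightarrow> qabs \<alpha> <\<^sub>Q r}"

definition Qb_ring :: "'c ring" where
  "Qb_ring = \<lparr>carrier = Qb, mult = qmul, one = qone, zero = qzero, add = qadd\<rparr>"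

text \<open>In the structure \<open>\<langle>R; A, M, L\<rangle>\<close> the classes \<open>A\<close>, \<open>M\<close> and \<open>L\<close> are the graphs of addition,
  multiplication and the order. The neutral elements are determined by the operations.\<close>

definition op_ring :: "'c \<Rightarrow> 'c \<Rightarrow> 'c \<Rightarrow> 'c ring" where
  "op_ring R A M =
     \<lparr>carrier = elts R,
      mult = (\<lambda>x y. app M (pair x y)),
      one = (THE u. u \<epsilon> R \<and> (\<forall>x\<in>elts R. app M (pair u x) = x)),
      zero = (THE z. z \<epsilon> R \<and> (\<forall>x\<in>elts R. app A (pair z x) = x)),
      add = (\<lambda>x y. app A (pair x y))\<rparr>"

definition le_rel :: "'c \<Rightarrow> ('c \<times> 'c) set" where
  "le_rel L = {(x, y). x \<in> V \<and> y \<in> V \<and> pair x y \<epsilon> L}"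

definition ordered_field :: "'c \<Rightarrow> 'c \<Rightarrow> 'c \<Rightarrow> 'c \<Rightarrow> bool" where
  "ordered_field R A M L \<longleftrightarrow>
     fun_into A {pair x y | x y. x \<epsilon> R \<and> y \<epsilon> R} (elts R) \<and>
     fun_into M {pair x y | x y. x \<epsilon> R \<and> y \<epsilon> R} (elts R) \<and>
     elts L \<subseteq> {pair x y | x y. x \<epsilon> R \<and> y \<epsilon> R} \<and>
     field (op_ring R A M) \<and>
     linear_order_on (elts R) (le_rel L) \<and>
     (\<forall>x\<in>elts R. \<forall>y\<in>elts R. \<forall>z\<in>elts R. (x, y) \<in> le_rel L \<longrightarrow>
        (x \<oplus>\<^bsub>op_ring R A M\<^esub> z, y \<oplus>\<^bsub>op_ring R A M\<^esub> z) \<in> le_rel L) \<and>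
     (\<forall>x\<in>elts R. \<forall>y\<in>elts R.
        (\<zero>\<^bsub>op_ring R A M\<^esub>, x) \<in> le_rel L \<and> (\<zero>\<^bsub>op_ring R A M\<^esub>, y) \<in> le_rel L \<longrightarrow>
        (\<zero>\<^bsub>op_ring R A M\<^esub>, x \<otimes>\<^bsub>op_ring R A M\<^esub> y) \<in> le_rel L)"

definition upper_bound :: "'c \<Rightarrow> 'c \<Rightarrow> 'c \<Rightarrow> 'c \<Rightarrow> bool" where
  "upper_bound R L Y b \<longleftrightarrow> b \<epsilon> R \<and> (\<forall>y\<in>elts Y. (y, b) \<in> le_rel L)"

text \<open>Suprema are required of nonempty subclasses only: in an ordered field the empty class is
  bounded above but has no supremum.\<close>

definition real_field :: "'c \<Rightarrow> 'c \<Rightarrow> 'c \<Rightarrow> 'c \<Rightarrow> bool" where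
  "real_field R A M L \<longleftrightarrow>
     ordered_field R A M L \<and>
     (\<forall>Y. elts Y \<subseteq> elts R \<and> elts Y \<noteq> {} \<and> (\<exists>b. upper_bound R L Y b) \<longrightarrow>
        (\<exists>s. upper_bound R L Y s \<and> (\<forall>b. upper_bound R L Y b \<longrightarrow> (s, b) \<in> le_rel L)))"

definition surj_ring_hom :: "'c \<Rightarrow> 'c ring \<Rightarrow> 'c ring \<Rightarrow> bool" where
  "surj_ring_hom F K K' \<longleftrightarrow>
     fun_into F (carrier K) (carrier K') \<and>
     app F \<in> ring_hom K K' \<and>
     app F ` carrier K = carrier K'"

end

end

theory Submission
  imports Defs
begin

text \<open>A bounded rational \<open>q\<close> determines a Dedekind cut in the standard rationals. As the latter are dense
  in the real field and embedded in it by dependent choice, exactly one real number fills this cut, and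
  sending \<open>q\<close> to it is a ring homomorphism with the infinitesimals as its kernel.

  For surjectivity let \<open>H\<close> be a nonstandard number, which exists by Thin. A real number \<open>x \<ge> 0\<close> is
  approximated on the grid of all \<open>k/H\<close>: if every grid point were bad for \<open>x\<close> at some
  standard precision $1/i$, then by Comp finitely many precisions would suffice, which is refuted by
  the grid point next to an approximation of \<open>x\<close> with larger standard denominator.

  For uniqueness, a homomorphism \<open>h\<close> fixes the standard rationals by induction, and it suffices that
  \<open>h\<close> is monotone on the bounded rationals. Each \<open>u \<ge> 1\<close> is a unit, so \<open>h u \<noteq> 0\<close>; if \<open>h u\<close> were
  negative, then $-h(u) = h(p)^2$ for some \<open>p\<close>, as positive reals have square roots and \<open>h\<close> is
  surjective, and $h(u + p^2) = 0$ would contradict $u + p^2 \geq 1$.\<close>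

subsection \<open>Ordered fields\<close>

text \<open>Numbers in \<open>N\<close> may be nonstandard, so HOL naturals and HOL recursion cannot
  stand for them: arithmetic and the rationals are rebuilt inside the structure. Comprehension and
  induction speak of formulas, hence every predicate to which they are applied has to be shown
  definable; the rules for \<open>dfn\<close> and \<open>fn\<close> reduce this to syntax-directed
  steps. Two levels are kept apart: induction over all of \<open>N\<close> needs a set formula,
  while induction over \<open>SN\<close>, comprehension and suprema accept class formulas. The
  distinction cannot be blurred, since induction for a set formula defining \<open>SN\<close> would
  make every number standard. Statements about standard rationals and real numbers are rewritten as
  statements about standard numbers before a class is formed from them. The purely algebraic part is
  isolated in locales about abstract ordered fields, where definability plays no part.\<close>

locale ofield = field K for K (structure) +
  fixes le :: "'a \<Rightarrow> 'a \<Rightarrow> bool"  (infix \<open>\<preceq>\<close> 50)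
  assumes le_refl: "x \<in> carrier K \<Longrightarrow> x \<preceq> x"
    and le_antisym: "\<lbrakk>x \<in> carrier K; y \<in> carrier K; x \<preceq> y; y \<preceq> x\<rbrakk> \<Longrightarrow> x = y"
    and le_trans: "\<lbrakk>x \<in> carrier K; y \<in> carrier K; z \<in> carrier K; x \<preceq> y; y \<preceq> z\<rbrakk> \<Longrightarrow> x \<preceq> z"
    and le_total: "\<lbrakk>x \<in> carrier K; y \<in> carrier K\<rbrakk> \<Longrightarrow> x \<preceq> y \<or> y \<preceq> x"
    and le_add: "\<lbrakk>x \<in> carrier K; y \<in> carrier K; z \<in> carrier K; x \<preceq> y\<rbrakk> \<Longrightarrow> x \<oplus> z \<preceq> y \<oplus> z"
    and le_mult: "\<lbrakk>x \<in> carrier K; y \<in> carrier K; \<zero> \<preceq> x; \<zero> \<preceq> y\<rbrakk> \<Longrightarrow> \<zero> \<preceq> x \<otimes> y"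
begin

text \<open>In a total order the negated converse is the strict order, so no second relation with
  laws of its own is needed, and proofs by contradiction deliver strict inequalities
  directly.\<close>

abbreviation lt :: "'a \<Rightarrow> 'a \<Rightarrow> bool"  (infix \<open>\<prec>\<close> 50) where
  "x \<prec> y \<equiv> \<not> y \<preceq> x"

lemma lt_imp_le: "\<lbrakk>x \<in> carrier K; y \<in> carrier K; x \<prec> y\<rbrakk> \<Longrightarrow> x \<preceq> y"
  using le_total by blast

lemma le_lt_trans: "\<lbrakk>x \<in> carrier K; y \<in> carrier K; z \<in> carrier K; x \<preceq> y; y \<prec> z\<rbrakk> \<Longrightarrow> x \<prec> z"
  using le_trans by blast

lemma lt_le_trans: "\<lbrakk>x \<in> carrier K; y \<in> carrier K; z \<in> carrier K; x \<prec> y; y \<preceq> z\<rbrakk> \<Longrightarrow> x \<prec> z"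
  using le_trans by blast

lemma add_minus_cancel: "\<lbrakk>x \<in> carrier K; z \<in> carrier K\<rbrakk> \<Longrightarrow> (x \<oplus> z) \<oplus> (\<ominus> z) = x"
  by (simp add: a_assoc r_neg)

lemma le_add_iff [simp]:
  assumes "x \<in> carrier K" "y \<in> carrier K" "z \<in> carrier K"
  shows "x \<oplus> z \<preceq> y \<oplus> z \<longleftrightarrow> x \<preceq> y"
proof
  assume "x \<oplus> z \<preceq> y \<oplus> z"
  then have "(x \<oplus> z) \<oplus> (\<ominus> z) \<preceq> (y \<oplus> z) \<oplus> (\<ominus> z)" using assms by (rule_tac le_add) simp_all
  then show "x \<preceq> y" unfolding add_minus_cancel[OF assms(1,3)] add_minus_cancel[OF assms(2,3)] .
qed (use assms le_add in blast)

lemma le_add_iff2 [simp]: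
  assumes "x \<in> carrier K" "y \<in> carrier K" "z \<in> carrier K"
  shows "z \<oplus> x \<preceq> z \<oplus> y \<longleftrightarrow> x \<preceq> y"
  using le_add_iff[OF assms] assms by (simp add: a_comm)

lemma add_mono:
  assumes "x \<in> carrier K" "y \<in> carrier K" "z \<in> carrier K" "w \<in> carrier K" "x \<preceq> y" "z \<preceq> w"
  shows "x \<oplus> z \<preceq> y \<oplus> w"
  by (rule le_trans[of _ "y \<oplus> z"]) (use assms in simp_all)

lemma le_diff_iff:
  assumes "x \<in> carrier K" "y \<in> carrier K" "z \<in> carrier K"
  shows "x \<preceq> y \<ominus> z \<longleftrightarrow> x \<oplus> z \<preceq> y"
proof -
  have "(y \<ominus> z) \<oplus> z = y" using assms by (simp add: a_minus_def a_assoc l_neg)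
  then show ?thesis using le_add_iff[of x "y \<ominus> z" z] assms by simp
qed

lemma le_minus_iff [simp]:
  assumes "x \<in> carrier K" "y \<in> carrier K" shows "\<ominus> x \<preceq> \<ominus> y \<longleftrightarrow> y \<preceq> x"
proof -
  have "(\<ominus> x) \<oplus> (x \<oplus> y) = y" "(\<ominus> y) \<oplus> (x \<oplus> y) = x"
    using assms r_neg1[of x y] r_neg1[of y x] a_comm[of x y] by simp_all
  then show ?thesis using le_add_iff[of "\<ominus> x" "\<ominus> y" "x \<oplus> y"] assms by simp
qed

lemma minus_nonneg: assumes "x \<in> carrier K" shows "\<zero> \<preceq> \<ominus> x \<longleftrightarrow> x \<preceq> \<zero>"
  using le_minus_iff[of \<zero> x] assms by simp

lemma le_diff_zero: assumes "x \<in> carrier K" "y \<in> carrier K" shows "\<zero> \<preceq> y \<ominus> x \<longleftrightarrow> x \<preceq> y"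
  using le_diff_iff[of \<zero> y x] assms by simp

lemma mult_mono:
  assumes "x \<in> carrier K" "y \<in> carrier K" "z \<in> carrier K" "x \<preceq> y" "\<zero> \<preceq> z"
  shows "x \<otimes> z \<preceq> y \<otimes> z"
proof -
  have "\<zero> \<preceq> (y \<ominus> x) \<otimes> z" using assms le_diff_zero by (rule_tac le_mult) simp_all
  moreover have "(y \<ominus> x) \<otimes> z = y \<otimes> z \<ominus> x \<otimes> z" using assms by (simp add: a_minus_def l_distr l_minus)
  ultimately show ?thesis using le_diff_zero[of "x \<otimes> z" "y \<otimes> z"] assms by simp
qed

lemma mult_mono2:
  assumes "x \<in> carrier K" "y \<in> carrier K" "z \<in> carrier K" "w \<in> carrier K"
    "x \<preceq> y" "z \<preceq> w" "\<zero> \<preceq> z" "\<zero> \<preceq> y"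
  shows "x \<otimes> z \<preceq> y \<otimes> w"
proof (rule le_trans)
  show "x \<otimes> z \<preceq> y \<otimes> z" using assms by (rule_tac mult_mono) simp_all
  show "y \<otimes> z \<preceq> y \<otimes> w" using mult_mono[of z w y] assms by (simp add: m_comm)
qed (use assms in simp_all)

lemma square_nonneg: assumes "x \<in> carrier K" shows "\<zero> \<preceq> x \<otimes> x"
proof (cases "\<zero> \<preceq> x")
  case False
  then have "\<zero> \<preceq> \<ominus> x" using assms minus_nonneg lt_imp_le[of x \<zero>] by simp
  then have "\<zero> \<preceq> (\<ominus> x) \<otimes> (\<ominus> x)" using assms by (rule_tac le_mult) simp_all
  then show ?thesis using assms by (simp add: l_minus r_minus)
qed (use assms le_mult in blast)

text \<open>One is a square, hence nonnegative, and it differs from zero in a field.\<close>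

lemma zero_lt_one: "\<zero> \<prec> \<one>"
  using square_nonneg[of \<one>] le_antisym[of \<zero> \<one>] zero_not_one by auto

lemma zero_le_one [simp]: "\<zero> \<preceq> \<one>"
  using square_nonneg[of \<one>] by simp

lemma pos_Units: "\<lbrakk>x \<in> carrier K; \<zero> \<prec> x\<rbrakk> \<Longrightarrow> x \<in> Units K"
  using le_refl by (auto simp: field_Units)

lemma inv_mult [simp]: "\<lbrakk>x \<in> carrier K; \<zero> \<prec> x\<rbrakk> \<Longrightarrow> inv x \<otimes> x = \<one>" "\<lbrakk>x \<in> carrier K; \<zero> \<prec> x\<rbrakk> \<Longrightarrow> x \<otimes> inv x = \<one>"
  "\<lbrakk>x \<in> carrier K; \<zero> \<prec> x\<rbrakk> \<Longrightarrow> inv x \<in> carrier K"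
  using pos_Units by simp_all

lemma inv_pos: assumes "x \<in> carrier K" "\<zero> \<prec> x" shows "\<zero> \<prec> inv x"
proof
  assume "inv x \<preceq> \<zero>"
  then have "inv x \<otimes> x \<preceq> \<zero> \<otimes> x" using assms lt_imp_le[of \<zero> x] by (rule_tac mult_mono) simp_all
  then show False using assms zero_lt_one by simp
qed

lemma mult_cancel_inv: "\<lbrakk>x \<in> carrier K; z \<in> carrier K; \<zero> \<prec> z\<rbrakk> \<Longrightarrow> (x \<otimes> z) \<otimes> inv z = x"
  "\<lbrakk>x \<in> carrier K; z \<in> carrier K; \<zero> \<prec> z\<rbrakk> \<Longrightarrow> (x \<otimes> inv z) \<otimes> z = x"
  by (simp_all add: m_assoc)

lemma le_mult_iff:
  assumes "x \<in> carrier K" "y \<in> carrier K" "z \<in> carrier K" "\<zero> \<prec> z"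
  shows "x \<otimes> z \<preceq> y \<otimes> z \<longleftrightarrow> x \<preceq> y"
proof
  assume *: "x \<otimes> z \<preceq> y \<otimes> z"
  have "\<zero> \<preceq> inv z" using inv_pos[OF assms(3,4)] lt_imp_le[of \<zero> "inv z"] assms by simp
  then have "(x \<otimes> z) \<otimes> inv z \<preceq> (y \<otimes> z) \<otimes> inv z" using assms(1-4) * inv_mult(3)[OF assms(3,4)] by (rule_tac mult_mono) simp_all
  then show "x \<preceq> y"
    unfolding mult_cancel_inv(1)[OF assms(1,3,4)] mult_cancel_inv(1)[OF assms(2,3,4)] .
qed (use assms mult_mono lt_imp_le[of \<zero> z] in simp)

lemma le_divide_iff:
  assumes "x \<in> carrier K" "y \<in> carrier K" "z \<in> carrier K" "\<zero> \<prec> z"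
  shows "x \<preceq> y \<otimes> inv z \<longleftrightarrow> x \<otimes> z \<preceq> y" "y \<otimes> inv z \<preceq> x \<longleftrightarrow> y \<preceq> x \<otimes> z"
  using le_mult_iff[of x "y \<otimes> inv z" z] le_mult_iff[of "y \<otimes> inv z" x z] assms
  by (simp_all add: mult_cancel_inv)

lemma mult_pos: assumes "x \<in> carrier K" "y \<in> carrier K" "\<zero> \<prec> x" "\<zero> \<prec> y" shows "\<zero> \<prec> x \<otimes> y"
  using le_mult_iff[of x \<zero> y] assms by simp

text \<open>The supremum \<open>s\<close> of all \<open>y\<close> with $y^2 \leq w$ satisfies $s^2 = w$: otherwise some \<open>e\<close> with
  \<open>e > 1\<close> and $e^2 \leq d$, where \<open>d > 1\<close> is the quotient of \<open>w\<close> and $s^2$, gives a contradiction.\<close>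

lemma square_root_step:
  assumes "d \<in> carrier K" "\<one> \<prec> d" and dense: "\<And>x y. x \<in> carrier K \<Longrightarrow> y \<in> carrier K \<Longrightarrow> x \<prec> y \<Longrightarrow>
      \<exists>z\<in>carrier K. x \<prec> z \<and> z \<prec> y"
  shows "\<exists>e\<in>carrier K. \<one> \<prec> e \<and> e \<otimes> e \<preceq> d"
proof -
  obtain e where e: "e \<in> carrier K" "\<one> \<prec> e" "e \<prec> d" using dense[OF one_closed assms(1,2)] by blast
  have e0: "\<zero> \<prec> e" using le_lt_trans[OF zero_closed one_closed e(1) zero_le_one e(2)] .
  show ?thesis
  proof (cases "e \<otimes> e \<preceq> d")
    case False
    \<comment> \<open>If \<open>e\<close> is too large, the complementary factor \<open>f\<close> of
      \<open>d\<close> is at most \<open>e\<close> but still exceeds one, and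
      \<open>f \<otimes> f\<close> is at most \<open>f \<otimes> e = d\<close>.\<close>
    define f where "f = d \<otimes> inv e"
    have f: "f \<in> carrier K" "f \<otimes> e = d" using assms(1) e e0 by (simp_all add: f_def mult_cancel_inv)
    have "\<one> \<prec> f" using le_divide_iff(2)[of \<one> d e] assms(1) e e0 by (simp add: f_def)
    moreover have "f \<preceq> e"
      using le_divide_iff(2)[of e d e] lt_imp_le[of d "e \<otimes> e"] False assms(1) e e0 by (simp add: f_def)
    then have "f \<otimes> f \<preceq> d"
      using mult_mono[of f e f] f e le_lt_trans[OF zero_closed one_closed f(1) zero_le_one \<open>\<one> \<prec> f\<close>]
        lt_imp_le[of \<zero> f] by (simp add: m_comm)
    ultimately show ?thesis using f by blast
  qed (use e in blast)
qed

lemma square_root: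
  assumes w: "w \<in> carrier K" "\<zero> \<prec> w" and s: "s \<in> carrier K"
    and dense: "\<And>x y. x \<in> carrier K \<Longrightarrow> y \<in> carrier K \<Longrightarrow> x \<prec> y \<Longrightarrow> \<exists>z\<in>carrier K. x \<prec> z \<and> z \<prec> y"
    and ub: "\<And>y. y \<in> carrier K \<Longrightarrow> \<zero> \<preceq> y \<Longrightarrow> y \<otimes> y \<preceq> w \<Longrightarrow> y \<preceq> s"
    and least: "\<And>b. b \<in> carrier K \<Longrightarrow> (\<And>y. y \<in> carrier K \<Longrightarrow> \<zero> \<preceq> y \<Longrightarrow> y \<otimes> y \<preceq> w \<Longrightarrow> y \<preceq> b) \<Longrightarrow> s \<preceq> b"
  shows "s \<otimes> s = w"
proof -
  \<comment> \<open>Some positive element has to lie below \<open>s\<close> to make \<open>s\<close>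
    positive; the smaller one of \<open>\<one>\<close> and \<open>w\<close> will do.\<close>
  have "\<exists>y\<in>carrier K. \<zero> \<prec> y \<and> y \<otimes> y \<preceq> w"
  proof (cases "\<one> \<preceq> w")
    case True then show ?thesis using zero_lt_one by (intro bexI[of _ \<one>]) simp_all
  next
    case False
    then have "w \<otimes> w \<preceq> \<one> \<otimes> w" using w lt_imp_le[of w \<one>] lt_imp_le[of \<zero> w] by (rule_tac mult_mono) simp_all
    then show ?thesis using w by (intro bexI[of _ w]) simp_all
  qed
  then obtain y where y: "y \<in> carrier K" "\<zero> \<prec> y" "y \<otimes> y \<preceq> w" by blast
  then have "\<zero> \<prec> s" using lt_le_trans[OF zero_closed y(1) s] ub lt_imp_le[of \<zero> y] by simp
  then have ss: "s \<otimes> s \<in> carrier K" "\<zero> \<prec> s \<otimes> s" using s mult_pos by simp_all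
  have s0: "\<zero> \<preceq> s" using \<open>\<zero> \<prec> s\<close> lt_imp_le[of \<zero> s] s by simp
  have "w \<preceq> s \<otimes> s"
  proof (rule ccontr)
    assume "s \<otimes> s \<prec> w"
    then have "\<one> \<prec> w \<otimes> inv (s \<otimes> s)" using le_divide_iff(2)[of \<one> w "s \<otimes> s"] ss w by simp
    then obtain e where e: "e \<in> carrier K" "\<one> \<prec> e" "e \<otimes> e \<preceq> w \<otimes> inv (s \<otimes> s)"
      using square_root_step[of "w \<otimes> inv (s \<otimes> s)"] dense ss w by auto
    \<comment> \<open>So the square of \<open>e \<otimes> s\<close> is still at most
      \<open>w\<close>, and \<open>s\<close> as an upper bound would have to dominate
      \<open>e \<otimes> s\<close>, although \<open>e\<close> exceeds one.\<close>
    have "(e \<otimes> e) \<otimes> (s \<otimes> s) \<preceq> w" using e ss w le_divide_iff(1)[of "e \<otimes> e" w "s \<otimes> s"] by simp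
    moreover have "(e \<otimes> e) \<otimes> (s \<otimes> s) = (e \<otimes> s) \<otimes> (e \<otimes> s)" using e(1) s by (simp add: m_ac)
    moreover have "\<zero> \<preceq> e" using le_trans[of \<zero> \<one> e] lt_imp_le[of \<one> e] e by simp
    ultimately have "e \<otimes> s \<preceq> \<one> \<otimes> s" using ub[of "e \<otimes> s"] e s s0 le_mult by simp
    then show False using le_mult_iff[of e \<one> s] e s \<open>\<zero> \<prec> s\<close> by simp
  qed
  moreover have "s \<otimes> s \<preceq> w"
  proof (rule ccontr)
    assume "w \<prec> s \<otimes> s"
    then have "\<one> \<prec> (s \<otimes> s) \<otimes> inv w" using le_divide_iff(2)[of \<one> "s \<otimes> s" w] ss w by simp
    then obtain e where e: "e \<in> carrier K" "\<one> \<prec> e" "e \<otimes> e \<preceq> (s \<otimes> s) \<otimes> inv w"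
      using square_root_step[of "(s \<otimes> s) \<otimes> inv w"] dense ss w by auto
    have e0: "\<zero> \<prec> e" using le_lt_trans[OF zero_closed one_closed e(1) zero_le_one e(2)] .
    have le: "(e \<otimes> e) \<otimes> w \<preceq> s \<otimes> s" using e ss w le_divide_iff(1)[of "e \<otimes> e" "s \<otimes> s" w] by simp
    \<comment> \<open>The quotient of \<open>s\<close> by \<open>e\<close> is an upper bound too: an
      admissible \<open>y\<close> above it would satisfy \<open>s \<prec> y \<otimes> e\<close>,
      hence the square of \<open>s\<close> would lie below that of \<open>y \<otimes> e\<close>,
      which is at most \<open>w \<otimes> (e \<otimes> e)\<close> and so at most
      \<open>s \<otimes> s\<close>.\<close>
    have "s \<preceq> s \<otimes> inv e"
    proof (rule least)
      fix y assume y: "y \<in> carrier K" "\<zero> \<preceq> y" "y \<otimes> y \<preceq> w"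
      show "y \<preceq> s \<otimes> inv e"
      proof (rule ccontr)
        assume "s \<otimes> inv e \<prec> y"
        then have lt: "s \<prec> y \<otimes> e" using le_divide_iff(1)[of y s e] y e e0 s by simp
        have ye: "\<zero> \<prec> y \<otimes> e" using lt le_lt_trans[of \<zero> s "y \<otimes> e"] s s0 y e by simp
        have "s \<otimes> s \<preceq> (y \<otimes> e) \<otimes> s" using lt s y e s0 lt_imp_le[of s "y \<otimes> e"] by (rule_tac mult_mono) simp_all
        moreover have "(y \<otimes> e) \<otimes> s \<prec> (y \<otimes> e) \<otimes> (y \<otimes> e)"
          using le_mult_iff[of "y \<otimes> e" s "y \<otimes> e"] lt ye s y e by (simp add: m_comm)
        ultimately have "s \<otimes> s \<prec> (y \<otimes> e) \<otimes> (y \<otimes> e)"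
          using le_lt_trans[of "s \<otimes> s" "(y \<otimes> e) \<otimes> s" "(y \<otimes> e) \<otimes> (y \<otimes> e)"] s y e by simp
        moreover have "(y \<otimes> e) \<otimes> (y \<otimes> e) = (y \<otimes> y) \<otimes> (e \<otimes> e)" using y(1) e(1) by (simp add: m_ac)
        moreover have "(y \<otimes> y) \<otimes> (e \<otimes> e) \<preceq> w \<otimes> (e \<otimes> e)"
          using y e w square_nonneg by (rule_tac mult_mono) simp_all
        moreover have "w \<otimes> (e \<otimes> e) \<preceq> s \<otimes> s" using le e(1) w by (simp add: m_comm)
        ultimately show False
          using le_trans[of "(y \<otimes> y) \<otimes> (e \<otimes> e)" "w \<otimes> (e \<otimes> e)" "s \<otimes> s"] y(1) e(1) w s by simp
      qed
    qed (use s e e0 in simp)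
    then have "s \<otimes> e \<preceq> s \<otimes> \<one>" using le_divide_iff(1)[of s s e] s e e0 by simp
    then show False using le_mult_iff[of e \<one> s] e s \<open>\<zero> \<prec> s\<close> by (simp add: m_comm)
  qed
  ultimately show ?thesis using le_antisym ss w by blast
qed

lemma mult_cancel:
  "\<lbrakk>x \<in> carrier K; y \<in> carrier K; z \<in> carrier K; \<zero> \<prec> z; x \<otimes> z = y \<otimes> z\<rbrakk> \<Longrightarrow> x = y"
  using le_mult_iff[of x y z] le_mult_iff[of y x z] le_refl[of "x \<otimes> z"] le_antisym[of x y] by simp

end

subsection \<open>Standard parts by Dedekind cuts\<close>

text \<open>Here \<open>T\<close> and \<open>\<iota>\<close> play the roles of the standard rationals and their embedding into the reals.\<close>

locale std_part = A: ofield A leA + B: ofield B leB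
  for A :: "'a ring" (structure) and leA (infix \<open>\<le>\<^sub>A\<close> 50) and B :: "'b ring" and leB (infix \<open>\<le>\<^sub>B\<close> 50) +
  fixes T :: "'a set" and \<iota> :: "'a \<Rightarrow> 'b"
  assumes T_A: "r \<in> T \<Longrightarrow> r \<in> carrier A"
    and T_add: "r \<in> T \<Longrightarrow> s \<in> T \<Longrightarrow> r \<oplus> s \<in> T"
    and T_mult: "r \<in> T \<Longrightarrow> s \<in> T \<Longrightarrow> r \<otimes> s \<in> T"
    and T_minus: "r \<in> T \<Longrightarrow> \<ominus> r \<in> T"
    and T_one: "\<one> \<in> T"
    and iota_B: "r \<in> T \<Longrightarrow> \<iota> r \<in> carrier B"
    and iota_add: "r \<in> T \<Longrightarrow> s \<in> T \<Longrightarrow> \<iota> (r \<oplus> s) = \<iota> r \<oplus>\<^bsub>B\<^esub> \<iota> s"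
    and iota_mult: "r \<in> T \<Longrightarrow> s \<in> T \<Longrightarrow> \<iota> (r \<otimes> s) = \<iota> r \<otimes>\<^bsub>B\<^esub> \<iota> s"
    and iota_one: "\<iota> \<one> = \<one>\<^bsub>B\<^esub>"
    and iota_le: "r \<in> T \<Longrightarrow> s \<in> T \<Longrightarrow> \<iota> r \<le>\<^sub>B \<iota> s \<longleftrightarrow> r \<le>\<^sub>A s"
    and dense: "x \<in> carrier B \<Longrightarrow> y \<in> carrier B \<Longrightarrow> \<not> y \<le>\<^sub>B x \<Longrightarrow> \<exists>r\<in>T. \<not> \<iota> r \<le>\<^sub>B x \<and> \<not> y \<le>\<^sub>B \<iota> r"
begin

definition bd :: "'a set" where
  "bd = {q \<in> carrier A. \<exists>r\<in>T. \<ominus> r \<le>\<^sub>A q \<and> q \<le>\<^sub>A r}"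

text \<open>A relation and not a function, because \<open>std_part\<close> assumes no completeness:
  the algebra of cuts is developed for cuts that happen to be filled, and existence enters only in
  \<open>complete_std_part\<close>. With nonstrict inequalities on both sides,
  \<open>\<iota> r\<close> fills the cut of \<open>r \<in> T\<close>, and negation simply exchanges
  the two halves.\<close>

definition cut :: "'a \<Rightarrow> 'b \<Rightarrow> bool" where
  "cut q x \<longleftrightarrow> q \<in> bd \<and> x \<in> carrier B \<and> (\<forall>r\<in>T. (r \<le>\<^sub>A q \<longrightarrow> \<iota> r \<le>\<^sub>B x) \<and> (q \<le>\<^sub>A r \<longrightarrow> x \<le>\<^sub>B \<iota> r))"

lemma bd_A: "q \<in> bd \<Longrightarrow> q \<in> carrier A"
  by (simp add: bd_def)

lemma cut_in: "cut q x \<Longrightarrow> q \<in> bd" "cut q x \<Longrightarrow> q \<in> carrier A" "cut q x \<Longrightarrow> x \<in> carrier B"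
  by (simp_all add: cut_def bd_A)

lemma cut_lower: "cut q x \<Longrightarrow> r \<in> T \<Longrightarrow> r \<le>\<^sub>A q \<Longrightarrow> \<iota> r \<le>\<^sub>B x"
  and cut_upper: "cut q x \<Longrightarrow> r \<in> T \<Longrightarrow> q \<le>\<^sub>A r \<Longrightarrow> x \<le>\<^sub>B \<iota> r"
  by (simp_all add: cut_def)

lemma T_zero: "\<zero> \<in> T"
proof -
  have "\<one> \<oplus> \<ominus> \<one> \<in> T" by (intro T_add T_minus T_one)
  then show ?thesis by (simp add: A.r_neg)
qed

lemma iota_zero: "\<iota> \<zero> = \<zero>\<^bsub>B\<^esub>"
proof -
  have "\<iota> \<zero> \<oplus>\<^bsub>B\<^esub> \<iota> \<zero> = \<iota> \<zero>"
    using iota_add[OF T_zero T_zero] by simp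
  then show ?thesis
    using B.add_minus_cancel[OF iota_B[OF T_zero] iota_B[OF T_zero]] iota_B[OF T_zero] by (simp add: B.r_neg)
qed

lemma iota_minus: assumes "r \<in> T" shows "\<iota> (\<ominus> r) = \<ominus>\<^bsub>B\<^esub> \<iota> r"
proof -
  have "\<iota> (\<ominus> r) \<oplus>\<^bsub>B\<^esub> \<iota> r = \<zero>\<^bsub>B\<^esub>"
    using iota_add[OF T_minus[OF assms] assms] iota_zero T_A[OF assms] by (simp add: A.l_neg)
  then show ?thesis using iota_B assms T_minus by (intro B.minus_equality[symmetric]) simp_all
qed

lemma bd_T: assumes "r \<in> T" shows "r \<in> bd"
proof (cases "\<zero> \<le>\<^sub>A r")
  case True
  have "\<ominus> r \<le>\<^sub>A \<zero>" using True A.le_minus_iff[of r "\<zero>"] T_A[OF assms] by simp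
  then have "\<ominus> r \<le>\<^sub>A r" using True A.le_trans[of "\<ominus> r" "\<zero>" r] T_A[OF assms] by simp
  then show ?thesis using assms T_A A.le_refl unfolding bd_def by blast
next
  case False
  then have r: "r \<le>\<^sub>A \<zero>" using A.lt_imp_le[of r "\<zero>"] T_A[OF assms] by simp
  then have "\<zero> \<le>\<^sub>A \<ominus> r" using A.minus_nonneg T_A[OF assms] by simp
  then have "r \<le>\<^sub>A \<ominus> r" using r A.le_trans[of r "\<zero>" "\<ominus> r"] T_A[OF assms] by simp
  moreover have "\<ominus> (\<ominus> r) \<le>\<^sub>A r" using T_A[OF assms] A.le_refl by simp
  ultimately show ?thesis using assms T_A T_minus unfolding bd_def by blast
qed

lemma cut_T: assumes "r \<in> T" shows "cut r (\<iota> r)"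
  unfolding cut_def using assms bd_T iota_B iota_le by simp

lemma bd_minus: assumes "q \<in> bd" shows "\<ominus> q \<in> bd"
proof -
  obtain r where r: "r \<in> T" "\<ominus> r \<le>\<^sub>A q" "q \<le>\<^sub>A r" using assms by (auto simp: bd_def)
  have "\<ominus> r \<le>\<^sub>A \<ominus> q" "\<ominus> q \<le>\<^sub>A r"
    using r T_A bd_A[OF assms] A.le_minus_iff[of q "\<ominus> r"] by simp_all
  then show ?thesis using r bd_A[OF assms] by (auto simp: bd_def)
qed

lemma bd_add: assumes "q \<in> bd" "q' \<in> bd" shows "q \<oplus> q' \<in> bd"
proof -
  obtain r where r: "r \<in> T" "\<ominus> r \<le>\<^sub>A q" "q \<le>\<^sub>A r" using assms by (auto simp: bd_def)
  obtain s where s: "s \<in> T" "\<ominus> s \<le>\<^sub>A q'" "q' \<le>\<^sub>A s" using assms by (auto simp: bd_def)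
  have "\<ominus> (r \<oplus> s) \<le>\<^sub>A q \<oplus> q'" "q \<oplus> q' \<le>\<^sub>A r \<oplus> s"
    using A.add_mono[of "\<ominus> r" q "\<ominus> s" q'] A.add_mono[of q r q' s] r s T_A bd_A assms
    by (simp_all add: A.minus_add)
  then show ?thesis using T_add[OF r(1) s(1)] bd_A assms unfolding bd_def by blast
qed

text \<open>Prepares the reduction of arbitrary products to products of elements that are at least
  one, where multiplication is monotone.\<close>

lemma bd_shift:
  assumes "q \<in> bd" "q' \<in> bd"
  obtains m where "m \<in> T" "\<one> \<le>\<^sub>A m" "\<one> \<le>\<^sub>A q \<oplus> m" "\<one> \<le>\<^sub>A q' \<oplus> m"
proof -
  obtain r where r: "r \<in> T" "\<ominus> r \<le>\<^sub>A q" "q \<le>\<^sub>A r" using assms by (auto simp: bd_def)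
  obtain s where s: "s \<in> T" "\<ominus> s \<le>\<^sub>A q'" "q' \<le>\<^sub>A s" using assms by (auto simp: bd_def)
  have *: "\<zero> \<le>\<^sub>A r'" if "\<ominus> r' \<le>\<^sub>A p" "p \<le>\<^sub>A r'" "r' \<in> T" "p \<in> carrier A" for r' p
  proof (rule ccontr)
    assume neg: "\<not> \<zero> \<le>\<^sub>A r'"
    then have "\<zero> \<le>\<^sub>A \<ominus> r'" using A.lt_imp_le[of r' "\<zero>"] A.minus_nonneg[of r'] T_A[OF that(3)] by simp
    then have "\<zero> \<le>\<^sub>A p" using A.le_trans[of "\<zero>" "\<ominus> r'" p] that T_A by simp
    then show False using neg A.le_trans[of "\<zero>" p r'] that T_A by simp
  qed
  have r0: "\<zero> \<le>\<^sub>A r" "\<zero> \<le>\<^sub>A s" using * r s bd_A assms by blast+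
  \<comment> \<open>Adding its own bound makes each of \<open>q\<close> and \<open>q'\<close>
    nonnegative; the other bound is nonnegative and does no harm, and the final one lifts all three
    quantities to at least one.\<close>
  define m where "m = r \<oplus> s \<oplus> \<one>"
  have rA: "r \<in> carrier A" "s \<in> carrier A" "q \<in> carrier A" "q' \<in> carrier A" using T_A r s bd_A assms by simp_all
  have m: "m \<in> T" unfolding m_def by (intro T_add T_one r s)
  have rs: "\<zero> \<le>\<^sub>A r \<oplus> s" using A.add_mono[of "\<zero>" r "\<zero>" s] r0 rA by simp
  have one: "\<one> \<le>\<^sub>A p \<oplus> (t \<oplus> u \<oplus> \<one>)"
    if "\<ominus> t \<le>\<^sub>A p" "\<zero> \<le>\<^sub>A u" "p \<in> carrier A" "t \<in> carrier A" "u \<in> carrier A" for p t u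
  proof -
    have "\<zero> \<le>\<^sub>A p \<oplus> t" using A.le_add_iff[of "\<ominus> t" p t] that by (simp add: A.l_neg)
    then have "\<zero> \<le>\<^sub>A p \<oplus> t \<oplus> u" using A.add_mono[of "\<zero>" "p \<oplus> t" "\<zero>" u] that by simp
    then have "\<zero> \<oplus> \<one> \<le>\<^sub>A p \<oplus> t \<oplus> u \<oplus> \<one>" using that by (subst A.le_add_iff) simp_all
    then show ?thesis using that by (simp add: A.a_assoc)
  qed
  have "\<one> \<le>\<^sub>A m"
    using A.le_add_iff[of "\<zero>" "r \<oplus> s" "\<one>"] rs rA by (simp add: m_def)
  moreover have "\<one> \<le>\<^sub>A q \<oplus> m" unfolding m_def using one r s r0 rA by blast
  moreover have "\<one> \<le>\<^sub>A q' \<oplus> m" unfolding m_def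
    using one[of s q' r] r s r0 rA by (simp add: A.a_comm[of r s])
  ultimately show ?thesis using that m by blast
qed

lemma cut_mono: assumes "cut q x" "cut q' y" "q \<le>\<^sub>A q'" shows "x \<le>\<^sub>B y"
proof (rule ccontr)
  note c = cut_in[OF assms(1)] cut_in[OF assms(2)]
  assume "\<not> x \<le>\<^sub>B y"
  then obtain r where r: "r \<in> T" "\<not> \<iota> r \<le>\<^sub>B y" "\<not> x \<le>\<^sub>B \<iota> r" using dense c by blast
  have "r \<le>\<^sub>A q" using cut_upper[OF assms(1) r(1)] r(3) A.le_total[of r q] T_A[OF r(1)] c by blast
  then have "r \<le>\<^sub>A q'" using A.le_trans[of r q q'] T_A[OF r(1)] c assms(3) by blast
  then show False using cut_lower[OF assms(2) r(1)] r(2) by blast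
qed

lemma cut_unique: "cut q x \<Longrightarrow> cut q y \<Longrightarrow> x = y"
  using cut_mono[of q x q y] cut_mono[of q y q x] A.le_refl B.le_antisym cut_in by metis

lemma cut_minus: assumes "cut q x" shows "cut (\<ominus> q) (\<ominus>\<^bsub>B\<^esub> x)"
  unfolding cut_def
proof (intro conjI ballI impI)
  note c = cut_in[OF assms]
  show "\<ominus> q \<in> bd" "\<ominus>\<^bsub>B\<^esub> x \<in> carrier B" using bd_minus c by simp_all
  fix r assume r: "r \<in> T"
  have rA: "r \<in> carrier A" "\<iota> r \<in> carrier B" using T_A iota_B r by simp_all
  { assume "r \<le>\<^sub>A \<ominus> q"
    then have "q \<le>\<^sub>A \<ominus> r" using A.le_minus_iff[of "\<ominus> r" q] rA c by simp
    then have "x \<le>\<^sub>B \<ominus>\<^bsub>B\<^esub> \<iota> r" using cut_upper[OF assms T_minus[OF r]] iota_minus[OF r] by simp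
    then show "\<iota> r \<le>\<^sub>B \<ominus>\<^bsub>B\<^esub> x" using B.le_minus_iff[of "\<ominus>\<^bsub>B\<^esub> \<iota> r" x] rA c by simp }
  { assume "\<ominus> q \<le>\<^sub>A r"
    then have "\<ominus> r \<le>\<^sub>A q" using A.le_minus_iff[of q "\<ominus> r"] rA c by simp
    then have "\<ominus>\<^bsub>B\<^esub> \<iota> r \<le>\<^sub>B x" using cut_lower[OF assms T_minus[OF r]] iota_minus[OF r] by simp
    then show "\<ominus>\<^bsub>B\<^esub> x \<le>\<^sub>B \<iota> r" using B.le_minus_iff[of x "\<ominus>\<^bsub>B\<^esub> \<iota> r"] rA c by simp }
qed

lemma cut_add_le:
  assumes "cut q x" "cut q' x'" "cut (q \<oplus> q') z" shows "x \<oplus>\<^bsub>B\<^esub> x' \<le>\<^sub>B z"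
proof (rule ccontr)
  note c = cut_in[OF assms(1)] cut_in[OF assms(2)] cut_in[OF assms(3)]
  assume "\<not> x \<oplus>\<^bsub>B\<^esub> x' \<le>\<^sub>B z"
  then have "\<not> x' \<le>\<^sub>B z \<ominus>\<^bsub>B\<^esub> x" using B.le_diff_iff[of x' z x] c by (simp add: B.a_comm)
  then obtain r where r: "r \<in> T" "\<not> \<iota> r \<le>\<^sub>B z \<ominus>\<^bsub>B\<^esub> x" "\<not> x' \<le>\<^sub>B \<iota> r" using dense[of "z \<ominus>\<^bsub>B\<^esub> x" x'] c by auto
  have rA: "r \<in> carrier A" "\<iota> r \<in> carrier B" using T_A iota_B r by simp_all
  have "\<not> x \<le>\<^sub>B z \<ominus>\<^bsub>B\<^esub> \<iota> r"
    using r(2) B.le_diff_iff[of "\<iota> r" z x] B.le_diff_iff[of x z "\<iota> r"] c rA by (simp add: B.a_comm)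
  then obtain s where s: "s \<in> T" "\<not> \<iota> s \<le>\<^sub>B z \<ominus>\<^bsub>B\<^esub> \<iota> r" "\<not> x \<le>\<^sub>B \<iota> s"
    using dense[of "z \<ominus>\<^bsub>B\<^esub> \<iota> r" x] c rA by auto
  have sA: "s \<in> carrier A" "\<iota> s \<in> carrier B" using T_A iota_B s by simp_all
  have "r \<le>\<^sub>A q'" using cut_upper[OF assms(2) r(1)] r(3) A.le_total[of r q'] rA c by blast
  moreover have "s \<le>\<^sub>A q" using cut_upper[OF assms(1) s(1)] s(3) A.le_total[of s q] sA c by blast
  ultimately have "s \<oplus> r \<le>\<^sub>A q \<oplus> q'" using A.add_mono rA sA c by blast
  then have "\<iota> s \<oplus>\<^bsub>B\<^esub> \<iota> r \<le>\<^sub>B z" using cut_lower[OF assms(3) T_add[OF s(1) r(1)]] iota_add s r by simp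
  then show False using s(2) B.le_diff_iff[of "\<iota> s" z "\<iota> r"] c rA sA by simp
qed

lemma cut_add_eq:
  assumes "cut q x" "cut q' x'" "cut (q \<oplus> q') z" shows "z = x \<oplus>\<^bsub>B\<^esub> x'"
proof (rule B.le_antisym)
  note c = cut_in[OF assms(1)] cut_in[OF assms(2)] cut_in[OF assms(3)]
  have "cut (\<ominus> q \<oplus> \<ominus> q') (\<ominus>\<^bsub>B\<^esub> z)"
    using cut_minus[OF assms(3)] c by (simp add: A.minus_add)
  from cut_add_le[OF cut_minus[OF assms(1)] cut_minus[OF assms(2)] this]
  have "\<ominus>\<^bsub>B\<^esub> (x \<oplus>\<^bsub>B\<^esub> x') \<le>\<^sub>B \<ominus>\<^bsub>B\<^esub> z" using c by (simp add: B.minus_add)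
  then show "z \<le>\<^sub>B x \<oplus>\<^bsub>B\<^esub> x'" using c by simp
  show "x \<oplus>\<^bsub>B\<^esub> x' \<le>\<^sub>B z" using cut_add_le[OF assms] .
qed (use cut_in assms in simp_all)

lemma cut_ge_one: assumes "cut q x" "\<one> \<le>\<^sub>A q" shows "\<one>\<^bsub>B\<^esub> \<le>\<^sub>B x"
  using cut_lower[OF assms(1) T_one assms(2)] iota_one by simp

text \<open>The argument for sums with division in place of subtraction. Both factors being at least
  one makes \<open>x\<close>, \<open>w\<close> and \<open>z\<close> positive, so that dividing
  preserves inequalities. Negation does not reverse the order of products, hence the two
  inequalities are proved separately.\<close>

lemma cut_mult_eq_ge_one:
  assumes "cut q x" "cut q' w" "cut (q \<otimes> q') z" "\<one> \<le>\<^sub>A q" "\<one> \<le>\<^sub>A q'"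
  shows "z = x \<otimes>\<^bsub>B\<^esub> w"
proof -
  note c = cut_in[OF assms(1)] cut_in[OF assms(2)] cut_in[OF assms(3)]
  have pos: "\<not> y \<le>\<^sub>B \<zero>\<^bsub>B\<^esub>" if "\<one>\<^bsub>B\<^esub> \<le>\<^sub>B y" "y \<in> carrier B" for y
    using B.lt_le_trans[OF B.zero_closed B.one_closed that(2) B.zero_lt_one that(1)] .
  have q0: "\<zero> \<le>\<^sub>A q" "\<zero> \<le>\<^sub>A q'"
    using A.le_trans[OF A.zero_closed A.one_closed _ A.zero_le_one] c assms(4,5) by blast+
  have "\<one> \<otimes> \<one> \<le>\<^sub>A q \<otimes> q'"
    using A.mult_mono2[of "\<one>" q "\<one>" q'] assms(4,5) c q0 by simp
  then have xwz: "\<not> x \<le>\<^sub>B \<zero>\<^bsub>B\<^esub>" "\<not> w \<le>\<^sub>B \<zero>\<^bsub>B\<^esub>" "\<not> z \<le>\<^sub>B \<zero>\<^bsub>B\<^esub>"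
    using pos cut_ge_one[OF assms(1,4)] cut_ge_one[OF assms(2,5)] cut_ge_one[OF assms(3)] c by simp_all
  have T_pos: "\<zero> \<le>\<^sub>A r" if "r \<in> T" "\<not> \<iota> r \<le>\<^sub>B \<zero>\<^bsub>B\<^esub>" for r
    using that iota_le[OF that(1) T_zero] iota_zero A.lt_imp_le[OF A.zero_closed T_A[OF that(1)]] by simp
  have "x \<otimes>\<^bsub>B\<^esub> w \<le>\<^sub>B z"
  proof (rule ccontr)
    assume lt: "\<not> x \<otimes>\<^bsub>B\<^esub> w \<le>\<^sub>B z"
    then have "\<not> x \<le>\<^sub>B z \<otimes>\<^bsub>B\<^esub> inv\<^bsub>B\<^esub> w" using B.le_divide_iff(1)[of x z w] c xwz by simp
    then obtain r where r: "r \<in> T" "\<not> \<iota> r \<le>\<^sub>B z \<otimes>\<^bsub>B\<^esub> inv\<^bsub>B\<^esub> w" "\<not> x \<le>\<^sub>B \<iota> r"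
      using dense[of "z \<otimes>\<^bsub>B\<^esub> inv\<^bsub>B\<^esub> w" x] c xwz by auto
    have rA: "r \<in> carrier A" "\<iota> r \<in> carrier B" using T_A iota_B r by simp_all
    have rwz: "\<not> \<iota> r \<otimes>\<^bsub>B\<^esub> w \<le>\<^sub>B z" using r(2) B.le_divide_iff(1)[of "\<iota> r" z w] rA c xwz by simp
    have r0: "\<not> \<iota> r \<le>\<^sub>B \<zero>\<^bsub>B\<^esub>"
    proof
      assume "\<iota> r \<le>\<^sub>B \<zero>\<^bsub>B\<^esub>"
      then have "\<iota> r \<otimes>\<^bsub>B\<^esub> w \<le>\<^sub>B \<zero>\<^bsub>B\<^esub>" using B.le_mult_iff[of "\<iota> r" "\<zero>\<^bsub>B\<^esub>" w] rA c xwz by simp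
      then show False using rwz B.le_trans[of "\<iota> r \<otimes>\<^bsub>B\<^esub> w" "\<zero>\<^bsub>B\<^esub>" z] B.lt_imp_le[of "\<zero>\<^bsub>B\<^esub>" z] rA c xwz by simp
    qed
    have "\<not> w \<le>\<^sub>B z \<otimes>\<^bsub>B\<^esub> inv\<^bsub>B\<^esub> \<iota> r"
      using rwz B.le_divide_iff(1)[of w z "\<iota> r"] c rA r0 by (simp add: B.m_comm)
    then obtain s where s: "s \<in> T" "\<not> \<iota> s \<le>\<^sub>B z \<otimes>\<^bsub>B\<^esub> inv\<^bsub>B\<^esub> \<iota> r" "\<not> w \<le>\<^sub>B \<iota> s"
      using dense[of "z \<otimes>\<^bsub>B\<^esub> inv\<^bsub>B\<^esub> \<iota> r" w] c rA r0 by auto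
    have sA: "s \<in> carrier A" "\<iota> s \<in> carrier B" using T_A iota_B s by simp_all
    have srz: "\<not> \<iota> s \<otimes>\<^bsub>B\<^esub> \<iota> r \<le>\<^sub>B z" using s(2) B.le_divide_iff(1)[of "\<iota> s" z "\<iota> r"] sA rA r0 c by simp
    have s0: "\<not> \<iota> s \<le>\<^sub>B \<zero>\<^bsub>B\<^esub>"
    proof
      assume "\<iota> s \<le>\<^sub>B \<zero>\<^bsub>B\<^esub>"
      then have "\<iota> s \<otimes>\<^bsub>B\<^esub> \<iota> r \<le>\<^sub>B \<zero>\<^bsub>B\<^esub>" using B.le_mult_iff[of "\<iota> s" "\<zero>\<^bsub>B\<^esub>" "\<iota> r"] rA sA r0 by simp
      then show False using srz B.le_trans[of "\<iota> s \<otimes>\<^bsub>B\<^esub> \<iota> r" "\<zero>\<^bsub>B\<^esub>" z] B.lt_imp_le[of "\<zero>\<^bsub>B\<^esub>" z] rA sA c xwz by simp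
    qed
    have "r \<le>\<^sub>A q" using cut_upper[OF assms(1) r(1)] r(3) A.le_total[of r q] rA c by blast
    moreover have "s \<le>\<^sub>A q'" using cut_upper[OF assms(2) s(1)] s(3) A.le_total[of s q'] sA c by blast
    ultimately have "r \<otimes> s \<le>\<^sub>A q \<otimes> q'"
      using A.mult_mono2[of r q s q'] rA sA c q0 T_pos[OF s(1) s0] by simp
    then have "\<iota> r \<otimes>\<^bsub>B\<^esub> \<iota> s \<le>\<^sub>B z"
      using cut_lower[OF assms(3) T_mult[OF r(1) s(1)]] iota_mult r s by simp
    then show False using srz rA sA by (simp add: B.m_comm)
  qed
  moreover have "z \<le>\<^sub>B x \<otimes>\<^bsub>B\<^esub> w"
  proof (rule ccontr)
    assume lt: "\<not> z \<le>\<^sub>B x \<otimes>\<^bsub>B\<^esub> w"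
    then have "\<not> z \<otimes>\<^bsub>B\<^esub> inv\<^bsub>B\<^esub> w \<le>\<^sub>B x" using B.le_divide_iff(2)[of x z w] c xwz by simp
    then obtain r where r: "r \<in> T" "\<not> \<iota> r \<le>\<^sub>B x" "\<not> z \<otimes>\<^bsub>B\<^esub> inv\<^bsub>B\<^esub> w \<le>\<^sub>B \<iota> r"
      using dense[of x "z \<otimes>\<^bsub>B\<^esub> inv\<^bsub>B\<^esub> w"] c xwz by auto
    have rA: "r \<in> carrier A" "\<iota> r \<in> carrier B" using T_A iota_B r by simp_all
    have rwz: "\<not> z \<le>\<^sub>B \<iota> r \<otimes>\<^bsub>B\<^esub> w" using r(3) B.le_divide_iff(2)[of "\<iota> r" z w] rA c xwz by simp
    have r0: "\<not> \<iota> r \<le>\<^sub>B \<zero>\<^bsub>B\<^esub>"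
      using B.le_trans[of "\<iota> r" "\<zero>\<^bsub>B\<^esub>" x] B.lt_imp_le[of "\<zero>\<^bsub>B\<^esub>" x] r(2) rA c xwz by auto
    have "\<not> z \<otimes>\<^bsub>B\<^esub> inv\<^bsub>B\<^esub> \<iota> r \<le>\<^sub>B w"
      using rwz B.le_divide_iff(2)[of w z "\<iota> r"] c rA r0 by (simp add: B.m_comm)
    then obtain s where s: "s \<in> T" "\<not> \<iota> s \<le>\<^sub>B w" "\<not> z \<otimes>\<^bsub>B\<^esub> inv\<^bsub>B\<^esub> \<iota> r \<le>\<^sub>B \<iota> s"
      using dense[of w "z \<otimes>\<^bsub>B\<^esub> inv\<^bsub>B\<^esub> \<iota> r"] c rA r0 by auto
    have sA: "s \<in> carrier A" "\<iota> s \<in> carrier B" using T_A iota_B s by simp_all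
    have srz: "\<not> z \<le>\<^sub>B \<iota> s \<otimes>\<^bsub>B\<^esub> \<iota> r" using s(3) B.le_divide_iff(2)[of "\<iota> s" z "\<iota> r"] sA rA r0 c by simp
    have "q \<le>\<^sub>A r" using cut_lower[OF assms(1) r(1)] r(2) A.le_total[of r q] rA c by blast
    moreover have "q' \<le>\<^sub>A s" using cut_lower[OF assms(2) s(1)] s(2) A.le_total[of s q'] sA c by blast
    ultimately have "q \<otimes> q' \<le>\<^sub>A r \<otimes> s"
      using A.mult_mono2[of q r q' s] rA sA c q0 T_pos[OF r(1) r0] by simp
    then have "z \<le>\<^sub>B \<iota> r \<otimes>\<^bsub>B\<^esub> \<iota> s"
      using cut_upper[OF assms(3) T_mult[OF r(1) s(1)]] iota_mult r s by simp
    then show False using srz rA sA by (simp add: B.m_comm)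
  qed
  ultimately show ?thesis using B.le_antisym c by simp
qed

end

text \<open>Every product on the right has factors among \<open>x \<oplus> m\<close>,
  \<open>y \<oplus> m\<close> and \<open>m\<close>. For the shift \<open>m\<close> from
  \<open>bd_shift\<close> these are all at least one, so compatibility of cuts with general products
  follows from that special case together with sums and negatives.\<close>

lemma (in cring) mult_shift:
  assumes "x \<in> carrier R" "y \<in> carrier R" "m \<in> carrier R"
  shows "x \<otimes> y = ((x \<oplus> m) \<otimes> (y \<oplus> m) \<oplus> \<ominus> ((x \<oplus> m) \<otimes> m)) \<oplus> (\<ominus> ((y \<oplus> m) \<otimes> m) \<oplus> m \<otimes> m)"
  using assms by algebra

section \<open>Standard parts when every cut is filled\<close>

locale complete_std_part = std_part +
  assumes cut_exists: "q \<in> bd \<Longrightarrow> \<exists>x. cut q x"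
begin

definition st :: "'a \<Rightarrow> 'b" where
  "st q = (THE x. cut q x)"

lemma cut_st: "q \<in> bd \<Longrightarrow> cut q (st q)"
  unfolding st_def using cut_exists[of q] cut_unique[of q] by (metis theI)

lemma st_eq: "cut q x \<Longrightarrow> st q = x"
  using cut_st[of q] cut_unique cut_in(1) by blast

lemma cut_add: assumes "cut q x" "cut q' x'" shows "cut (q \<oplus> q') (x \<oplus>\<^bsub>B\<^esub> x')"
proof -
  have "cut (q \<oplus> q') (st (q \<oplus> q'))" using cut_st bd_add cut_in assms by blast
  then show ?thesis using cut_add_eq[OF assms] by metis
qed

lemma bd_nonneg_le:
  assumes "u \<in> carrier A" "\<zero> \<le>\<^sub>A u" "u \<le>\<^sub>A t" "t \<in> T" shows "u \<in> bd"
proof -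
  have "\<zero> \<le>\<^sub>A t" using A.le_trans[of "\<zero>" u t] assms T_A by simp
  then have "\<ominus> t \<le>\<^sub>A \<zero>" using A.le_minus_iff[of t "\<zero>"] T_A[OF assms(4)] by simp
  then have "\<ominus> t \<le>\<^sub>A u" using A.le_trans[of "\<ominus> t" "\<zero>" u] assms T_A by simp
  then show ?thesis unfolding bd_def using assms by blast
qed

lemma ge_one_nonneg: "u \<in> carrier A \<Longrightarrow> \<one> \<le>\<^sub>A u \<Longrightarrow> \<zero> \<le>\<^sub>A u"
  using A.le_trans[of "\<zero>" "\<one>" u] by simp

lemma bd_mult_ge_one:
  assumes "q \<in> bd" "q' \<in> bd" "\<one> \<le>\<^sub>A q" "\<one> \<le>\<^sub>A q'" shows "q \<otimes> q' \<in> bd"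
proof -
  obtain r where r: "r \<in> T" "q \<le>\<^sub>A r" using assms by (auto simp: bd_def)
  obtain s where s: "s \<in> T" "q' \<le>\<^sub>A s" using assms by (auto simp: bd_def)
  note c = bd_A[OF assms(1)] bd_A[OF assms(2)] T_A[OF r(1)] T_A[OF s(1)]
  have q0: "\<zero> \<le>\<^sub>A q" "\<zero> \<le>\<^sub>A q'" using ge_one_nonneg c assms by blast+
  moreover have "\<zero> \<le>\<^sub>A r" using A.le_trans[of "\<zero>" q r] q0 r c by simp
  ultimately have "q \<otimes> q' \<le>\<^sub>A r \<otimes> s" using A.mult_mono2[of q r q' s] r s c by simp
  moreover have "\<zero> \<le>\<^sub>A q \<otimes> q'" using A.le_mult q0 c by simp
  ultimately show ?thesis using bd_nonneg_le T_mult[OF r(1) s(1)] c by simp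
qed

lemma cut_mult_ge_one:
  assumes "cut q x" "cut q' x'" "\<one> \<le>\<^sub>A q" "\<one> \<le>\<^sub>A q'"
  shows "cut (q \<otimes> q') (x \<otimes>\<^bsub>B\<^esub> x')"
proof -
  have "cut (q \<otimes> q') (st (q \<otimes> q'))" using cut_st bd_mult_ge_one cut_in assms by blast
  then show ?thesis using cut_mult_eq_ge_one[OF assms(1,2) _ assms(3,4)] by metis
qed

lemma cut_mult: assumes "cut q x" "cut q' x'" shows "cut (q \<otimes> q') (x \<otimes>\<^bsub>B\<^esub> x')"
proof -
  note c = cut_in[OF assms(1)] cut_in[OF assms(2)]
  obtain m where m: "m \<in> T" "\<one> \<le>\<^sub>A m" "\<one> \<le>\<^sub>A q \<oplus> m" "\<one> \<le>\<^sub>A q' \<oplus> m"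
    using bd_shift c by blast
  have mm: "cut m (\<iota> m)" "m \<in> carrier A" "\<iota> m \<in> carrier B" using cut_T m T_A iota_B by simp_all
  have qm: "cut (q \<oplus> m) (x \<oplus>\<^bsub>B\<^esub> \<iota> m)" "cut (q' \<oplus> m) (x' \<oplus>\<^bsub>B\<^esub> \<iota> m)"
    using cut_add assms mm by blast+
  show ?thesis
    unfolding A.mult_shift[OF c(2,5) mm(2)] B.mult_shift[OF c(3,6) mm(3)]
    using cut_add[OF cut_add[OF cut_mult_ge_one[OF qm m(3,4)] cut_minus[OF cut_mult_ge_one[OF qm(1) mm(1) m(3,2)]]]
       cut_add[OF cut_minus[OF cut_mult_ge_one[OF qm(2) mm(1) m(4,2)]] cut_mult_ge_one[OF mm(1) mm(1) m(2,2)]]] .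
qed

lemma bd_mult: "q \<in> bd \<Longrightarrow> q' \<in> bd \<Longrightarrow> q \<otimes> q' \<in> bd"
  using cut_mult cut_st cut_in by blast

text \<open>If neither \<open>q\<close> nor its negative reaches a positive standard element, then
  the standard elements below \<open>q\<close> are at most zero and those above \<open>q\<close> at
  least zero, so zero fills the cut. The right-hand side is the form in which \<open>mu0\<close> is
  compared with the kernel.\<close>

lemma st_zero_iff:
  assumes "q \<in> bd"
  shows "st q = \<zero>\<^bsub>B\<^esub> \<longleftrightarrow> (\<forall>r\<in>T. \<not> r \<le>\<^sub>A \<zero> \<longrightarrow> \<not> r \<le>\<^sub>A q \<and> \<not> q \<le>\<^sub>A \<ominus> r)"
proof
  assume "st q = \<zero>\<^bsub>B\<^esub>"
  then have c: "cut q \<zero>\<^bsub>B\<^esub>" using cut_st[OF assms] by simp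
  show "\<forall>r\<in>T. \<not> r \<le>\<^sub>A \<zero> \<longrightarrow> \<not> r \<le>\<^sub>A q \<and> \<not> q \<le>\<^sub>A \<ominus> r"
  proof (intro ballI impI conjI notI)
    fix r assume r: "r \<in> T" "\<not> r \<le>\<^sub>A \<zero>"
    then have pos: "\<not> \<iota> r \<le>\<^sub>B \<zero>\<^bsub>B\<^esub>" using iota_le[OF r(1) T_zero] iota_zero by simp
    { assume "r \<le>\<^sub>A q" then show False using cut_lower[OF c r(1)] pos by blast }
    { assume "q \<le>\<^sub>A \<ominus> r"
      then have "\<zero>\<^bsub>B\<^esub> \<le>\<^sub>B \<ominus>\<^bsub>B\<^esub> \<iota> r" using cut_upper[OF c T_minus[OF r(1)]] iota_minus r by simp
      then show False using pos B.minus_nonneg iota_B r by simp }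
  qed
next
  assume *: "\<forall>r\<in>T. \<not> r \<le>\<^sub>A \<zero> \<longrightarrow> \<not> r \<le>\<^sub>A q \<and> \<not> q \<le>\<^sub>A \<ominus> r"
  have "cut q \<zero>\<^bsub>B\<^esub>" unfolding cut_def
  proof (intro conjI ballI impI)
    fix r assume r: "r \<in> T"
    { assume "r \<le>\<^sub>A q"
      then have "r \<le>\<^sub>A \<zero>" using * r by blast
      then show "\<iota> r \<le>\<^sub>B \<zero>\<^bsub>B\<^esub>" using iota_le[OF r T_zero] iota_zero by simp }
    { assume "q \<le>\<^sub>A r"
      then have "q \<le>\<^sub>A \<ominus> (\<ominus> r)" using T_A[OF r] by simp
      then have "\<ominus> r \<le>\<^sub>A \<zero>" using * T_minus[OF r] by blast
      then have "\<zero> \<le>\<^sub>A r" using A.le_minus_iff[of r "\<zero>"] T_A[OF r] by simp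
      then show "\<zero>\<^bsub>B\<^esub> \<le>\<^sub>B \<iota> r" using iota_le[OF T_zero r] iota_zero by simp }
  qed (use assms in simp_all)
  then show "st q = \<zero>\<^bsub>B\<^esub>" by (rule st_eq)
qed

text \<open>Agreement with \<open>\<iota>\<close> on \<open>T\<close> is assumed here, since it
  rests on induction over standard numbers, which does not exist at this level of abstraction. The
  conclusion is phrased with \<open>cut\<close> because uniqueness of cuts then determines
  \<open>h q\<close>.\<close>

lemma hom_is_cut:
  assumes h: "\<And>q. q \<in> bd \<Longrightarrow> h q \<in> carrier B"
    and h_add: "\<And>p q. p \<in> bd \<Longrightarrow> q \<in> bd \<Longrightarrow> h (p \<oplus> q) = h p \<oplus>\<^bsub>B\<^esub> h q"
    and h_mult: "\<And>p q. p \<in> bd \<Longrightarrow> q \<in> bd \<Longrightarrow> h (p \<otimes> q) = h p \<otimes>\<^bsub>B\<^esub> h q"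
    and h_T: "\<And>r. r \<in> T \<Longrightarrow> h r = \<iota> r"
    and surj: "\<And>x. x \<in> carrier B \<Longrightarrow> \<exists>p\<in>bd. h p = x"
    and root: "\<And>w. w \<in> carrier B \<Longrightarrow> \<not> w \<le>\<^sub>B \<zero>\<^bsub>B\<^esub> \<Longrightarrow> \<exists>y\<in>carrier B. y \<otimes>\<^bsub>B\<^esub> y = w"
    and q: "q \<in> bd"
  shows "cut q (h q)"
proof -
  have h_minus: "h (\<ominus> p) = \<ominus>\<^bsub>B\<^esub> h p" if "p \<in> bd" for p
  proof -
    have "h (\<ominus> p) \<oplus>\<^bsub>B\<^esub> h p = \<zero>\<^bsub>B\<^esub>"
      using h_add[OF bd_minus[OF that] that] h_T[OF T_zero] iota_zero bd_A[OF that] by (simp add: A.l_neg)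
    then show ?thesis using h that bd_minus by (intro B.minus_equality[symmetric]) simp_all
  qed
  have unit: "h u \<noteq> \<zero>\<^bsub>B\<^esub>" if u: "u \<in> bd" "\<one> \<le>\<^sub>A u" for u
  proof
    assume 0: "h u = \<zero>\<^bsub>B\<^esub>"
    have uA: "u \<in> carrier A" using bd_A u by blast
    have u0: "\<not> u \<le>\<^sub>A \<zero>" using A.lt_le_trans[OF _ _ uA A.zero_lt_one u(2)] by simp
    have inv: "inv u \<in> carrier A" "\<zero> \<le>\<^sub>A inv u"
      using A.inv_pos[OF uA u0] A.lt_imp_le[of "\<zero>" "inv u"] uA u0 by simp_all
    \<comment> \<open>The inverse of \<open>u\<close> lies between zero and one, so it is bounded
      and \<open>h\<close> may be applied to it.\<close>
    have "\<one> \<otimes> inv u \<le>\<^sub>A u \<otimes> inv u" using uA u inv by (rule_tac A.mult_mono) simp_all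
    then have "inv u \<le>\<^sub>A \<one>" using uA u0 by simp
    then have bd: "inv u \<in> bd" using bd_nonneg_le inv T_one by blast
    have "h (u \<otimes> inv u) = \<zero>\<^bsub>B\<^esub>" using h_mult[OF u(1) bd] 0 h[OF bd] by simp
    then show False using uA u0 h_T[OF T_one] iota_one B.zero_not_one by simp
  qed
  have pos: "\<not> h u \<le>\<^sub>B \<zero>\<^bsub>B\<^esub>" if u: "u \<in> bd" "\<one> \<le>\<^sub>A u" for u
  proof
    assume le: "h u \<le>\<^sub>B \<zero>\<^bsub>B\<^esub>"
    have "\<not> \<ominus>\<^bsub>B\<^esub> h u \<le>\<^sub>B \<zero>\<^bsub>B\<^esub>"
    proof
      assume "\<ominus>\<^bsub>B\<^esub> h u \<le>\<^sub>B \<zero>\<^bsub>B\<^esub>"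
      then have "\<zero>\<^bsub>B\<^esub> \<le>\<^sub>B h u" using B.le_minus_iff[of "h u" "\<zero>\<^bsub>B\<^esub>"] h[OF u(1)] by simp
      then show False using le unit[OF u] B.le_antisym[of "h u" "\<zero>\<^bsub>B\<^esub>"] h[OF u(1)] by simp
    qed
    then obtain y where y: "y \<in> carrier B" "y \<otimes>\<^bsub>B\<^esub> y = \<ominus>\<^bsub>B\<^esub> h u" using root h u by blast
    obtain p where p: "p \<in> bd" "h p = y" using surj y by blast
    have pA: "p \<in> carrier A" "u \<in> carrier A" using bd_A p u by blast+
    have "\<one> \<oplus> \<zero> \<le>\<^sub>A u \<oplus> p \<otimes> p"
      using pA u A.square_nonneg by (rule_tac A.add_mono) simp_all
    then have "\<one> \<le>\<^sub>A u \<oplus> p \<otimes> p" by simp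
    moreover have "h (u \<oplus> p \<otimes> p) = \<zero>\<^bsub>B\<^esub>"
      using h_add[OF u(1) bd_mult[OF p(1) p(1)]] h_mult[OF p(1) p(1)] p(2) y h[OF u(1)] by (simp add: B.r_neg)
    ultimately show False using unit bd_add u bd_mult p by blast
  qed
  have lower: "\<iota> r \<le>\<^sub>B h p" if r: "r \<in> T" "r \<le>\<^sub>A p" and p: "p \<in> bd" for r p
  proof (rule ccontr)
    assume lt: "\<not> \<iota> r \<le>\<^sub>B h p"
    note c = T_A[OF r(1)] bd_A[OF p] iota_B[OF r(1)] h[OF p]
    \<comment> \<open>If \<open>h p\<close> fell short of \<open>\<iota> r\<close> by a positive
      \<open>d\<close>, take a standard \<open>t\<close> with \<open>t d > 1\<close>. The element
      \<open>u\<close>, which is \<open>t (p - r) + 1\<close>, is at least one, yet \<open>h\<close>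
      maps it to \<open>1 - t d\<close>, which is negative, contradicting
      \<open>pos\<close>.\<close>
    define d where "d = \<iota> r \<ominus>\<^bsub>B\<^esub> h p"
    have d: "d \<in> carrier B" "\<not> d \<le>\<^sub>B \<zero>\<^bsub>B\<^esub>"
      using lt c B.le_add_iff[of d "\<zero>\<^bsub>B\<^esub>" "h p"]
      by (simp_all add: d_def a_minus_def B.a_assoc B.l_neg)
    \<comment> \<open>Density between the inverse of \<open>d\<close> and the same element plus one
      takes the place of the Archimedean property.\<close>
    have "\<not> inv\<^bsub>B\<^esub> d \<oplus>\<^bsub>B\<^esub> \<one>\<^bsub>B\<^esub> \<le>\<^sub>B inv\<^bsub>B\<^esub> d \<oplus>\<^bsub>B\<^esub> \<zero>\<^bsub>B\<^esub>"
      using B.le_add_iff2[of "\<one>\<^bsub>B\<^esub>" "\<zero>\<^bsub>B\<^esub>" "inv\<^bsub>B\<^esub> d"] B.zero_lt_one d by simp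
    then obtain t where t: "t \<in> T" "\<not> \<iota> t \<le>\<^sub>B inv\<^bsub>B\<^esub> d"
      using dense[of "inv\<^bsub>B\<^esub> d" "inv\<^bsub>B\<^esub> d \<oplus>\<^bsub>B\<^esub> \<one>\<^bsub>B\<^esub>"] d by auto
    have tA: "t \<in> carrier A" "\<iota> t \<in> carrier B" using t T_A iota_B by simp_all
    have td: "\<not> \<iota> t \<otimes>\<^bsub>B\<^esub> d \<le>\<^sub>B \<one>\<^bsub>B\<^esub>"
      using t(2) B.le_divide_iff(1)[of "\<iota> t" "\<one>\<^bsub>B\<^esub>" d] d tA by simp
    have "\<zero>\<^bsub>B\<^esub> \<le>\<^sub>B \<iota> t"
      using B.le_lt_trans[of "\<zero>\<^bsub>B\<^esub>" "inv\<^bsub>B\<^esub> d" "\<iota> t"] B.inv_pos[OF d] B.lt_imp_le[of "\<zero>\<^bsub>B\<^esub>" "inv\<^bsub>B\<^esub> d"]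
        B.lt_imp_le[of "\<zero>\<^bsub>B\<^esub>" "\<iota> t"] t(2) d tA by simp
    then have t0: "\<zero> \<le>\<^sub>A t" using iota_le[OF T_zero t(1)] iota_zero by simp
    define u where "u = t \<otimes> (p \<oplus> \<ominus> r) \<oplus> \<one>"
    have bds: "p \<oplus> \<ominus> r \<in> bd" "t \<otimes> (p \<oplus> \<ominus> r) \<in> bd"
      using bd_add bd_minus bd_mult bd_T p r t by simp_all
    then have u: "u \<in> bd" unfolding u_def using bd_add bd_T T_one by simp
    have "\<zero> \<le>\<^sub>A p \<oplus> \<ominus> r" using A.le_diff_zero[of r p] r c by (simp add: a_minus_def)
    then have "\<zero> \<le>\<^sub>A t \<otimes> (p \<oplus> \<ominus> r)" using t0 tA c by (rule_tac A.le_mult) simp_all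
    then have "\<zero> \<oplus> \<one> \<le>\<^sub>A u" unfolding u_def using tA c by (subst A.le_add_iff) simp_all
    then have "\<one> \<le>\<^sub>A u" by simp
    from pos[OF u this] have "\<not> h u \<le>\<^sub>B \<zero>\<^bsub>B\<^esub>" .
    moreover have "h u = \<iota> t \<otimes>\<^bsub>B\<^esub> (h p \<oplus>\<^bsub>B\<^esub> \<ominus>\<^bsub>B\<^esub> \<iota> r) \<oplus>\<^bsub>B\<^esub> \<one>\<^bsub>B\<^esub>"
      unfolding u_def using h_add h_mult h_minus h_T iota_one bds bd_T bd_minus p r t T_one by simp
    moreover have "\<iota> t \<otimes>\<^bsub>B\<^esub> (h p \<oplus>\<^bsub>B\<^esub> \<ominus>\<^bsub>B\<^esub> \<iota> r) \<oplus>\<^bsub>B\<^esub> \<one>\<^bsub>B\<^esub> = \<one>\<^bsub>B\<^esub> \<ominus>\<^bsub>B\<^esub> \<iota> t \<otimes>\<^bsub>B\<^esub> d"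
      unfolding d_def using tA(2) c(3,4) B.one_closed by algebra
    ultimately have "\<not> \<one>\<^bsub>B\<^esub> \<ominus>\<^bsub>B\<^esub> \<iota> t \<otimes>\<^bsub>B\<^esub> d \<le>\<^sub>B \<zero>\<^bsub>B\<^esub>" by simp
    then have "\<zero>\<^bsub>B\<^esub> \<le>\<^sub>B \<one>\<^bsub>B\<^esub> \<ominus>\<^bsub>B\<^esub> \<iota> t \<otimes>\<^bsub>B\<^esub> d" using tA d by (rule_tac B.lt_imp_le) simp_all
    then show False using td B.le_diff_zero[of "\<iota> t \<otimes>\<^bsub>B\<^esub> d" "\<one>\<^bsub>B\<^esub>"] tA d by simp
  qed
  show ?thesis unfolding cut_def
  proof (intro conjI ballI impI)
    fix r assume r: "r \<in> T"
    note c = T_A[OF r(1)] bd_A[OF q] iota_B[OF r(1)] h[OF q]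
    { assume "r \<le>\<^sub>A q" then show "\<iota> r \<le>\<^sub>B h q" using lower r q by blast }
    { assume "q \<le>\<^sub>A r"
      then have "\<ominus> r \<le>\<^sub>A \<ominus> q" using c by simp
      then have "\<iota> (\<ominus> r) \<le>\<^sub>B h (\<ominus> q)" using lower T_minus r bd_minus q by blast
      then show "h q \<le>\<^sub>B \<iota> r" using iota_minus[OF r] h_minus[OF q] c by simp }
  qed (use q h in simp_all)
qed
end

subsection \<open>Definability\<close>

primrec vars :: "fm \<Rightarrow> nat set" where
  "vars (Mem i j) = {i, j}"
| "vars (Eq i j) = {i, j}"
| "vars (Neg \<phi>) = vars \<phi>"
| "vars (Conj \<phi> \<psi>) = vars \<phi> \<union> vars \<psi>"
| "vars (All i \<phi>) = insert i (vars \<phi>)"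

lemma finite_vars: "finite (vars \<phi>)"
  by (induction \<phi>) auto

lemma sat_cong: "(\<And>i. i \<in> vars \<phi> \<Longrightarrow> e i = e' i) \<Longrightarrow> sat m D e \<phi> \<longleftrightarrow> sat m D e' \<phi>"
proof (induction \<phi> arbitrary: e e')
  case (All i \<phi>)
  have "sat m D (e(i := x)) \<phi> \<longleftrightarrow> sat m D (e'(i := x)) \<phi>" for x
    by (rule All.IH) (use All.prems in auto)
  then show ?case by simp
next
  case (Conj \<phi> \<psi>)
  have "sat m D e \<phi> \<longleftrightarrow> sat m D e' \<phi>" by (rule Conj.IH(1)) (use Conj.prems in auto)
  moreover have "sat m D e \<psi> \<longleftrightarrow> sat m D e' \<psi>" by (rule Conj.IH(2)) (use Conj.prems in auto)
  ultimately show ?case by simp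
next
  case (Neg \<phi>)
  have "sat m D e \<phi> \<longleftrightarrow> sat m D e' \<phi>" by (rule Neg.IH) (use Neg.prems in auto)
  then show ?case by simp
qed auto

text \<open>The renaming \<open>f\<close> need not be injective. A bound variable is sent to some
  \<open>k\<close> outside the image of all variables of the formula, which excludes
  capture.\<close>

lemma sat_rename: "\<exists>\<phi>'. \<forall>e. sat m D (\<lambda>i. e (f i)) \<phi> \<longleftrightarrow> sat m D e \<phi>'"
proof (induction \<phi> arbitrary: f)
  case (Mem i j)
  show ?case by (rule exI[of _ "Mem (f i) (f j)"]) simp
next
  case (Eq i j)
  show ?case by (rule exI[of _ "Eq (f i) (f j)"]) simp
next
  case (Neg \<phi>)
  then obtain \<phi>' where "\<forall>e. sat m D (\<lambda>i. e (f i)) \<phi> \<longleftrightarrow> sat m D e \<phi>'" by blast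
  then show ?case by (intro exI[of _ "Neg \<phi>'"]) simp
next
  case (Conj \<phi> \<psi>)
  obtain \<phi>' where "\<forall>e. sat m D (\<lambda>i. e (f i)) \<phi> \<longleftrightarrow> sat m D e \<phi>'"
    using Conj.IH(1) by blast
  moreover obtain \<psi>' where "\<forall>e. sat m D (\<lambda>i. e (f i)) \<psi> \<longleftrightarrow> sat m D e \<psi>'"
    using Conj.IH(2) by blast
  ultimately show ?case by (intro exI[of _ "Conj \<phi>' \<psi>'"]) simp
next
  case (All i \<phi>)
  obtain k where k: "k \<notin> f ` vars \<phi>"
    using ex_new_if_finite[OF infinite_UNIV_nat finite_imageI[OF finite_vars]] by blast
  obtain \<phi>' where \<phi>': "\<forall>e. sat m D (\<lambda>j. e ((f(i := k)) j)) \<phi> \<longleftrightarrow> sat m D e \<phi>'"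
    using All.IH by blast
  have "sat m D ((\<lambda>j. e (f j))(i := x)) \<phi> \<longleftrightarrow> sat m D (e(k := x)) \<phi>'" for e x
  proof -
    have "sat m D (e(k := x)) \<phi>' \<longleftrightarrow> sat m D (\<lambda>j. (e(k := x)) ((f(i := k)) j)) \<phi>"
      by (rule \<phi>'[rule_format, symmetric])
    also have "\<dots> \<longleftrightarrow> sat m D ((\<lambda>j. e (f j))(i := x)) \<phi>"
      by (rule sat_cong) (use k in auto)
    finally show ?thesis by simp
  qed
  then show ?case by (intro exI[of _ "All k \<phi>'"]) simp
qed

context class_structure
begin

text \<open>A predicate on environments ranging over \<open>W\<close> is \<open>D\<close>-definable if it is given by a formula with
  quantifiers over \<open>D\<close> whose variables are replaced by variables or by parameters from \<open>D\<close>.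
  The quantifier rules below shift environments in the style of de Bruijn, which spares all
  freshness conditions.\<close>

definition tm :: "'c set \<Rightarrow> ((nat \<Rightarrow> 'c) \<Rightarrow> 'c) \<Rightarrow> bool" where
  "tm D t \<longleftrightarrow> (\<exists>i. t = (\<lambda>e. e i)) \<or> (\<exists>c\<in>D. t = (\<lambda>_. c))"

definition dfn :: "'c set \<Rightarrow> 'c set \<Rightarrow> ((nat \<Rightarrow> 'c) \<Rightarrow> bool) \<Rightarrow> bool" where
  "dfn D W P \<longleftrightarrow> (\<exists>\<phi> t. (\<forall>i. tm D (t i)) \<and>
     (\<forall>e. range e \<subseteq> W \<longrightarrow> (P e \<longleftrightarrow> sat (\<epsilon>) D (\<lambda>i. t i e) \<phi>)))"

text \<open>The value sits at position 0 and the arguments are shifted by one, as in the quantifier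
  rules. Values in \<open>W\<close> are demanded so that a definable function may replace a variable
  ranging over \<open>W\<close>.\<close>

definition fn :: "'c set \<Rightarrow> 'c set \<Rightarrow> ((nat \<Rightarrow> 'c) \<Rightarrow> 'c) \<Rightarrow> bool" where
  "fn D W f \<longleftrightarrow> (\<forall>e. range e \<subseteq> W \<longrightarrow> f e \<in> W) \<and> dfn D W (\<lambda>e. e 0 = f (\<lambda>i. e (Suc i)))"

text \<open>Quantifiers inside a formula range over \<open>D\<close>, those in the definability
  rules over \<open>W\<close>; the formula \<open>\<psi>\<close> relativizes the former to the
  latter. The cases that occur are \<open>W = D\<close> and sets among classes, that is
  \<open>W = V\<close> with \<open>D = UNIV\<close>.\<close>

definition dom_ok :: "'c set \<Rightarrow> 'c set \<Rightarrow> bool" where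
  "dom_ok D W \<longleftrightarrow> W \<subseteq> D \<and> (\<exists>\<psi>. \<forall>e. range e \<subseteq> D \<longrightarrow> (sat (\<epsilon>) D e \<psi> \<longleftrightarrow> e 0 \<in> W))"

lemma tm_var: "tm D (\<lambda>e. e i)"
  by (auto simp: tm_def)

lemma tm_const: "c \<in> D \<Longrightarrow> tm D (\<lambda>_. c)"
  by (auto simp: tm_def)

lemma tm_shift: "tm D t \<Longrightarrow> tm D (\<lambda>e. t (\<lambda>i. e (f i)))"
  by (auto simp: tm_def)

lemma tm_in: "tm D t \<Longrightarrow> W \<subseteq> D \<Longrightarrow> range e \<subseteq> W \<Longrightarrow> t e \<in> D"
  by (auto simp: tm_def)

lemma dom_ok_refl: "dom_ok D D"
proof -
  have "\<forall>e. range e \<subseteq> D \<longrightarrow> (sat (\<epsilon>) D e (Eq 0 0) \<longleftrightarrow> e 0 \<in> D)" by auto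
  then show ?thesis unfolding dom_ok_def by blast
qed

lemma dom_ok_V: "dom_ok UNIV V"
proof -
  have "\<forall>e. sat (\<epsilon>) UNIV e (Neg (All 1 (Neg (Mem 0 1)))) \<longleftrightarrow> e 0 \<in> V"
    by (auto simp: V_def)
  then show ?thesis unfolding dom_ok_def by blast
qed

lemma dfn_cong: "dfn D W P' \<Longrightarrow> (\<And>e. range e \<subseteq> W \<Longrightarrow> P e = P' e) \<Longrightarrow> dfn D W P"
  unfolding dfn_def by simp

lemma dfn_mem_tm: "tm D a \<Longrightarrow> tm D b \<Longrightarrow> dfn D W (\<lambda>e. a e \<epsilon> b e)"
  unfolding dfn_def by (intro exI[of _ "Mem 0 1"] exI[of _ "\<lambda>i. if i = 0 then a else b"]) auto

lemma dfn_eq_tm: "tm D a \<Longrightarrow> tm D b \<Longrightarrow> dfn D W (\<lambda>e. a e = b e)"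
  unfolding dfn_def by (intro exI[of _ "Eq 0 1"] exI[of _ "\<lambda>i. if i = 0 then a else b"]) auto

lemma dfn_not:
  assumes "dfn D W P" shows "dfn D W (\<lambda>e. \<not> P e)"
proof -
  obtain \<phi> t where "\<And>i. tm D (t i)" "\<And>e. range e \<subseteq> W \<Longrightarrow> P e = sat (\<epsilon>) D (\<lambda>i. t i e) \<phi>"
    using assms by (auto simp: dfn_def)
  then show ?thesis unfolding dfn_def by (intro exI[of _ "Neg \<phi>"] exI[of _ t]) simp
qed

text \<open>Both formulas may use the same variable for different terms, so the terms of the first
  are moved to even and those of the second to odd positions.\<close>

lemma dfn_conj:
  assumes "dfn D W P" "dfn D W P2"
  shows "dfn D W (\<lambda>e. P e \<and> P2 e)"
proof -
  obtain \<phi> s where s: "\<And>i. tm D (s i)" and \<phi>: "\<And>e. range e \<subseteq> W \<Longrightarrow> P e = sat (\<epsilon>) D (\<lambda>i. s i e) \<phi>"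
    using assms(1) by (auto simp: dfn_def)
  obtain \<psi> t where t: "\<And>i. tm D (t i)" and \<psi>: "\<And>e. range e \<subseteq> W \<Longrightarrow> P2 e = sat (\<epsilon>) D (\<lambda>i. t i e) \<psi>"
    using assms(2) by (auto simp: dfn_def)
  define u where "u i = (if even i then s (i div 2) else t (i div 2))" for i
  obtain \<phi>' where \<phi>': "\<forall>e. sat (\<epsilon>) D (\<lambda>i. e (2 * i)) \<phi> \<longleftrightarrow> sat (\<epsilon>) D e \<phi>'"
    using sat_rename[of _ _ "\<lambda>i. 2 * i"] by blast
  obtain \<psi>' where \<psi>': "\<forall>e. sat (\<epsilon>) D (\<lambda>i. e (2 * i + 1)) \<psi> \<longleftrightarrow> sat (\<epsilon>) D e \<psi>'"
    using sat_rename[of _ _ "\<lambda>i. 2 * i + 1"] by blast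
  have "tm D (u i)" for i by (simp add: u_def s t)
  moreover have "(P e \<and> P2 e) = sat (\<epsilon>) D (\<lambda>i. u i e) (Conj \<phi>' \<psi>')" if "range e \<subseteq> W" for e
    using \<phi>'[rule_format, of "\<lambda>i. u i e"] \<psi>'[rule_format, of "\<lambda>i. u i e"]
    by (simp add: \<phi>[OF that] \<psi>[OF that] u_def)
  ultimately show ?thesis unfolding dfn_def by blast
qed

lemma dfn_disj:
  assumes "dfn D W P" "dfn D W P2" shows "dfn D W (\<lambda>e. P e \<or> P2 e)"
  using dfn_not[OF dfn_conj[OF dfn_not[OF assms(1)] dfn_not[OF assms(2)]]] by simp

lemma dfn_imp:
  assumes "dfn D W P" "dfn D W P2" shows "dfn D W (\<lambda>e. P e \<longrightarrow> P2 e)"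
  using dfn_disj[OF dfn_not[OF assms(1)] assms(2)] by simp

lemma dfn_iff:
  assumes "dfn D W P" "dfn D W P2" shows "dfn D W (\<lambda>e. P e \<longleftrightarrow> P2 e)"
  using dfn_conj[OF dfn_imp[OF assms] dfn_imp[OF assms(2,1)]] by (simp only: iff_conv_conj_imp)

lemma dfn_true: "dfn D W (\<lambda>e. True)"
  using dfn_eq_tm[OF tm_var[of D 0] tm_var[of D 0]] by simp

text \<open>Exactly the variables standing for environment position 0 have to follow the quantifier.
  They are merged into variable 0, which is then bound, while all other variables move up by
  one.\<close>

lemma dfn_all:
  assumes "dom_ok D W" "dfn D W (\<lambda>e. \<Phi> (\<lambda>i. e (Suc i)) (e 0))"
  shows "dfn D W (\<lambda>e. \<forall>x\<in>W. \<Phi> e x)"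
proof -
  obtain \<chi> where WD: "W \<subseteq> D" and \<chi>: "\<And>e. range e \<subseteq> D \<Longrightarrow> sat (\<epsilon>) D e \<chi> \<longleftrightarrow> e 0 \<in> W"
    using assms(1) by (auto simp: dom_ok_def)
  obtain \<phi> t where t: "\<And>i. tm D (t i)"
    and \<phi>: "\<And>e. range e \<subseteq> W \<Longrightarrow> \<Phi> (\<lambda>i. e (Suc i)) (e 0) = sat (\<epsilon>) D (\<lambda>i. t i e) \<phi>"
    using assms(2) by (auto simp: dfn_def)
  define f where "f i = (if t i = (\<lambda>e. e 0) then 0 else Suc i)" for i
  obtain \<phi>' where \<phi>': "\<And>e. sat (\<epsilon>) D (\<lambda>i. e (f i)) \<phi> \<longleftrightarrow> sat (\<epsilon>) D e \<phi>'"
    using sat_rename[of _ _ f] by blast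
  \<comment> \<open>The entry \<open>undefined\<close> is never read: a term that is not position 0
    is a constant or a later position, and \<open>step\<close> states that it ignores the first
    entry.\<close>
  define u where "u j = (case j of 0 \<Rightarrow> (\<lambda>e. e 0) | Suc i \<Rightarrow>
     (if t i = (\<lambda>e. e 0) then (\<lambda>e. e 0) else (\<lambda>e. t i (case_nat undefined e))))" for j
  have step: "t i (case_nat x e) = t i (case_nat y e)" if "t i \<noteq> (\<lambda>e. e 0)" for i x y e
  proof -
    consider k where "t i = (\<lambda>e. e k)" | c where "t i = (\<lambda>_. c)"
      using t[of i] by (auto simp: tm_def)
    then show ?thesis using that by cases (auto split: nat.split)
  qed
  have u: "tm D (u j)" for j
  proof (cases j)
    case (Suc i)
    consider k where "t i = (\<lambda>e. e (Suc k))" | "t i = (\<lambda>e. e 0)" | c where "c \<in> D" "t i = (\<lambda>_. c)"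
      using t[of i] unfolding tm_def by (metis not0_implies_Suc)
    then show ?thesis by cases (auto simp: u_def Suc tm_def)
  qed (auto simp: u_def tm_def)
  have ev: "\<Phi> e x = sat (\<epsilon>) D ((\<lambda>j. u j e)(0 := x)) \<phi>'" if "range e \<subseteq> W" "x \<in> W" for e x
  proof -
    have "range (case_nat x e) \<subseteq> W" using that by (simp add: image_subset_iff split: nat.split)
    then have "\<Phi> e x = sat (\<epsilon>) D (\<lambda>i. t i (case_nat x e)) \<phi>"
      using \<phi>[of "case_nat x e"] by simp
    also have "(\<lambda>i. t i (case_nat x e)) = (\<lambda>i. ((\<lambda>j. u j e)(0 := x)) (f i))"
    proof
      fix i show "t i (case_nat x e) = ((\<lambda>j. u j e)(0 := x)) (f i)"
        using step[of i x e undefined] by (simp add: f_def u_def)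
    qed
    finally show ?thesis by (simp only: \<phi>')
  qed
  have "(\<forall>x\<in>W. \<Phi> e x) = sat (\<epsilon>) D (\<lambda>j. u j e) (All 0 (Neg (Conj \<chi> (Neg \<phi>'))))"
    if e: "range e \<subseteq> W" for e
  proof -
    have "sat (\<epsilon>) D ((\<lambda>j. u j e)(0 := x)) \<chi> \<longleftrightarrow> x \<in> W" if "x \<in> D" for x
      using that e tm_in[OF u WD] by (subst \<chi>) auto
    then show ?thesis using ev[OF e] WD by auto
  qed
  then show ?thesis unfolding dfn_def using u by blast
qed

lemma dfn_ex:
  assumes "dom_ok D W" "dfn D W (\<lambda>e. \<Phi> (\<lambda>i. e (Suc i)) (e 0))"
  shows "dfn D W (\<lambda>e. \<exists>x\<in>W. \<Phi> e x)"
  using dfn_not[OF dfn_all[where \<Phi> = "\<lambda>e x. \<not> \<Phi> e x", OF assms(1) dfn_not[OF assms(2)]]] by simp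

lemma dfn_comp:
  assumes "dfn D W P" shows "dfn D W (\<lambda>e. P (\<lambda>i. e (f i)))"
proof -
  obtain \<phi> t where t: "\<And>i. tm D (t i)" and \<phi>: "\<And>e. range e \<subseteq> W \<Longrightarrow> P e = sat (\<epsilon>) D (\<lambda>i. t i e) \<phi>"
    using assms by (auto simp: dfn_def)
  have "P (\<lambda>i. e (f i)) = sat (\<epsilon>) D (\<lambda>i. t i (\<lambda>i. e (f i))) \<phi>" if "range e \<subseteq> W" for e
    by (rule \<phi>) (use that in auto)
  moreover have "tm D (\<lambda>e. t i (\<lambda>i. e (f i)))" for i
    by (rule tm_shift[OF t])
  ultimately show ?thesis unfolding dfn_def
    by (intro exI[of _ \<phi>] exI[of _ "\<lambda>i e. t i (\<lambda>i. e (f i))"]) blast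
qed

section \<open>Definable functions and their substitution into definable predicates\<close>

lemma fn_var: "fn D W (\<lambda>e. e i)"
  unfolding fn_def using dfn_eq_tm[OF tm_var[of D 0] tm_var[of D "Suc i"]] by auto

lemma fn_const: "W \<subseteq> D \<Longrightarrow> c \<in> W \<Longrightarrow> fn D W (\<lambda>_. c)"
  unfolding fn_def using dfn_eq_tm[OF tm_var[of D 0] tm_const[of c D]] by auto

lemma fn_comp: "fn D W f \<Longrightarrow> fn D W (\<lambda>e. f (\<lambda>i. e (g i)))"
  unfolding fn_def
  using dfn_comp[of D W "\<lambda>e. e 0 = f (\<lambda>i. e (Suc i))" "case_nat 0 (\<lambda>i. Suc (g i))"]
  by (simp add: image_subset_iff)

text \<open>Atomic formulas admit only variables and parameters, so a function value is introduced
  by an existential quantifier over the graph of the function.\<close>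

lemma dfn_subst:
  assumes "dom_ok D W" "fn D W f" "dfn D W (\<lambda>e. \<Phi> (\<lambda>i. e (Suc i)) (e 0))"
  shows "dfn D W (\<lambda>e. \<Phi> e (f e))"
proof (rule dfn_cong)
  have "dfn D W (\<lambda>e. e 0 = f (\<lambda>i. e (Suc i)))" using assms(2) by (simp add: fn_def)
  then show "dfn D W (\<lambda>e. \<exists>x\<in>W. x = f e \<and> \<Phi> e x)"
    by (intro dfn_ex dfn_conj assms(1,3))
next
  fix e :: "nat \<Rightarrow> 'c" assume "range e \<subseteq> W"
  then have "f e \<in> W" using assms(2) by (simp add: fn_def)
  then show "\<Phi> e (f e) = (\<exists>x\<in>W. x = f e \<and> \<Phi> e x)" by simp
qed

lemma dfn_lift1:
  assumes "dom_ok D W" "dfn D W (\<lambda>e. \<Phi> (e 0))" "fn D W a"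
  shows "dfn D W (\<lambda>e. \<Phi> (a e))"
  by (rule dfn_subst[where \<Phi> = "\<lambda>e x. \<Phi> x", OF assms(1,3,2)])

lemma dfn_lift2:
  assumes "dom_ok D W" "dfn D W (\<lambda>e. \<Phi> (e 0) (e (Suc 0)))" "fn D W a" "fn D W b"
  shows "dfn D W (\<lambda>e. \<Phi> (a e) (b e))"
proof (rule dfn_subst[where \<Phi> = "\<lambda>e x. \<Phi> x (b e)", OF assms(1,3)])
  show "dfn D W (\<lambda>e. \<Phi> (e 0) (b (\<lambda>i. e (Suc i))))"
  proof (rule dfn_subst[where \<Phi> = "\<lambda>e x. \<Phi> (e 0) x", OF assms(1) fn_comp[OF assms(4)]])
    show "dfn D W (\<lambda>e. \<Phi> (e (Suc 0)) (e 0))"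
      using dfn_comp[OF assms(2), of "\<lambda>i. if i = 0 then 1 else 0"] by simp
  qed
qed

lemma dfn_lift3:
  assumes "dom_ok D W" "dfn D W (\<lambda>e. \<Phi> (e 0) (e (Suc 0)) (e (Suc (Suc 0))))"
    "fn D W a" "fn D W b" "fn D W c"
  shows "dfn D W (\<lambda>e. \<Phi> (a e) (b e) (c e))"
proof (rule dfn_subst[where \<Phi> = "\<lambda>e x. \<Phi> x (b e) (c e)", OF assms(1,3)])
  show "dfn D W (\<lambda>e. \<Phi> (e 0) (b (\<lambda>i. e (Suc i))) (c (\<lambda>i. e (Suc i))))"
  proof (rule dfn_subst[where \<Phi> = "\<lambda>e x. \<Phi> (e 0) x (c (\<lambda>i. e (Suc i)))",
        OF assms(1) fn_comp[OF assms(4)]])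
    show "dfn D W (\<lambda>e. \<Phi> (e (Suc 0)) (e 0) (c (\<lambda>i. e (Suc (Suc i)))))"
    proof (rule dfn_subst[where \<Phi> = "\<lambda>e x. \<Phi> (e (Suc 0)) (e 0) x",
          OF assms(1) fn_comp[OF assms(5)]])
      show "dfn D W (\<lambda>e. \<Phi> (e (Suc (Suc 0))) (e (Suc 0)) (e 0))"
        using dfn_comp[OF assms(2), of "\<lambda>i. if i = 0 then 2 else if i = 1 then 1 else 0"]
        by (simp add: numeral_2_eq_2)
    qed
  qed
qed

lemma fn_lift1:
  assumes "dom_ok D W" "fn D W (\<lambda>e. f (e 0))" "fn D W a"
  shows "fn D W (\<lambda>e. f (a e))"
  unfolding fn_def
proof (intro conjI allI impI)
  fix e :: "nat \<Rightarrow> 'c" assume e: "range e \<subseteq> W"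
  then have "range (\<lambda>i. a e) \<subseteq> W" using assms(3) by (auto simp: fn_def)
  from conjunct1[OF assms(2)[unfolded fn_def], rule_format, OF this]
  show "f (a e) \<in> W" by simp
next
  have "dfn D W (\<lambda>e. e 0 = f (e (Suc 0)))" using assms(2) by (simp add: fn_def)
  then show "dfn D W (\<lambda>e. e 0 = f (a (\<lambda>i. e (Suc i))))"
    by (rule dfn_lift2[where \<Phi> = "\<lambda>x y. x = f y", OF assms(1) _ fn_var fn_comp[OF assms(3)]])
qed

lemma fn_lift2:
  assumes "dom_ok D W" "fn D W (\<lambda>e. f (e 0) (e (Suc 0)))" "fn D W a" "fn D W b"
  shows "fn D W (\<lambda>e. f (a e) (b e))"
  unfolding fn_def
proof (intro conjI allI impI)
  fix e :: "nat \<Rightarrow> 'c" assume e: "range e \<subseteq> W"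
  then have "range (\<lambda>i. if i = (0::nat) then a e else b e) \<subseteq> W"
    using assms(3,4) by (auto simp: fn_def)
  from conjunct1[OF assms(2)[unfolded fn_def], rule_format, OF this]
  show "f (a e) (b e) \<in> W" by simp
next
  have "dfn D W (\<lambda>e. e 0 = f (e (Suc 0)) (e (Suc (Suc 0))))" using assms(2) by (simp add: fn_def)
  then show "dfn D W (\<lambda>e. e 0 = f (a (\<lambda>i. e (Suc i))) (b (\<lambda>i. e (Suc i))))"
    by (rule dfn_lift3[where \<Phi> = "\<lambda>x y z. x = f y z", OF assms(1) _ fn_var
        fn_comp[OF assms(3)] fn_comp[OF assms(4)]])
qed

lemma dfn_mem:
  assumes "dom_ok D W" "fn D W a" "fn D W b" shows "dfn D W (\<lambda>e. a e \<epsilon> b e)"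
  by (rule dfn_lift2[where \<Phi> = "(\<epsilon>)", OF assms(1) _ assms(2,3)]) (intro dfn_mem_tm tm_var)

lemma dfn_eq:
  assumes "dom_ok D W" "fn D W a" "fn D W b" shows "dfn D W (\<lambda>e. a e = b e)"
  by (rule dfn_lift2[where \<Phi> = "(=)", OF assms(1) _ assms(2,3)]) (intro dfn_eq_tm tm_var)

lemma dfn_mem_const:
  assumes "dom_ok D W" "fn D W a" "C \<in> D" shows "dfn D W (\<lambda>e. a e \<epsilon> C)"
  by (rule dfn_lift1[where \<Phi> = "\<lambda>x. x \<epsilon> C", OF assms(1) _ assms(2)]) (intro dfn_mem_tm tm_var tm_const assms)

lemma dfn_const: "dfn D W (\<lambda>e. p)"
  by (cases p) (use dfn_true[of D W] dfn_not[OF dfn_true[of D W]] in auto)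

text \<open>Satisfaction is a HOL recursion and not a formula, but for each fixed
  \<open>\<phi>\<close> it can be unfolded into a formula whose quantifiers are relativized to
  \<open>U\<close>. With \<open>U = V\<close> this reads set formulas as class formulas; with
  \<open>U = S\<close> it is needed for induction over the standard sets.\<close>

lemma dfn_sat_relative:
  assumes "dom_ok D W" "dfn D W (\<lambda>e. e 0 \<in> U)" "U \<subseteq> W" "\<And>i. tm D (t i)"
  shows "dfn D W (\<lambda>e. sat (\<epsilon>) U (\<lambda>i. t i e) \<phi>)"
  using assms(4)
proof (induction \<phi> arbitrary: t)
  case (All i \<phi>)
  define t' where "t' j = (if j = i then (\<lambda>e. e 0) else (\<lambda>e. t j (\<lambda>k. e (Suc k))))" for j
  have t': "tm D (t' j)" for j
    using All.prems by (auto simp: t'_def tm_var intro: tm_shift)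
  have *: "(\<lambda>j. t' j e) = (\<lambda>j. t j (\<lambda>k. e (Suc k)))(i := e 0)" for e
    by (auto simp: t'_def)
  have "dfn D W (\<lambda>e. e 0 \<in> U \<longrightarrow> sat (\<epsilon>) U ((\<lambda>j. t j (\<lambda>k. e (Suc k)))(i := e 0)) \<phi>)"
    using dfn_imp[OF assms(2) All.IH[of t', OF t']] unfolding * .
  then have "dfn D W (\<lambda>e. \<forall>x\<in>W. x \<in> U \<longrightarrow> sat (\<epsilon>) U ((\<lambda>j. t j e)(i := x)) \<phi>)"
    by (rule dfn_all[where \<Phi> = "\<lambda>e x. x \<in> U \<longrightarrow> sat (\<epsilon>) U ((\<lambda>j. t j e)(i := x)) \<phi>", OF assms(1)])
  then show ?case
    by (rule dfn_cong) (use assms(3) in auto)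
qed (auto intro: dfn_mem_tm dfn_eq_tm dfn_not dfn_conj)

lemma dfn_V_imp_UNIV:
  assumes "dfn V V P" shows "dfn UNIV V P"
proof -
  obtain \<phi> t where t: "\<And>i. tm V (t i)" and \<phi>: "\<And>e. range e \<subseteq> V \<Longrightarrow> P e = sat (\<epsilon>) V (\<lambda>i. t i e) \<phi>"
    using assms by (auto simp: dfn_def)
  have "dfn UNIV V (\<lambda>e. sat (\<epsilon>) V (\<lambda>i. t i e) \<phi>)"
  proof (rule dfn_sat_relative[OF dom_ok_V])
    show "dfn UNIV V (\<lambda>e. e 0 \<in> V)"
      by (rule dfn_cong[OF dfn_true]) auto
    show "tm UNIV (t i)" for i using t[of i] by (auto simp: tm_def)
  qed simp
  then show ?thesis by (rule dfn_cong) (rule \<phi>)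
qed

lemma fn_V_imp_UNIV: "fn V V f \<Longrightarrow> fn UNIV V f"
  by (auto simp: fn_def intro: dfn_V_imp_UNIV)

text \<open>Leads from definability back to the shape of the axioms: one formula, the variable 0 and
  parameters in \<open>D\<close>. As the predicate depends on position 0 only, it can be evaluated
  in constant environments, where all variables have the same value and may be merged.\<close>

lemma dfn_sat_var:
  assumes "dfn D W (\<lambda>e. P (e 0))" "W \<subseteq> D" "W \<noteq> {}"
  shows "\<exists>\<phi> e. range e \<subseteq> D \<and> (\<forall>x\<in>W. P x \<longleftrightarrow> sat (\<epsilon>) D (e(0 := x)) \<phi>)"
proof -
  obtain \<phi> t where t: "\<And>i. tm D (t i)" and \<phi>: "\<And>e. range e \<subseteq> W \<Longrightarrow> P (e 0) = sat (\<epsilon>) D (\<lambda>i. t i e) \<phi>"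
    using assms(1) by (auto simp: dfn_def)
  obtain w where w: "w \<in> W" using assms(3) by blast
  define f where "f i = (if \<exists>j. t i = (\<lambda>e. e j) then 0 else Suc i)" for i
  obtain \<phi>' where \<phi>': "\<And>e. sat (\<epsilon>) D (\<lambda>i. e (f i)) \<phi> \<longleftrightarrow> sat (\<epsilon>) D e \<phi>'"
    using sat_rename[of _ _ f] by blast
  \<comment> \<open>Apart from variable 0 only entries of constant terms are read, so
    \<open>w\<close> is arbitrary; taking it from \<open>W\<close> keeps the remaining entries
    inside \<open>D\<close>.\<close>
  define e where "e j = t (j - 1) (\<lambda>_. w)" for j
  have "range e \<subseteq> D" using tm_in[OF t assms(2)] w by (auto simp: e_def)
  moreover have "P x \<longleftrightarrow> sat (\<epsilon>) D (e(0 := x)) \<phi>'" if "x \<in> W" for x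
  proof -
    have "P x = sat (\<epsilon>) D (\<lambda>i. t i (\<lambda>_. x)) \<phi>"
      using \<phi>[of "\<lambda>_. x"] that by auto
    also have "(\<lambda>i. t i (\<lambda>_. x)) = (\<lambda>i. (e(0 := x)) (f i))"
    proof
      fix i show "t i (\<lambda>_. x) = (e(0 := x)) (f i)"
      proof (cases "\<exists>j. t i = (\<lambda>e. e j)")
        case False
        then obtain c where "t i = (\<lambda>_. c)" using t[of i] by (auto simp: tm_def)
        then show ?thesis using False by (auto simp: f_def e_def)
      qed (auto simp: f_def)
    qed
    finally show ?thesis by (simp only: \<phi>')
  qed
  ultimately show ?thesis by blast
qed

lemma elts_iff [simp]: "x \<in> elts X \<longleftrightarrow> x \<epsilon> X"
  by (simp add: elts_def)

lemma mem_V: "x \<epsilon> Y \<Longrightarrow> x \<in> V"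
  by (auto simp: V_def)

lemma dfn_all_in:
  assumes "dom_ok D W" "T \<subseteq> W" "dfn D W (\<lambda>e. e 0 \<in> T)" "dfn D W (\<lambda>e. \<Phi> (\<lambda>i. e (Suc i)) (e 0))"
  shows "dfn D W (\<lambda>e. \<forall>x\<in>T. \<Phi> e x)"
proof (rule dfn_cong)
  show "dfn D W (\<lambda>e. \<forall>x\<in>W. x \<in> T \<longrightarrow> \<Phi> e x)"
    by (intro dfn_all[where \<Phi> = "\<lambda>e x. x \<in> T \<longrightarrow> \<Phi> e x"] assms(1)) (intro dfn_imp assms(3,4))
qed (use assms(2) in blast)

lemma dfn_ex_in:
  assumes "dom_ok D W" "T \<subseteq> W" "dfn D W (\<lambda>e. e 0 \<in> T)" "dfn D W (\<lambda>e. \<Phi> (\<lambda>i. e (Suc i)) (e 0))"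
  shows "dfn D W (\<lambda>e. \<exists>x\<in>T. \<Phi> e x)"
  using dfn_not[OF dfn_all_in[where \<Phi> = "\<lambda>e x. \<not> \<Phi> e x", OF assms(1-3) dfn_not[OF assms(4)]]] by simp

lemma dfn_all_elts:
  assumes "dom_ok D W" "V \<subseteq> W" "fn D W a" "dfn D W (\<lambda>e. \<Phi> (\<lambda>i. e (Suc i)) (e 0))"
  shows "dfn D W (\<lambda>e. \<forall>x\<in>elts (a e). \<Phi> e x)"
proof (rule dfn_cong)
  show "dfn D W (\<lambda>e. \<forall>x\<in>W. x \<epsilon> a e \<longrightarrow> \<Phi> e x)"
    by (intro dfn_all[where \<Phi> = "\<lambda>e x. x \<epsilon> a e \<longrightarrow> \<Phi> e x"] assms(1))
       (intro dfn_imp assms(4) dfn_mem assms(1) fn_var fn_comp[OF assms(3)])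
qed (use subsetD[OF assms(2) mem_V] in auto)

lemma dfn_ex_elts:
  assumes "dom_ok D W" "V \<subseteq> W" "fn D W a" "dfn D W (\<lambda>e. \<Phi> (\<lambda>i. e (Suc i)) (e 0))"
  shows "dfn D W (\<lambda>e. \<exists>x\<in>elts (a e). \<Phi> e x)"
  using dfn_not[OF dfn_all_elts[where \<Phi> = "\<lambda>e x. \<not> \<Phi> e x", OF assms(1-3) dfn_not[OF assms(4)]]] by simp

lemma dfn_elts:
  assumes "dom_ok D W" "fn D W a" "fn D W b" shows "dfn D W (\<lambda>e. a e \<in> elts (b e))"
  using dfn_mem[OF assms] by simp

lemma dfn_in_W: "fn D W a \<Longrightarrow> dfn D W (\<lambda>e. a e \<in> W)"
  by (rule dfn_cong[OF dfn_true]) (auto simp: fn_def)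

lemmas dfn_intros = dfn_const dfn_conj dfn_disj dfn_imp dfn_iff dfn_not dfn_all dfn_ex dfn_all_elts dfn_ex_elts
  dfn_mem_const dfn_mem dfn_eq dfn_elts dfn_in_W dom_ok_refl dom_ok_V fn_var fn_const

end

subsection \<open>Sets and set induction\<close>

context THS
begin

lemma emp_V [simp]: "emp \<in> V" and elts_emp: "elts emp = {}"
proof -
  obtain z where z: "z \<in> V" "elts z = {}" using empty_set by blast
  then have "emp = z" unfolding emp_def by (intro the_equality) (auto intro: extensionality)
  then show "emp \<in> V" "elts emp = {}" using z by auto
qed

lemma not_mem_emp [simp]: "\<not> x \<epsilon> emp"
  using elts_emp by (auto simp: elts_def)

lemma adj_V [simp]: "x \<in> V \<Longrightarrow> y \<in> V \<Longrightarrow> adj x y \<in> V"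
  and elts_adj: "x \<in> V \<Longrightarrow> y \<in> V \<Longrightarrow> elts (adj x y) = insert y (elts x)"
proof -
  assume "x \<in> V" "y \<in> V"
  then obtain z where z: "z \<in> V" "elts z = insert y (elts x)" using adjunction by blast
  then have "adj x y = z" unfolding adj_def by (intro the_equality) (auto intro: extensionality)
  then show "adj x y \<in> V" "elts (adj x y) = insert y (elts x)" using z by auto
qed

lemma mem_adj [simp]: "x \<in> V \<Longrightarrow> y \<in> V \<Longrightarrow> z \<epsilon> adj x y \<longleftrightarrow> z = y \<or> z \<epsilon> x"
  using elts_adj[of x y] by (auto simp: elts_def)

lemma ext: "(\<And>z. z \<epsilon> x \<longleftrightarrow> z \<epsilon> y) \<Longrightarrow> x = y"
  by (rule extensionality) (auto simp: elts_def)

lemma ext_iff: "x = y \<longleftrightarrow> (\<forall>z. z \<epsilon> x \<longleftrightarrow> z \<epsilon> y)"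
  by (auto intro: ext)

lemma emp_eq: "x = emp \<longleftrightarrow> (\<forall>z. \<not> z \<epsilon> x)"
  by (auto intro: ext)

lemma V_nonempty: "V \<noteq> {}"
  using emp_V by blast

lemma dom_ok_V_subset: "dom_ok D V \<Longrightarrow> V \<subseteq> D"
  by (simp add: dom_ok_def)

text \<open>\<open>adj\<close> is a description, but between sets its graph merely says which
  elements the value has. Successors and pairs become usable inside formulas through this
  rule.\<close>

lemma fn_adj:
  assumes D: "dom_ok D V" and "fn D V a" "fn D V b"
  shows "fn D V (\<lambda>e. adj (a e) (b e))"
proof (rule fn_lift2[where f = adj, OF assms(1) _ assms(2,3)])
  have "dfn D V (\<lambda>e. \<forall>x\<in>V. x \<epsilon> e 0 \<longleftrightarrow> x = e (Suc (Suc 0)) \<or> x \<epsilon> e (Suc 0))"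
    by (intro dfn_intros D)
  then have "dfn D V (\<lambda>e. e 0 = adj (e (Suc 0)) (e (Suc (Suc 0))))"
  proof (rule dfn_cong)
    fix e :: "nat \<Rightarrow> 'c" assume "range e \<subseteq> V"
    then have "e 0 \<in> V" "e (Suc 0) \<in> V" "e (Suc (Suc 0)) \<in> V" by auto
    then show "(e 0 = adj (e (Suc 0)) (e (Suc (Suc 0)))) =
      (\<forall>x\<in>V. x \<epsilon> e 0 \<longleftrightarrow> x = e (Suc (Suc 0)) \<or> x \<epsilon> e (Suc 0))"
      by (subst ext_iff) (auto dest: mem_V)
  qed
  then show "fn D V (\<lambda>e. adj (e 0) (e (Suc 0)))"
    by (simp add: fn_def image_subset_iff)
qed

lemma cls_Collect:
  assumes "dfn UNIV W (\<lambda>e. P (e 0))" "V \<subseteq> W"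
  shows "\<exists>X. \<forall>x. x \<epsilon> X \<longleftrightarrow> x \<in> V \<and> P x"
proof -
  have "W \<noteq> {}" using assms(2) V_nonempty by auto
  from dfn_sat_var[OF assms(1) subset_UNIV this] obtain \<phi> e
    where e: "\<forall>x\<in>W. P x \<longleftrightarrow> sat (\<epsilon>) UNIV (e(0 := x)) \<phi>" by (elim exE conjE)
  from comprehension[of e 0 \<phi>]
  obtain X where X: "\<forall>x. x \<epsilon> X \<longleftrightarrow> x \<in> V \<and> sat (\<epsilon>) UNIV (e(0 := x)) \<phi>" by (elim exE)
  have "x \<epsilon> X \<longleftrightarrow> x \<in> V \<and> P x" for x using X e assms(2) by (cases "x \<in> V") auto
  then show ?thesis by blast
qed

lemma cls_V: "\<exists>X. \<forall>x. x \<epsilon> X \<longleftrightarrow> x \<in> V"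
  using cls_Collect[where P = "\<lambda>_. True", OF dfn_true[of UNIV V]] by auto

lemma Inter_elts: "x \<in> \<Inter> {elts X | X. P X} \<longleftrightarrow> (\<forall>X. P X \<longrightarrow> x \<epsilon> X)"
  by (auto simp: elts_def)

lemma S_iff:
  "x \<in> S \<longleftrightarrow> (\<forall>X. emp \<epsilon> X \<and> (\<forall>a b. a \<epsilon> X \<and> b \<epsilon> X \<longrightarrow> adj a b \<epsilon> X) \<longrightarrow> x \<epsilon> X)"
  unfolding S_def by (rule Inter_elts)

lemma S_emp: "emp \<in> S" and S_adj: "a \<in> S \<Longrightarrow> b \<in> S \<Longrightarrow> adj a b \<in> S"
  unfolding S_iff by blast+

lemma S_V: "S \<subseteq> V"
proof -
  obtain X where X: "\<And>z. z \<epsilon> X \<longleftrightarrow> z \<in> V" using cls_V by auto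
  show ?thesis
  proof
    fix x assume "x \<in> S"
    then have "emp \<epsilon> X \<and> (\<forall>a b. a \<epsilon> X \<and> b \<epsilon> X \<longrightarrow> adj a b \<epsilon> X) \<longrightarrow> x \<epsilon> X"
      unfolding S_iff by blast
    then show "x \<in> V" by (simp add: X)
  qed
qed

lemma S_induct:
  assumes "dfn UNIV W (\<lambda>e. P (e 0))" "V \<subseteq> W"
    and "P emp" "\<And>a b. a \<in> V \<Longrightarrow> b \<in> V \<Longrightarrow> P a \<Longrightarrow> P b \<Longrightarrow> P (adj a b)" "x \<in> S"
  shows "P x"
proof -
  obtain X where X: "\<And>z. z \<epsilon> X \<longleftrightarrow> z \<in> V \<and> P z" using cls_Collect[OF assms(1,2)] by auto
  then have "emp \<epsilon> X" "\<forall>a b. a \<epsilon> X \<and> b \<epsilon> X \<longrightarrow> adj a b \<epsilon> X" using assms(3,4) by auto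
  then have "x \<epsilon> X" using assms(5) unfolding S_iff by blast
  then show ?thesis using X by simp
qed

text \<open>Membership in \<open>S\<close> quantifies over classes, so environments range over all
  classes. There \<open>a\<close> and \<open>b\<close> may be proper, where nothing is known about
  \<open>adj\<close>; hence the element condition \<open>ad\<close> replaces it, and
  \<open>a \<epsilon> X\<close>, \<open>b \<epsilon> X\<close> restore the sets.\<close>

lemma cls_S: "\<exists>C. \<forall>x. x \<epsilon> C \<longleftrightarrow> x \<in> S"
proof -
  define ad where "ad a b c \<longleftrightarrow> (\<forall>z\<in>UNIV. z \<epsilon> c \<longleftrightarrow> z = b \<or> z \<epsilon> a)" for a b c
  have ad: "ad a b c \<longleftrightarrow> c = adj a b" if "a \<in> V" "b \<in> V" for a b c
    unfolding ad_def using that by (subst ext_iff) simp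
  have "dfn UNIV UNIV (\<lambda>e. \<forall>X\<in>UNIV. emp \<epsilon> X \<and>
     (\<forall>a\<in>UNIV. \<forall>b\<in>UNIV. a \<epsilon> X \<and> b \<epsilon> X \<longrightarrow> (\<exists>c\<in>UNIV. c \<epsilon> X \<and> ad a b c)) \<longrightarrow> e 0 \<epsilon> X)"
    unfolding ad_def by (intro dfn_intros) auto
  from cls_Collect[where P = "\<lambda>x. \<forall>X\<in>UNIV. emp \<epsilon> X \<and>
     (\<forall>a\<in>UNIV. \<forall>b\<in>UNIV. a \<epsilon> X \<and> b \<epsilon> X \<longrightarrow> (\<exists>c\<in>UNIV. c \<epsilon> X \<and> ad a b c)) \<longrightarrow> x \<epsilon> X", OF this subset_UNIV]
  obtain C where C: "\<forall>x. x \<epsilon> C \<longleftrightarrow> x \<in> V \<and> (\<forall>X\<in>UNIV. emp \<epsilon> X \<and>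
     (\<forall>a\<in>UNIV. \<forall>b\<in>UNIV. a \<epsilon> X \<and> b \<epsilon> X \<longrightarrow> (\<exists>c\<in>UNIV. c \<epsilon> X \<and> ad a b c)) \<longrightarrow> x \<epsilon> X)"
    by (elim exE)
  have "(a \<epsilon> X \<and> b \<epsilon> X \<longrightarrow> (\<exists>c\<in>UNIV. c \<epsilon> X \<and> ad a b c)) \<longleftrightarrow> (a \<epsilon> X \<and> b \<epsilon> X \<longrightarrow> adj a b \<epsilon> X)"
    for a b X
    by (cases "a \<epsilon> X \<and> b \<epsilon> X") (auto simp: ad[OF mem_V mem_V])
  then have eq: "(\<forall>a\<in>UNIV. \<forall>b\<in>UNIV. a \<epsilon> X \<and> b \<epsilon> X \<longrightarrow> (\<exists>c\<in>UNIV. c \<epsilon> X \<and> ad a b c)) \<longleftrightarrow>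
     (\<forall>a b. a \<epsilon> X \<and> b \<epsilon> X \<longrightarrow> adj a b \<epsilon> X)" for X
    by (simp only: ball_UNIV)
  have "x \<epsilon> C \<longleftrightarrow> x \<in> V \<and> x \<in> S" for x
    unfolding S_iff C[rule_format] unfolding eq unfolding ball_UNIV by (rule refl)
  then have "\<forall>x. x \<epsilon> C \<longleftrightarrow> x \<in> S" using S_V by blast
  then show ?thesis by (rule exI)
qed

text \<open>The elements of \<open>adj a b\<close> are \<open>b\<close> and those of
  \<open>a\<close>, so standardness of the set itself must be part of the induction
  hypothesis.\<close>

lemma S_trans:
  assumes "x \<in> S" "y \<epsilon> x" shows "y \<in> S"
proof -
  obtain C where C: "\<And>x. x \<epsilon> C \<longleftrightarrow> x \<in> S" using cls_S by auto
  have "dfn UNIV V (\<lambda>e. e 0 \<epsilon> C \<and> (\<forall>y\<in>V. y \<epsilon> e 0 \<longrightarrow> y \<epsilon> C))"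
    by (intro dfn_intros) auto
  from S_induct[where P = "\<lambda>x. x \<epsilon> C \<and> (\<forall>y\<in>V. y \<epsilon> x \<longrightarrow> y \<epsilon> C)", OF this _ _ _ assms(1)]
  have "\<forall>y\<in>V. y \<epsilon> x \<longrightarrow> y \<in> S"
    using S_emp S_adj by (auto simp: C)
  then show ?thesis using assms(2) mem_V by blast
qed

section \<open>Set induction as a formula that can be transferred\<close>

definition fm_imp :: "fm \<Rightarrow> fm \<Rightarrow> fm" where
  "fm_imp \<phi> \<psi> = Neg (Conj \<phi> (Neg \<psi>))"

definition fm_disj :: "fm \<Rightarrow> fm \<Rightarrow> fm" where
  "fm_disj \<phi> \<psi> = fm_imp (Neg \<phi>) \<psi>"

lemma sat_fm_imp [simp]: "sat m D e (fm_imp \<phi> \<psi>) \<longleftrightarrow> (sat m D e \<phi> \<longrightarrow> sat m D e \<psi>)"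
  by (simp add: fm_imp_def)

lemma sat_fm_disj [simp]: "sat m D e (fm_disj \<phi> \<psi>) \<longleftrightarrow> sat m D e \<phi> \<or> sat m D e \<psi>"
  by (auto simp: fm_disj_def)

text \<open>The induction scheme for \<open>\<phi>\<close> in variable 0, where \<open>n\<close> is
  to exceed all variables of \<open>\<phi>\<close>, so that \<open>n\<close> and its two successors
  are fresh. The empty set and \<open>adj\<close> are spelled out by membership, and
  \<open>\<phi>\<close> at the value of variable \<open>n\<close> is expressed by equating variable
  0 with it.\<close>

definition ind_fm :: "nat \<Rightarrow> fm \<Rightarrow> fm" where
  "ind_fm n \<phi> =
    fm_imp (All 0 (fm_imp (All n (Neg (Mem n 0))) \<phi>))
    (fm_imp (All n (fm_imp (All 0 (fm_imp (Eq 0 n) \<phi>))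
        (All (Suc n) (All 0 (fm_imp (All (Suc (Suc n)) (Conj
            (fm_imp (Mem (Suc (Suc n)) 0) (fm_disj (Mem (Suc (Suc n)) n) (Eq (Suc (Suc n)) (Suc n))))
            (fm_imp (fm_disj (Mem (Suc (Suc n)) n) (Eq (Suc (Suc n)) (Suc n))) (Mem (Suc (Suc n)) 0)))) \<phi>)))))
      (All 0 \<phi>))"

text \<open>As \<open>D\<close> contains the elements of its elements, quantifiers over
  \<open>D\<close> suffice to recognize the empty set and \<open>adj a b\<close>. The formula
  therefore has its intended meaning in \<open>V\<close> and in \<open>S\<close> alike.\<close>

lemma sat_ind_fm:
  assumes D: "emp \<in> D" "\<And>a b. a \<in> D \<Longrightarrow> b \<in> D \<Longrightarrow> adj a b \<in> D" "\<And>x y. x \<in> D \<Longrightarrow> y \<epsilon> x \<Longrightarrow> y \<in> D" "D \<subseteq> V"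
    and n: "\<And>i. i \<in> vars \<phi> \<Longrightarrow> i < n" "0 < n"
  defines "P e x \<equiv> sat (\<epsilon>) D (e(0 := x)) \<phi>"
  shows "sat (\<epsilon>) D e (ind_fm n \<phi>) \<longleftrightarrow>
    (P e emp \<longrightarrow> (\<forall>a\<in>D. P e a \<longrightarrow> (\<forall>b\<in>D. P e (adj a b))) \<longrightarrow> (\<forall>x\<in>D. P e x))"
proof -
  have 1: "P (e(n := a)) x \<longleftrightarrow> P e x" for a x
    unfolding P_def by (rule sat_cong) (use n in \<open>auto dest: n(1)\<close>)
  have 2: "P (e(n := a, Suc n := b)) x \<longleftrightarrow> P e x" for a b x
  proof -
    have "n \<notin> vars \<phi>" "Suc n \<notin> vars \<phi>" using n(1)[of n] n(1)[of "Suc n"] by auto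
    then show ?thesis unfolding P_def by (intro sat_cong) auto
  qed
  have 3: "(\<forall>y\<in>D. \<not> y \<epsilon> x) \<longleftrightarrow> x = emp" if "x \<in> D" for x
    using D(3)[OF that] by (auto simp: emp_eq)
  have 4: "(\<forall>c\<in>D. (c \<epsilon> x \<longrightarrow> c \<epsilon> a \<or> c = b) \<and> (c \<epsilon> a \<longrightarrow> c \<epsilon> x) \<and> (c = b \<longrightarrow> b \<epsilon> x)) \<longleftrightarrow> x = adj a b"
    if "x \<in> D" "a \<in> D" "b \<in> D" for x a b
  proof -
    have "a \<in> V" "b \<in> V" using that D(4) by auto
    then have "x = adj a b \<longleftrightarrow> (\<forall>c. c \<epsilon> x \<longleftrightarrow> c = b \<or> c \<epsilon> a)"
      by (simp add: ext_iff[of x])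
    then show ?thesis using that D(3) by blast
  qed
  have "sat (\<epsilon>) D e (ind_fm n \<phi>) \<longleftrightarrow>
    ((\<forall>x\<in>D. (\<forall>y\<in>D. \<not> y \<epsilon> x) \<longrightarrow> P e x) \<longrightarrow>
     (\<forall>a\<in>D. (\<forall>x\<in>D. x = a \<longrightarrow> P e x) \<longrightarrow> (\<forall>b\<in>D. \<forall>x\<in>D.
       (\<forall>c\<in>D. (c \<epsilon> x \<longrightarrow> c \<epsilon> a \<or> c = b) \<and> (c \<epsilon> a \<or> c = b \<longrightarrow> c \<epsilon> x)) \<longrightarrow> P e x)) \<longrightarrow>
     (\<forall>x\<in>D. P e x))"
    using n(2) by (simp add: ind_fm_def P_def[symmetric] 1 2)
  also have "\<dots> \<longleftrightarrow> (P e emp \<longrightarrow> (\<forall>a\<in>D. P e a \<longrightarrow> (\<forall>b\<in>D. P e (adj a b))) \<longrightarrow> (\<forall>x\<in>D. P e x))"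
    using D(1,2) by (simp add: 3 4 cong: ball_cong)
  finally show ?thesis .
qed

lemma sat_ind_fm_V:
  assumes "\<forall>i\<in>vars \<phi>. i < n" "0 < n"
  shows "sat (\<epsilon>) V e (ind_fm n \<phi>) \<longleftrightarrow>
    (sat (\<epsilon>) V (e(0 := emp)) \<phi> \<longrightarrow>
     (\<forall>a\<in>V. sat (\<epsilon>) V (e(0 := a)) \<phi> \<longrightarrow> (\<forall>b\<in>V. sat (\<epsilon>) V (e(0 := adj a b)) \<phi>)) \<longrightarrow>
     (\<forall>x\<in>V. sat (\<epsilon>) V (e(0 := x)) \<phi>))"
  using assms by (intro sat_ind_fm) (auto intro: mem_V)

text \<open>Transfer admits standard parameters only, while induction is wanted with arbitrary sets
  as parameters; closing the formula turns its parameters into bound variables.\<close>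

primrec close_fm :: "nat \<Rightarrow> fm \<Rightarrow> fm" where
  "close_fm 0 \<phi> = \<phi>"
| "close_fm (Suc n) \<phi> = All n (close_fm n \<phi>)"

lemma sat_close_fm:
  "sat (\<epsilon>) D e (close_fm n \<phi>) \<longleftrightarrow>
    (\<forall>e'. (\<forall>i<n. e' i \<in> D) \<and> (\<forall>i\<ge>n. e' i = e i) \<longrightarrow> sat (\<epsilon>) D e' \<phi>)"
proof (induction n arbitrary: e)
  case 0
  have "e' = e" if "\<forall>i. e' i = e i" for e' using that by auto
  then show ?case by auto
next
  case (Suc n)
  have *: "(\<forall>i<Suc n. e' i \<in> D) \<and> (\<forall>i\<ge>Suc n. e' i = e i) \<longleftrightarrow>
    (\<exists>x\<in>D. (\<forall>i<n. e' i \<in> D) \<and> (\<forall>i\<ge>n. e' i = (e(n := x)) i))" for e'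
  proof
    assume "(\<forall>i<Suc n. e' i \<in> D) \<and> (\<forall>i\<ge>Suc n. e' i = e i)"
    then show "\<exists>x\<in>D. (\<forall>i<n. e' i \<in> D) \<and> (\<forall>i\<ge>n. e' i = (e(n := x)) i)"
      by (intro bexI[of _ "e' n"]) (auto simp: Suc_le_eq)
  next
    assume "\<exists>x\<in>D. (\<forall>i<n. e' i \<in> D) \<and> (\<forall>i\<ge>n. e' i = (e(n := x)) i)"
    then obtain x where x: "x \<in> D" "\<And>i. i < n \<Longrightarrow> e' i \<in> D" "\<And>i. i \<ge> n \<Longrightarrow> e' i = (e(n := x)) i" by blast
    have "e' i \<in> D" if "i < Suc n" for i using x that by (cases "i = n") auto
    then show "(\<forall>i<Suc n. e' i \<in> D) \<and> (\<forall>i\<ge>Suc n. e' i = e i)" using x(3) by auto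
  qed
  show ?case unfolding * using Suc by auto
qed

text \<open>Since \<open>S\<close> is a class, a formula with quantifiers over \<open>S\<close> is a
  class formula, and the minimality of \<open>S\<close> applies to the class that it
  defines.\<close>

lemma ind_fm_S:
  assumes "range e \<subseteq> S" "\<And>i. i \<in> vars \<phi> \<Longrightarrow> i < n" "0 < n"
  shows "sat (\<epsilon>) S e (ind_fm n \<phi>)"
proof -
  define P where "P x \<longleftrightarrow> sat (\<epsilon>) S (e(0 := x)) \<phi>" for x
  have "P x" if "P emp" "\<forall>a\<in>S. P a \<longrightarrow> (\<forall>b\<in>S. P (adj a b))" "x \<in> S" for x
  proof -
    obtain C where C': "\<And>x. x \<in> S \<longleftrightarrow> x \<epsilon> C" using cls_S by auto
    define t :: "nat \<Rightarrow> (nat \<Rightarrow> 'c) \<Rightarrow> 'c"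
      where "t i = (if i = 0 then (\<lambda>e. e 0) else (\<lambda>_. e i))" for i
    have "tm UNIV (t i)" for i by (auto simp: t_def tm_def)
    moreover have inS: "dfn UNIV UNIV (\<lambda>e. e 0 \<in> S)"
      unfolding C' by (intro dfn_intros) auto
    ultimately have "dfn UNIV UNIV (\<lambda>e. sat (\<epsilon>) S (\<lambda>i. t i e) \<phi>)"
      by (intro dfn_sat_relative dom_ok_refl) auto
    then have "dfn UNIV UNIV (\<lambda>e'. P (e' 0))"
      by (rule dfn_cong) (auto simp: P_def t_def intro!: arg_cong[where f = "\<lambda>e. sat (\<epsilon>) S e \<phi>"])
    then have "dfn UNIV UNIV (\<lambda>e'. e' 0 \<in> S \<and> P (e' 0))" by (intro dfn_conj inS)
    from S_induct[where P = "\<lambda>x. x \<in> S \<and> P x", OF this _ _ _ that(3)]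
    show ?thesis using that(1,2) S_emp S_adj by auto
  qed
  moreover have "sat (\<epsilon>) S e (ind_fm n \<phi>) \<longleftrightarrow>
     (P emp \<longrightarrow> (\<forall>a\<in>S. P a \<longrightarrow> (\<forall>b\<in>S. P (adj a b))) \<longrightarrow> (\<forall>x\<in>S. P x))"
    unfolding P_def by (rule sat_ind_fm) (use S_emp S_adj S_trans S_V assms(2,3) in auto)
  ultimately show ?thesis by blast
qed

text \<open>Standard sets satisfy set induction by their definition; transfer of its universal closure
  yields set induction for all sets.\<close>

lemma ind_fm_V:
  assumes "range e \<subseteq> V" "\<forall>i\<in>vars \<phi>. i < n" "0 < n"
  shows "sat (\<epsilon>) V e (ind_fm n \<phi>)"
proof -
  have "sat (\<epsilon>) S (\<lambda>_. emp) (close_fm n (ind_fm n \<phi>))"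
    unfolding sat_close_fm
  proof (intro allI impI)
    fix e' assume e': "(\<forall>i<n. e' i \<in> S) \<and> (\<forall>i\<ge>n. e' i = emp)"
    have "e' i \<in> S" for i using e' S_emp by (cases "i < n") auto
    then show "sat (\<epsilon>) S e' (ind_fm n \<phi>)" by (intro ind_fm_S) (use assms(2,3) in auto)
  qed
  then have "sat (\<epsilon>) V (\<lambda>_. emp) (close_fm n (ind_fm n \<phi>))"
    using transfer[of "\<lambda>_. emp"] S_emp by auto
  then have *: "sat (\<epsilon>) V (\<lambda>i. if i < n then e i else emp) (ind_fm n \<phi>)"
    unfolding sat_close_fm using assms(1) by (elim allE) (erule mp, auto)
  have "sat (\<epsilon>) V ((\<lambda>i. if i < n then e i else emp)(0 := x)) \<phi> = sat (\<epsilon>) V (e(0 := x)) \<phi>" for x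
    by (rule sat_cong) (use assms(2) in auto)
  with * show ?thesis
    unfolding sat_ind_fm_V[OF assms(2,3)] by simp
qed

lemma set_induct:
  assumes "dfn V V (\<lambda>e. P (e 0))" "P emp"
    and "\<And>x y. x \<in> V \<Longrightarrow> y \<in> V \<Longrightarrow> P x \<Longrightarrow> P (adj x y)" "x \<in> V"
  shows "P x"
proof -
  from dfn_sat_var[OF assms(1) order_refl V_nonempty] obtain \<phi> e
    where e: "range e \<subseteq> V" "\<forall>x\<in>V. P x \<longleftrightarrow> sat (\<epsilon>) V (e(0 := x)) \<phi>" by (elim exE conjE)
  define n where "n = Suc (Max (insert 0 (vars \<phi>)))"
  have n: "\<forall>i\<in>vars \<phi>. i < n"
    using finite_vars[of \<phi>] by (simp add: n_def less_Suc_eq_le)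
  have "0 < n" by (simp add: n_def)
  have "sat (\<epsilon>) V e (ind_fm n \<phi>)" using e(1) n \<open>0 < n\<close> by (rule ind_fm_V)
  then have "P emp \<longrightarrow> (\<forall>a\<in>V. P a \<longrightarrow> (\<forall>b\<in>V. P (adj a b))) \<longrightarrow> (\<forall>x\<in>V. P x)"
    unfolding sat_ind_fm_V[OF n \<open>0 < n\<close>] using e(2) by simp
  then show ?thesis using assms(2-4) by blast
qed

lemma elem_induct:
  assumes "dfn V V (\<lambda>e. P (e 0))" "\<And>x. x \<in> V \<Longrightarrow> (\<And>y. y \<epsilon> x \<Longrightarrow> P y) \<Longrightarrow> P x" "x \<in> V"
  shows "P x"
proof -
  from dfn_sat_var[OF assms(1) order_refl V_nonempty] obtain \<phi> e
    where e: "range e \<subseteq> V" "\<forall>x\<in>V. P x \<longleftrightarrow> sat (\<epsilon>) V (e(0 := x)) \<phi>" by (elim exE conjE)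
  have "\<forall>x\<in>V. sat (\<epsilon>) V (e(0 := x)) \<phi>"
    by (rule mem_induction[OF e(1)]) (use e(2) assms(2) mem_V in auto)
  then show ?thesis using e(2) assms(3) by simp
qed

text \<open>By set induction the subset is built up one element at a time. The restriction to set
  formulas is essential: the standard numbers below a nonstandard one do not form a set.\<close>

lemma separation:
  assumes "dfn V V (\<lambda>e. P (e 0))" "x \<in> V"
  shows "\<exists>z\<in>V. \<forall>y. y \<epsilon> z \<longleftrightarrow> y \<epsilon> x \<and> P y"
proof -
  note P = dfn_lift1[OF dom_ok_refl assms(1) fn_var]
  have "\<exists>z\<in>V. \<forall>y\<in>V. y \<epsilon> z \<longleftrightarrow> y \<epsilon> x \<and> P y"
  proof (rule set_induct[where P = "\<lambda>x. \<exists>z\<in>V. \<forall>y\<in>V. y \<epsilon> z \<longleftrightarrow> y \<epsilon> x \<and> P y", OF _ _ _ assms(2)])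
    show "dfn V V (\<lambda>e. \<exists>z\<in>V. \<forall>y\<in>V. y \<epsilon> z \<longleftrightarrow> y \<epsilon> e 0 \<and> P y)"
      by (intro dfn_intros P)
    show "\<exists>z\<in>V. \<forall>y\<in>V. y \<epsilon> z \<longleftrightarrow> y \<epsilon> emp \<and> P y" by (intro bexI[of _ emp]) auto
    fix x y assume "x \<in> V" "y \<in> V" "\<exists>z\<in>V. \<forall>y\<in>V. y \<epsilon> z \<longleftrightarrow> y \<epsilon> x \<and> P y"
    then obtain z where "z \<in> V" "\<forall>y\<in>V. y \<epsilon> z \<longleftrightarrow> y \<epsilon> x \<and> P y" by blast
    then show "\<exists>z\<in>V. \<forall>y'\<in>V. y' \<epsilon> z \<longleftrightarrow> y' \<epsilon> adj x y \<and> P y'"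
      using \<open>x \<in> V\<close> \<open>y \<in> V\<close> by (intro bexI[of _ "if P y then adj z y else z"]) auto
  qed
  then show ?thesis using mem_V by blast
qed

lemma ball_elts [simp]: "(\<forall>x\<in>elts X. P x) \<longleftrightarrow> (\<forall>x. x \<epsilon> X \<longrightarrow> P x)"
  by (simp add: Ball_def)

lemma bex_elts [simp]: "(\<exists>x\<in>elts X. P x) \<longleftrightarrow> (\<exists>x. x \<epsilon> X \<and> P x)"
  by (simp add: Bex_def)

text \<open>The two ranges of quantifiers in use for predicates of sets. A rule proved once with set
  quantifiers thereby serves both inductions over all sets and class comprehension.\<close>

definition set_or_univ :: "'c set \<Rightarrow> bool" where
  "set_or_univ D \<longleftrightarrow> D = V \<or> D = UNIV"

lemma set_or_univ [simp]: "set_or_univ V" "set_or_univ UNIV"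
  by (simp_all add: set_or_univ_def)

lemma dfn_V_lift: "set_or_univ D \<Longrightarrow> dfn V V P \<Longrightarrow> dfn D V P"
  unfolding set_or_univ_def by (elim disjE) (simp_all add: dfn_V_imp_UNIV)

lemma fn_V_lift: "set_or_univ D \<Longrightarrow> fn V V P \<Longrightarrow> fn D V P"
  unfolding set_or_univ_def by (elim disjE) (simp_all add: fn_V_imp_UNIV)

lemma dom_ok_set_or_univ: "set_or_univ D \<Longrightarrow> dom_ok D V"
  unfolding set_or_univ_def by (elim disjE) (simp_all add: dom_ok_refl dom_ok_V)

lemma suc_V [simp]: "n \<in> V \<Longrightarrow> suc n \<in> V"
  by (simp add: suc_def)

lemma mem_suc [simp]: "n \<in> V \<Longrightarrow> z \<epsilon> suc n \<longleftrightarrow> z = n \<or> z \<epsilon> n"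
  by (simp add: suc_def)

lemma upair_V [simp]: "x \<in> V \<Longrightarrow> y \<in> V \<Longrightarrow> upair x y \<in> V"
  by (simp add: upair_def)

lemma mem_upair [simp]: "x \<in> V \<Longrightarrow> y \<in> V \<Longrightarrow> z \<epsilon> upair x y \<longleftrightarrow> z = x \<or> z = y"
  by (auto simp: upair_def)

lemma pair_V [simp]: "x \<in> V \<Longrightarrow> y \<in> V \<Longrightarrow> pair x y \<in> V"
  by (simp add: pair_def)

lemma upair_eq:
  assumes "x \<in> V" "y \<in> V" "x' \<in> V" "y' \<in> V"
  shows "upair x y = upair x' y' \<longleftrightarrow> (x = x' \<and> y = y' \<or> x = y' \<and> y = x')"
proof
  assume "upair x y = upair x' y'"
  then have "z = x \<or> z = y \<longleftrightarrow> z = x' \<or> z = y'" for z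
    using mem_upair[OF assms(1,2), of z] mem_upair[OF assms(3,4), of z] by simp
  then show "x = x' \<and> y = y' \<or> x = y' \<and> y = x'" by metis
next
  assume "x = x' \<and> y = y' \<or> x = y' \<and> y = x'"
  then show "upair x y = upair x' y'" using assms by (auto simp: ext_iff[of "upair x y"])
qed

lemma pair_eq [simp]:
  assumes "x \<in> V" "y \<in> V" "x' \<in> V" "y' \<in> V"
  shows "pair x y = pair x' y' \<longleftrightarrow> x = x' \<and> y = y'"
  using assms by (auto simp: pair_def upair_eq)

lemma fn_suc: "dom_ok D V \<Longrightarrow> fn D V a \<Longrightarrow> fn D V (\<lambda>e. suc (a e))"
  unfolding suc_def by (rule fn_adj)

lemma fn_pair:
  assumes "dom_ok D V" "fn D V a" "fn D V b"
  shows "fn D V (\<lambda>e. pair (a e) (b e))"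
  unfolding pair_def upair_def
  by (intro fn_adj assms fn_const emp_V dom_ok_V_subset[OF assms(1)])

lemmas set_intros = dfn_intros fn_adj fn_suc fn_pair order_refl subset_UNIV emp_V

text \<open>Set induction makes every set finite in the internal sense, so a total preorder given by
  a set formula has a greatest element on it. Applications are predecessors of numbers, maxima of
  sets of numbers and the largest member of a chain of sets.\<close>

lemma set_max:
  assumes "dfn V V (\<lambda>e. r (e 0) (e (Suc 0)))" "x \<in> V"
    and "x \<noteq> emp" "\<And>a b. a \<epsilon> x \<Longrightarrow> b \<epsilon> x \<Longrightarrow> r a b \<or> r b a"
    and "\<And>a b c. a \<epsilon> x \<Longrightarrow> b \<epsilon> x \<Longrightarrow> c \<epsilon> x \<Longrightarrow> r a b \<Longrightarrow> r b c \<Longrightarrow> r a c"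
  shows "\<exists>m. m \<epsilon> x \<and> (\<forall>k. k \<epsilon> x \<longrightarrow> r k m)"
proof -
  note r = dfn_lift2[where \<Phi> = r, OF dom_ok_refl assms(1)]
  define P where "P x \<longleftrightarrow> x \<noteq> emp \<and> (\<forall>a\<in>elts x. \<forall>b\<in>elts x. r a b \<or> r b a) \<and>
    (\<forall>a\<in>elts x. \<forall>b\<in>elts x. \<forall>c\<in>elts x. r a b \<longrightarrow> r b c \<longrightarrow> r a c) \<longrightarrow>
    (\<exists>m\<in>elts x. \<forall>k\<in>elts x. r k m)" for x
  have "P x"
  proof (rule set_induct[OF _ _ _ assms(2)])
    show "dfn V V (\<lambda>e. P (e 0))" unfolding P_def
      by (intro set_intros r)
    show "P emp" by (simp add: P_def)
    fix x y assume xy: "x \<in> V" "y \<in> V" "P x"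
    show "P (adj x y)" unfolding P_def
    proof (intro impI, elim conjE)
      assume tot: "\<forall>a\<in>elts (adj x y). \<forall>b\<in>elts (adj x y). r a b \<or> r b a"
        and tr: "\<forall>a\<in>elts (adj x y). \<forall>b\<in>elts (adj x y). \<forall>c\<in>elts (adj x y). r a b \<longrightarrow> r b c \<longrightarrow> r a c"
      have yy: "r y y" using tot[rule_format, of y y] xy by simp
      show "\<exists>m\<in>elts (adj x y). \<forall>k\<in>elts (adj x y). r k m"
      proof (cases "x = emp")
        case True
        then show ?thesis using xy yy by (intro bexI[of _ y]) simp_all
      next
        case False
        have sub: "a \<in> elts x \<Longrightarrow> a \<in> elts (adj x y)" for a using xy by simp
        have "\<forall>a\<in>elts x. \<forall>b\<in>elts x. r a b \<or> r b a"
          "\<forall>a\<in>elts x. \<forall>b\<in>elts x. \<forall>c\<in>elts x. r a b \<longrightarrow> r b c \<longrightarrow> r a c"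
          using tot tr sub by meson+
        then have "\<exists>m\<in>elts x. \<forall>k\<in>elts x. r k m"
          using xy(3) False unfolding P_def by iprover
        then obtain m where m: "m \<epsilon> x" "\<And>k. k \<epsilon> x \<Longrightarrow> r k m" by auto
        have "r m y \<or> r y m" using tot[rule_format, of m y] m(1) xy by simp
        then show ?thesis
        proof
          assume my: "r m y"
          have "r k y" if "k \<epsilon> x" for k
            using tr[rule_format, of k m y] that m my xy by simp
          then show ?thesis using xy yy by (intro bexI[of _ y]) auto
        next
          assume "r y m"
          then show ?thesis using xy m by (intro bexI[of _ m]) auto
        qed
      qed
    qed
  qed
  then show ?thesis using assms(3-5) unfolding P_def ball_elts bex_elts by blast
qed

subsection \<open>Natural numbers\<close>

lemma N_iff: "n \<in> N \<longleftrightarrow> n \<in> V \<and> (\<forall>x\<in>elts n. \<forall>y\<in>elts x. y \<epsilon> n) \<and> (\<forall>x\<in>elts n. \<not> x \<epsilon> x) \<and>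
  (\<forall>x\<in>elts n. \<forall>y\<in>elts n. \<forall>z\<in>elts n. x \<epsilon> y \<longrightarrow> y \<epsilon> z \<longrightarrow> x \<epsilon> z) \<and>
  (\<forall>x\<in>elts n. \<forall>y\<in>elts n. x \<noteq> y \<longrightarrow> x \<epsilon> y \<or> y \<epsilon> x)"
  unfolding N_def irreflp_on_def transp_on_def totalp_on_def subset_eq mem_Collect_eq by simp

lemma N_V: "n \<in> N \<Longrightarrow> n \<in> V"
  by (simp add: N_iff)

lemma dfn_N:
  assumes "set_or_univ D" "fn D V a" shows "dfn D V (\<lambda>e. a e \<in> N)"
proof (rule dfn_lift1[where \<Phi> = "\<lambda>x. x \<in> N", OF dom_ok_set_or_univ[OF assms(1)] _ assms(2)])
  show "dfn D V (\<lambda>e. e 0 \<in> N)"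
    by (rule dfn_V_lift[OF assms(1)]) (unfold N_iff, intro set_intros)
qed

lemma N_subset_V: "N \<subseteq> V"
  using N_V by blast

lemma dfn_all_N:
  assumes "set_or_univ D" "dfn D V (\<lambda>e. \<Phi> (\<lambda>i. e (Suc i)) (e 0))"
  shows "dfn D V (\<lambda>e. \<forall>x\<in>N. \<Phi> e x)"
  by (rule dfn_all_in[OF dom_ok_set_or_univ[OF assms(1)] N_subset_V dfn_N[OF assms(1) fn_var] assms(2)])

lemma dfn_ex_N:
  assumes "set_or_univ D" "dfn D V (\<lambda>e. \<Phi> (\<lambda>i. e (Suc i)) (e 0))"
  shows "dfn D V (\<lambda>e. \<exists>x\<in>N. \<Phi> e x)"
  by (rule dfn_ex_in[OF dom_ok_set_or_univ[OF assms(1)] N_subset_V dfn_N[OF assms(1) fn_var] assms(2)])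

lemmas N_intros = set_intros dfn_N dfn_all_N dfn_ex_N set_or_univ

lemma N_emp [simp]: "emp \<in> N"
  by (simp add: N_iff)

lemma N_not_self: "n \<in> N \<Longrightarrow> \<not> n \<epsilon> n"
  unfolding N_iff ball_elts by blast

lemma N_trans: "n \<in> N \<Longrightarrow> x \<epsilon> n \<Longrightarrow> y \<epsilon> x \<Longrightarrow> y \<epsilon> n"
  unfolding N_iff ball_elts by blast

lemma N_suc [simp]: assumes "n \<in> N" shows "suc n \<in> N"
proof -
  have n: "n \<in> V" "\<And>x y. x \<epsilon> n \<Longrightarrow> y \<epsilon> x \<Longrightarrow> y \<epsilon> n" "\<And>x. x \<epsilon> n \<Longrightarrow> \<not> x \<epsilon> x"
    "\<And>x y z. x \<epsilon> n \<Longrightarrow> y \<epsilon> n \<Longrightarrow> z \<epsilon> n \<Longrightarrow> x \<epsilon> y \<Longrightarrow> y \<epsilon> z \<Longrightarrow> x \<epsilon> z"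
    "\<And>x y. x \<epsilon> n \<Longrightarrow> y \<epsilon> n \<Longrightarrow> x \<noteq> y \<Longrightarrow> x \<epsilon> y \<or> y \<epsilon> x"
    using assms unfolding N_iff ball_elts by blast+
  have nn: "\<not> n \<epsilon> n" using n(3) by blast
  have nx: "\<not> n \<epsilon> x" if "x \<epsilon> n" for x using n(2)[OF that, of n] nn by blast
  show ?thesis unfolding N_iff ball_elts mem_suc[OF n(1)]
  proof (intro conjI allI impI)
    show "suc n \<in> V" using n(1) by simp
    show "y = n \<or> y \<epsilon> n" if "x = n \<or> x \<epsilon> n" "y \<epsilon> x" for x y using that n(2) by blast
    show "\<not> x \<epsilon> x" if "x = n \<or> x \<epsilon> n" for x using that nn n(3) by blast
    show "x \<epsilon> z" if "x = n \<or> x \<epsilon> n" "y = n \<or> y \<epsilon> n" "z = n \<or> z \<epsilon> n" "x \<epsilon> y" "y \<epsilon> z" for x y z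
    proof (cases "z = n")
      case True
      then show ?thesis using n(2)[of y x] that nn nx by blast
    next
      case False
      then have z: "z \<epsilon> n" using that by blast
      then have y: "y \<epsilon> n" using nx that by blast
      then have "x \<epsilon> n" using nx that by blast
      then show ?thesis using n(4) y z that by blast
    qed
    show "x \<epsilon> y \<or> y \<epsilon> x" if "x = n \<or> x \<epsilon> n" "y = n \<or> y \<epsilon> n" "x \<noteq> y" for x y
      using that n(5) by blast
  qed
qed

lemma N_elem: assumes "n \<in> N" "k \<epsilon> n" shows "k \<in> N"
proof -
  have n: "\<And>x y. x \<epsilon> n \<Longrightarrow> y \<epsilon> x \<Longrightarrow> y \<epsilon> n" "\<And>x. x \<epsilon> n \<Longrightarrow> \<not> x \<epsilon> x"
    "\<And>x y z. x \<epsilon> n \<Longrightarrow> y \<epsilon> n \<Longrightarrow> z \<epsilon> n \<Longrightarrow> x \<epsilon> y \<Longrightarrow> y \<epsilon> z \<Longrightarrow> x \<epsilon> z"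
    "\<And>x y. x \<epsilon> n \<Longrightarrow> y \<epsilon> n \<Longrightarrow> x \<noteq> y \<Longrightarrow> x \<epsilon> y \<or> y \<epsilon> x"
    using assms(1) unfolding N_iff ball_elts by blast+
  have k: "x \<epsilon> n" if "x \<epsilon> k" for x using n(1)[OF assms(2) that] .
  show ?thesis unfolding N_iff ball_elts
  proof (intro conjI allI impI)
    show "k \<in> V" using assms(2) mem_V by blast
    show "y \<epsilon> k" if "x \<epsilon> k" "y \<epsilon> x" for x y
      using n(3)[OF n(1)[OF k[OF that(1)] that(2)] k[OF that(1)] assms(2) that(2,1)] .
    show "\<not> x \<epsilon> x" if "x \<epsilon> k" for x using n(2)[OF k[OF that]] .
    show "x \<epsilon> z" if "x \<epsilon> k" "y \<epsilon> k" "z \<epsilon> k" "x \<epsilon> y" "y \<epsilon> z" for x y z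
      using n(3)[OF k[OF that(1)] k[OF that(2)] k[OF that(3)] that(4,5)] .
    show "x \<epsilon> y \<or> y \<epsilon> x" if "x \<epsilon> k" "y \<epsilon> k" "x \<noteq> y" for x y
      using n(4)[OF k[OF that(1)] k[OF that(2)] that(3)] .
  qed
qed

text \<open>The predecessor is the greatest element with respect to membership, which exists because
  sets are internally finite; limit numbers cannot occur.\<close>

lemma N_cases:
  assumes "n \<in> N"
  obtains "n = emp" | m where "m \<in> N" "n = suc m"
proof (cases "n = emp")
  case False
  have n: "n \<in> V" "\<And>x y z. x \<epsilon> n \<Longrightarrow> y \<epsilon> n \<Longrightarrow> z \<epsilon> n \<Longrightarrow> x \<epsilon> y \<Longrightarrow> y \<epsilon> z \<Longrightarrow> x \<epsilon> z"
    "\<And>x y. x \<epsilon> n \<Longrightarrow> y \<epsilon> n \<Longrightarrow> x \<noteq> y \<Longrightarrow> x \<epsilon> y \<or> y \<epsilon> x"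
    using assms unfolding N_iff ball_elts by blast+
  have "dfn V V (\<lambda>e. e 0 = e (Suc 0) \<or> e 0 \<epsilon> e (Suc 0))" by (intro set_intros)
  then have "\<exists>m. m \<epsilon> n \<and> (\<forall>k. k \<epsilon> n \<longrightarrow> k = m \<or> k \<epsilon> m)"
    by (rule set_max[OF _ n(1) False]) (use n(2,3) in blast)+
  then obtain m where m: "m \<epsilon> n" "\<And>k. k \<epsilon> n \<Longrightarrow> k = m \<or> k \<epsilon> m" by blast
  have mN: "m \<in> N" using N_elem[OF assms m(1)] .
  have "n = suc m"
    using m N_trans[OF assms m(1)] N_V[OF mN] by (subst ext_iff) auto
  with mN that show ?thesis by blast
qed (rule that)

text \<open>Membership induction suffices, as a nonempty number has its predecessor as an element.
  The predicate must be a set formula, hence it cannot mention \<open>SN\<close> or classes outside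
  the sets.\<close>

lemma N_induct [consumes 2, case_names emp suc]:
  assumes "n \<in> N" "dfn V V (\<lambda>e. P (e 0))" "P emp" "\<And>n. n \<in> N \<Longrightarrow> P n \<Longrightarrow> P (suc n)"
  shows "P n"
proof -
  have "n \<in> N \<longrightarrow> P n"
  proof (rule elem_induct[where P = "\<lambda>n. n \<in> N \<longrightarrow> P n", OF _ _ N_V[OF assms(1)]])
    show "dfn V V (\<lambda>e. e 0 \<in> N \<longrightarrow> P (e 0))" by (intro dfn_imp assms(2) N_intros)
    fix x assume IH: "\<And>y. y \<epsilon> x \<Longrightarrow> y \<in> N \<longrightarrow> P y"
    show "x \<in> N \<longrightarrow> P x"
    proof
      assume "x \<in> N"
      then show "P x"
      proof (cases rule: N_cases)
        case (2 m)
        then show ?thesis using IH[of m] assms(4) N_V by auto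
      qed (simp add: assms(3))
    qed
  qed
  then show ?thesis using assms(1) by blast
qed

lemma N_least:
  assumes "dfn V V (\<lambda>e. P (e 0))" "n \<in> N" "P n"
  shows "\<exists>m\<in>N. P m \<and> (\<forall>k. k \<epsilon> m \<longrightarrow> \<not> P k)"
proof (rule ccontr)
  assume *: "\<not> ?thesis"
  have "n \<in> N \<longrightarrow> \<not> P n"
  proof (rule elem_induct[where P = "\<lambda>n. n \<in> N \<longrightarrow> \<not> P n", OF _ _ N_V[OF assms(2)]])
    show "dfn V V (\<lambda>e. e 0 \<in> N \<longrightarrow> \<not> P (e 0))" by (intro dfn_imp dfn_not assms(1) N_intros)
    fix x assume IH: "\<And>y. y \<epsilon> x \<Longrightarrow> y \<in> N \<longrightarrow> \<not> P y"
    show "x \<in> N \<longrightarrow> \<not> P x"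
    proof
      assume "x \<in> N"
      then have "\<forall>k. k \<epsilon> x \<longrightarrow> \<not> P k" using IH N_elem by blast
      then show "\<not> P x" using * \<open>x \<in> N\<close> by blast
    qed
  qed
  then show False using assms(2,3) by blast
qed

lemma emp_mem: assumes "n \<in> N" shows "n = emp \<or> emp \<epsilon> n"
  by (rule N_induct[where P = "\<lambda>n. n = emp \<or> emp \<epsilon> n", OF assms]) (intro N_intros, auto dest: N_V)

lemma suc_le: assumes "n \<in> N" "m \<epsilon> n" shows "suc m \<epsilon> n \<or> suc m = n"
proof -
  have m: "m \<in> N" using N_elem[OF assms] .
  then have "m \<epsilon> n \<longrightarrow> suc m \<epsilon> n \<or> suc m = n"
    by (intro N_induct[where P = "\<lambda>n. m \<epsilon> n \<longrightarrow> suc m \<epsilon> n \<or> suc m = n", OF assms(1)])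
       (intro N_intros, auto dest: N_V)
  then show ?thesis using assms(2) by blast
qed

lemma N_linear: assumes "m \<in> N" "n \<in> N" shows "m \<epsilon> n \<or> m = n \<or> n \<epsilon> m"
  using assms(2)
proof (rule N_induct[where P = "\<lambda>n. m \<epsilon> n \<or> m = n \<or> n \<epsilon> m"])
  show "dfn V V (\<lambda>e. m \<epsilon> e 0 \<or> m = e 0 \<or> e 0 \<epsilon> m)" using assms by (intro N_intros N_V)
  show "m \<epsilon> emp \<or> m = emp \<or> emp \<epsilon> m" using emp_mem[OF assms(1)] by blast
  fix n assume "n \<in> N" "m \<epsilon> n \<or> m = n \<or> n \<epsilon> m"
  then show "m \<epsilon> suc n \<or> m = suc n \<or> suc n \<epsilon> m"
    using suc_le[OF assms(1)] N_V by auto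
qed

lemma suc_inj [simp]: assumes "m \<in> N" "n \<in> N" shows "suc m = suc n \<longleftrightarrow> m = n"
proof
  assume "suc m = suc n"
  then have "m \<epsilon> suc n" "n \<epsilon> suc m" using assms N_V mem_suc by metis+
  then show "m = n" using assms N_V N_trans[of m n m] N_not_self by auto
qed simp

lemma suc_neq_emp [simp]: "n \<in> N \<Longrightarrow> suc n \<noteq> emp"
  using N_V[of n] mem_suc[of n n] not_mem_emp[of n] by metis

lemma suc_mem_suc: assumes "m \<in> N" "n \<in> N" shows "suc m \<epsilon> suc n \<longleftrightarrow> m \<epsilon> n"
proof
  assume "m \<epsilon> n" then show "suc m \<epsilon> suc n" using suc_le[OF assms(2)] N_V[OF assms(2)] by auto
next
  assume *: "suc m \<epsilon> suc n"
  have "m \<epsilon> suc m" using N_V[OF assms(1)] by simp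
  then show "m \<epsilon> n" using * N_trans[OF assms(2), of "suc m" m] N_V[OF assms(2)] by auto
qed

subsection \<open>Iteration\<close>

text \<open>Unique existence is resolved into connectives and quantifiers over sets, so that being a
  witness for an iteration becomes a set formula.\<close>

lemma fun_on_elts_iff:
  "fun_on f (elts d) \<longleftrightarrow> (\<forall>p\<in>elts f. \<exists>x\<in>elts d. \<exists>y\<in>V. p = pair x y) \<and>
    (\<forall>x\<in>elts d. \<exists>y\<in>V. pair x y \<epsilon> f \<and> (\<forall>z\<in>V. pair x z \<epsilon> f \<longrightarrow> z = y))"
  unfolding fun_on_def Ex1_def by blast

definition itfun :: "('c \<Rightarrow> 'c) \<Rightarrow> 'c \<Rightarrow> 'c \<Rightarrow> 'c \<Rightarrow> bool" where
  "itfun g a n f \<longleftrightarrow> fun_on f (elts (suc n)) \<and> pair emp a \<epsilon> f \<and>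
     (\<forall>i\<in>elts n. \<forall>v\<in>V. pair i v \<epsilon> f \<longrightarrow> pair (suc i) (g v) \<epsilon> f)"

lemma iter_itfun: "iter g a n = (THE k. k \<in> V \<and> (\<exists>f\<in>V. itfun g a n f \<and> pair n k \<epsilon> f))"
  unfolding iter_def itfun_def by (simp add: conj_assoc)

lemma itfun_single:
  assumes "itfun g a n f" "i \<epsilon> suc n" "v \<in> V" "w \<in> V" "pair i v \<epsilon> f" "pair i w \<epsilon> f"
  shows "v = w"
  using assms unfolding itfun_def fun_on_elts_iff ball_elts by blast

lemma itfun_total:
  assumes "itfun g a n f" "i \<epsilon> suc n" shows "\<exists>v\<in>V. pair i v \<epsilon> f"
  using assms unfolding itfun_def fun_on_elts_iff ball_elts by blast

lemma itfun_step:
  assumes "itfun g a n f" "i \<epsilon> n" "v \<in> V" "pair i v \<epsilon> f" shows "pair (suc i) (g v) \<epsilon> f"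
  using assms unfolding itfun_def ball_elts by blast

text \<open>Stated for two step functions and two lengths in order to serve three purposes:
  uniqueness of the iterated value, comparison of the witnesses for \<open>n\<close> and
  \<open>suc n\<close>, and independence of the values of the step function outside
  \<open>N\<close>.\<close>

lemma itfun_agree:
  assumes g: "\<forall>v\<in>N. g v \<in> N" "\<forall>v\<in>N. g v = g' v" "a \<in> N"
    and f: "itfun g a n f" "itfun g' a n' f'" and n: "n \<in> N" "n' \<in> N" "f \<in> V" "f' \<in> V"
    and i: "i \<epsilon> suc n" "i \<epsilon> suc n'" "v \<in> V" "pair i v \<epsilon> f"
  shows "v \<in> N \<and> pair i v \<epsilon> f'"
proof -
  have "i \<in> N" using i(1) n N_elem N_suc by blast
  then have "i \<epsilon> suc n \<and> i \<epsilon> suc n' \<longrightarrow> (\<forall>v\<in>V. pair i v \<epsilon> f \<longrightarrow> v \<in> N \<and> pair i v \<epsilon> f')"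
  proof (rule N_induct[where P = "\<lambda>i. i \<epsilon> suc n \<and> i \<epsilon> suc n' \<longrightarrow> (\<forall>v\<in>V. pair i v \<epsilon> f \<longrightarrow> v \<in> N \<and> pair i v \<epsilon> f')"])
    show "dfn V V (\<lambda>e. e 0 \<epsilon> suc n \<and> e 0 \<epsilon> suc n' \<longrightarrow>
        (\<forall>v\<in>V. pair (e 0) v \<epsilon> f \<longrightarrow> v \<in> N \<and> pair (e 0) v \<epsilon> f'))"
      using n by (intro N_intros suc_V) (use N_V in auto)
    have "pair emp a \<epsilon> f" "pair emp a \<epsilon> f'" using f by (simp_all add: itfun_def)
    then show "emp \<epsilon> suc n \<and> emp \<epsilon> suc n' \<longrightarrow> (\<forall>v\<in>V. pair emp v \<epsilon> f \<longrightarrow> v \<in> N \<and> pair emp v \<epsilon> f')"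
      using itfun_single[OF f(1)] g(3) N_V by blast
  next
    fix i assume i: "i \<in> N" "i \<epsilon> suc n \<and> i \<epsilon> suc n' \<longrightarrow> (\<forall>v\<in>V. pair i v \<epsilon> f \<longrightarrow> v \<in> N \<and> pair i v \<epsilon> f')"
    show "suc i \<epsilon> suc n \<and> suc i \<epsilon> suc n' \<longrightarrow> (\<forall>v\<in>V. pair (suc i) v \<epsilon> f \<longrightarrow> v \<in> N \<and> pair (suc i) v \<epsilon> f')"
    proof (intro impI ballI, elim conjE)
      fix w assume w: "suc i \<epsilon> suc n" "suc i \<epsilon> suc n'" "w \<in> V" "pair (suc i) w \<epsilon> f"
      have in_n: "i \<epsilon> n" "i \<epsilon> n'" using w(1,2) suc_mem_suc i(1) n by auto
      then have in_sn: "i \<epsilon> suc n" "i \<epsilon> suc n'" using n N_V by auto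
      obtain v where v: "v \<in> V" "pair i v \<epsilon> f" using itfun_total[OF f(1) in_sn(1)] by blast
      then have v': "v \<in> N" "pair i v \<epsilon> f'" using i(2) in_sn by blast+
      have "w = g v"
        using itfun_single[OF f(1) w(1,3) _ w(4) itfun_step[OF f(1) in_n(1) v]] g(1) v'(1) N_V by blast
      moreover have "pair (suc i) (g' v) \<epsilon> f'" using itfun_step[OF f(2) in_n(2) v(1) v'(2)] .
      ultimately show "w \<in> N \<and> pair (suc i) w \<epsilon> f'" using g(1,2) v'(1) by auto
    qed
  qed
  then show ?thesis using i by blast
qed

text \<open>A witness for \<open>n\<close> is extended by a single pair with \<open>adj\<close>, so
  it remains a set. Definability of \<open>g\<close> makes the claim a set formula and thus
  accessible to induction over all numbers.\<close>

lemma itfun_exists: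
  assumes g: "fn V V (\<lambda>e. g (e 0))" "\<forall>v\<in>N. g v \<in> N" and a: "a \<in> N" and n: "n \<in> N"
  shows "\<exists>f\<in>V. itfun g a n f \<and> (\<exists>k\<in>N. pair n k \<epsilon> f)"
  using n
proof (rule N_induct[where P = "\<lambda>n. \<exists>f\<in>V. itfun g a n f \<and> (\<exists>k\<in>N. pair n k \<epsilon> f)"])
  show "dfn V V (\<lambda>e. \<exists>f\<in>V. itfun g a (e 0) f \<and> (\<exists>k\<in>N. pair (e 0) k \<epsilon> f))"
    unfolding itfun_def fun_on_elts_iff
    using a by (intro N_intros fn_lift1[where f = g, OF dom_ok_refl g(1)] N_V)
  show "\<exists>f\<in>V. itfun g a emp f \<and> (\<exists>k\<in>N. pair emp k \<epsilon> f)"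
    using a N_V[OF a] by (intro bexI[of _ "adj emp (pair emp a)"]) (auto simp: itfun_def fun_on_elts_iff)
next
  fix n assume n: "n \<in> N" and "\<exists>f\<in>V. itfun g a n f \<and> (\<exists>k\<in>N. pair n k \<epsilon> f)"
  then obtain f k where f: "f \<in> V" "itfun g a n f" and k: "k \<in> N" "pair n k \<epsilon> f" by blast
  have V: "n \<in> V" "k \<in> V" "g k \<in> V" "g k \<in> N" using n k g(2) N_V by auto
  define p where "p = pair (suc n) (g k)"
  have p: "p \<in> V" using V by (simp add: p_def)
  have fV: "\<And>x y. pair x y \<epsilon> f \<Longrightarrow> x \<in> V \<Longrightarrow> y \<in> V \<Longrightarrow> x \<epsilon> suc n"
    using f(2) unfolding itfun_def fun_on_elts_iff ball_elts bex_elts by (metis mem_V pair_eq)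
  have sn: "\<not> suc n \<epsilon> suc n" using N_not_self[OF N_suc[OF n]] .
  have "itfun g a (suc n) (adj f p)"
    unfolding itfun_def fun_on_elts_iff
  proof (intro conjI ballI impI)
    fix q assume "q \<in> elts (adj f p)"
    then have "q = p \<or> q \<epsilon> f" using f p by auto
    then show "\<exists>x\<in>elts (suc (suc n)). \<exists>y\<in>V. q = pair x y"
    proof
      assume "q = p" then show ?thesis
        unfolding p_def using V by (intro bexI[of _ "suc n"] bexI[of _ "g k"]) auto
    next
      assume "q \<epsilon> f"
      then obtain x y where "x \<epsilon> suc n" "y \<in> V" "q = pair x y"
        using f(2) unfolding itfun_def fun_on_elts_iff by auto
      then show ?thesis using V by (intro bexI[of _ x] bexI[of _ y]) auto
    qed
  next
    fix x assume "x \<in> elts (suc (suc n))"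
    then have "x = suc n \<or> x \<epsilon> suc n" using V by auto
    then show "\<exists>y\<in>V. pair x y \<epsilon> adj f p \<and> (\<forall>z\<in>V. pair x z \<epsilon> adj f p \<longrightarrow> z = y)"
    proof
      assume x: "x = suc n"
      have "z = g k" if "z \<in> V" "pair (suc n) z = p \<or> pair (suc n) z \<epsilon> f" for z
        using that fV[of "suc n" z] sn V unfolding p_def by auto
      then have "\<forall>z\<in>V. pair (suc n) z \<epsilon> adj f p \<longrightarrow> z = g k" using mem_adj[OF f(1) p] by blast
      moreover have "pair (suc n) (g k) \<epsilon> adj f p" using f p by (simp add: p_def)
      ultimately show ?thesis using V(3) unfolding x by blast
    next
      assume x: "x \<epsilon> suc n"
      then have xV: "x \<in> V" "x \<noteq> suc n" using mem_V sn by blast+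
      obtain y where y: "y \<in> V" "pair x y \<epsilon> f" using itfun_total[OF f(2) x] by blast
      have "z = y" if "z \<in> V" "pair x z = p \<or> pair x z \<epsilon> f" for z
        using that itfun_single[OF f(2) x _ y(1) _ y(2)] xV V by (auto simp: p_def)
      then have "\<forall>z\<in>V. pair x z \<epsilon> adj f p \<longrightarrow> z = y" using mem_adj[OF f(1) p] by blast
      moreover have "pair x y \<epsilon> adj f p" using f p y by simp
      ultimately show ?thesis using y(1) by blast
    qed
  next
    show "pair emp a \<epsilon> adj f p" using f p by (simp add: itfun_def)
  next
    fix i v assume i: "i \<in> elts (suc n)" "v \<in> V" "pair i v \<epsilon> adj f p"
    then have iN: "i \<epsilon> suc n" "i \<in> V" using mem_V by auto
    then have "pair i v \<noteq> p" using sn i(2) V by (auto simp: p_def)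
    then have iv: "pair i v \<epsilon> f" using i f p by simp
    show "pair (suc i) (g v) \<epsilon> adj f p"
    proof (cases "i = n")
      case True
      then have "v = k" using itfun_single[OF f(2) iN(1) i(2) V(2) iv] k by blast
      then show ?thesis using True f p by (simp add: p_def)
    next
      case False
      then have "i \<epsilon> n" using iN V by simp
      then show ?thesis using itfun_step[OF f(2) _ i(2) iv] f p by simp
    qed
  qed
  moreover have "pair (suc n) (g k) \<epsilon> adj f p" using f p by (simp add: p_def)
  ultimately show "\<exists>f\<in>V. itfun g a (suc n) f \<and> (\<exists>k\<in>N. pair (suc n) k \<epsilon> f)"
    using f p V by (intro bexI[of _ "adj f p"]) auto
qed

lemma iter_eqI:
  assumes g: "\<forall>v\<in>N. g v \<in> N" "\<forall>v\<in>N. g v = g' v" and a: "a \<in> N" and n: "n \<in> N"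
    and f: "f \<in> V" "itfun g' a n f" "k \<in> V" "pair n k \<epsilon> f" and ex: "fn V V (\<lambda>e. g (e 0))"
  shows "k \<in> N" "iter g a n = k" "iter g' a n = k"
proof -
  obtain f' k' where f': "f' \<in> V" "itfun g a n f'" "k' \<in> N" "pair n k' \<epsilon> f'"
    using itfun_exists[of g a n, OF ex g(1) a n] by blast
  have nn: "n \<epsilon> suc n" using N_V[OF n] by simp
  have g': "\<forall>v\<in>N. g' v \<in> N" "\<forall>v\<in>N. g v = g v" "\<forall>v\<in>N. g' v = g v" "\<forall>v\<in>N. g' v = g' v" using g by auto
  have *: "j = k" if "h \<in> V" "itfun g a n h \<or> itfun g' a n h" "j \<in> V" "pair n j \<epsilon> h" for h j
    using that(2)
  proof
    assume "itfun g a n h"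
    then have "pair n j \<epsilon> f"
      using itfun_agree[OF g a _ f(2) n n that(1) f(1) nn nn that(3,4)] by blast
    then show ?thesis using itfun_single[OF f(2) nn that(3) f(3) _ f(4)] by blast
  next
    assume "itfun g' a n h"
    then have "pair n j \<epsilon> f"
      using itfun_agree[OF g'(1,4) a _ f(2) n n that(1) f(1) nn nn that(3,4)] by blast
    then show ?thesis using itfun_single[OF f(2) nn that(3) f(3) _ f(4)] by blast
  qed
  have "k' = k" using *[OF f'(1)] f' N_V by blast
  then show "k \<in> N" using f' by simp
  show "iter g a n = k" unfolding iter_itfun
    using f' \<open>k' = k\<close> N_V * by (intro the_equality) blast+
  show "iter g' a n = k" unfolding iter_itfun
    using f * by (intro the_equality) blast+
qed

text \<open>The fourth claim describes the graph of iteration without a description operator, which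
  makes sums and products definable. The fifth permits another step function that agrees on
  \<open>N\<close> only, as happens between \<open>*\<^sub>N\<close> and
  \<open>\<star>\<close>.\<close>

lemma iter_rec:
  assumes g: "fn V V (\<lambda>e. g (e 0))" "\<forall>v\<in>N. g v \<in> N" and a: "a \<in> N"
  shows "iter g a emp = a" and "n \<in> N \<Longrightarrow> iter g a n \<in> N"
    and "n \<in> N \<Longrightarrow> iter g a (suc n) = g (iter g a n)"
    and "n \<in> N \<Longrightarrow> k \<in> V \<Longrightarrow> k = iter g a n \<longleftrightarrow> (\<exists>f\<in>V. itfun g a n f \<and> pair n k \<epsilon> f)"
    and "n \<in> N \<Longrightarrow> \<forall>v\<in>N. g v = g' v \<Longrightarrow> iter g' a n = iter g a n"
proof -
  have rf: "\<forall>v\<in>N. g v = g v" by simp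
  note eqI = iter_eqI[of g g, OF g(2) rf a _ _ _ _ _ g(1)]
  have ex: "\<exists>f\<in>V. itfun g a n f \<and> (\<exists>k\<in>N. pair n k \<epsilon> f)" if "n \<in> N" for n
    by (rule itfun_exists[OF g a that])
  have "pair emp a \<epsilon> f" if "itfun g a n f" for f n using that by (simp add: itfun_def)
  then show "iter g a emp = a" using ex[of emp] eqI(2)[of emp _ a] a N_V by auto
  assume n: "n \<in> N"
  from ex[OF n] obtain f k where f: "f \<in> V" "itfun g a n f" "k \<in> N" "pair n k \<epsilon> f" by blast
  then have k: "iter g a n = k" using eqI(2)[OF n f(1,2) N_V[OF f(3)] f(4)] by blast
  then show "iter g a n \<in> N" using f by simp
  show iff: "k = iter g a n \<longleftrightarrow> (\<exists>f\<in>V. itfun g a n f \<and> pair n k \<epsilon> f)" if "k \<in> V" for k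
    using f k eqI(2)[OF n _ _ that] by blast
  from ex[OF N_suc[OF n]] obtain f' k' where f': "f' \<in> V" "itfun g a (suc n) f'" "k' \<in> N" "pair (suc n) k' \<epsilon> f'" by blast
  then have k': "iter g a (suc n) = k'" using eqI(2)[OF N_suc[OF n] f'(1,2) N_V[OF f'(3)] f'(4)] by blast
  have nV: "n \<in> V" using N_V[OF n] .
  have "pair n k \<epsilon> f'"
    using itfun_agree[OF g(2) rf a f(2) f'(2) n N_suc[OF n] f(1) f'(1), of n k] f nV N_V by auto
  then have "pair (suc n) (g k) \<epsilon> f'" using itfun_step[OF f'(2), of n k] f nV N_V by auto
  then have "k' = g k"
    using itfun_single[OF f'(2), of "suc n" k' "g k"] f' f nV N_V g(2) by auto
  then show "iter g a (suc n) = g (iter g a n)" using k k' by simp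
  assume g': "\<forall>v\<in>N. g v = g' v"
  have "itfun g' a n f"
    unfolding itfun_def
  proof (intro conjI ballI impI)
    show "fun_on f (elts (suc n))" "pair emp a \<epsilon> f" using f(2) by (simp_all add: itfun_def)
    fix i v assume i: "i \<in> elts n" "v \<in> V" "pair i v \<epsilon> f"
    then have "v \<in> N" using itfun_agree[OF g(2) rf a f(2) f(2) n n f(1) f(1), of i v] nV by auto
    moreover have "pair (suc i) (g v) \<epsilon> f" using itfun_step[OF f(2)] i by simp
    ultimately show "pair (suc i) (g' v) \<epsilon> f" using g' by simp
  qed
  then show "iter g' a n = iter g a n"
    using iter_eqI(3)[of g g', OF g(2) g' a n f(1) _ N_V[OF f(3)] f(4) g(1)] k by simp
qed

subsection \<open>Arithmetic\<close>

text \<open>Total versions of the operations. Outside \<^term>\<open>N\<close> they take an absorbing value that is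
  not a number, so that the associative, commutative and distributive laws hold
  unconditionally.\<close>

definition junk :: 'c where
  "junk = adj emp (suc emp)"

definition padd :: "'c \<Rightarrow> 'c \<Rightarrow> 'c" (infixl \<open>\<uplus>\<close> 65) where
  "m \<uplus> n = (if m \<in> N \<and> n \<in> N then iter suc m n else junk)"

definition pmul :: "'c \<Rightarrow> 'c \<Rightarrow> 'c" (infixl \<open>\<star>\<close> 70) where
  "m \<star> n = (if m \<in> N \<and> n \<in> N then iter (\<lambda>k. k \<uplus> m) emp n else junk)"

abbreviation one\<^sub>N :: 'c where
  "one\<^sub>N \<equiv> suc emp"

lemma junk_V [simp]: "junk \<in> V"
  by (simp add: junk_def)

text \<open>\<open>junk\<close> has \<open>suc emp\<close> as its only element, so it is not
  transitive: \<open>emp\<close> is missing.\<close>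

lemma junk_N [simp]: "junk \<notin> N"
proof
  assume "junk \<in> N"
  moreover have "one\<^sub>N \<epsilon> junk" "emp \<epsilon> one\<^sub>N" "emp \<noteq> one\<^sub>N" by (simp_all add: junk_def not_sym)
  ultimately show False using N_trans[of junk one\<^sub>N emp] by (simp add: junk_def)
qed

lemma fn_suc0: "fn V V (\<lambda>e. suc (e 0))"
  by (intro N_intros)

lemma padd_emp [simp]: "m \<in> N \<Longrightarrow> m \<uplus> emp = m"
  using iter_rec(1)[OF fn_suc0] by (simp add: padd_def)

lemma padd_suc: "m \<in> N \<Longrightarrow> n \<in> N \<Longrightarrow> m \<uplus> suc n = suc (m \<uplus> n)"
  using iter_rec(3)[OF fn_suc0] by (simp add: padd_def)

lemma padd_closed: "m \<in> N \<Longrightarrow> n \<in> N \<Longrightarrow> m \<uplus> n \<in> N"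
  using iter_rec(2)[OF fn_suc0] by (simp add: padd_def)

lemma padd_N [simp]: "m \<uplus> n \<in> N \<longleftrightarrow> m \<in> N \<and> n \<in> N"
  using padd_closed by (cases "m \<in> N \<and> n \<in> N") (auto simp: padd_def)

lemma padd_V: "m \<uplus> n \<in> V"
proof (cases "m \<in> N \<and> n \<in> N")
  case True
  then show ?thesis using N_V[OF padd_closed] by blast
next
  case False
  then have "m \<uplus> n = junk" by (auto simp: padd_def)
  then show ?thesis by simp
qed

lemma fn_padd:
  assumes "set_or_univ D" "fn D V a" "fn D V b"
  shows "fn D V (\<lambda>e. a e \<uplus> b e)"
proof (rule fn_lift2[where f = "(\<uplus>)", OF dom_ok_set_or_univ[OF assms(1)] _ assms(2,3)])
  have "dfn V V (\<lambda>e. (e (Suc 0) \<in> N \<and> e (Suc (Suc 0)) \<in> N \<and>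
      (\<exists>f\<in>V. itfun suc (e (Suc 0)) (e (Suc (Suc 0))) f \<and> pair (e (Suc (Suc 0))) (e 0) \<epsilon> f)) \<or>
      (\<not> (e (Suc 0) \<in> N \<and> e (Suc (Suc 0)) \<in> N) \<and> e 0 = junk))"
    unfolding itfun_def fun_on_elts_iff by (intro N_intros junk_V)
  then have "dfn V V (\<lambda>e. e 0 = e (Suc 0) \<uplus> e (Suc (Suc 0)))"
  proof (rule dfn_cong)
    fix e :: "nat \<Rightarrow> 'c" assume "range e \<subseteq> V"
    then have "e 0 \<in> V" by blast
    then have it: "e 0 = iter suc (e (Suc 0)) (e (Suc (Suc 0))) \<longleftrightarrow>
      (\<exists>f\<in>V. itfun suc (e (Suc 0)) (e (Suc (Suc 0))) f \<and> pair (e (Suc (Suc 0))) (e 0) \<epsilon> f)"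
      if "e (Suc 0) \<in> N" "e (Suc (Suc 0)) \<in> N"
      using iter_rec(4)[OF fn_suc0 _ that] by simp
    then show "(e 0 = e (Suc 0) \<uplus> e (Suc (Suc 0))) = ((e (Suc 0) \<in> N \<and> e (Suc (Suc 0)) \<in> N \<and>
      (\<exists>f\<in>V. itfun suc (e (Suc 0)) (e (Suc (Suc 0))) f \<and> pair (e (Suc (Suc 0))) (e 0) \<epsilon> f)) \<or>
      (\<not> (e (Suc 0) \<in> N \<and> e (Suc (Suc 0)) \<in> N) \<and> e 0 = junk))"
    proof (cases "e (Suc 0) \<in> N \<and> e (Suc (Suc 0)) \<in> N")
      case True
      then show ?thesis using it by (simp add: padd_def)
    next
      case False
      then have "e (Suc 0) \<uplus> e (Suc (Suc 0)) = junk" by (auto simp: padd_def)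
      then show ?thesis using False by auto
    qed
  qed
  then have "fn V V (\<lambda>e. e 0 \<uplus> e (Suc 0))" by (simp add: fn_def padd_V)
  then show "fn D V (\<lambda>e. e 0 \<uplus> e (Suc 0))" by (rule fn_V_lift[OF assms(1)])
qed

lemmas add_intros = N_intros fn_padd junk_V

lemma padd_assoc_N: assumes "a \<in> N" "b \<in> N" "c \<in> N" shows "a \<uplus> b \<uplus> c = a \<uplus> (b \<uplus> c)"
  using assms(3)
proof (rule N_induct[where P = "\<lambda>c. a \<uplus> b \<uplus> c = a \<uplus> (b \<uplus> c)"])
  show "dfn V V (\<lambda>e. a \<uplus> b \<uplus> e 0 = a \<uplus> (b \<uplus> e 0))"
    by (intro add_intros) (use assms N_V in auto)
qed (use assms in \<open>simp_all add: padd_suc\<close>)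

lemma emp_padd_N: assumes "a \<in> N" shows "emp \<uplus> a = a"
  using assms
proof (rule N_induct[where P = "\<lambda>a. emp \<uplus> a = a"])
  show "dfn V V (\<lambda>e. emp \<uplus> e 0 = e 0)" by (intro add_intros)
qed (simp_all add: padd_suc)

lemma suc_padd_N: assumes "a \<in> N" "b \<in> N" shows "suc a \<uplus> b = suc (a \<uplus> b)"
  using assms(2)
proof (rule N_induct[where P = "\<lambda>b. suc a \<uplus> b = suc (a \<uplus> b)"])
  show "dfn V V (\<lambda>e. suc a \<uplus> e 0 = suc (a \<uplus> e 0))"
    by (intro add_intros suc_V) (use assms N_V in auto)
qed (use assms in \<open>simp_all add: padd_suc\<close>)

lemma padd_commute_N: assumes "a \<in> N" "b \<in> N" shows "a \<uplus> b = b \<uplus> a"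
  using assms(2)
proof (rule N_induct[where P = "\<lambda>b. a \<uplus> b = b \<uplus> a"])
  show "dfn V V (\<lambda>e. a \<uplus> e 0 = e 0 \<uplus> a)" by (intro add_intros) (use assms N_V in auto)
qed (use assms in \<open>simp_all add: padd_suc emp_padd_N suc_padd_N\<close>)

lemma padd_junk: "a \<notin> N \<or> b \<notin> N \<Longrightarrow> a \<uplus> b = junk"
  by (auto simp: padd_def)

lemma padd_assoc: "a \<uplus> b \<uplus> c = a \<uplus> (b \<uplus> c)"
proof (cases "a \<in> N \<and> b \<in> N \<and> c \<in> N")
  case False
  then have "a \<uplus> b \<uplus> c = junk" "a \<uplus> (b \<uplus> c) = junk" by (intro padd_junk; auto)+
  then show ?thesis by simp
qed (simp add: padd_assoc_N)

lemma padd_commute: "a \<uplus> b = b \<uplus> a"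
  by (cases "a \<in> N \<and> b \<in> N") (auto simp: padd_commute_N padd_junk)

lemma padd_left_commute: "a \<uplus> (b \<uplus> c) = b \<uplus> (a \<uplus> c)"
  using padd_assoc padd_commute by metis

lemmas padd_ac = padd_assoc padd_commute padd_left_commute

lemma emp_padd [simp]: "a \<in> N \<Longrightarrow> emp \<uplus> a = a"
  by (rule emp_padd_N)

lemma fn_padd_right: "m \<in> V \<Longrightarrow> fn V V (\<lambda>e. e 0 \<uplus> m)"
  by (intro add_intros)

lemma pmul_emp [simp]: "m \<in> N \<Longrightarrow> m \<star> emp = emp"
  using iter_rec(1)[OF fn_padd_right[of m], of emp] N_V by (simp add: pmul_def)

lemma pmul_suc: "m \<in> N \<Longrightarrow> n \<in> N \<Longrightarrow> m \<star> suc n = m \<star> n \<uplus> m"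
  using iter_rec(3)[OF fn_padd_right[of m], of emp] N_V by (simp add: pmul_def)

lemma pmul_closed: "m \<in> N \<Longrightarrow> n \<in> N \<Longrightarrow> m \<star> n \<in> N"
  using iter_rec(2)[OF fn_padd_right[of m], of emp] N_V by (simp add: pmul_def)

lemma pmul_N [simp]: "m \<star> n \<in> N \<longleftrightarrow> m \<in> N \<and> n \<in> N"
  using pmul_closed by (cases "m \<in> N \<and> n \<in> N") (auto simp: pmul_def)

lemma pmul_junk: "a \<notin> N \<or> b \<notin> N \<Longrightarrow> a \<star> b = junk"
  by (auto simp: pmul_def)

lemma pmul_V: "m \<star> n \<in> V"
  using N_V[OF pmul_closed] pmul_junk junk_V by (cases "m \<in> N \<and> n \<in> N") auto

lemma fn_pmul:
  assumes "set_or_univ D" "fn D V a" "fn D V b"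
  shows "fn D V (\<lambda>e. a e \<star> b e)"
proof (rule fn_lift2[where f = "(\<star>)", OF dom_ok_set_or_univ[OF assms(1)] _ assms(2,3)])
  have "dfn V V (\<lambda>e. (e (Suc 0) \<in> N \<and> e (Suc (Suc 0)) \<in> N \<and>
      (\<exists>f\<in>V. itfun (\<lambda>k. k \<uplus> e (Suc 0)) emp (e (Suc (Suc 0))) f \<and> pair (e (Suc (Suc 0))) (e 0) \<epsilon> f)) \<or>
      (\<not> (e (Suc 0) \<in> N \<and> e (Suc (Suc 0)) \<in> N) \<and> e 0 = junk))"
    unfolding itfun_def fun_on_elts_iff by (intro add_intros)
  then have "dfn V V (\<lambda>e. e 0 = e (Suc 0) \<star> e (Suc (Suc 0)))"
  proof (rule dfn_cong)
    fix e :: "nat \<Rightarrow> 'c" assume "range e \<subseteq> V"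
    then have e: "e 0 \<in> V" "e (Suc 0) \<in> V" by blast+
    then have it: "e 0 = iter (\<lambda>k. k \<uplus> e (Suc 0)) emp (e (Suc (Suc 0))) \<longleftrightarrow>
      (\<exists>f\<in>V. itfun (\<lambda>k. k \<uplus> e (Suc 0)) emp (e (Suc (Suc 0))) f \<and> pair (e (Suc (Suc 0))) (e 0) \<epsilon> f)"
      if "e (Suc 0) \<in> N" "e (Suc (Suc 0)) \<in> N"
      using iter_rec(4)[OF fn_padd_right[OF e(2)] _ N_emp that(2)] that(1) by simp
    then show "(e 0 = e (Suc 0) \<star> e (Suc (Suc 0))) = ((e (Suc 0) \<in> N \<and> e (Suc (Suc 0)) \<in> N \<and>
      (\<exists>f\<in>V. itfun (\<lambda>k. k \<uplus> e (Suc 0)) emp (e (Suc (Suc 0))) f \<and> pair (e (Suc (Suc 0))) (e 0) \<epsilon> f)) \<or>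
      (\<not> (e (Suc 0) \<in> N \<and> e (Suc (Suc 0)) \<in> N) \<and> e 0 = junk))"
    proof (cases "e (Suc 0) \<in> N \<and> e (Suc (Suc 0)) \<in> N")
      case True
      then show ?thesis using it by (simp add: pmul_def)
    next
      case False
      then have "e (Suc 0) \<star> e (Suc (Suc 0)) = junk" by (auto simp: pmul_def)
      then show ?thesis using False by auto
    qed
  qed
  then have "fn V V (\<lambda>e. e 0 \<star> e (Suc 0))" by (simp add: fn_def pmul_V)
  then show "fn D V (\<lambda>e. e 0 \<star> e (Suc 0))" by (rule fn_V_lift[OF assms(1)])
qed

lemmas arith_intros = add_intros fn_pmul

lemma nadd_eq: "m \<in> N \<Longrightarrow> n \<in> N \<Longrightarrow> m +\<^sub>N n = m \<uplus> n"
  by (simp add: nadd_def padd_def)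

lemma nmul_eq: assumes "m \<in> N" "n \<in> N" shows "m *\<^sub>N n = m \<star> n"
proof -
  have "\<forall>v\<in>N. v \<uplus> m \<in> N" "\<forall>v\<in>N. v \<uplus> m = v +\<^sub>N m" using assms(1) by (simp_all add: nadd_eq)
  from iter_rec(5)[OF fn_padd_right[OF N_V[OF assms(1)]] this(1) N_emp assms(2) this(2)]
  show ?thesis using assms by (simp only: nmul_def pmul_def if_True conj_absorb simp_thms)
qed

lemma padd_distrib_N: assumes "a \<in> N" "b \<in> N" "c \<in> N" shows "a \<star> (b \<uplus> c) = a \<star> b \<uplus> a \<star> c"
  using assms(3)
proof (rule N_induct[where P = "\<lambda>c. a \<star> (b \<uplus> c) = a \<star> b \<uplus> a \<star> c"])
  show "dfn V V (\<lambda>e. a \<star> (b \<uplus> e 0) = a \<star> b \<uplus> a \<star> e 0)"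
    by (intro arith_intros pmul_V) (use assms N_V in auto)
qed (use assms in \<open>simp_all add: padd_suc pmul_suc padd_assoc\<close>)

lemma emp_pmul_N: assumes "a \<in> N" shows "emp \<star> a = emp"
  using assms
proof (rule N_induct[where P = "\<lambda>a. emp \<star> a = emp"])
  show "dfn V V (\<lambda>e. emp \<star> e 0 = emp)" by (intro arith_intros)
qed (simp_all add: pmul_suc)

lemma suc_pmul_N: assumes "a \<in> N" "b \<in> N" shows "suc a \<star> b = a \<star> b \<uplus> b"
  using assms(2)
proof (rule N_induct[where P = "\<lambda>b. suc a \<star> b = a \<star> b \<uplus> b"])
  show "dfn V V (\<lambda>e. suc a \<star> e 0 = a \<star> e 0 \<uplus> e 0)"
    by (intro arith_intros suc_V) (use assms N_V in auto)
  fix n assume "n \<in> N" "suc a \<star> n = a \<star> n \<uplus> n"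
  then show "suc a \<star> suc n = a \<star> suc n \<uplus> suc n"
    using assms by (simp add: pmul_suc padd_suc suc_padd_N padd_ac)
qed (use assms in simp)

lemma pmul_commute_N: assumes "a \<in> N" "b \<in> N" shows "a \<star> b = b \<star> a"
  using assms(2)
proof (rule N_induct[where P = "\<lambda>b. a \<star> b = b \<star> a"])
  show "dfn V V (\<lambda>e. a \<star> e 0 = e 0 \<star> a)" by (intro arith_intros) (use assms N_V in auto)
qed (use assms in \<open>simp_all add: pmul_suc emp_pmul_N suc_pmul_N\<close>)

lemma pmul_assoc_N: assumes "a \<in> N" "b \<in> N" "c \<in> N" shows "a \<star> b \<star> c = a \<star> (b \<star> c)"
  using assms(3)
proof (rule N_induct[where P = "\<lambda>c. a \<star> b \<star> c = a \<star> (b \<star> c)"])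
  show "dfn V V (\<lambda>e. a \<star> b \<star> e 0 = a \<star> (b \<star> e 0))"
    by (intro arith_intros pmul_V) (use assms N_V in auto)
qed (use assms in \<open>simp_all add: pmul_suc padd_distrib_N\<close>)

lemma pmul_assoc: "a \<star> b \<star> c = a \<star> (b \<star> c)"
proof (cases "a \<in> N \<and> b \<in> N \<and> c \<in> N")
  case False
  then have "a \<star> b \<star> c = junk" "a \<star> (b \<star> c) = junk" by (intro pmul_junk; auto)+
  then show ?thesis by simp
qed (simp add: pmul_assoc_N)

lemma pmul_commute: "a \<star> b = b \<star> a"
  by (cases "a \<in> N \<and> b \<in> N") (auto simp: pmul_commute_N pmul_junk)

lemma pmul_left_commute: "a \<star> (b \<star> c) = b \<star> (a \<star> c)"
  using pmul_assoc pmul_commute by metis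

lemma padd_distrib_left: "a \<star> (b \<uplus> c) = a \<star> b \<uplus> a \<star> c"
proof (cases "a \<in> N \<and> b \<in> N \<and> c \<in> N")
  case False
  then have "a \<star> (b \<uplus> c) = junk" by (intro pmul_junk) auto
  moreover have "a \<star> b \<uplus> a \<star> c = junk" using False by (intro padd_junk) auto
  ultimately show ?thesis by simp
qed (simp add: padd_distrib_N)

lemma padd_distrib_right: "(b \<uplus> c) \<star> a = b \<star> a \<uplus> c \<star> a"
  using padd_distrib_left pmul_commute by metis

lemmas pmul_ac = pmul_assoc pmul_commute pmul_left_commute
lemmas N_algebra = padd_ac pmul_ac padd_distrib_left padd_distrib_right

lemma emp_pmul [simp]: "a \<in> N \<Longrightarrow> emp \<star> a = emp"
  by (rule emp_pmul_N)

lemma pmul_one [simp]: "a \<in> N \<Longrightarrow> a \<star> one\<^sub>N = a"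
  by (simp add: pmul_suc)

lemma one_pmul [simp]: "a \<in> N \<Longrightarrow> one\<^sub>N \<star> a = a"
  by (simp add: suc_pmul_N)

lemma padd_one: "a \<in> N \<Longrightarrow> a \<uplus> one\<^sub>N = suc a"
  by (simp add: padd_suc)

lemma one_neq_emp [simp]: "one\<^sub>N \<noteq> emp"
  by simp

section \<open>Cancellation, order and division with remainder\<close>

lemma padd_right_cancel [simp]:
  assumes "a \<in> N" "b \<in> N" "c \<in> N" shows "a \<uplus> c = b \<uplus> c \<longleftrightarrow> a = b"
  using assms(3)
proof (rule N_induct[where P = "\<lambda>c. a \<uplus> c = b \<uplus> c \<longleftrightarrow> a = b"])
  show "dfn V V (\<lambda>e. a \<uplus> e 0 = b \<uplus> e 0 \<longleftrightarrow> a = b)"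
    by (intro arith_intros) (use assms N_V in auto)
qed (use assms in \<open>simp_all add: padd_suc\<close>)

lemma padd_left_cancel [simp]:
  assumes "a \<in> N" "b \<in> N" "c \<in> N" shows "c \<uplus> a = c \<uplus> b \<longleftrightarrow> a = b"
  using padd_right_cancel[OF assms] by (simp add: padd_commute)

lemma padd_eq_emp: assumes "a \<in> N" "b \<in> N" shows "a \<uplus> b = emp \<longleftrightarrow> a = emp \<and> b = emp"
  using assms(2) by (cases rule: N_cases) (use assms(1) in \<open>auto simp: padd_suc\<close>)

lemma mem_padd_suc: assumes "m \<in> N" "k \<in> N" shows "m \<epsilon> m \<uplus> suc k"
  using assms(2)
proof (rule N_induct[where P = "\<lambda>k. m \<epsilon> m \<uplus> suc k"])
  show "dfn V V (\<lambda>e. m \<epsilon> m \<uplus> suc (e 0))"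
    by (intro arith_intros) (use assms N_V in auto)
qed (use assms N_V in \<open>simp_all add: padd_suc\<close>)

lemma mem_iff: assumes "m \<in> N" "n \<in> N" shows "m \<epsilon> n \<longleftrightarrow> (\<exists>k\<in>N. n = m \<uplus> suc k)"
proof
  assume "m \<epsilon> n"
  moreover have "m \<epsilon> n \<longrightarrow> (\<exists>k\<in>N. n = m \<uplus> suc k)"
    using assms(2)
  proof (rule N_induct[where P = "\<lambda>n. m \<epsilon> n \<longrightarrow> (\<exists>k\<in>N. n = m \<uplus> suc k)"])
    show "dfn V V (\<lambda>e. m \<epsilon> e 0 \<longrightarrow> (\<exists>k\<in>N. e 0 = m \<uplus> suc k))"
      by (intro arith_intros) (use assms N_V in auto)
    show "m \<epsilon> emp \<longrightarrow> (\<exists>k\<in>N. emp = m \<uplus> suc k)" by simp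
    fix n assume n: "n \<in> N" "m \<epsilon> n \<longrightarrow> (\<exists>k\<in>N. n = m \<uplus> suc k)"
    show "m \<epsilon> suc n \<longrightarrow> (\<exists>k\<in>N. suc n = m \<uplus> suc k)"
    proof
      assume "m \<epsilon> suc n"
      then consider "m = n" | k where "k \<in> N" "n = m \<uplus> suc k" using n N_V by auto
      then show "\<exists>k\<in>N. suc n = m \<uplus> suc k"
      proof cases
        case 1 then show ?thesis using n(1) by (intro bexI[of _ emp]) (simp_all add: padd_suc)
      next
        case 2 then show ?thesis using assms(1) by (intro bexI[of _ "suc k"]) (simp_all add: padd_suc)
      qed
    qed
  qed
  ultimately show "\<exists>k\<in>N. n = m \<uplus> suc k" by blast
qed (use mem_padd_suc[OF assms(1)] in blast)

lemma nle_iff: assumes "m \<in> N" "n \<in> N" shows "m \<le>\<^sub>N n \<longleftrightarrow> (\<exists>k\<in>N. n = m \<uplus> k)"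
proof
  assume "m \<le>\<^sub>N n"
  then consider "m \<epsilon> n" | "m = n" by (auto simp: nle_def)
  then show "\<exists>k\<in>N. n = m \<uplus> k"
  proof cases
    case 1 then show ?thesis using mem_iff[OF assms] N_suc by blast
  next
    case 2 then show ?thesis using assms by (intro bexI[of _ emp]) simp_all
  qed
next
  assume "\<exists>k\<in>N. n = m \<uplus> k"
  then obtain k where k: "k \<in> N" "n = m \<uplus> k" by blast
  then show "m \<le>\<^sub>N n"
    by (cases rule: N_cases[OF k(1)]) (use assms mem_padd_suc in \<open>auto simp: nle_def\<close>)
qed

lemma dfn_nle:
  assumes "dom_ok D V" "fn D V a" "fn D V b" shows "dfn D V (\<lambda>e. a e \<le>\<^sub>N b e)"
  unfolding nle_def by (intro set_intros assms)

lemmas order_intros = arith_intros dfn_nle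

lemma nle_refl [simp]: "a \<le>\<^sub>N a"
  by (simp add: nle_def)

lemma nle_linear: "a \<in> N \<Longrightarrow> b \<in> N \<Longrightarrow> a \<le>\<^sub>N b \<or> b \<le>\<^sub>N a"
  using N_linear by (auto simp: nle_def)

lemma nle_trans: "c \<in> N \<Longrightarrow> a \<le>\<^sub>N b \<Longrightarrow> b \<le>\<^sub>N c \<Longrightarrow> a \<le>\<^sub>N c"
  using N_trans by (auto simp: nle_def)

lemma nle_antisym: "b \<in> N \<Longrightarrow> a \<le>\<^sub>N b \<Longrightarrow> b \<le>\<^sub>N a \<Longrightarrow> a = b"
  using N_trans[of b a b] N_not_self by (auto simp: nle_def)

lemma not_nle: "a \<in> N \<Longrightarrow> b \<in> N \<Longrightarrow> \<not> a \<le>\<^sub>N b \<longleftrightarrow> b \<epsilon> a"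
  using N_linear[of a b] N_trans[of b a b] N_not_self by (auto simp: nle_def)

lemma emp_nle [simp]: "a \<in> N \<Longrightarrow> emp \<le>\<^sub>N a"
  using emp_mem by (auto simp: nle_def)

lemma mem_iff_suc_nle: "a \<in> N \<Longrightarrow> b \<in> N \<Longrightarrow> a \<epsilon> b \<longleftrightarrow> suc a \<le>\<^sub>N b"
  using suc_le[of b a] N_trans[of b "suc a" a] N_V by (auto simp: nle_def)

lemma nle_padd: "a \<in> N \<Longrightarrow> b \<in> N \<Longrightarrow> a \<le>\<^sub>N a \<uplus> b"
  by (subst nle_iff) auto

lemma nle_padd_cancel [simp]:
  assumes "a \<in> N" "b \<in> N" "c \<in> N" shows "a \<uplus> c \<le>\<^sub>N b \<uplus> c \<longleftrightarrow> a \<le>\<^sub>N b"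
proof -
  have "b \<uplus> c = a \<uplus> c \<uplus> k \<longleftrightarrow> b = a \<uplus> k" if "k \<in> N" for k
  proof -
    have "a \<uplus> c \<uplus> k = a \<uplus> k \<uplus> c" by (simp add: padd_ac)
    then show ?thesis using assms that by simp
  qed
  then show ?thesis using assms by (auto simp: nle_iff)
qed

lemma nle_padd_mono:
  assumes "a \<in> N" "b \<in> N" "c \<in> N" "d \<in> N" "a \<le>\<^sub>N b" "c \<le>\<^sub>N d" shows "a \<uplus> c \<le>\<^sub>N b \<uplus> d"
proof (rule nle_trans)
  show "a \<uplus> c \<le>\<^sub>N b \<uplus> c" using assms by simp
  show "b \<uplus> c \<le>\<^sub>N b \<uplus> d" using assms nle_padd_cancel[of c d b] by (simp add: padd_commute)
qed (use assms in simp)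

lemma pmul_eq_emp: assumes "a \<in> N" "b \<in> N" shows "a \<star> b = emp \<longleftrightarrow> a = emp \<or> b = emp"
  using assms(2) by (cases rule: N_cases) (use assms(1) in \<open>auto simp: pmul_suc padd_eq_emp\<close>)

lemma nle_pmul_mono: assumes "a \<in> N" "b \<in> N" "c \<in> N" "a \<le>\<^sub>N b" shows "a \<star> c \<le>\<^sub>N b \<star> c"
proof -
  obtain k where "k \<in> N" "b = a \<uplus> k" using assms nle_iff by blast
  then show ?thesis using assms by (simp add: padd_distrib_right nle_padd)
qed

lemma mem_pmul_mono: assumes "a \<in> N" "b \<in> N" "c \<in> N" "c \<noteq> emp" "a \<epsilon> b" shows "a \<star> c \<epsilon> b \<star> c"
proof -
  obtain k where k: "k \<in> N" "b = a \<uplus> suc k" using assms mem_iff by blast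
  have "suc k \<star> c \<noteq> emp" using k assms by (simp add: pmul_eq_emp)
  moreover have "suc k \<star> c \<in> N" using k assms by simp
  ultimately obtain j where j: "j \<in> N" "suc k \<star> c = suc j" using N_cases by metis
  then have "b \<star> c = a \<star> c \<uplus> suc j" using k by (simp add: padd_distrib_right)
  then show ?thesis using mem_padd_suc[of "a \<star> c" j] j assms by simp
qed

lemma nle_pmul_cancel [simp]:
  assumes "a \<in> N" "b \<in> N" "c \<in> N" "c \<noteq> emp" shows "a \<star> c \<le>\<^sub>N b \<star> c \<longleftrightarrow> a \<le>\<^sub>N b"
proof
  assume *: "a \<star> c \<le>\<^sub>N b \<star> c"
  show "a \<le>\<^sub>N b"
  proof (rule ccontr)
    assume "\<not> a \<le>\<^sub>N b"
    then have "b \<star> c \<epsilon> a \<star> c" using mem_pmul_mono assms not_nle by simp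
    then show False using * not_nle[of "a \<star> c" "b \<star> c"] assms by simp
  qed
qed (use nle_pmul_mono assms in simp)

lemma pmul_right_cancel [simp]:
  assumes "a \<in> N" "b \<in> N" "c \<in> N" "c \<noteq> emp" shows "a \<star> c = b \<star> c \<longleftrightarrow> a = b"
proof
  assume "a \<star> c = b \<star> c"
  then have "a \<star> c \<le>\<^sub>N b \<star> c" "b \<star> c \<le>\<^sub>N a \<star> c" by simp_all
  then show "a = b" using assms nle_antisym by simp
qed simp

lemma division: assumes "n \<in> N" "d \<in> N" "d \<noteq> emp"
  shows "\<exists>q\<in>N. \<exists>r\<in>N. n = q \<star> d \<uplus> r \<and> r \<epsilon> d"
  using assms(1)
proof (rule N_induct[where P = "\<lambda>n. \<exists>q\<in>N. \<exists>r\<in>N. n = q \<star> d \<uplus> r \<and> r \<epsilon> d"])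
  show "dfn V V (\<lambda>e. \<exists>q\<in>N. \<exists>r\<in>N. e 0 = q \<star> d \<uplus> r \<and> r \<epsilon> d)"
    by (intro arith_intros) (use assms N_V in auto)
  show "\<exists>q\<in>N. \<exists>r\<in>N. emp = q \<star> d \<uplus> r \<and> r \<epsilon> d"
    using assms emp_mem[OF assms(2)] by (intro bexI[of _ emp]) simp_all
  fix n assume "n \<in> N" "\<exists>q\<in>N. \<exists>r\<in>N. n = q \<star> d \<uplus> r \<and> r \<epsilon> d"
  then obtain q r where qr: "q \<in> N" "r \<in> N" "n = q \<star> d \<uplus> r" "r \<epsilon> d" by blast
  have "suc r \<epsilon> d \<or> suc r = d" using suc_le assms(2) qr(4) by blast
  then show "\<exists>q\<in>N. \<exists>r\<in>N. suc n = q \<star> d \<uplus> r \<and> r \<epsilon> d"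
  proof
    assume "suc r \<epsilon> d"
    then show ?thesis using qr assms by (intro bexI[of _ q] bexI[of _ "suc r"]) (simp_all add: padd_suc)
  next
    assume d: "suc r = d"
    have "suc n = q \<star> d \<uplus> suc r" using qr assms by (simp add: padd_suc)
    also have "\<dots> = suc q \<star> d \<uplus> emp" using d qr assms by (simp add: suc_pmul_N)
    finally show ?thesis using qr assms emp_mem[OF assms(2)]
      by (intro bexI[of _ "suc q"] bexI[of _ emp]) simp_all
  qed
qed

subsection \<open>Rational numbers\<close>

lemma ndvd_iff: "d \<in> N \<Longrightarrow> ndvd d n \<longleftrightarrow> (\<exists>k\<in>N. d \<star> k = n)"
  by (simp add: ndvd_def nmul_eq)

lemma ncoprime_iff: "ncoprime m n \<longleftrightarrow>
    (\<forall>d\<in>N. (\<exists>k\<in>N. d \<star> k = m) \<and> (\<exists>k\<in>N. d \<star> k = n) \<longrightarrow> d = one\<^sub>N)"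
  unfolding ncoprime_def by (simp add: ndvd_iff cong: ball_cong)

lemma nle_one: "d \<in> N \<Longrightarrow> d \<noteq> emp \<Longrightarrow> d \<le>\<^sub>N one\<^sub>N \<Longrightarrow> d = one\<^sub>N"
  by (auto simp: nle_def)

lemma nle_pmul: assumes "t \<in> N" "d \<in> N" "t \<noteq> emp" shows "d \<le>\<^sub>N t \<star> d"
proof -
  obtain s where "s \<in> N" "t = suc s" using assms N_cases by metis
  then show ?thesis using assms nle_padd[of d "s \<star> d"] by (simp add: suc_pmul_N padd_commute)
qed

lemma pmul_eq_one: assumes "t \<in> N" "d \<in> N" "t \<star> d = one\<^sub>N" shows "d = one\<^sub>N"
proof -
  have "t \<noteq> emp" "d \<noteq> emp" using assms by (metis emp_pmul pmul_emp one_neq_emp)+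
  then show ?thesis using nle_pmul[of t d] assms nle_one by simp
qed

text \<open>The least positive denominator does the work of a greatest common divisor: division with
  remainder shows that every denominator of the same fraction is a multiple of it, since a remainder
  would be a smaller denominator.\<close>

lemma lowest_terms:
  assumes a: "a \<in> N" and c: "c \<in> N" "c \<noteq> emp"
  obtains a0 c0 where "a0 \<in> N" "c0 \<in> N" "c0 \<noteq> emp" "a \<star> c0 = a0 \<star> c" "ncoprime a0 c0"
    "\<And>a' c'. a' \<in> N \<Longrightarrow> c' \<in> N \<Longrightarrow> c' \<noteq> emp \<Longrightarrow> a \<star> c' = a' \<star> c \<Longrightarrow> \<exists>k\<in>N. a' = k \<star> a0 \<and> c' = k \<star> c0"
proof -
  have "dfn V V (\<lambda>e. e 0 \<noteq> emp \<and> (\<exists>a'\<in>N. a \<star> e 0 = a' \<star> c))"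
    by (intro order_intros) (use a c N_V in auto)
  from N_least[where P = "\<lambda>c'. c' \<noteq> emp \<and> (\<exists>a'\<in>N. a \<star> c' = a' \<star> c)", OF this c(1)]
  obtain c0 where c0: "c0 \<in> N" "c0 \<noteq> emp" "\<exists>a'\<in>N. a \<star> c0 = a' \<star> c"
    and least: "\<And>k a'. k \<epsilon> c0 \<Longrightarrow> a' \<in> N \<Longrightarrow> a \<star> k = a' \<star> c \<Longrightarrow> k = emp"
    using a c by blast
  obtain a0 where a0: "a0 \<in> N" "a \<star> c0 = a0 \<star> c" using c0(3) by blast
  have mult: "\<exists>k\<in>N. a' = k \<star> a0 \<and> c' = k \<star> c0"
    if a': "a' \<in> N" and c': "c' \<in> N" and eq: "a \<star> c' = a' \<star> c" for a' c'
  proof -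
    obtain q r where qr: "q \<in> N" "r \<in> N" "c' = q \<star> c0 \<uplus> r" "r \<epsilon> c0"
      using division[OF c' c0(1,2)] by blast
    have "a' \<star> c = q \<star> (a \<star> c0) \<uplus> a \<star> r" unfolding eq[symmetric] qr(3) by (simp add: N_algebra)
    then have *: "a' \<star> c = (q \<star> a0) \<star> c \<uplus> a \<star> r" by (simp add: a0(2) pmul_assoc)
    then have "(q \<star> a0) \<star> c \<le>\<^sub>N a' \<star> c" using nle_padd[of "(q \<star> a0) \<star> c" "a \<star> r"] a a0 c qr by simp
    then have "q \<star> a0 \<le>\<^sub>N a'" using a' a0 c qr by simp
    then obtain s where s: "s \<in> N" "a' = q \<star> a0 \<uplus> s" using nle_iff[of "q \<star> a0" a'] a' a0 qr by auto
    have "(q \<star> a0) \<star> c \<uplus> s \<star> c = (q \<star> a0) \<star> c \<uplus> a \<star> r" using * s(2) by (simp add: padd_distrib_right)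
    \<comment> \<open>The remainder \<open>r\<close> is itself a denominator of the fraction, with
      numerator \<open>s\<close>, unless it is zero; minimality of \<open>c0\<close> leaves only
      zero.\<close>
    then have sc: "a \<star> r = s \<star> c" using a a0 c qr s by simp
    then have r: "r = emp" using least[OF qr(4) s(1)] by blast
    then have "s \<star> c = emp" using sc a by simp
    then have "s = emp" using pmul_eq_emp[of s c] s c by simp
    then show ?thesis using r s qr a0 c0 by (intro bexI[of _ q]) simp_all
  qed
  have "ncoprime a0 c0"
    unfolding ncoprime_iff
  proof (intro ballI impI, elim conjE bexE)
    fix d k j assume d: "d \<in> N" "k \<in> N" "j \<in> N" "d \<star> k = a0" "d \<star> j = c0"
    have dj: "d \<noteq> emp" "j \<noteq> emp" using d c0 by auto
    have "(a \<star> j) \<star> d = (k \<star> c) \<star> d" using a0(2) d(4,5) by (metis pmul_ac)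
    then have "a \<star> j = k \<star> c" using a c d dj by simp
    \<comment> \<open>Cancelling a common divisor \<open>d\<close> leaves the denominator
      \<open>j\<close>, which is a multiple of \<open>c0\<close>; as \<open>c0\<close> is in turn
      \<open>d \<star> j\<close>, the divisor is one.\<close>
    then obtain t where t: "t \<in> N" "j = t \<star> c0" using mult[OF d(2,3)] by blast
    have "(t \<star> d) \<star> j = j" using t(2) d(5) by (simp add: pmul_assoc)
    then have "(t \<star> d) \<star> j = one\<^sub>N \<star> j" using d by simp
    then have "t \<star> d = one\<^sub>N" using t d dj pmul_right_cancel[of "t \<star> d" "one\<^sub>N" j] by simp
    then show "d = one\<^sub>N" using pmul_eq_one t d by blast
  qed
  then show ?thesis using that[OF a0(1) c0(1,2) a0(2) _ mult] by blast
qed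

lemma rat_eq [simp]:
  assumes "a \<in> N" "b \<in> N" "c \<in> N" "a' \<in> N" "b' \<in> N" "c' \<in> N"
  shows "rat a b c = rat a' b' c' \<longleftrightarrow> a = a' \<and> b = b' \<and> c = c'"
  using assms N_V by (simp add: rat_def)

lemma qparts_rat:
  assumes "a \<in> N" "b \<in> N" "c \<in> N"
  shows "qpos (rat a b c) = a" "qneg (rat a b c) = b" "qden (rat a b c) = c"
  unfolding qpos_def qneg_def qden_def using assms by (auto intro!: the_equality)

lemma Q_iff: "q \<in> Q \<longleftrightarrow> q = rat (qpos q) (qneg q) (qden q) \<and> qpos q \<in> N \<and> qneg q \<in> N \<and> qden q \<in> N \<and>
    qden q \<noteq> emp \<and> (qpos q = emp \<or> qneg q = emp) \<and> ncoprime (qpos q \<uplus> qneg q) (qden q)"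
proof
  assume "q \<in> Q"
  then obtain a b c where "q = rat a b c" "a \<in> N" "b \<in> N" "c \<in> N" "c \<noteq> emp" "a = emp \<or> b = emp"
    "ncoprime (a +\<^sub>N b) c" unfolding Q_def by blast
  then show "q = rat (qpos q) (qneg q) (qden q) \<and> qpos q \<in> N \<and> qneg q \<in> N \<and> qden q \<in> N \<and>
    qden q \<noteq> emp \<and> (qpos q = emp \<or> qneg q = emp) \<and> ncoprime (qpos q \<uplus> qneg q) (qden q)"
    by (simp add: qparts_rat nadd_eq)
next
  assume *: "q = rat (qpos q) (qneg q) (qden q) \<and> qpos q \<in> N \<and> qneg q \<in> N \<and> qden q \<in> N \<and>
    qden q \<noteq> emp \<and> (qpos q = emp \<or> qneg q = emp) \<and> ncoprime (qpos q \<uplus> qneg q) (qden q)"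
  then have "ncoprime (qpos q +\<^sub>N qneg q) (qden q)" by (simp add: nadd_eq)
  then show "q \<in> Q" unfolding Q_def using * by blast
qed

lemma Q_parts:
  assumes "q \<in> Q"
  shows "qpos q \<in> N" "qneg q \<in> N" "qden q \<in> N" "qden q \<noteq> emp"
  using assms unfolding Q_iff[of q] by blast+

lemma rat_in_Q:
  assumes "a \<in> N" "b \<in> N" "c \<in> N"
  shows "rat a b c \<in> Q \<longleftrightarrow> c \<noteq> emp \<and> (a = emp \<or> b = emp) \<and> ncoprime (a \<uplus> b) c"
  using assms by (simp add: Q_iff[of "rat a b c"] qparts_rat)

text \<open>\<open>val q a b c\<close>: the rational number \<open>q\<close> has the value $(a-b)/c$.\<close>

definition val :: "'c \<Rightarrow> 'c \<Rightarrow> 'c \<Rightarrow> 'c \<Rightarrow> bool" where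
  "val q a b c \<longleftrightarrow> q \<in> Q \<and> a \<in> N \<and> b \<in> N \<and> c \<in> N \<and> c \<noteq> emp \<and>
    a \<star> qden q \<uplus> qneg q \<star> c = b \<star> qden q \<uplus> qpos q \<star> c"

definition qminus :: "'c \<Rightarrow> 'c" where
  "qminus q = rat (qneg q) (qpos q) (qden q)"

lemma qminus_Q: assumes "q \<in> Q" shows "qminus q \<in> Q"
  using assms Q_parts[OF assms] unfolding qminus_def
  by (subst rat_in_Q) (auto simp: Q_iff[of q] padd_commute)

lemma qminus_parts:
  assumes "q \<in> Q"
  shows "qpos (qminus q) = qneg q" "qneg (qminus q) = qpos q" "qden (qminus q) = qden q"
  using Q_parts[OF assms] by (simp_all add: qminus_def qparts_rat)

lemma qminus_qminus: assumes "q \<in> Q" shows "qminus (qminus q) = q"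
  using assms Q_iff[of q] by (simp add: qminus_def[of "qminus q"] qminus_parts)

lemma val_minus: assumes "val q a b c" shows "val (qminus q) b a c"
  using assms qminus_Q unfolding val_def by (simp add: qminus_parts)

text \<open>For \<open>b \<le>\<^sub>N a\<close> the value is a nonnegative fraction, and its lowest
  terms are the code. The last clause retains the cancelled factor \<open>k\<close>, from which the
  bounds on the parts of \<open>q\<close> are read off.\<close>

lemma val_exists_unique_le:
  assumes "a \<in> N" "b \<in> N" "c \<in> N" "c \<noteq> emp" "b \<le>\<^sub>N a"
  shows "\<exists>q. val q a b c \<and> (\<forall>q'. val q' a b c \<longrightarrow> q' = q) \<and>
    (\<exists>k\<in>N. \<exists>m\<in>N. qneg q = emp \<and> c = k \<star> qden q \<and> m = k \<star> qpos q \<and> a = b \<uplus> m)"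
proof -
  obtain m where m: "m \<in> N" "a = b \<uplus> m" using assms nle_iff by blast
  obtain m0 c0 where mc: "m0 \<in> N" "c0 \<in> N" "c0 \<noteq> emp" "m \<star> c0 = m0 \<star> c" "ncoprime m0 c0"
    and least: "\<And>a' c'. a' \<in> N \<Longrightarrow> c' \<in> N \<Longrightarrow> c' \<noteq> emp \<Longrightarrow> m \<star> c' = a' \<star> c \<Longrightarrow> \<exists>k\<in>N. a' = k \<star> m0 \<and> c' = k \<star> c0"
    using lowest_terms[OF m(1) assms(3,4)] by metis
  define q where "q = rat m0 emp c0"
  have q: "q \<in> Q" "qpos q = m0" "qneg q = emp" "qden q = c0"
    using mc by (simp_all add: q_def rat_in_Q qparts_rat)
  have "val q a b c"
    unfolding val_def q using q(1) assms mc m by (simp add: padd_distrib_right)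
  moreover have "q' = q" if q': "val q' a b c" for q'
  proof -
    have Q': "q' \<in> Q" using q' by (simp add: val_def)
    note p = Q_parts[OF Q']
    have cases: "qpos q' = emp \<or> qneg q' = emp" and cop: "ncoprime (qpos q' \<uplus> qneg q') (qden q')"
      and q'_eq: "q' = rat (qpos q') (qneg q') (qden q')"
      using Q' Q_iff[of q'] by blast+
    have "b \<star> qden q' \<uplus> (m \<star> qden q' \<uplus> qneg q' \<star> c) = b \<star> qden q' \<uplus> qpos q' \<star> c"
      using q' m by (simp add: val_def padd_distrib_right padd_assoc)
    then have eq: "m \<star> qden q' \<uplus> qneg q' \<star> c = qpos q' \<star> c" using p m assms by simp
    have neg: "qneg q' = emp"
    proof (rule ccontr)
      assume n: "qneg q' \<noteq> emp"
      then have "m \<star> qden q' \<uplus> qneg q' \<star> c = emp" using cases eq assms by simp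
      then have "qneg q' \<star> c = emp" using padd_eq_emp[of "m \<star> qden q'" "qneg q' \<star> c"] p m assms by simp
      then show False using n pmul_eq_emp[of "qneg q'" c] p assms by simp
    qed
    then have "m \<star> qden q' = qpos q' \<star> c" using eq p m assms by simp
    then obtain k where k: "k \<in> N" "qpos q' = k \<star> m0" "qden q' = k \<star> c0" using least p by blast
    \<comment> \<open>\<open>k\<close> divides both the numerator and the denominator of the reduced
      \<open>q'\<close>.\<close>
    have "k = one\<^sub>N" using cop neg k p mc unfolding ncoprime_iff by auto
    then have "qpos q' = m0" "qden q' = c0" using k mc by simp_all
    then show "q' = q" using q'_eq neg by (simp add: q_def)
  qed
  moreover have "\<exists>k\<in>N. m = k \<star> m0 \<and> c = k \<star> c0" using least[OF m(1) assms(3,4) refl] .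
  ultimately show ?thesis using q m by blast
qed

lemma val_exists_unique:
  assumes "a \<in> N" "b \<in> N" "c \<in> N" "c \<noteq> emp"
  shows "\<exists>q. val q a b c \<and> (\<forall>q'. val q' a b c \<longrightarrow> q' = q)"
proof (cases "b \<le>\<^sub>N a")
  case True
  then show ?thesis using val_exists_unique_le assms by blast
next
  case False
  then have "a \<le>\<^sub>N b" using nle_linear assms by blast
  then obtain q where q: "val q b a c" "\<And>q'. val q' b a c \<Longrightarrow> q' = q"
    using val_exists_unique_le[OF assms(2,1,3,4)] by blast
  have "q' = qminus q" if "val q' a b c" for q'
  proof -
    have "qminus q' = q" using q(2)[OF val_minus[OF that]] .
    then show ?thesis using qminus_qminus[of q'] that by (simp add: val_def)
  qed
  then show ?thesis using val_minus[OF q(1)] by blast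
qed

lemma val_unique: assumes "val q a b c" "val q' a b c" shows "q = q'"
proof -
  have "a \<in> N" "b \<in> N" "c \<in> N" "c \<noteq> emp" using assms by (simp_all add: val_def)
  from val_exists_unique[OF this] show ?thesis using assms by metis
qed

lemma val_reduce: assumes "a \<in> N" "b \<in> N" "c \<in> N" "c \<noteq> emp" shows "val (reduce a b c) a b c"
proof -
  obtain q where q: "val q a b c" "\<And>q'. val q' a b c \<Longrightarrow> q' = q"
    using val_exists_unique[OF assms] by blast
  have "(q' \<in> Q \<and> a *\<^sub>N qden q' +\<^sub>N qneg q' *\<^sub>N c = b *\<^sub>N qden q' +\<^sub>N qpos q' *\<^sub>N c) \<longleftrightarrow> val q' a b c" for q'
  proof (cases "q' \<in> Q")
    case True
    then show ?thesis using assms Q_parts[OF True] by (simp add: val_def nadd_eq nmul_eq)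
  qed (simp add: val_def)
  then have "reduce a b c = (THE q. val q a b c)" by (simp add: reduce_def)
  also have "\<dots> = q" using q by (intro the_equality) blast+
  finally show ?thesis using q(1) by simp
qed

text \<open>Cancelling a common factor cannot enlarge an entry. Consequently a fraction with
  standard entries represents a standard rational.\<close>

lemma val_bounds: assumes "val q a b c" shows "qpos q \<le>\<^sub>N a \<and> qneg q \<le>\<^sub>N b \<and> qden q \<le>\<^sub>N c"
proof -
  have N: "a \<in> N" "b \<in> N" "c \<in> N" "c \<noteq> emp" using assms by (simp_all add: val_def)
  have *: "qpos q \<le>\<^sub>N a \<and> qneg q = emp \<and> qden q \<le>\<^sub>N c"
    if q: "val q a b c" and le: "b \<le>\<^sub>N a" for q a b
  proof -
    have N: "a \<in> N" "b \<in> N" "q \<in> Q" using q by (simp_all add: val_def)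
    obtain q' k m where q': "val q' a b c" "k \<in> N" "m \<in> N" "qneg q' = emp" "c = k \<star> qden q'"
      "m = k \<star> qpos q'" "a = b \<uplus> m"
      using val_exists_unique_le[OF N(1,2) \<open>c \<in> N\<close> \<open>c \<noteq> emp\<close> le] by blast
    have "q' = q" using val_unique q q'(1) by blast
    note q' = q'[unfolded this]
    have "k \<noteq> emp" using q'(5) \<open>c \<noteq> emp\<close> Q_parts[OF N(3)] by auto
    then have "qden q \<le>\<^sub>N c" "qpos q \<le>\<^sub>N m" using nle_pmul q' Q_parts[OF N(3)] by metis+
    moreover have "m \<le>\<^sub>N a" using nle_padd[of m b] q' N by (simp add: padd_commute)
    ultimately show ?thesis using q'(4) nle_trans N by blast
  qed
  show ?thesis
  proof (cases "b \<le>\<^sub>N a")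
    case True then show ?thesis using *[OF assms] N by simp
  next
    case False
    then have "a \<le>\<^sub>N b" using nle_linear N by blast
    moreover have "q \<in> Q" using assms by (simp add: val_def)
    ultimately show ?thesis using *[OF val_minus[OF assms]] N by (simp add: qminus_parts)
  qed
qed

lemma val_self: "q \<in> Q \<Longrightarrow> val q (qpos q) (qneg q) (qden q)"
  using Q_parts[of q] by (simp add: val_def padd_commute)

text \<open>Equality of signed fractions by cross-multiplication, derived by passing through the
  reduced entries of \<open>q\<close> and without subtraction.\<close>

lemma val_iff:
  assumes "val q a b c" "a' \<in> N" "b' \<in> N" "c' \<in> N" "c' \<noteq> emp"
  shows "val q a' b' c' \<longleftrightarrow> a \<star> c' \<uplus> b' \<star> c = b \<star> c' \<uplus> a' \<star> c"
proof -
  have q: "q \<in> Q" "a \<in> N" "b \<in> N" "c \<in> N" "c \<noteq> emp"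
    and eq: "a \<star> qden q \<uplus> qneg q \<star> c = b \<star> qden q \<uplus> qpos q \<star> c"
    using assms(1) by (simp_all add: val_def)
  note p = Q_parts[OF q(1)]
  define A where "A = a \<star> qden q \<star> c'"
  define B where "B = b \<star> qden q \<star> c'"
  define n where "n = qneg q \<star> c \<star> c'"
  define m where "m = qpos q \<star> c \<star> c'"
  define A' where "A' = a' \<star> qden q \<star> c"
  define B' where "B' = b' \<star> qden q \<star> c"
  have in_N: "A \<in> N" "B \<in> N" "n \<in> N" "m \<in> N" "A' \<in> N" "B' \<in> N"
    using q p assms(2-4) by (simp_all add: A_def B_def n_def m_def A'_def B'_def)
  have 1: "A \<uplus> n = B \<uplus> m"
    using arg_cong[OF eq, of "\<lambda>x. x \<star> c'"] by (simp add: A_def B_def n_def m_def padd_distrib_right)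
  have "val q a' b' c' \<longleftrightarrow> (a' \<star> qden q \<uplus> qneg q \<star> c') \<star> c = (b' \<star> qden q \<uplus> qpos q \<star> c') \<star> c"
    using q p assms by (simp add: val_def)
  also have "\<dots> \<longleftrightarrow> A' \<uplus> n = B' \<uplus> m"
    by (simp add: A'_def B'_def n_def m_def N_algebra)
  \<comment> \<open>Adding \<open>A \<uplus> B\<close> makes the two sides of equation
    \<open>1\<close> appear as summands, one on either side, which can then be cancelled.\<close>
  also have "\<dots> \<longleftrightarrow> (A' \<uplus> n) \<uplus> (A \<uplus> B) = (B' \<uplus> m) \<uplus> (A \<uplus> B)" using in_N by simp
  also have "\<dots> \<longleftrightarrow> (B \<uplus> A') \<uplus> (A \<uplus> n) = (A \<uplus> B') \<uplus> (B \<uplus> m)" by (simp add: padd_ac)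
  also have "\<dots> \<longleftrightarrow> B \<uplus> A' = A \<uplus> B'" using in_N by (simp add: 1)
  also have "\<dots> \<longleftrightarrow> (a \<star> c' \<uplus> b' \<star> c) \<star> qden q = (b \<star> c' \<uplus> a' \<star> c) \<star> qden q"
    by (auto simp: A_def B_def A'_def B'_def N_algebra)
  also have "\<dots> \<longleftrightarrow> a \<star> c' \<uplus> b' \<star> c = b \<star> c' \<uplus> a' \<star> c" using q p assms by simp
  finally show ?thesis .
qed

lemma val_scale: assumes "val q a b c" "k \<in> N" "k \<noteq> emp" shows "val q (a \<star> k) (b \<star> k) (c \<star> k)"
proof -
  have "a \<in> N" "b \<in> N" "c \<in> N" "c \<noteq> emp" using assms(1) by (simp_all add: val_def)
  then show ?thesis using assms
    by (subst val_iff[OF assms(1)]) (simp_all add: pmul_eq_emp pmul_ac padd_commute)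
qed

lemma val_common:
  assumes "p \<in> Q" "q \<in> Q"
  obtains a b a' b' c where "val p a b c" "val q a' b' c"
  using val_scale[OF val_self[OF assms(1)] Q_parts(3,4)[OF assms(2)]]
    val_scale[OF val_self[OF assms(2)] Q_parts(3,4)[OF assms(1)]] that
  by (metis pmul_commute)

lemma qadd_eq: assumes "p \<in> Q" "q \<in> Q"
  shows "qadd p q = reduce (qpos p \<star> qden q \<uplus> qpos q \<star> qden p)
      (qneg p \<star> qden q \<uplus> qneg q \<star> qden p) (qden p \<star> qden q)"
  using Q_parts[OF assms(1)] Q_parts[OF assms(2)] by (simp add: qadd_def nadd_eq nmul_eq)

lemma qmul_eq: assumes "p \<in> Q" "q \<in> Q"
  shows "qmul p q = reduce (qpos p \<star> qpos q \<uplus> qneg p \<star> qneg q)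
      (qpos p \<star> qneg q \<uplus> qneg p \<star> qpos q) (qden p \<star> qden q)"
  using Q_parts[OF assms(1)] Q_parts[OF assms(2)] by (simp add: qmul_def nadd_eq nmul_eq)

lemma qle_eq: assumes "p \<in> Q" "q \<in> Q"
  shows "p \<le>\<^sub>Q q \<longleftrightarrow> qpos p \<star> qden q \<uplus> qneg q \<star> qden p \<le>\<^sub>N qpos q \<star> qden p \<uplus> qneg p \<star> qden q"
  using Q_parts[OF assms(1)] Q_parts[OF assms(2)] by (simp add: qle_def nadd_eq nmul_eq)

lemma val_add:
  assumes "val p a b c" "val q a' b' c'"
  shows "val (qadd p q) (a \<star> c' \<uplus> a' \<star> c) (b \<star> c' \<uplus> b' \<star> c) (c \<star> c')"
proof -
  have p: "p \<in> Q" "a \<in> N" "b \<in> N" "c \<in> N" "c \<noteq> emp"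
    and 1: "a \<star> qden p \<uplus> qneg p \<star> c = b \<star> qden p \<uplus> qpos p \<star> c" using assms(1) by (simp_all add: val_def)
  have q: "q \<in> Q" "a' \<in> N" "b' \<in> N" "c' \<in> N" "c' \<noteq> emp"
    and 2: "a' \<star> qden q \<uplus> qneg q \<star> c' = b' \<star> qden q \<uplus> qpos q \<star> c'" using assms(2) by (simp_all add: val_def)
  note pp = Q_parts[OF p(1)] and qq = Q_parts[OF q(1)]
  have v: "val (qadd p q) (qpos p \<star> qden q \<uplus> qpos q \<star> qden p)
      (qneg p \<star> qden q \<uplus> qneg q \<star> qden p) (qden p \<star> qden q)"
    unfolding qadd_eq[OF p(1) q(1)] by (rule val_reduce) (use pp qq in \<open>simp_all add: pmul_eq_emp\<close>)
  have "(qpos p \<star> qden q \<uplus> qpos q \<star> qden p) \<star> (c \<star> c') \<uplus> (b \<star> c' \<uplus> b' \<star> c) \<star> (qden p \<star> qden q) =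
    (b \<star> qden p \<uplus> qpos p \<star> c) \<star> (c' \<star> qden q) \<uplus> (b' \<star> qden q \<uplus> qpos q \<star> c') \<star> (c \<star> qden p)"
    by (simp add: N_algebra)
  also have "\<dots> = (a \<star> qden p \<uplus> qneg p \<star> c) \<star> (c' \<star> qden q) \<uplus> (a' \<star> qden q \<uplus> qneg q \<star> c') \<star> (c \<star> qden p)"
    by (simp only: 1 2)
  also have "\<dots> = (qneg p \<star> qden q \<uplus> qneg q \<star> qden p) \<star> (c \<star> c') \<uplus> (a \<star> c' \<uplus> a' \<star> c) \<star> (qden p \<star> qden q)"
    by (simp add: N_algebra)
  finally show ?thesis
    using p q by (subst val_iff[OF v]) (simp_all add: pmul_eq_emp)
qed

text \<open>Independence of the representation is checked one factor at a time: \<open>v'\<close>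
  has the given entries for \<open>p\<close> and still the reduced ones for
  \<open>q\<close>.\<close>

lemma val_mul:
  assumes "val p a b c" "val q a' b' c'"
  shows "val (qmul p q) (a \<star> a' \<uplus> b \<star> b') (a \<star> b' \<uplus> b \<star> a') (c \<star> c')"
proof -
  have p: "p \<in> Q" "a \<in> N" "b \<in> N" "c \<in> N" "c \<noteq> emp"
    and 1: "a \<star> qden p \<uplus> qneg p \<star> c = b \<star> qden p \<uplus> qpos p \<star> c" using assms(1) by (simp_all add: val_def)
  have q: "q \<in> Q" "a' \<in> N" "b' \<in> N" "c' \<in> N" "c' \<noteq> emp"
    and 2: "a' \<star> qden q \<uplus> qneg q \<star> c' = b' \<star> qden q \<uplus> qpos q \<star> c'" using assms(2) by (simp_all add: val_def)
  note pp = Q_parts[OF p(1)] and qq = Q_parts[OF q(1)]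
  have v: "val (qmul p q) (qpos p \<star> qpos q \<uplus> qneg p \<star> qneg q)
      (qpos p \<star> qneg q \<uplus> qneg p \<star> qpos q) (qden p \<star> qden q)"
    unfolding qmul_eq[OF p(1) q(1)] by (rule val_reduce) (use pp qq in \<open>simp_all add: pmul_eq_emp\<close>)
  have "(qpos p \<star> qpos q \<uplus> qneg p \<star> qneg q) \<star> (c \<star> qden q) \<uplus> (a \<star> qneg q \<uplus> b \<star> qpos q) \<star> (qden p \<star> qden q) =
    (b \<star> qden p \<uplus> qpos p \<star> c) \<star> (qpos q \<star> qden q) \<uplus> (a \<star> qden p \<uplus> qneg p \<star> c) \<star> (qneg q \<star> qden q)"
    by (simp add: N_algebra)
  also have "\<dots> = (a \<star> qden p \<uplus> qneg p \<star> c) \<star> (qpos q \<star> qden q) \<uplus> (b \<star> qden p \<uplus> qpos p \<star> c) \<star> (qneg q \<star> qden q)"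
    by (simp only: 1)
  also have "\<dots> = (qpos p \<star> qneg q \<uplus> qneg p \<star> qpos q) \<star> (c \<star> qden q) \<uplus> (a \<star> qpos q \<uplus> b \<star> qneg q) \<star> (qden p \<star> qden q)"
    by (simp add: N_algebra)
  finally have v': "val (qmul p q) (a \<star> qpos q \<uplus> b \<star> qneg q) (a \<star> qneg q \<uplus> b \<star> qpos q) (c \<star> qden q)"
    using p q pp qq by (subst val_iff[OF v]) (simp_all add: pmul_eq_emp)
  have "(a \<star> qpos q \<uplus> b \<star> qneg q) \<star> (c \<star> c') \<uplus> (a \<star> b' \<uplus> b \<star> a') \<star> (c \<star> qden q) =
    (b' \<star> qden q \<uplus> qpos q \<star> c') \<star> (a \<star> c) \<uplus> (a' \<star> qden q \<uplus> qneg q \<star> c') \<star> (b \<star> c)"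
    by (simp add: N_algebra)
  also have "\<dots> = (a' \<star> qden q \<uplus> qneg q \<star> c') \<star> (a \<star> c) \<uplus> (b' \<star> qden q \<uplus> qpos q \<star> c') \<star> (b \<star> c)"
    by (simp only: 2)
  also have "\<dots> = (a \<star> qneg q \<uplus> b \<star> qpos q) \<star> (c \<star> c') \<uplus> (a \<star> a' \<uplus> b \<star> b') \<star> (c \<star> qden q)"
    by (simp add: N_algebra)
  finally show ?thesis
    using p q by (subst val_iff[OF v']) (simp_all add: pmul_eq_emp)
qed

text \<open>The hypothesis says that \<open>u - w\<close> and \<open>x - y\<close> agree, written
  without subtraction; hence they have the same sign.\<close>

lemma nle_balance:
  assumes "u \<in> N" "w \<in> N" "x \<in> N" "y \<in> N" "u \<uplus> y = w \<uplus> x"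
  shows "x \<le>\<^sub>N y \<longleftrightarrow> u \<le>\<^sub>N w"
proof -
  have "x \<le>\<^sub>N y \<longleftrightarrow> u \<uplus> x \<le>\<^sub>N u \<uplus> y" using assms nle_padd_cancel[of x y u] by (simp add: padd_commute)
  also have "\<dots> \<longleftrightarrow> u \<le>\<^sub>N w" using assms by simp
  finally show ?thesis .
qed

lemma val_le:
  assumes "val p a b c" "val q a' b' c'"
  shows "p \<le>\<^sub>Q q \<longleftrightarrow> a \<star> c' \<uplus> b' \<star> c \<le>\<^sub>N a' \<star> c \<uplus> b \<star> c'"
proof -
  have p: "p \<in> Q" "a \<in> N" "b \<in> N" "c \<in> N" "c \<noteq> emp"
    and 1: "a \<star> qden p \<uplus> qneg p \<star> c = b \<star> qden p \<uplus> qpos p \<star> c" using assms(1) by (simp_all add: val_def)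
  have q: "q \<in> Q" "a' \<in> N" "b' \<in> N" "c' \<in> N" "c' \<noteq> emp"
    and 2: "a' \<star> qden q \<uplus> qneg q \<star> c' = b' \<star> qden q \<uplus> qpos q \<star> c'" using assms(2) by (simp_all add: val_def)
  note pp = Q_parts[OF p(1)] and qq = Q_parts[OF q(1)]
  define X where "X = qpos p \<star> qden q \<uplus> qneg q \<star> qden p"
  define Y where "Y = qpos q \<star> qden p \<uplus> qneg p \<star> qden q"
  define U where "U = a \<star> c' \<uplus> b' \<star> c"
  define W where "W = a' \<star> c \<uplus> b \<star> c'"
  have in_N: "X \<in> N" "Y \<in> N" "U \<in> N" "W \<in> N"
    using p q pp qq by (simp_all add: X_def Y_def U_def W_def)
  have "U \<star> (qden p \<star> qden q) \<uplus> Y \<star> (c \<star> c') =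
    (a \<star> qden p \<uplus> qneg p \<star> c) \<star> (c' \<star> qden q) \<uplus> (b' \<star> qden q \<uplus> qpos q \<star> c') \<star> (c \<star> qden p)"
    by (simp add: U_def Y_def N_algebra)
  also have "\<dots> = (b \<star> qden p \<uplus> qpos p \<star> c) \<star> (c' \<star> qden q) \<uplus> (a' \<star> qden q \<uplus> qneg q \<star> c') \<star> (c \<star> qden p)"
    by (simp only: 1 2)
  also have "\<dots> = W \<star> (qden p \<star> qden q) \<uplus> X \<star> (c \<star> c')"
    by (simp add: W_def X_def N_algebra)
  finally have *: "U \<star> (qden p \<star> qden q) \<uplus> Y \<star> (c \<star> c') = W \<star> (qden p \<star> qden q) \<uplus> X \<star> (c \<star> c')" .
  have "p \<le>\<^sub>Q q \<longleftrightarrow> X \<le>\<^sub>N Y" using p q by (simp add: qle_eq X_def Y_def)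
  also have "\<dots> \<longleftrightarrow> X \<star> (c \<star> c') \<le>\<^sub>N Y \<star> (c \<star> c')" using in_N p q by (simp add: pmul_eq_emp)
  also have "\<dots> \<longleftrightarrow> U \<star> (qden p \<star> qden q) \<le>\<^sub>N W \<star> (qden p \<star> qden q)"
    by (rule nle_balance) (use in_N p q pp qq * in simp_all)
  also have "\<dots> \<longleftrightarrow> U \<le>\<^sub>N W" using in_N pp qq by (simp add: pmul_eq_emp)
  finally show ?thesis by (simp add: U_def W_def)
qed

lemma val_add_common:
  assumes "val p a b c" "val q a' b' c" shows "val (qadd p q) (a \<uplus> a') (b \<uplus> b') c"
proof -
  have "a \<in> N" "b \<in> N" "c \<in> N" "c \<noteq> emp" "a' \<in> N" "b' \<in> N" using assms by (simp_all add: val_def)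
  then show ?thesis
    by (subst val_iff[OF val_add[OF assms]]) (simp_all add: N_algebra)
qed

lemma val_le_common:
  assumes "val p a b c" "val q a' b' c" shows "p \<le>\<^sub>Q q \<longleftrightarrow> a \<uplus> b' \<le>\<^sub>N a' \<uplus> b"
proof -
  have "a \<in> N" "b \<in> N" "c \<in> N" "c \<noteq> emp" "a' \<in> N" "b' \<in> N" using assms by (simp_all add: val_def)
  then show ?thesis
    using nle_pmul_cancel[of "a \<uplus> b'" "a' \<uplus> b" c] by (simp add: val_le[OF assms] padd_distrib_right)
qed

lemma val_nat: assumes "n \<in> N" shows "val (rat n emp one\<^sub>N) n emp one\<^sub>N"
proof -
  have "ncoprime n one\<^sub>N" unfolding ncoprime_iff using pmul_eq_one by (metis pmul_commute)
  then have "rat n emp one\<^sub>N \<in> Q" using assms by (simp add: rat_in_Q)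
  then show ?thesis using assms by (simp add: val_def qparts_rat)
qed

lemma val_zero: "val qzero emp emp one\<^sub>N" and val_one: "val qone one\<^sub>N emp one\<^sub>N"
  unfolding qzero_def qone_def by (rule val_nat; simp)+

lemma val_zeroI: assumes "c \<in> N" "c \<noteq> emp" "a \<in> N" shows "val qzero a a c"
  using assms by (subst val_iff[OF val_zero]) simp_all

lemma val_oneI: assumes "c \<in> N" "c \<noteq> emp" shows "val qone c emp c"
  using assms by (subst val_iff[OF val_one]) simp_all

lemma val_nonneg: assumes "val p a b c" shows "qzero \<le>\<^sub>Q p \<longleftrightarrow> b \<le>\<^sub>N a"
proof -
  have "a \<in> N" "b \<in> N" "c \<in> N" "c \<noteq> emp" using assms by (simp_all add: val_def)
  then show ?thesis using val_le[OF val_zero assms] by simp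
qed

lemma nonneg_val:
  assumes "p \<in> Q" "qzero \<le>\<^sub>Q p" shows "val p (qpos p) emp (qden p)"
proof -
  have "qneg p \<le>\<^sub>N qpos p" using val_nonneg[OF val_self[OF assms(1)]] assms(2) by simp
  moreover have "qpos p = emp \<or> qneg p = emp" using assms(1) Q_iff[of p] by blast
  ultimately have "qneg p = emp" by (auto simp: nle_def)
  then show ?thesis using val_self[OF assms(1)] by simp
qed

subsection \<open>The ordered field of rational numbers\<close>

definition Qring :: "'c ring" where
  "Qring = \<lparr>carrier = Q, mult = qmul, one = qone, zero = qzero, add = qadd\<rparr>"

lemma Qring_simps [simp]:
  "carrier Qring = Q" "mult Qring = qmul" "one Qring = qone" "zero Qring = qzero" "add Qring = qadd"
  by (simp_all add: Qring_def)

lemma val_Q: "val q a b c \<Longrightarrow> q \<in> Q"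
  by (simp add: val_def)

lemma val_in: "val q a b c \<Longrightarrow> a \<in> N \<and> b \<in> N \<and> c \<in> N \<and> c \<noteq> emp"
  by (simp add: val_def)

lemma qadd_Q: assumes "p \<in> Q" "q \<in> Q" shows "qadd p q \<in> Q"
  using val_Q[OF val_add[OF val_self[OF assms(1)] val_self[OF assms(2)]]] .

lemma qmul_Q: assumes "p \<in> Q" "q \<in> Q" shows "qmul p q \<in> Q"
  using val_Q[OF val_mul[OF val_self[OF assms(1)] val_self[OF assms(2)]]] .

lemma qzero_Q: "qzero \<in> Q" and qone_Q: "qone \<in> Q"
  using val_Q val_zero val_one by blast+

lemma qadd_assoc: assumes "p \<in> Q" "q \<in> Q" "r \<in> Q" shows "qadd (qadd p q) r = qadd p (qadd q r)"
proof -
  note v = val_self[OF assms(1)] val_self[OF assms(2)] val_self[OF assms(3)]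
  note l = val_add[OF val_add[OF v(1,2)] v(3)] and r = val_add[OF v(1) val_add[OF v(2,3)]]
  show ?thesis by (rule val_unique[OF l]) (use r in \<open>simp only: N_algebra\<close>)
qed

lemma qadd_comm: assumes "p \<in> Q" "q \<in> Q" shows "qadd p q = qadd q p"
proof -
  note v = val_self[OF assms(1)] val_self[OF assms(2)]
  show ?thesis by (rule val_unique[OF val_add[OF v]]) (use val_add[OF v(2,1)] in \<open>simp only: N_algebra\<close>)
qed

lemma qadd_zero: assumes "p \<in> Q" shows "qadd qzero p = p"
proof -
  note v = val_self[OF assms]
  show ?thesis
    by (rule val_unique[OF _ v]) (use val_add[OF val_zero v] val_in[OF v] in simp)
qed

lemma qadd_minus: assumes "p \<in> Q" shows "qadd (qminus p) p = qzero"
proof -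
  note v = val_self[OF assms]
  have "val (qadd (qminus p) p) (qneg p \<uplus> qpos p) (qneg p \<uplus> qpos p) (qden p)"
    using val_add_common[OF val_minus[OF v] v] by (simp add: padd_commute)
  moreover have "val qzero (qneg p \<uplus> qpos p) (qneg p \<uplus> qpos p) (qden p)"
    using Q_parts[OF assms] by (intro val_zeroI) simp_all
  ultimately show ?thesis by (rule val_unique)
qed

lemma qadd_inverse: "p \<in> Q \<Longrightarrow> \<exists>y\<in>Q. qadd y p = qzero"
  using qadd_minus qminus_Q by blast

lemma qmul_assoc: assumes "p \<in> Q" "q \<in> Q" "r \<in> Q" shows "qmul (qmul p q) r = qmul p (qmul q r)"
proof -
  note v = val_self[OF assms(1)] val_self[OF assms(2)] val_self[OF assms(3)]
  note l = val_mul[OF val_mul[OF v(1,2)] v(3)] and r = val_mul[OF v(1) val_mul[OF v(2,3)]]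
  show ?thesis by (rule val_unique[OF l]) (use r in \<open>simp only: N_algebra\<close>)
qed

lemma qmul_comm: assumes "p \<in> Q" "q \<in> Q" shows "qmul p q = qmul q p"
proof -
  note v = val_self[OF assms(1)] val_self[OF assms(2)]
  show ?thesis by (rule val_unique[OF val_mul[OF v]]) (use val_mul[OF v(2,1)] in \<open>simp only: N_algebra\<close>)
qed

lemma qmul_one: assumes "p \<in> Q" shows "qmul qone p = p"
proof -
  note v = val_self[OF assms]
  show ?thesis
    by (rule val_unique[OF _ v]) (use val_mul[OF val_one v] val_in[OF v] in simp)
qed

lemma qdistrib: assumes "p \<in> Q" "q \<in> Q" "r \<in> Q" shows "qmul (qadd p q) r = qadd (qmul p r) (qmul q r)"
proof -
  obtain a b a' b' c where v: "val p a b c" "val q a' b' c" by (rule val_common[OF assms(1,2)])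
  note w = val_self[OF assms(3)]
  note l = val_mul[OF val_add_common[OF v] w] and r = val_add_common[OF val_mul[OF v(1) w] val_mul[OF v(2) w]]
  show ?thesis by (rule val_unique[OF l]) (use r in \<open>simp only: N_algebra\<close>)
qed

lemma qmul_inverse: assumes "p \<in> Q" "p \<noteq> qzero" shows "\<exists>q\<in>Q. qmul p q = qone"
proof -
  note v = val_self[OF assms(1)] and P = Q_parts[OF assms(1)]
  consider "qneg p = emp" | "qpos p = emp" using assms(1) Q_iff[of p] by blast
  then show ?thesis
  proof cases
    case 1
    have "qpos p \<noteq> emp" using val_unique[of p emp emp "qden p" qzero] v 1 assms(2) val_zeroI P by auto
    then have w: "val (reduce (qden p) emp (qpos p)) (qden p) emp (qpos p)" using P by (intro val_reduce) simp_all
    have "val (qmul p (reduce (qden p) emp (qpos p))) (qpos p \<star> qden p) emp (qpos p \<star> qden p)"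
      using val_mul[OF v w] 1 P by (simp add: pmul_commute)
    moreover have "val qone (qpos p \<star> qden p) emp (qpos p \<star> qden p)"
      using P \<open>qpos p \<noteq> emp\<close> by (intro val_oneI) (simp_all add: pmul_eq_emp)
    ultimately show ?thesis using val_unique val_Q[OF w] by blast
  next
    case 2
    have "qneg p \<noteq> emp" using val_unique[of p emp emp "qden p" qzero] v 2 assms(2) val_zeroI P by auto
    then have w: "val (reduce emp (qden p) (qneg p)) emp (qden p) (qneg p)" using P by (intro val_reduce) simp_all
    have "val (qmul p (reduce emp (qden p) (qneg p))) (qneg p \<star> qden p) emp (qneg p \<star> qden p)"
      using val_mul[OF v w] 2 P by (simp add: pmul_commute)
    moreover have "val qone (qneg p \<star> qden p) emp (qneg p \<star> qden p)"
      using P \<open>qneg p \<noteq> emp\<close> by (intro val_oneI) (simp_all add: pmul_eq_emp)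
    ultimately show ?thesis using val_unique val_Q[OF w] by blast
  qed
qed

lemma qzero_neq_qone: "qzero \<noteq> qone"
proof
  assume "qzero = qone"
  then have "val qone emp emp one\<^sub>N" using val_zero by simp
  then show False using val_iff[OF val_one, of emp emp "one\<^sub>N"] by simp
qed

lemma Q_cring: "cring Qring"
proof (rule cringI)
  show "abelian_group Qring"
    by (rule abelian_groupI)
      (auto simp: qadd_Q qzero_Q qadd_assoc qadd_zero qadd_inverse intro: qadd_comm)
  show "comm_monoid Qring"
    by (rule comm_monoidI) (auto simp: qmul_Q qone_Q qmul_assoc qmul_one intro: qmul_comm)
qed (simp add: qdistrib)

lemma Q_field: "field Qring"
  by (rule cring.cring_fieldI2[OF Q_cring]) (auto simp: qzero_neq_qone qmul_inverse)

lemma Q_ofield: "ofield Qring (\<le>\<^sub>Q)"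
proof (rule ofield.intro[OF Q_field], unfold_locales)
  fix x assume "x \<in> carrier Qring"
  then show "x \<le>\<^sub>Q x" using val_le_common[OF val_self val_self, of x] by simp
next
  fix x y assume "x \<in> carrier Qring" "y \<in> carrier Qring"
  then have Q: "x \<in> Q" "y \<in> Q" by simp_all
  obtain a b a' b' c where v: "val x a b c" "val y a' b' c" by (rule val_common[OF Q])
  note N = val_in[OF v(1)] val_in[OF v(2)]
  show "x \<le>\<^sub>Q y \<or> y \<le>\<^sub>Q x"
    unfolding val_le_common[OF v] val_le_common[OF v(2,1)] using nle_linear N by simp
  assume "x \<le>\<^sub>Q y" "y \<le>\<^sub>Q x"
  then have "a \<uplus> b' = a' \<uplus> b"
    unfolding val_le_common[OF v] val_le_common[OF v(2,1)] using nle_antisym N by simp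
  then have "a \<star> c \<uplus> b' \<star> c = b \<star> c \<uplus> a' \<star> c" by (metis padd_commute padd_distrib_right)
  then have "val x a' b' c" using N by (subst val_iff[OF v(1)]) simp_all
  then show "x = y" using v(2) val_unique by blast
next
  fix x y z assume "x \<in> carrier Qring" "y \<in> carrier Qring" "z \<in> carrier Qring"
  then have Q: "x \<in> Q" "y \<in> Q" "z \<in> Q" by simp_all
  obtain a b a' b' c where v: "val x a b c" "val y a' b' c" by (rule val_common[OF Q(1,2)])
  let ?d = "qden z"
  have d: "?d \<in> N" "?d \<noteq> emp" using Q_parts Q by simp_all
  have c: "c \<in> N" "c \<noteq> emp" using val_in[OF v(1)] by simp_all
  note v = val_scale[OF v(1) d] val_scale[OF v(2) d] val_scale[OF val_self[OF Q(3)] c]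
  obtain a1 b1 a2 b2 a3 b3 e where w: "val x a1 b1 e" "val y a2 b2 e" "val z a3 b3 e"
    using that[OF v(1,2)] v(3) by (simp only: pmul_commute[of "qden z"])
  note N = val_in[OF w(1)] val_in[OF w(2)] val_in[OF w(3)]
  { assume "x \<le>\<^sub>Q y" "y \<le>\<^sub>Q z"
    then have "a1 \<uplus> b2 \<le>\<^sub>N a2 \<uplus> b1" "a2 \<uplus> b3 \<le>\<^sub>N a3 \<uplus> b2" using val_le_common w by blast+
    then have "(a1 \<uplus> b2) \<uplus> (a2 \<uplus> b3) \<le>\<^sub>N (a2 \<uplus> b1) \<uplus> (a3 \<uplus> b2)" using N by (rule_tac nle_padd_mono) simp_all
    moreover have "(a1 \<uplus> b2) \<uplus> (a2 \<uplus> b3) = (a1 \<uplus> b3) \<uplus> (a2 \<uplus> b2)"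
      "(a2 \<uplus> b1) \<uplus> (a3 \<uplus> b2) = (a3 \<uplus> b1) \<uplus> (a2 \<uplus> b2)" by (simp_all only: padd_ac)
    ultimately have "(a1 \<uplus> b3) \<uplus> (a2 \<uplus> b2) \<le>\<^sub>N (a3 \<uplus> b1) \<uplus> (a2 \<uplus> b2)" by simp
    then show "x \<le>\<^sub>Q z" unfolding val_le_common[OF w(1,3)] using N by simp }
  { assume "x \<le>\<^sub>Q y"
    then have "a1 \<uplus> b2 \<le>\<^sub>N a2 \<uplus> b1" using val_le_common w by blast
    then have "(a1 \<uplus> b2) \<uplus> (a3 \<uplus> b3) \<le>\<^sub>N (a2 \<uplus> b1) \<uplus> (a3 \<uplus> b3)" using N by simp
    moreover have "(a1 \<uplus> b2) \<uplus> (a3 \<uplus> b3) = (a1 \<uplus> a3) \<uplus> (b2 \<uplus> b3)"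
      "(a2 \<uplus> b1) \<uplus> (a3 \<uplus> b3) = (a2 \<uplus> a3) \<uplus> (b1 \<uplus> b3)" by (simp_all only: padd_ac)
    ultimately show "x \<oplus>\<^bsub>Qring\<^esub> z \<le>\<^sub>Q y \<oplus>\<^bsub>Qring\<^esub> z"
      using val_le_common[OF val_add_common[OF w(1,3)] val_add_common[OF w(2,3)]] by simp }
next
  fix x y assume *: "x \<in> carrier Qring" "y \<in> carrier Qring" "\<zero>\<^bsub>Qring\<^esub> \<le>\<^sub>Q x" "\<zero>\<^bsub>Qring\<^esub> \<le>\<^sub>Q y"
  then have v: "val x (qpos x) emp (qden x)" "val y (qpos y) emp (qden y)" using nonneg_val by simp_all
  have "val (qmul x y) (qpos x \<star> qpos y) emp (qden x \<star> qden y)"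
    using val_mul[OF v] val_in[OF v(1)] val_in[OF v(2)] by simp
  then show "\<zero>\<^bsub>Qring\<^esub> \<le>\<^sub>Q x \<otimes>\<^bsub>Qring\<^esub> y"
    using val_nonneg val_in[OF v(1)] val_in[OF v(2)] by simp
qed

subsection \<open>Standard natural numbers\<close>

lemma SN_iff: "x \<in> SN \<longleftrightarrow> (\<forall>X. emp \<epsilon> X \<and> (\<forall>n. n \<epsilon> X \<longrightarrow> suc n \<epsilon> X) \<longrightarrow> x \<epsilon> X)"
  unfolding SN_def by (rule Inter_elts)

lemma SN_emp [simp]: "emp \<in> SN" and SN_suc [simp]: "n \<in> SN \<Longrightarrow> suc n \<in> SN"
  unfolding SN_iff by blast+

lemma SN_V: "x \<in> SN \<Longrightarrow> x \<in> V"
proof -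
  obtain X where X: "\<And>z. z \<epsilon> X \<longleftrightarrow> z \<in> V" using cls_V by auto
  assume "x \<in> SN"
  then have "emp \<epsilon> X \<and> (\<forall>n. n \<epsilon> X \<longrightarrow> suc n \<epsilon> X) \<longrightarrow> x \<epsilon> X" unfolding SN_iff by blast
  then show "x \<in> V" by (simp add: X)
qed

lemma cls_SN: "\<exists>C. \<forall>x. x \<epsilon> C \<longleftrightarrow> x \<in> SN"
proof -
  define sc where "sc a c \<longleftrightarrow> (\<forall>z\<in>UNIV. z \<epsilon> c \<longleftrightarrow> z = a \<or> z \<epsilon> a)" for a c
  have sc: "sc a c \<longleftrightarrow> c = suc a" if "a \<in> V" for a c
    unfolding sc_def ext_iff[of c] using that by simp
  have "dfn UNIV UNIV (\<lambda>e. \<forall>X\<in>UNIV. emp \<epsilon> X \<and>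
     (\<forall>a\<in>UNIV. a \<epsilon> X \<longrightarrow> (\<exists>c\<in>UNIV. c \<epsilon> X \<and> sc a c)) \<longrightarrow> e 0 \<epsilon> X)"
    unfolding sc_def by (intro dfn_intros) auto
  from cls_Collect[where P = "\<lambda>x. \<forall>X\<in>UNIV. emp \<epsilon> X \<and>
     (\<forall>a\<in>UNIV. a \<epsilon> X \<longrightarrow> (\<exists>c\<in>UNIV. c \<epsilon> X \<and> sc a c)) \<longrightarrow> x \<epsilon> X", OF this subset_UNIV]
  obtain C where C: "\<forall>x. x \<epsilon> C \<longleftrightarrow> x \<in> V \<and> (\<forall>X\<in>UNIV. emp \<epsilon> X \<and>
     (\<forall>a\<in>UNIV. a \<epsilon> X \<longrightarrow> (\<exists>c\<in>UNIV. c \<epsilon> X \<and> sc a c)) \<longrightarrow> x \<epsilon> X)"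
    by (elim exE)
  have "(a \<epsilon> X \<longrightarrow> (\<exists>c\<in>UNIV. c \<epsilon> X \<and> sc a c)) \<longleftrightarrow> (a \<epsilon> X \<longrightarrow> suc a \<epsilon> X)" for a X
    by (cases "a \<epsilon> X") (auto simp: sc[OF mem_V])
  then have eq: "(\<forall>a\<in>UNIV. a \<epsilon> X \<longrightarrow> (\<exists>c\<in>UNIV. c \<epsilon> X \<and> sc a c)) \<longleftrightarrow> (\<forall>a. a \<epsilon> X \<longrightarrow> suc a \<epsilon> X)" for X
    by (simp only: ball_UNIV)
  have "x \<epsilon> C \<longleftrightarrow> x \<in> V \<and> x \<in> SN" for x
    unfolding SN_iff C[rule_format] unfolding eq unfolding ball_UNIV by (rule refl)
  then have "\<forall>x. x \<epsilon> C \<longleftrightarrow> x \<in> SN" using SN_V by blast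
  then show ?thesis by (rule exI)
qed

text \<open>\<open>SN\<close>, \<open>S\<close> and the carriers are mere HOL sets. Bounded
  quantifiers over them are definable, and suprema of them are available, only when some class has
  exactly these elements.\<close>

definition is_cls :: "'c set \<Rightarrow> bool" where
  "is_cls T \<longleftrightarrow> (\<exists>C. \<forall>x. x \<epsilon> C \<longleftrightarrow> x \<in> T)"

lemma is_cls_V: "is_cls T \<Longrightarrow> T \<subseteq> V"
  unfolding is_cls_def using mem_V by blast

lemma dfn_cls: assumes "is_cls T" "fn UNIV V a" shows "dfn UNIV V (\<lambda>e. a e \<in> T)"
proof -
  obtain C where C: "\<And>x. x \<epsilon> C \<longleftrightarrow> x \<in> T" using assms(1) by (auto simp: is_cls_def)
  show ?thesis unfolding C[symmetric] by (intro dfn_mem_const dom_ok_V assms(2) UNIV_I)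
qed

lemma is_cls_Collect: assumes "dfn UNIV V (\<lambda>e. P (e 0))" shows "is_cls {x \<in> V. P x}"
  using cls_Collect[where P = P, OF assms order_refl] by (simp add: is_cls_def)

lemma is_cls_SN: "is_cls SN" and is_cls_S: "is_cls S"
  using cls_SN cls_S by (simp_all add: is_cls_def)

lemma is_cls_elts: "is_cls (elts X)"
  unfolding is_cls_def elts_iff by blast

lemma dfn_all_cls:
  assumes "is_cls T" "dfn UNIV V (\<lambda>e. \<Phi> (\<lambda>i. e (Suc i)) (e 0))"
  shows "dfn UNIV V (\<lambda>e. \<forall>x\<in>T. \<Phi> e x)"
  by (rule dfn_all_in[OF dom_ok_V is_cls_V[OF assms(1)] dfn_cls[OF assms(1) fn_var] assms(2)])

lemma dfn_ex_cls:
  assumes "is_cls T" "dfn UNIV V (\<lambda>e. \<Phi> (\<lambda>i. e (Suc i)) (e 0))"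
  shows "dfn UNIV V (\<lambda>e. \<exists>x\<in>T. \<Phi> e x)"
  by (rule dfn_ex_in[OF dom_ok_V is_cls_V[OF assms(1)] dfn_cls[OF assms(1) fn_var] assms(2)])

lemmas dfn_all_SN = dfn_all_cls[OF is_cls_SN] and dfn_ex_SN = dfn_ex_cls[OF is_cls_SN]
  and dfn_SN = dfn_cls[OF is_cls_SN]

lemmas cls_intros = order_intros dfn_all_SN dfn_ex_SN dfn_SN UNIV_I

text \<open>Unlike \<open>N_induct\<close> this accepts class formulas, because \<open>SN\<close> is
  contained in every class that contains \<open>emp\<close> and is closed under successors.\<close>

lemma SN_induct:
  assumes "n \<in> SN" "dfn UNIV V (\<lambda>e. P (e 0))" "P emp" "\<And>n. n \<in> SN \<Longrightarrow> P n \<Longrightarrow> P (suc n)"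
  shows "P n"
proof -
  have "dfn UNIV V (\<lambda>e. e 0 \<in> SN \<and> P (e 0))" by (intro dfn_conj assms(2) cls_intros)
  from cls_Collect[where P = "\<lambda>n. n \<in> SN \<and> P n", OF this order_refl]
  obtain X where X: "\<And>z. z \<epsilon> X \<longleftrightarrow> z \<in> V \<and> z \<in> SN \<and> P z" by auto
  have "emp \<epsilon> X \<and> (\<forall>n. n \<epsilon> X \<longrightarrow> suc n \<epsilon> X)" using assms(3,4) by (simp add: X)
  then have "n \<epsilon> X" using assms(1) unfolding SN_iff by blast
  then show ?thesis by (simp add: X)
qed

lemma SN_N: assumes "n \<in> SN" shows "n \<in> N"
  by (rule SN_induct[where P = "\<lambda>n. n \<in> N", OF assms]) (intro cls_intros, simp_all)

lemma SN_elem: assumes "n \<in> SN" "k \<epsilon> n" shows "k \<in> SN"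
proof -
  have "\<forall>k\<in>elts n. k \<in> SN"
    by (rule SN_induct[where P = "\<lambda>n. \<forall>k\<in>elts n. k \<in> SN", OF assms(1)])
      (intro cls_intros, auto simp: SN_V)
  then show ?thesis using assms(2) by simp
qed

lemma SN_nle: "n \<in> SN \<Longrightarrow> k \<le>\<^sub>N n \<Longrightarrow> k \<in> SN"
  using SN_elem by (auto simp: nle_def)

lemma SN_padd [simp]: assumes "m \<in> SN" "n \<in> SN" shows "m \<uplus> n \<in> SN"
proof (rule SN_induct[where P = "\<lambda>n. m \<uplus> n \<in> SN", OF assms(2)])
  show "dfn UNIV V (\<lambda>e. m \<uplus> e 0 \<in> SN)" by (intro cls_intros SN_V[OF assms(1)])
qed (use assms SN_N in \<open>simp_all add: padd_suc\<close>)

lemma SN_pmul [simp]: assumes "m \<in> SN" "n \<in> SN" shows "m \<star> n \<in> SN"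
proof (rule SN_induct[where P = "\<lambda>n. m \<star> n \<in> SN", OF assms(2)])
  show "dfn UNIV V (\<lambda>e. m \<star> e 0 \<in> SN)" by (intro cls_intros SN_V[OF assms(1)])
qed (use assms SN_N in \<open>simp_all add: pmul_suc\<close>)

lemma SN_S: assumes "n \<in> SN" shows "n \<in> S"
  by (rule SN_induct[where P = "\<lambda>n. n \<in> S", OF assms])
    (intro dfn_cls is_cls_S cls_intros, simp_all add: S_emp S_adj suc_def)

text \<open>A number lying in \<open>S\<close> cannot be beyond all standard numbers, for it would
  then contain all of them. This is how \<open>N \<inter> S\<close> is identified with
  \<open>SN\<close>.\<close>

lemma S_bounded: assumes "x \<in> S" shows "\<exists>m\<in>SN. \<forall>k\<in>SN. k \<epsilon> x \<longrightarrow> k \<epsilon> m"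
proof (rule S_induct[where P = "\<lambda>x. \<exists>m\<in>SN. \<forall>k\<in>SN. k \<epsilon> x \<longrightarrow> k \<epsilon> m", OF _ _ _ _ assms])
  show "dfn UNIV V (\<lambda>e. \<exists>m\<in>SN. \<forall>k\<in>SN. k \<epsilon> e 0 \<longrightarrow> k \<epsilon> m)" by (intro cls_intros)
  show "\<exists>m\<in>SN. \<forall>k\<in>SN. k \<epsilon> emp \<longrightarrow> k \<epsilon> m" by (intro bexI[of _ emp]) simp_all
  fix a b assume ab: "a \<in> V" "b \<in> V" "\<exists>m\<in>SN. \<forall>k\<in>SN. k \<epsilon> a \<longrightarrow> k \<epsilon> m"
  then obtain m where m: "m \<in> SN" "\<And>k. k \<in> SN \<Longrightarrow> k \<epsilon> a \<Longrightarrow> k \<epsilon> m" by blast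
  show "\<exists>m\<in>SN. \<forall>k\<in>SN. k \<epsilon> adj a b \<longrightarrow> k \<epsilon> m"
  proof (cases "b \<in> SN")
    case False
    then show ?thesis using m ab by (intro bexI[of _ m]) auto
  next
    case True
    have N: "m \<in> N" "suc b \<in> N" using m True SN_N by auto
    show ?thesis
    proof (cases "m \<le>\<^sub>N suc b")
      case le: True
      have "k \<epsilon> suc b" if "k \<in> SN" "k \<epsilon> adj a b" for k
        using that m(2)[OF that(1)] ab le N_trans[OF N(2), of m k] by (auto simp: nle_def)
      then show ?thesis using True by (intro bexI[of _ "suc b"]) auto
    next
      case False
      then have "suc b \<epsilon> m" using N not_nle by blast
      then have "b \<epsilon> m" using N_trans[OF N(1), of "suc b" b] ab by simp
      then show ?thesis using m ab by (intro bexI[of _ m]) auto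
    qed
  qed
qed simp

lemma N_S_SN: assumes "n \<in> N" "n \<in> S" shows "n \<in> SN"
proof -
  obtain m where m: "m \<in> SN" "\<And>k. k \<in> SN \<Longrightarrow> k \<epsilon> n \<Longrightarrow> k \<epsilon> m" using S_bounded[OF assms(2)] by blast
  then have "\<not> m \<epsilon> n" using N_not_self SN_N by blast
  then have "n \<le>\<^sub>N m" using not_nle[of n m] assms SN_N m by blast
  then show ?thesis using SN_nle m by blast
qed

lemma S_pair: "x \<in> S \<Longrightarrow> y \<in> S \<Longrightarrow> pair x y \<in> S"
  by (simp add: pair_def upair_def S_adj S_emp)

lemma S_pairD: assumes "pair x y \<in> S" "x \<in> V" "y \<in> V" shows "x \<in> S" "y \<in> S"
proof -
  have "upair x y \<epsilon> pair x y" using assms by (simp add: pair_def)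
  then have "upair x y \<in> S" using S_trans assms by blast
  then show "x \<in> S" "y \<in> S" using S_trans assms by (metis mem_upair)+
qed

lemma SQ_iff: "q \<in> SQ \<longleftrightarrow> q \<in> Q \<and> qpos q \<in> SN \<and> qneg q \<in> SN \<and> qden q \<in> SN"
proof
  assume "q \<in> SQ"
  then have q: "q \<in> Q" "q \<in> S" by (simp_all add: SQ_def)
  note P = Q_parts[OF q(1)]
  have "pair (pair (qpos q) (qneg q)) (qden q) \<in> S" using q Q_iff[of q] by (simp add: rat_def)
  then have "qpos q \<in> S" "qneg q \<in> S" "qden q \<in> S" using S_pairD P N_V by (metis pair_V)+
  then show "q \<in> Q \<and> qpos q \<in> SN \<and> qneg q \<in> SN \<and> qden q \<in> SN" using q P N_S_SN by blast
next
  assume q: "q \<in> Q \<and> qpos q \<in> SN \<and> qneg q \<in> SN \<and> qden q \<in> SN"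
  then have "rat (qpos q) (qneg q) (qden q) \<in> S" unfolding rat_def by (intro S_pair SN_S) simp_all
  then show "q \<in> SQ" using q Q_iff[of q] by (simp add: SQ_def)
qed

lemma SQ_val: "r \<in> SQ \<Longrightarrow> \<exists>a\<in>SN. \<exists>b\<in>SN. \<exists>c\<in>SN. val r a b c"
  using val_self SQ_iff by blast

lemma val_SQ: "val q a b c \<Longrightarrow> a \<in> SN \<Longrightarrow> b \<in> SN \<Longrightarrow> c \<in> SN \<Longrightarrow> q \<in> SQ"
  using val_bounds[of q a b c] SN_nle val_Q unfolding SQ_iff by blast

lemma SQ_common:
  assumes "p \<in> SQ" "q \<in> SQ"
  obtains a b a' b' c where "val p a b c" "val q a' b' c"
    "a \<in> SN" "b \<in> SN" "a' \<in> SN" "b' \<in> SN" "c \<in> SN"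
proof -
  obtain a b c where p: "a \<in> SN" "b \<in> SN" "c \<in> SN" "val p a b c" using SQ_val[OF assms(1)] by blast
  obtain a' b' c' where q: "a' \<in> SN" "b' \<in> SN" "c' \<in> SN" "val q a' b' c'" using SQ_val[OF assms(2)] by blast
  have "val p (a \<star> c') (b \<star> c') (c \<star> c')" "val q (a' \<star> c) (b' \<star> c) (c \<star> c')"
    using val_scale[OF p(4), of c'] val_scale[OF q(4), of c] val_in[OF p(4)] val_in[OF q(4)]
    by (simp_all add: pmul_commute[of c' c])
  then show ?thesis using that p q by simp
qed

subsection \<open>Nonstandard numbers and saturation\<close>

lemma subset_smallD: "small t \<Longrightarrow> (\<And>z. z \<epsilon> Y \<Longrightarrow> z \<epsilon> t) \<Longrightarrow> Y \<in> V"
  unfolding small_def by (auto simp: subset_eq)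

lemma smallI: "(\<And>Y. (\<And>z. z \<epsilon> Y \<Longrightarrow> z \<epsilon> t) \<Longrightarrow> Y \<in> V) \<Longrightarrow> small t"
  unfolding small_def by (auto simp: subset_eq)

lemma small_emp: "small emp"
proof (rule smallI)
  fix Y assume "\<And>z. z \<epsilon> Y \<Longrightarrow> z \<epsilon> emp"
  then have "Y = emp" by (auto simp: emp_eq)
  then show "Y \<in> V" by simp
qed

lemma small_mono: assumes "small t" "\<And>z. z \<epsilon> s \<Longrightarrow> z \<epsilon> t" shows "small s"
  by (rule smallI) (use subset_smallD[OF assms(1)] assms(2) in blast)

text \<open>A subclass without \<open>w\<close> is a subclass of \<open>t\<close>, hence a set, and
  \<open>adj\<close> puts \<open>w\<close> back.\<close>

lemma small_adj: assumes "small t" "t \<in> V" "w \<in> V" shows "small (adj t w)"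
proof (rule smallI)
  fix Y assume Y: "\<And>z. z \<epsilon> Y \<Longrightarrow> z \<epsilon> adj t w"
  have "dfn UNIV V (\<lambda>e. e 0 \<epsilon> Y \<and> e 0 \<epsilon> t)" by (intro cls_intros)
  from cls_Collect[where P = "\<lambda>z. z \<epsilon> Y \<and> z \<epsilon> t", OF this order_refl]
  obtain Y' where Y': "\<And>z. z \<epsilon> Y' \<longleftrightarrow> z \<in> V \<and> z \<epsilon> Y \<and> z \<epsilon> t" by auto
  then have "Y' \<in> V" using subset_smallD[OF assms(1)] by blast
  moreover have "Y = (if w \<epsilon> Y then adj Y' w else Y')"
    using Y' Y assms \<open>Y' \<in> V\<close> mem_V by (subst ext_iff) auto
  ultimately show "Y \<in> V" using assms by (metis adj_V)
qed

text \<open>Smallness quantifies over subclasses, so it is definable at first only over all classes.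
  Once it is given by a class, it can enter inductions over \<open>SN\<close>.\<close>

lemma cls_small: "is_cls {x \<in> V. small x}"
proof -
  have "dfn UNIV UNIV (\<lambda>e. \<forall>Y\<in>UNIV. (\<forall>z\<in>UNIV. z \<epsilon> Y \<longrightarrow> z \<epsilon> e 0) \<longrightarrow> (\<exists>Z\<in>UNIV. Y \<epsilon> Z))"
    by (intro dfn_intros)
  from cls_Collect[where P = "\<lambda>x. \<forall>Y\<in>UNIV. (\<forall>z\<in>UNIV. z \<epsilon> Y \<longrightarrow> z \<epsilon> x) \<longrightarrow> (\<exists>Z\<in>UNIV. Y \<epsilon> Z)", OF this subset_UNIV]
  obtain C where C: "\<forall>x. x \<epsilon> C \<longleftrightarrow> x \<in> V \<and> (\<forall>Y\<in>UNIV. (\<forall>z\<in>UNIV. z \<epsilon> Y \<longrightarrow> z \<epsilon> x) \<longrightarrow> (\<exists>Z\<in>UNIV. Y \<epsilon> Z))"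
    by (elim exE)
  have sm: "small x \<longleftrightarrow> (\<forall>Y\<in>UNIV. (\<forall>z\<in>UNIV. z \<epsilon> Y \<longrightarrow> z \<epsilon> x) \<longrightarrow> (\<exists>Z\<in>UNIV. Y \<epsilon> Z))" for x
    unfolding small_def V_def subset_eq mem_Collect_eq ball_UNIV bex_UNIV ball_elts elts_iff by (rule refl)
  show ?thesis unfolding is_cls_def mem_Collect_eq sm by (intro exI[of _ C]) (rule C)
qed

lemma small_SN: assumes "n \<in> SN" shows "small n"
proof -
  have "n \<in> {x \<in> V. small x}"
    by (rule SN_induct[where P = "\<lambda>n. n \<in> {x \<in> V. small x}", OF assms])
      (intro dfn_cls cls_small cls_intros, simp_all add: small_emp small_adj suc_def)
  then show ?thesis by simp
qed

lemma set_max_nle: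
  assumes "y \<in> V" "y \<noteq> emp" "\<And>z. z \<epsilon> y \<Longrightarrow> z \<in> N"
  shows "\<exists>m. m \<epsilon> y \<and> (\<forall>k. k \<epsilon> y \<longrightarrow> k \<le>\<^sub>N m)"
proof (rule set_max[OF _ assms(1,2)])
  show "dfn V V (\<lambda>e. e 0 \<le>\<^sub>N e (Suc 0))" by (intro order_intros)
qed (use assms(3) nle_linear nle_trans in blast)+

text \<open>A nonempty set of standard numbers has a greatest element \<open>m\<close>, hence it is
  included in the standard number \<open>suc m\<close>, and standard numbers are small.\<close>

lemma thin_SN: assumes "\<And>x. x \<epsilon> C \<longleftrightarrow> x \<in> SN" shows "thin C"
  unfolding thin_def
proof (intro ballI impI)
  fix y assume y: "y \<in> V" "elts y \<subseteq> elts C"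
  then have sub: "z \<epsilon> y \<Longrightarrow> z \<in> SN" for z using assms by (auto simp: subset_eq)
  show "small y"
  proof (cases "y = emp")
    case False
    obtain m where m: "m \<epsilon> y" "\<And>k. k \<epsilon> y \<Longrightarrow> k \<le>\<^sub>N m"
      using set_max_nle[OF y(1) False] sub SN_N by blast
    have "small (suc m)" "m \<in> V" using small_SN SN_suc SN_V sub[OF m(1)] by blast+
    then show ?thesis using m(2) by (elim small_mono) (auto simp: nle_def)
  qed (simp add: small_emp)
qed

lemma N_unbounded: assumes "x \<in> V" shows "\<exists>h\<in>N. \<forall>k\<in>N. k \<epsilon> x \<longrightarrow> k \<epsilon> h"
proof (rule set_induct[where P = "\<lambda>x. \<exists>h\<in>N. \<forall>k\<in>N. k \<epsilon> x \<longrightarrow> k \<epsilon> h", OF _ _ _ assms])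
  show "dfn V V (\<lambda>e. \<exists>h\<in>N. \<forall>k\<in>N. k \<epsilon> e 0 \<longrightarrow> k \<epsilon> h)" by (intro order_intros)
  show "\<exists>h\<in>N. \<forall>k\<in>N. k \<epsilon> emp \<longrightarrow> k \<epsilon> h" by (intro bexI[of _ emp]) simp_all
  fix a b assume ab: "a \<in> V" "b \<in> V" "\<exists>h\<in>N. \<forall>k\<in>N. k \<epsilon> a \<longrightarrow> k \<epsilon> h"
  then obtain h where h: "h \<in> N" "\<And>k. k \<in> N \<Longrightarrow> k \<epsilon> a \<Longrightarrow> k \<epsilon> h" by blast
  show "\<exists>h\<in>N. \<forall>k\<in>N. k \<epsilon> adj a b \<longrightarrow> k \<epsilon> h"
  proof (cases "b \<in> N")
    case False
    then show ?thesis using h ab by (intro bexI[of _ h]) auto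
  next
    case True
    have "h \<epsilon> suc (h \<uplus> b) \<or> h = suc (h \<uplus> b)" "b \<epsilon> suc (h \<uplus> b)"
      using nle_padd[of h b] nle_padd[of b h] h True N_V by (auto simp: nle_def padd_commute)
    then have "k \<epsilon> suc (h \<uplus> b)" if "k \<in> N" "k \<epsilon> adj a b" for k
      using that h ab True N_trans[of "suc (h \<uplus> b)" h k] by auto
    then show ?thesis using h True by (intro bexI[of _ "suc (h \<uplus> b)"]) auto
  qed
qed

text \<open>Some set \<open>y\<close> contains the thin class of standard numbers. A number above
  all numbers in \<open>y\<close> cannot be standard, since it would be an element of
  itself.\<close>

lemma nonstandard_exists: "\<exists>H\<in>N. H \<notin> SN"
proof -
  obtain C where C: "\<And>x. x \<epsilon> C \<longleftrightarrow> x \<in> SN" using cls_SN by auto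
  obtain y where y: "y \<in> V" "elts C \<subseteq> elts y" using Thin[OF thin_SN[OF C]] by blast
  obtain h where h: "h \<in> N" "\<And>k. k \<in> N \<Longrightarrow> k \<epsilon> y \<Longrightarrow> k \<epsilon> h" using N_unbounded[OF y(1)] by blast
  have "h \<notin> SN"
  proof
    assume "h \<in> SN"
    then have "h \<epsilon> y" using y(2) C by (auto simp: subset_eq)
    then show False using h N_not_self by blast
  qed
  then show ?thesis using h(1) by blast
qed

lemma set_union: assumes "x \<in> V" "y \<in> V" shows "\<exists>z\<in>V. \<forall>k. k \<epsilon> z \<longleftrightarrow> k \<epsilon> x \<or> k \<epsilon> y"
proof -
  have "\<exists>z\<in>V. \<forall>k\<in>V. k \<epsilon> z \<longleftrightarrow> k \<epsilon> x \<or> k \<epsilon> y"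
  proof (rule set_induct[where P = "\<lambda>x. \<exists>z\<in>V. \<forall>k\<in>V. k \<epsilon> z \<longleftrightarrow> k \<epsilon> x \<or> k \<epsilon> y", OF _ _ _ assms(1)])
    show "dfn V V (\<lambda>e. \<exists>z\<in>V. \<forall>k\<in>V. k \<epsilon> z \<longleftrightarrow> k \<epsilon> e 0 \<or> k \<epsilon> y)" by (intro set_intros assms)
    show "\<exists>z\<in>V. \<forall>k\<in>V. k \<epsilon> z \<longleftrightarrow> k \<epsilon> emp \<or> k \<epsilon> y" using assms(2) by (intro bexI[of _ y]) simp_all
    fix a b assume ab: "a \<in> V" "b \<in> V" "\<exists>z\<in>V. \<forall>k\<in>V. k \<epsilon> z \<longleftrightarrow> k \<epsilon> a \<or> k \<epsilon> y"
    then obtain z where "z \<in> V" "\<forall>k\<in>V. k \<epsilon> z \<longleftrightarrow> k \<epsilon> a \<or> k \<epsilon> y" by blast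
    then show "\<exists>z\<in>V. \<forall>k\<in>V. k \<epsilon> z \<longleftrightarrow> k \<epsilon> adj a b \<or> k \<epsilon> y"
      using ab by (intro bexI[of _ "adj z b"]) auto
  qed
  then show ?thesis using mem_V by blast
qed

text \<open>A set covered by a sequence of sets indexed by the standard numbers is covered by
  finitely many of them. \<open>Comp\<close> is applied to the increasing sequence of the finite unions,
  which is thin because a set of members of a chain has a largest element.\<close>

lemma saturation:
  assumes u: "u \<in> V" and G: "dfn UNIV V (\<lambda>e. G (e 0) (e (Suc 0)))"
    and sec: "\<And>i. i \<in> SN \<Longrightarrow> \<exists>z\<in>V. \<forall>k. k \<epsilon> z \<longleftrightarrow> k \<epsilon> u \<and> G i k"
    and cover: "\<And>k. k \<epsilon> u \<Longrightarrow> \<exists>i\<in>SN. G i k"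
  shows "\<exists>n\<in>SN. \<forall>k. k \<epsilon> u \<longrightarrow> (\<exists>i. i \<le>\<^sub>N n \<and> G i k)"
proof -
  note dG = dfn_lift2[where \<Phi> = G, OF dom_ok_V G]
  \<comment> \<open>\<open>w\<close> collects the elements of \<open>u\<close> covered by some stage
    up to \<open>n\<close>. The variable \<open>i\<close> may range over \<open>V\<close>, since
    \<open>i \<le>\<^sub>N n\<close> already makes it a standard number when \<open>n\<close> is
    one.\<close>
  define W where "W n w \<longleftrightarrow> (\<forall>k\<in>V. k \<epsilon> w \<longleftrightarrow> k \<epsilon> u \<and> (\<exists>i\<in>V. i \<le>\<^sub>N n \<and> G i k))" for n w
  have W: "k \<epsilon> w \<longleftrightarrow> k \<epsilon> u \<and> (\<exists>i\<in>V. i \<le>\<^sub>N n \<and> G i k)" if "W n w" for n w k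
    using that mem_V unfolding W_def by blast
  have dW: "fn UNIV V a \<Longrightarrow> fn UNIV V b \<Longrightarrow> dfn UNIV V (\<lambda>e. W (a e) (b e))" for a b
    by (rule dfn_lift2[where \<Phi> = W, OF dom_ok_V]) (unfold W_def, intro cls_intros dG u)
  have W_ex: "\<exists>w\<in>V. W n w" if "n \<in> SN" for n
  proof (rule SN_induct[where P = "\<lambda>n. \<exists>w\<in>V. W n w", OF that])
    show "dfn UNIV V (\<lambda>e. \<exists>w\<in>V. W (e 0) w)" by (intro cls_intros dW)
    obtain z where z: "z \<in> V" "\<And>k. k \<epsilon> z \<longleftrightarrow> k \<epsilon> u \<and> G emp k" using sec[OF SN_emp] by blast
    have "W emp z" unfolding W_def by (auto simp: z nle_def)
    then show "\<exists>w\<in>V. W emp w" using z(1) by blast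
    fix n assume n: "n \<in> SN" "\<exists>w\<in>V. W n w"
    then obtain w where w: "w \<in> V" "W n w" by blast
    obtain z where z: "z \<in> V" "\<And>k. k \<epsilon> z \<longleftrightarrow> k \<epsilon> u \<and> G (suc n) k" using sec[OF SN_suc[OF n(1)]] by blast
    obtain y where y: "y \<in> V" "\<And>k. k \<epsilon> y \<longleftrightarrow> k \<epsilon> w \<or> k \<epsilon> z" using set_union[OF w(1) z(1)] by blast
    have "i \<le>\<^sub>N suc n \<longleftrightarrow> i \<le>\<^sub>N n \<or> i = suc n" for i
      using SN_V[OF n(1)] by (auto simp: nle_def)
    then have "W (suc n) y" unfolding W_def y(2) z(2) W[OF w(2)] using SN_V[OF n(1)] by auto
    then show "\<exists>w\<in>V. W (suc n) w" using y(1) by blast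
  qed
  have W_mono: "k \<epsilon> w'" if "W n w" "W n' w'" "n \<le>\<^sub>N n'" "n' \<in> SN" "k \<epsilon> w" for n n' w w' k
    using that W[OF that(1)] W[OF that(2)] nle_trans[of n' _ n] SN_N by blast
  have W_unique: "w = w'" if "W n w" "W n w'" for n w w'
    by (rule ext) (simp only: W[OF that(1)] W[OF that(2)])
  have "dfn UNIV V (\<lambda>e. \<exists>n\<in>SN. W n (e 0))" by (intro cls_intros dW)
  from cls_Collect[where P = "\<lambda>w. \<exists>n\<in>SN. W n w", OF this order_refl]
  obtain X where X: "\<And>w. w \<epsilon> X \<longleftrightarrow> w \<in> V \<and> (\<exists>n\<in>SN. W n w)" by auto
  have max: "\<exists>w n. w \<epsilon> y \<and> n \<in> SN \<and> W n w \<and> (\<forall>w'. w' \<epsilon> y \<longrightarrow> (\<forall>k. k \<epsilon> w' \<longrightarrow> k \<epsilon> w))"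
    if y: "y \<in> V" "y \<noteq> emp" "\<And>w. w \<epsilon> y \<Longrightarrow> w \<epsilon> X" for y
  proof -
    have "\<exists>m. m \<epsilon> y \<and> (\<forall>w'. w' \<epsilon> y \<longrightarrow> (\<forall>k\<in>V. k \<epsilon> w' \<longrightarrow> k \<epsilon> m))"
    proof (rule set_max[OF _ y(1,2)])
      show "dfn V V (\<lambda>e. \<forall>k\<in>V. k \<epsilon> e 0 \<longrightarrow> k \<epsilon> e (Suc 0))" by (intro set_intros)
      fix a b assume "a \<epsilon> y" "b \<epsilon> y"
      then obtain n n' where n: "n \<in> SN" "W n a" "n' \<in> SN" "W n' b" using y(3) X by blast
      then show "(\<forall>k\<in>V. k \<epsilon> a \<longrightarrow> k \<epsilon> b) \<or> (\<forall>k\<in>V. k \<epsilon> b \<longrightarrow> k \<epsilon> a)"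
        using nle_linear[of n n'] SN_N W_mono by blast
    qed blast
    then obtain m where m: "m \<epsilon> y" "\<And>w' k. w' \<epsilon> y \<Longrightarrow> k \<in> V \<Longrightarrow> k \<epsilon> w' \<Longrightarrow> k \<epsilon> m" by blast
    obtain n where "n \<in> SN" "W n m" using X y(3)[OF m(1)] by blast
    moreover have "\<forall>w'. w' \<epsilon> y \<longrightarrow> (\<forall>k. k \<epsilon> w' \<longrightarrow> k \<epsilon> m)" using m(2) mem_V by blast
    ultimately show ?thesis using m(1) by blast
  qed
  \<comment> \<open>The small set of all stages up to \<open>n\<close>. It will include every set of
    stages whose largest member is stage \<open>n\<close>, which is what thinness of
    \<open>X\<close> requires.\<close>
  have T: "\<exists>t\<in>V. t \<in> {x \<in> V. small x} \<and> (\<forall>w\<in>V. w \<epsilon> t \<longleftrightarrow> (\<exists>i\<in>SN. i \<le>\<^sub>N n \<and> W i w))" if "n \<in> SN" for n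
  proof (rule SN_induct[where P = "\<lambda>n. \<exists>t\<in>V. t \<in> {x \<in> V. small x} \<and> (\<forall>w\<in>V. w \<epsilon> t \<longleftrightarrow> (\<exists>i\<in>SN. i \<le>\<^sub>N n \<and> W i w))", OF that])
    show "dfn UNIV V (\<lambda>e. \<exists>t\<in>V. t \<in> {x \<in> V. small x} \<and> (\<forall>w\<in>V. w \<epsilon> t \<longleftrightarrow> (\<exists>i\<in>SN. i \<le>\<^sub>N e 0 \<and> W i w)))"
      by (intro cls_intros dW dfn_cls[OF cls_small])
    obtain w where w: "w \<in> V" "W emp w" using W_ex[OF SN_emp] by blast
    have "z \<epsilon> adj emp w \<longleftrightarrow> (\<exists>i\<in>SN. i \<le>\<^sub>N emp \<and> W i z)" for z
    proof -
      have "i \<le>\<^sub>N emp \<longleftrightarrow> i = emp" for i by (simp add: nle_def)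
      then have "(\<exists>i\<in>SN. i \<le>\<^sub>N emp \<and> W i z) \<longleftrightarrow> W emp z" using SN_emp by auto
      also have "\<dots> \<longleftrightarrow> z = w" using W_unique w(2) by blast
      finally show ?thesis using w(1) by simp
    qed
    then show "\<exists>t\<in>V. t \<in> {x \<in> V. small x} \<and> (\<forall>w\<in>V. w \<epsilon> t \<longleftrightarrow> (\<exists>i\<in>SN. i \<le>\<^sub>N emp \<and> W i w))"
      using w(1) small_adj[OF small_emp emp_V w(1)] by (intro bexI[of _ "adj emp w"]) simp_all
    fix n assume n: "n \<in> SN" "\<exists>t\<in>V. t \<in> {x \<in> V. small x} \<and> (\<forall>w\<in>V. w \<epsilon> t \<longleftrightarrow> (\<exists>i\<in>SN. i \<le>\<^sub>N n \<and> W i w))"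
    then obtain t where t: "t \<in> V" "small t" "\<forall>w\<in>V. w \<epsilon> t \<longleftrightarrow> (\<exists>i\<in>SN. i \<le>\<^sub>N n \<and> W i w)" by blast
    obtain w where w: "w \<in> V" "W (suc n) w" using W_ex[OF SN_suc[OF n(1)]] by blast
    have i: "i \<le>\<^sub>N suc n \<longleftrightarrow> i \<le>\<^sub>N n \<or> i = suc n" for i
      using SN_V[OF n(1)] by (auto simp: nle_def)
    have "z \<epsilon> adj t w \<longleftrightarrow> (\<exists>i\<in>SN. i \<le>\<^sub>N suc n \<and> W i z)" if "z \<in> V" for z
    proof -
      have "z \<epsilon> adj t w \<longleftrightarrow> z = w \<or> (\<exists>i\<in>SN. i \<le>\<^sub>N n \<and> W i z)" using t w that by simp
      also have "z = w \<longleftrightarrow> W (suc n) z" using W_unique w(2) by blast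
      finally show ?thesis using i SN_suc[OF n(1)] by blast
    qed
    then show "\<exists>t\<in>V. t \<in> {x \<in> V. small x} \<and> (\<forall>w\<in>V. w \<epsilon> t \<longleftrightarrow> (\<exists>i\<in>SN. i \<le>\<^sub>N suc n \<and> W i w))"
      using t w small_adj[OF t(2,1) w(1)] by (intro bexI[of _ "adj t w"]) simp_all
  qed
  have thX: "thin X" unfolding thin_def
  proof (intro ballI impI)
    fix y assume y: "y \<in> V" "elts y \<subseteq> elts X"
    then have sub: "w \<epsilon> y \<Longrightarrow> w \<epsilon> X" for w by (auto simp: subset_eq)
    show "small y"
    proof (cases "y = emp")
      case False
      obtain w n where w: "w \<epsilon> y" "n \<in> SN" "W n w" "\<And>w' k. w' \<epsilon> y \<Longrightarrow> k \<epsilon> w' \<Longrightarrow> k \<epsilon> w"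
        using max[OF y(1) False sub] by blast
      obtain t where t: "small t" "\<And>w. w \<in> V \<Longrightarrow> w \<epsilon> t \<longleftrightarrow> (\<exists>i\<in>SN. i \<le>\<^sub>N n \<and> W i w)" using T[OF w(2)] by auto
      show ?thesis
      proof (rule small_mono[OF t(1)])
        fix z assume z: "z \<epsilon> y"
        then obtain i where i: "i \<in> SN" "W i z" "z \<in> V" using sub X by blast
        show "z \<epsilon> t"
        proof (cases "i \<le>\<^sub>N n")
          case True then show ?thesis using i t(2) by blast
        next
          case False
          \<comment> \<open>A member with an index beyond \<open>n\<close> contains stage
            \<open>n\<close> by monotonicity and is contained in it by maximality, so it is the same
            set.\<close>
          then have "n \<le>\<^sub>N i" using nle_linear[of n i] SN_N i w by blast
          then have "k \<epsilon> z" if "k \<epsilon> w" for k using W_mono[OF w(3) i(2) _ i(1) that] by blast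
          then have "z = w" using w(4)[OF z] by (intro ext) blast
          then show ?thesis using w(2,3) i(3) t(2) nle_refl by blast
        qed
      qed
    qed (simp add: small_emp)
  qed
  have uX: "elts u \<subseteq> \<Union> (elts ` elts X)"
  proof
    fix k assume "k \<in> elts u"
    then have k: "k \<epsilon> u" by simp
    obtain i where i: "i \<in> SN" "G i k" using cover[OF k] by blast
    obtain w where w: "w \<in> V" "W i w" using W_ex[OF i(1)] by blast
    have "k \<epsilon> w" using W[OF w(2)] k i SN_V nle_refl by blast
    moreover have "w \<epsilon> X" using X w i by blast
    ultimately show "k \<in> \<Union> (elts ` elts X)" by auto
  qed
  from Comp[OF thX u uX] obtain x
    where x: "x \<in> V" "elts x \<subseteq> elts X" "elts u \<subseteq> \<Union> (elts ` elts x)" by (elim bexE conjE)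
  have sub: "w \<epsilon> x \<Longrightarrow> w \<epsilon> X" for w using x(2) by (auto simp: subset_eq)
  have cov: "\<exists>w. w \<epsilon> x \<and> k \<epsilon> w" if "k \<epsilon> u" for k
  proof -
    have "k \<in> \<Union> (elts ` elts x)" using x(3) that by (intro subsetD[OF x(3)]) simp
    then show ?thesis by auto
  qed
  show ?thesis
  proof (cases "x = emp")
    case True
    then have "\<not> k \<epsilon> u" for k using cov by auto
    then show ?thesis using SN_emp by blast
  next
    case False
    obtain w n where w: "w \<epsilon> x" "n \<in> SN" "W n w" "\<And>w' k. w' \<epsilon> x \<Longrightarrow> k \<epsilon> w' \<Longrightarrow> k \<epsilon> w"
      using max[OF x(1) False sub] by blast
    have "k \<epsilon> u \<Longrightarrow> k \<epsilon> w" for k using cov w(4) by blast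
    then show ?thesis using W[OF w(3)] w(2) by blast
  qed
qed

section \<open>Values of class functions\<close>

lemma app_mem:
  assumes "fun_on F D" "x \<in> D" shows "app F x \<in> V" "pair x (app F x) \<epsilon> F"
proof -
  have "\<exists>!y. y \<in> V \<and> pair x y \<epsilon> F" using assms by (simp add: fun_on_def)
  from theI'[OF this] show "app F x \<in> V" "pair x (app F x) \<epsilon> F" unfolding app_def by blast+
qed

lemma app_eq_iff:
  assumes "fun_on F D" "x \<in> D" "y \<in> V" shows "y = app F x \<longleftrightarrow> pair x y \<epsilon> F"
proof
  assume "pair x y \<epsilon> F"
  moreover have "\<exists>!y. y \<in> V \<and> pair x y \<epsilon> F" using assms by (simp add: fun_on_def)
  ultimately show "y = app F x" using app_mem[OF assms(1,2)] assms(3) by blast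
qed (use app_mem[OF assms(1,2)] in simp)

text \<open>Totalized application: definability of a function requires a value in \<open>V\<close>
  for every set, and the description in \<open>app\<close> guarantees one on the domain only. The
  default \<open>emp\<close> is itself a set.\<close>

definition ap :: "'c \<Rightarrow> 'c set \<Rightarrow> 'c \<Rightarrow> 'c" where
  "ap F D x = (if x \<in> D then app F x else emp)"

lemma fn_ap:
  assumes F: "fun_on F D" and D: "is_cls D" and a: "fn UNIV V a"
  shows "fn UNIV V (\<lambda>e. ap F D (a e))"
proof (rule fn_lift1[where f = "ap F D", OF dom_ok_V _ a])
  have apV: "ap F D x \<in> V" for x using app_mem(1)[OF F] by (simp add: ap_def)
  have "dfn UNIV V (\<lambda>e. (e (Suc 0) \<in> D \<and> pair (e (Suc 0)) (e 0) \<epsilon> F) \<or> (\<not> e (Suc 0) \<in> D \<and> e 0 = emp))"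
    by (intro cls_intros dfn_cls[OF D])
  then have "dfn UNIV V (\<lambda>e. e 0 = ap F D (e (Suc 0)))"
  proof (rule dfn_cong)
    fix e :: "nat \<Rightarrow> 'c" assume "range e \<subseteq> V"
    then have "e 0 \<in> V" by blast
    then show "(e 0 = ap F D (e (Suc 0))) =
      ((e (Suc 0) \<in> D \<and> pair (e (Suc 0)) (e 0) \<epsilon> F) \<or> (\<not> e (Suc 0) \<in> D \<and> e 0 = emp))"
      using app_eq_iff[OF F] by (cases "e (Suc 0) \<in> D") (simp_all add: ap_def)
  qed
  then show "fn UNIV V (\<lambda>e. ap F D (e 0))" by (simp add: fn_def apV)
qed

lemma fun_on_eqI:
  assumes F: "fun_on F D" and G: "fun_on G D" and D: "D \<subseteq> V" and eq: "\<And>x. x \<in> D \<Longrightarrow> app F x = app G x"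
  shows "F = G"
proof (rule ext)
  fix p
  have *: "p \<epsilon> K'" if K: "fun_on K D" and K': "fun_on K' D" and eq: "\<And>x. x \<in> D \<Longrightarrow> app K x = app K' x"
    and p: "p \<epsilon> K" for K K'
  proof -
    obtain x y where xy: "x \<in> D" "y \<in> V" "p = pair x y"
      using K p unfolding fun_on_def by auto
    then have "y = app K x" using app_eq_iff[OF K xy(1,2)] p by simp
    then show ?thesis using app_eq_iff[OF K' xy(1,2)] eq xy by simp
  qed
  show "p \<epsilon> F \<longleftrightarrow> p \<epsilon> G" using *[OF F G eq] *[OF G F eq[symmetric]] by blast
qed

text \<open>In fractions, \<open>k/H\<close> is the grid point below \<open>m'/(n+1)\<close>, with
  remainder \<open>r\<close>, and \<open>m/i\<close> is at most \<open>(m'+1)/(n+1)\<close>.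
  Multiplying out, the slack \<open>H\<close> is gained \<open>n+1\<close> times but lost only
  \<open>i\<close> times, and \<open>i\<close> is at most \<open>n\<close>; so one \<open>H\<close>
  must be absorbed by \<open>r \<star> i\<close>. This is impossible for standard \<open>r\<close>
  and \<open>i\<close> when \<open>H\<close> is nonstandard.\<close>

lemma grid_lower:
  assumes "k \<in> N" "r \<in> N" "m \<in> N" "m' \<in> N" "n \<in> N" "i \<in> N" "H \<in> N"
    and div: "m' \<star> H = k \<star> suc n \<uplus> r" and m: "m \<star> suc n \<le>\<^sub>N suc m' \<star> i" and i: "i \<le>\<^sub>N n"
    and le: "k \<star> i \<uplus> H \<le>\<^sub>N m \<star> H"
  shows "H \<le>\<^sub>N r \<star> i"
proof -
  define X where "X = k \<star> suc n \<star> i"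
  have X: "X \<in> N" using assms(1,5,6) by (simp add: X_def)
  have "(k \<star> i \<uplus> H) \<star> suc n \<le>\<^sub>N (m \<star> H) \<star> suc n" using assms(1-7) le by (intro nle_pmul_mono) simp_all
  also have "(k \<star> i \<uplus> H) \<star> suc n = H \<star> suc n \<uplus> X" by (simp add: X_def N_algebra)
  also have "(m \<star> H) \<star> suc n = (m \<star> suc n) \<star> H" by (simp add: pmul_ac)
  finally have 1: "H \<star> suc n \<uplus> X \<le>\<^sub>N (m \<star> suc n) \<star> H" .
  have "(m \<star> suc n) \<star> H \<le>\<^sub>N (suc m' \<star> i) \<star> H" using assms(1-7) m by (intro nle_pmul_mono) simp_all
  also have "(suc m' \<star> i) \<star> H = (m' \<star> H) \<star> i \<uplus> i \<star> H" using assms(4,6) by (simp add: pmul_suc N_algebra)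
  also have "\<dots> = (r \<star> i \<uplus> i \<star> H) \<uplus> X" unfolding div by (simp add: X_def N_algebra)
  finally have 2: "(m \<star> suc n) \<star> H \<le>\<^sub>N (r \<star> i \<uplus> i \<star> H) \<uplus> X" .
  have "H \<star> suc n \<uplus> X \<le>\<^sub>N (r \<star> i \<uplus> i \<star> H) \<uplus> X" by (rule nle_trans[OF _ 1 2]) (use assms X in simp)
  then have "H \<star> suc n \<le>\<^sub>N r \<star> i \<uplus> i \<star> H" using assms(1-7) X by simp
  moreover have "r \<star> i \<uplus> i \<star> H \<le>\<^sub>N r \<star> i \<uplus> n \<star> H"
    using assms(1-7) i by (intro nle_padd_mono nle_pmul_mono) simp_all
  ultimately have "H \<star> suc n \<le>\<^sub>N r \<star> i \<uplus> n \<star> H" using assms(1-7) by (rule_tac nle_trans) simp_all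
  then show ?thesis using assms(1-7) nle_padd_cancel[of H "r \<star> i" "n \<star> H"]
    by (simp add: pmul_suc pmul_commute[of H n] padd_commute[of "n \<star> H" H])
qed

text \<open>As \<open>k/H\<close> is at most \<open>m'/(n+1)\<close>, the hypothesis
  \<open>m\<close> bounds \<open>k i/H\<close> by \<open>m+1\<close>, one less than what is
  refuted.\<close>

lemma grid_upper:
  assumes "k \<in> N" "r \<in> N" "m \<in> N" "m' \<in> N" "n \<in> N" "i \<in> N" "H \<in> N" "H \<noteq> emp"
    and div: "m' \<star> H = k \<star> suc n \<uplus> r" and m: "m' \<star> i \<le>\<^sub>N suc m \<star> suc n"
  shows "\<not> suc (suc m) \<star> H \<le>\<^sub>N k \<star> i"
proof
  assume "suc (suc m) \<star> H \<le>\<^sub>N k \<star> i"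
  then have "(suc (suc m) \<star> H) \<star> suc n \<le>\<^sub>N (k \<star> i) \<star> suc n" using assms(1-7) by (intro nle_pmul_mono) simp_all
  also have "(k \<star> i) \<star> suc n = (k \<star> suc n) \<star> i" by (simp add: pmul_ac)
  finally have 1: "(suc (suc m) \<star> H) \<star> suc n \<le>\<^sub>N (k \<star> suc n) \<star> i" .
  have 2: "(k \<star> suc n) \<star> i \<le>\<^sub>N (m' \<star> H) \<star> i" unfolding div
    using assms(1-7) by (intro nle_pmul_mono nle_padd) simp_all
  have "(m' \<star> i) \<star> H \<le>\<^sub>N (suc m \<star> suc n) \<star> H" using assms(1-7) m by (intro nle_pmul_mono) simp_all
  then have 3: "(m' \<star> H) \<star> i \<le>\<^sub>N suc m \<star> (H \<star> suc n)" by (simp add: pmul_ac)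
  have "suc (suc m) \<star> (H \<star> suc n) \<le>\<^sub>N suc m \<star> (H \<star> suc n)"
    using nle_trans[OF _ nle_trans[OF _ 1 2] 3] assms(1-7) by (simp add: pmul_assoc)
  then have "suc (suc m) \<le>\<^sub>N suc m" using assms(1-8) by (simp add: pmul_eq_emp)
  then show False using mem_iff_suc_nle[of "suc m" "suc m"] N_not_self assms(3) by simp
qed

end

section \<open>The given field of real numbers\<close>

locale THS_reals = THS mem for mem :: "'c \<Rightarrow> 'c \<Rightarrow> bool"  (infix \<open>\<epsilon>\<close> 50) +
  fixes R A M L :: 'c
  assumes real_field: "real_field R A M L"
begin

abbreviation RR :: "'c ring" where
  "RR \<equiv> op_ring R A M"

abbreviation plus_R (infixl \<open>\<^bold>+\<close> 65) where "x \<^bold>+ y \<equiv> x \<oplus>\<^bsub>RR\<^esub> y"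
abbreviation times_R (infixl \<open>\<^bold>*\<close> 70) where "x \<^bold>* y \<equiv> x \<otimes>\<^bsub>RR\<^esub> y"
abbreviation zero_R (\<open>\<^bold>0\<close>) where "\<^bold>0 \<equiv> \<zero>\<^bsub>RR\<^esub>"
abbreviation one_R (\<open>\<^bold>1\<close>) where "\<^bold>1 \<equiv> \<one>\<^bsub>RR\<^esub>"

definition rle :: "'c \<Rightarrow> 'c \<Rightarrow> bool"  (infix \<open>\<le>\<^sub>R\<close> 50) where
  "x \<le>\<^sub>R y \<longleftrightarrow> (x, y) \<in> le_rel L"

lemma carrier_RR: "carrier RR = elts R"
  by (simp add: op_ring_def)

lemma ordered_field_R: "ordered_field R A M L"
  using real_field by (simp add: real_field_def)

lemma R_ofield: "ofield RR rle"
proof -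
  have *: "field RR" "linear_order_on (elts R) (le_rel L)"
    "\<forall>x\<in>elts R. \<forall>y\<in>elts R. \<forall>z\<in>elts R. (x, y) \<in> le_rel L \<longrightarrow> (x \<^bold>+ z, y \<^bold>+ z) \<in> le_rel L"
    "\<forall>x\<in>elts R. \<forall>y\<in>elts R. (\<^bold>0, x) \<in> le_rel L \<and> (\<^bold>0, y) \<in> le_rel L \<longrightarrow>
        (\<^bold>0, x \<^bold>* y) \<in> le_rel L"
    using ordered_field_R unfolding ordered_field_def by - (elim conjE, assumption)+
  have r: "refl_on (elts R) (le_rel L)" "trans (le_rel L)" "antisym (le_rel L)" "total_on (elts R) (le_rel L)"
    using *(2) unfolding linear_order_on_def partial_order_on_def preorder_on_def by blast+
  show ?thesis
  proof (rule ofield.intro[OF *(1)], unfold_locales, unfold carrier_RR rle_def)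
    show "(x, x) \<in> le_rel L" if "x \<in> elts R" for x using refl_onD[OF r(1) that] .
    show "x = y" if "(x, y) \<in> le_rel L" "(y, x) \<in> le_rel L" for x y using antisymD[OF r(3) that] .
    show "(x, z) \<in> le_rel L" if "(x, y) \<in> le_rel L" "(y, z) \<in> le_rel L" for x y z using transD[OF r(2) that] .
    show "(x, y) \<in> le_rel L \<or> (y, x) \<in> le_rel L" if "x \<in> elts R" "y \<in> elts R" for x y
    proof (cases "x = y")
      case True
      then show ?thesis using refl_onD[OF r(1) that(1)] by simp
    next
      case False
      then show ?thesis using r(4)[unfolded total_on_def, rule_format, OF that] by simp
    qed
    show "(x \<^bold>+ z, y \<^bold>+ z) \<in> le_rel L"
      if "x \<in> elts R" "y \<in> elts R" "z \<in> elts R" "(x, y) \<in> le_rel L" for x y z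
      using *(3)[rule_format, OF that] .
    show "(\<^bold>0, x \<^bold>* y) \<in> le_rel L"
      if "x \<in> elts R" "y \<in> elts R" "(\<^bold>0, x) \<in> le_rel L" "(\<^bold>0, y) \<in> le_rel L" for x y
      using *(4)[rule_format, OF that(1,2) conjI[OF that(3,4)]] .
  qed
qed

sublocale RF: ofield RR rle
  by (rule R_ofield)

sublocale QF: ofield Qring "(\<le>\<^sub>Q)"
  by (rule Q_ofield)

lemma carrier_V: "x \<in> carrier RR \<Longrightarrow> x \<in> V"
  unfolding carrier_RR elts_iff by (rule mem_V)

text \<open>Suprema exist for subclasses only; a HOL set must be named by a class first. Each
  supremum taken below therefore comes with a definability proof.\<close>

lemma R_complete:
  assumes "is_cls B" "B \<subseteq> carrier RR" "B \<noteq> {}" "b \<in> carrier RR" "\<forall>y\<in>B. y \<le>\<^sub>R b"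
  shows "\<exists>s\<in>carrier RR. (\<forall>y\<in>B. y \<le>\<^sub>R s) \<and> (\<forall>b\<in>carrier RR. (\<forall>y\<in>B. y \<le>\<^sub>R b) \<longrightarrow> s \<le>\<^sub>R b)"
proof -
  obtain C where C: "\<And>x. x \<epsilon> C \<longleftrightarrow> x \<in> B" using assms(1) by (auto simp: is_cls_def)
  have el: "elts C = B" using C by (auto simp: elts_def)
  have ub: "upper_bound R L C b \<longleftrightarrow> b \<in> carrier RR \<and> (\<forall>y\<in>B. y \<le>\<^sub>R b)" for b
    unfolding upper_bound_def el rle_def carrier_RR elts_iff by (rule refl)
  have "\<forall>Y. elts Y \<subseteq> elts R \<and> elts Y \<noteq> {} \<and> (\<exists>b. upper_bound R L Y b) \<longrightarrow>
        (\<exists>s. upper_bound R L Y s \<and> (\<forall>b. upper_bound R L Y b \<longrightarrow> (s, b) \<in> le_rel L))"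
    using real_field unfolding real_field_def by (elim conjE)
  then have "elts C \<subseteq> elts R \<and> elts C \<noteq> {} \<and> (\<exists>b. upper_bound R L C b) \<longrightarrow>
        (\<exists>s. upper_bound R L C s \<and> (\<forall>b. upper_bound R L C b \<longrightarrow> (s, b) \<in> le_rel L))" by (rule spec)
  then have "\<exists>s. upper_bound R L C s \<and> (\<forall>b. upper_bound R L C b \<longrightarrow> (s, b) \<in> le_rel L)"
    using assms(2-5) ub unfolding el carrier_RR by blast
  then show ?thesis unfolding ub rle_def[symmetric] by blast
qed

definition RxR :: "'c set" where
  "RxR = {pair x y | x y. x \<epsilon> R \<and> y \<epsilon> R}"

lemma is_cls_R: "is_cls (carrier RR)"
  unfolding carrier_RR by (rule is_cls_elts)

lemma is_cls_RxR: "is_cls RxR"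
proof -
  have "dfn UNIV V (\<lambda>e. \<exists>x\<in>carrier RR. \<exists>y\<in>carrier RR. e 0 = pair x y)"
    by (intro dfn_ex_cls is_cls_R cls_intros)
  from is_cls_Collect[where P = "\<lambda>p. \<exists>x\<in>carrier RR. \<exists>y\<in>carrier RR. p = pair x y", OF this]
  have "is_cls {p \<in> V. \<exists>x\<in>carrier RR. \<exists>y\<in>carrier RR. p = pair x y}" .
  also have "{p \<in> V. \<exists>x\<in>carrier RR. \<exists>y\<in>carrier RR. p = pair x y} = RxR"
    unfolding RxR_def carrier_RR using mem_V by (auto intro!: pair_V)
  finally show ?thesis .
qed

lemma fun_A: "fun_on A RxR" and fun_M: "fun_on M RxR"
  using ordered_field_R unfolding ordered_field_def fun_into_def RxR_def by - (elim conjE, assumption)+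

text \<open>A total variant of the addition of \<open>RR\<close>, with which it agrees on the
  carrier, so that real sums may occur inside definable predicates; likewise
  \<open>rmul\<close>.\<close>

definition radd :: "'c \<Rightarrow> 'c \<Rightarrow> 'c" where
  "radd x y = ap A RxR (pair x y)"

definition rmul :: "'c \<Rightarrow> 'c \<Rightarrow> 'c" where
  "rmul x y = ap M RxR (pair x y)"

lemma radd_eq: "x \<in> carrier RR \<Longrightarrow> y \<in> carrier RR \<Longrightarrow> x \<^bold>+ y = radd x y"
  and rmul_eq: "x \<in> carrier RR \<Longrightarrow> y \<in> carrier RR \<Longrightarrow> x \<^bold>* y = rmul x y"
  by (auto simp: radd_def rmul_def ap_def op_ring_def RxR_def)

lemma fn_radd: "fn UNIV V a \<Longrightarrow> fn UNIV V b \<Longrightarrow> fn UNIV V (\<lambda>e. radd (a e) (b e))"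
  unfolding radd_def by (intro fn_ap fun_A is_cls_RxR fn_pair dom_ok_V)

lemma fn_rmul: "fn UNIV V a \<Longrightarrow> fn UNIV V b \<Longrightarrow> fn UNIV V (\<lambda>e. rmul (a e) (b e))"
  unfolding rmul_def by (intro fn_ap fun_M is_cls_RxR fn_pair dom_ok_V)

lemma dfn_rle: "fn UNIV V a \<Longrightarrow> fn UNIV V b \<Longrightarrow> dfn UNIV V (\<lambda>e. a e \<le>\<^sub>R b e)"
  unfolding rle_def le_rel_def mem_Collect_eq case_prod_conv by (intro cls_intros)

subsection \<open>The embedding of the standard numbers into the real numbers\<close>

definition emb_fun :: "'c \<Rightarrow> bool" where
  "emb_fun F \<longleftrightarrow> fun_on F SN \<and> app F emp = \<^bold>0 \<and>
    (\<forall>n\<in>SN. app F n \<in> carrier RR \<and> app F (suc n) = app F n \<^bold>+ \<^bold>1)"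

text \<open>The relation \<open>G\<close> given to dependent choice is the graph of adding one, so
  the sequence obtained satisfies the recursion equations.\<close>

lemma emb_fun_exists: "\<exists>F. emb_fun F"
proof -
  have 1: "\<^bold>1 \<in> V" using carrier_V RF.one_closed .
  have "dfn UNIV V (\<lambda>e. \<exists>x\<in>carrier RR. \<exists>y\<in>carrier RR. e 0 = pair x y \<and> y = radd x \<^bold>1)"
    by (intro dfn_ex_cls is_cls_R cls_intros fn_radd 1)
  from cls_Collect[where P = "\<lambda>p. \<exists>x\<in>carrier RR. \<exists>y\<in>carrier RR. p = pair x y \<and> y = radd x \<^bold>1", OF this order_refl]
  obtain G where G: "\<And>p. p \<epsilon> G \<longleftrightarrow> p \<in> V \<and> (\<exists>x\<in>carrier RR. \<exists>y\<in>carrier RR. p = pair x y \<and> y = radd x \<^bold>1)"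
    by auto
  have G': "pair x y \<epsilon> G \<longleftrightarrow> y = x \<^bold>+ \<^bold>1" if "x \<in> carrier RR" "y \<in> carrier RR" for x y
  proof -
    have V: "x \<in> V" "y \<in> V" using that carrier_V by blast+
    have "(\<exists>x'\<in>carrier RR. \<exists>y'\<in>carrier RR. pair x y = pair x' y' \<and> y' = radd x' \<^bold>1) \<longleftrightarrow> y = radd x \<^bold>1"
      using that V pair_eq carrier_V by metis
    then show ?thesis using V that by (simp add: G radd_eq)
  qed
  have G1: "\<forall>x\<in>elts R. \<exists>y\<in>elts R. pair x y \<epsilon> G" unfolding carrier_RR[symmetric]
  proof
    fix x assume x: "x \<in> carrier RR"
    then have "x \<^bold>+ \<^bold>1 \<in> carrier RR" by simp
    then show "\<exists>y\<in>carrier RR. pair x y \<epsilon> G" using G' x by blast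
  qed
  have "\<^bold>0 \<epsilon> R" using RF.zero_closed unfolding carrier_RR by simp
  from dependent_choice[OF G1 this] obtain F where F: "fun_into F SN (elts R)" "app F emp = \<^bold>0"
    "\<forall>n\<in>SN. pair (app F n) (app F (suc n)) \<epsilon> G"
    by (elim exE conjE)
  have "emb_fun F" unfolding emb_fun_def
  proof (intro conjI ballI)
    show "fun_on F SN" using F(1) by (simp add: fun_into_def)
    have c: "app F n \<in> carrier RR" if "n \<in> SN" for n using F(1) that unfolding fun_into_def carrier_RR by blast
    fix n assume n: "n \<in> SN"
    show "app F n \<in> carrier RR" using c n .
    show "app F (suc n) = app F n \<^bold>+ \<^bold>1" using F(3) n G' c SN_suc by blast
  qed (rule F(2))
  then show ?thesis by blast
qed

text \<open>Being the application of a class function, the embedding is definable and may occur in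
  inductions over \<open>SN\<close>; any choice of the class will do.\<close>

definition emb :: "'c \<Rightarrow> 'c" where
  "emb = ap (SOME F. emb_fun F) SN"

lemma emb_fun_emb: "emb_fun (SOME F. emb_fun F)"
  using emb_fun_exists by (rule someI_ex)

lemma emb_R [simp]: "n \<in> SN \<Longrightarrow> emb n \<in> carrier RR"
  and emb_emp: "emb emp = \<^bold>0"
  and emb_suc: "n \<in> SN \<Longrightarrow> emb (suc n) = emb n \<^bold>+ \<^bold>1"
  using emb_fun_emb unfolding emb_fun_def emb_def ap_def by simp_all

lemma emb_funD: "emb_fun F \<Longrightarrow> fun_on F SN"
  by (simp add: emb_fun_def)

lemma fn_emb: "fn UNIV V a \<Longrightarrow> fn UNIV V (\<lambda>e. emb (a e))"
  unfolding emb_def by (intro fn_ap is_cls_SN emb_funD[OF emb_fun_emb])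

lemmas real_intros = cls_intros fn_radd fn_rmul fn_emb dfn_rle dfn_ex_cls[OF is_cls_R] dfn_all_cls[OF is_cls_R]
  dfn_cls[OF is_cls_R]

lemma emb_V: "n \<in> SN \<Longrightarrow> emb n \<in> V"
  using carrier_V emb_R .

lemma emb_add: assumes "m \<in> SN" "n \<in> SN" shows "emb (m \<uplus> n) = emb m \<^bold>+ emb n"
proof -
  have "emb (m \<uplus> n) = radd (emb m) (emb n)"
  proof (rule SN_induct[where P = "\<lambda>n. emb (m \<uplus> n) = radd (emb m) (emb n)", OF assms(2)])
    show "dfn UNIV V (\<lambda>e. emb (m \<uplus> e 0) = radd (emb m) (emb (e 0)))"
      by (intro real_intros emb_V SN_V[OF assms(1)] assms(1))
    show "emb (m \<uplus> emp) = radd (emb m) (emb emp)"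
      using assms(1) SN_N emb_emp by (simp add: radd_eq[symmetric])
    fix n assume n: "n \<in> SN" "emb (m \<uplus> n) = radd (emb m) (emb n)"
    have "emb (m \<uplus> suc n) = (emb m \<^bold>+ emb n) \<^bold>+ \<^bold>1"
      using n assms(1) SN_N by (simp add: padd_suc emb_suc radd_eq)
    also have "\<dots> = emb m \<^bold>+ emb (suc n)" using n(1) assms(1) by (simp add: emb_suc RF.a_assoc)
    finally show "emb (m \<uplus> suc n) = radd (emb m) (emb (suc n))" using n(1) assms(1) by (simp add: radd_eq)
  qed
  then show ?thesis using assms by (simp add: radd_eq)
qed

lemma emb_mult: assumes "m \<in> SN" "n \<in> SN" shows "emb (m \<star> n) = emb m \<^bold>* emb n"
proof -
  have "emb (m \<star> n) = rmul (emb m) (emb n)"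
  proof (rule SN_induct[where P = "\<lambda>n. emb (m \<star> n) = rmul (emb m) (emb n)", OF assms(2)])
    show "dfn UNIV V (\<lambda>e. emb (m \<star> e 0) = rmul (emb m) (emb (e 0)))"
      by (intro real_intros emb_V SN_V[OF assms(1)] assms(1))
    show "emb (m \<star> emp) = rmul (emb m) (emb emp)"
      using assms(1) SN_N emb_emp by (simp add: rmul_eq[symmetric])
    fix n assume n: "n \<in> SN" "emb (m \<star> n) = rmul (emb m) (emb n)"
    have "emb (m \<star> suc n) = emb m \<^bold>* emb n \<^bold>+ emb m"
      using n assms(1) SN_N by (simp add: pmul_suc emb_add rmul_eq)
    also have "\<dots> = emb m \<^bold>* emb (suc n)" using n(1) assms(1) by (simp add: emb_suc RF.r_distr)
    finally show "emb (m \<star> suc n) = rmul (emb m) (emb (suc n))" using n(1) assms(1) by (simp add: rmul_eq)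
  qed
  then show ?thesis using assms by (simp add: rmul_eq)
qed

lemma emb_nonneg: assumes "n \<in> SN" shows "\<^bold>0 \<le>\<^sub>R emb n"
proof (rule SN_induct[where P = "\<lambda>n. \<^bold>0 \<le>\<^sub>R emb n", OF assms])
  show "dfn UNIV V (\<lambda>e. \<^bold>0 \<le>\<^sub>R emb (e 0))"
    by (intro real_intros carrier_V RF.zero_closed)
  show "\<^bold>0 \<le>\<^sub>R emb emp" using emb_emp RF.le_refl[OF RF.zero_closed] by simp
  fix n assume n: "n \<in> SN" "\<^bold>0 \<le>\<^sub>R emb n"
  then have "\<^bold>0 \<^bold>+ \<^bold>0 \<le>\<^sub>R emb n \<^bold>+ \<^bold>1"
    using RF.zero_le_one by (rule_tac RF.add_mono) simp_all
  then show "\<^bold>0 \<le>\<^sub>R emb (suc n)" using n by (simp add: emb_suc)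
qed

lemma emb_le: assumes "m \<in> SN" "n \<in> SN" shows "emb m \<le>\<^sub>R emb n \<longleftrightarrow> m \<le>\<^sub>N n"
proof
  assume "m \<le>\<^sub>N n"
  then obtain k where k: "k \<in> N" "n = m \<uplus> k" using nle_iff assms SN_N by blast
  then have "k \<in> SN" using nle_padd[of k m] SN_nle[of n k] assms SN_N by (simp add: padd_commute)
  then show "emb m \<le>\<^sub>R emb n"
    using k assms emb_nonneg RF.le_add_iff2[of "\<^bold>0" "emb k" "emb m"] by (simp add: emb_add)
next
  assume *: "emb m \<le>\<^sub>R emb n"
  show "m \<le>\<^sub>N n"
  proof (rule ccontr)
    assume "\<not> m \<le>\<^sub>N n"
    then have "n \<epsilon> m" using not_nle assms SN_N by blast
    then obtain k where k: "k \<in> N" "m = n \<uplus> suc k" using mem_iff assms SN_N by blast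
    have "suc k \<le>\<^sub>N suc k \<uplus> n" using k(1) SN_N[OF assms(2)] by (intro nle_padd) simp_all
    then have "suc k \<le>\<^sub>N m" using k(2) padd_commute by metis
    then have "suc k \<in> SN" by (rule SN_nle[OF assms(1)])
    then have "k \<in> SN" by (rule SN_elem) (use N_V[OF k(1)] in simp)
    then have "emb n \<^bold>+ (emb k \<^bold>+ \<^bold>1) \<le>\<^sub>R emb n \<^bold>+ \<^bold>0"
      using * k \<open>k \<in> SN\<close> assms by (simp add: emb_add emb_suc)
    then have le: "emb k \<^bold>+ \<^bold>1 \<le>\<^sub>R \<^bold>0"
      using \<open>k \<in> SN\<close> assms by (rule_tac iffD1[OF RF.le_add_iff2[of _ _ "emb n"]]) simp_all
    have "\<^bold>0 \<^bold>+ \<^bold>1 \<le>\<^sub>R emb k \<^bold>+ \<^bold>1"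
      using emb_nonneg \<open>k \<in> SN\<close> by (subst RF.le_add_iff) simp_all
    then have "\<^bold>1 \<le>\<^sub>R \<^bold>0"
      using le RF.le_trans[of "\<^bold>1" "emb k \<^bold>+ \<^bold>1" "\<^bold>0"] \<open>k \<in> SN\<close> by simp
    then show False using RF.zero_lt_one by blast
  qed
qed

lemma emb_pos: assumes "n \<in> SN" "n \<noteq> emp" shows "\<not> emb n \<le>\<^sub>R \<^bold>0"
  using emb_le[OF assms(1) SN_emp] assms(2) by (simp add: emb_emp nle_def)

lemma archimedean: assumes "x \<in> carrier RR" shows "\<exists>n\<in>SN. \<not> emb n \<le>\<^sub>R x"
proof (rule ccontr)
  assume "\<not> ?thesis"
  then have x: "\<forall>n\<in>SN. emb n \<le>\<^sub>R x" by blast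
  have "dfn UNIV V (\<lambda>e. \<exists>n\<in>SN. e 0 = emb n)" by (intro real_intros)
  from is_cls_Collect[where P = "\<lambda>y. \<exists>n\<in>SN. y = emb n", OF this]
  have B: "is_cls {y \<in> V. \<exists>n\<in>SN. y = emb n}" .
  have "\<exists>s\<in>carrier RR. (\<forall>y\<in>{y \<in> V. \<exists>n\<in>SN. y = emb n}. y \<le>\<^sub>R s) \<and>
      (\<forall>b\<in>carrier RR. (\<forall>y\<in>{y \<in> V. \<exists>n\<in>SN. y = emb n}. y \<le>\<^sub>R b) \<longrightarrow> s \<le>\<^sub>R b)"
  proof (rule R_complete[OF B _ _ assms])
    show "{y \<in> V. \<exists>n\<in>SN. y = emb n} \<noteq> {}" using emb_V[OF SN_emp] SN_emp by blast
  qed (use x in auto)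
  then obtain s where s0: "s \<in> carrier RR" "\<forall>y\<in>{y \<in> V. \<exists>n\<in>SN. y = emb n}. y \<le>\<^sub>R s"
    "\<forall>b\<in>carrier RR. (\<forall>y\<in>{y \<in> V. \<exists>n\<in>SN. y = emb n}. y \<le>\<^sub>R b) \<longrightarrow> s \<le>\<^sub>R b" by (elim bexE conjE)
  have s: "s \<in> carrier RR" "\<And>n. n \<in> SN \<Longrightarrow> emb n \<le>\<^sub>R s"
    "\<And>b. b \<in> carrier RR \<Longrightarrow> (\<And>n. n \<in> SN \<Longrightarrow> emb n \<le>\<^sub>R b) \<Longrightarrow> s \<le>\<^sub>R b"
  proof -
    show "emb n \<le>\<^sub>R s" if "n \<in> SN" for n using that emb_V[OF that] by (intro bspec[OF s0(2)]) blast
    show "s \<le>\<^sub>R b" if "b \<in> carrier RR" "\<And>n. n \<in> SN \<Longrightarrow> emb n \<le>\<^sub>R b" for b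
      using that by (intro mp[OF bspec[OF s0(3)]]) auto
  qed (rule s0(1))
  have "s \<le>\<^sub>R s \<ominus>\<^bsub>RR\<^esub> \<^bold>1"
  proof (rule s(3))
    fix n assume n: "n \<in> SN"
    have "emb n \<^bold>+ \<^bold>1 \<le>\<^sub>R s" using s(2)[OF SN_suc[OF n]] n by (simp add: emb_suc)
    then show "emb n \<le>\<^sub>R s \<ominus>\<^bsub>RR\<^esub> \<^bold>1" using RF.le_diff_iff n s(1) by simp
  qed (use s(1) in simp)
  then have "s \<^bold>+ \<^bold>1 \<le>\<^sub>R s \<^bold>+ \<^bold>0" using RF.le_diff_iff[of s s "\<^bold>1"] s(1) by simp
  then show False using RF.le_add_iff2[of "\<^bold>1" "\<^bold>0" s] RF.zero_lt_one s(1) by simp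
qed

text \<open>Found by induction on an Archimedean bound. \<open>N_least\<close> does not apply,
  because the condition refers to the real field and is only a class formula.\<close>

lemma floor_exists:
  assumes "z \<in> carrier RR" "\<^bold>0 \<le>\<^sub>R z" shows "\<exists>m\<in>SN. emb m \<le>\<^sub>R z \<and> \<not> emb (suc m) \<le>\<^sub>R z"
proof -
  obtain n where n: "n \<in> SN" "\<not> emb n \<le>\<^sub>R z" using archimedean[OF assms(1)] by blast
  have "\<not> emb n \<le>\<^sub>R z \<longrightarrow> (\<exists>m\<in>SN. emb m \<le>\<^sub>R z \<and> \<not> emb (suc m) \<le>\<^sub>R z)"
  proof (rule SN_induct[where P = "\<lambda>n. \<not> emb n \<le>\<^sub>R z \<longrightarrow> (\<exists>m\<in>SN. emb m \<le>\<^sub>R z \<and> \<not> emb (suc m) \<le>\<^sub>R z)", OF n(1)])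
    show "dfn UNIV V (\<lambda>e. \<not> emb (e 0) \<le>\<^sub>R z \<longrightarrow> (\<exists>m\<in>SN. emb m \<le>\<^sub>R z \<and> \<not> emb (suc m) \<le>\<^sub>R z))"
      by (intro real_intros carrier_V assms)
  qed (use assms(2) emb_emp in \<open>simp, blast\<close>)
  then show ?thesis using n(2) by blast
qed

section \<open>The embedding extended to the standard rationals\<close>

definition iota :: "'c \<Rightarrow> 'c" where
  "iota r = (emb (qpos r) \<ominus>\<^bsub>RR\<^esub> emb (qneg r)) \<^bold>* inv\<^bsub>RR\<^esub> emb (qden r)"

lemma iota_R: assumes "r \<in> SQ" shows "iota r \<in> carrier RR"
proof -
  have r: "r \<in> Q" "qpos r \<in> SN" "qneg r \<in> SN" "qden r \<in> SN" using assms SQ_iff by blast+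
  show ?thesis unfolding iota_def using r emb_pos Q_parts[OF r(1)] RF.inv_mult(3) by simp
qed

text \<open>Determines \<open>iota r\<close> from any representation with standard entries, free of
  subtraction and division. Order, sums and products of embedded rationals are all treated through
  this equation.\<close>

lemma iota_val:
  assumes v: "val r a b c" and abc: "a \<in> SN" "b \<in> SN" "c \<in> SN"
  shows "iota r \<^bold>* emb c \<^bold>+ emb b = emb a"
proof -
  have "r \<in> SQ" using val_SQ[OF assms] .
  then have r: "r \<in> Q" "qpos r \<in> SN" "qneg r \<in> SN" "qden r \<in> SN" using SQ_iff by blast+
  define x where "x = iota r"
  define D where "D = emb (qden r)"
  define Ng where "Ng = emb (qneg r)"
  define P where "P = emb (qpos r)"
  have c: "x \<in> carrier RR" "D \<in> carrier RR" "Ng \<in> carrier RR" "P \<in> carrier RR" "\<not> D \<le>\<^sub>R \<^bold>0"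
    "emb a \<in> carrier RR" "emb b \<in> carrier RR" "emb c \<in> carrier RR"
    using iota_R[OF \<open>r \<in> SQ\<close>] r abc emb_pos Q_parts[OF r(1)] by (simp_all add: x_def D_def Ng_def P_def)
  have "x \<^bold>* D = P \<ominus>\<^bsub>RR\<^esub> Ng"
    unfolding x_def iota_def D_def[symmetric] Ng_def[symmetric] P_def[symmetric]
    using c(2-5) by (simp add: RF.mult_cancel_inv)
  then have P: "P = x \<^bold>* D \<^bold>+ Ng" using c by (simp add: a_minus_def RF.a_assoc RF.l_neg)
  have "a \<star> qden r \<uplus> qneg r \<star> c = b \<star> qden r \<uplus> qpos r \<star> c" using v by (simp add: val_def)
  then have "emb (a \<star> qden r \<uplus> qneg r \<star> c) = emb (b \<star> qden r \<uplus> qpos r \<star> c)" by simp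
  then have "emb a \<^bold>* D \<^bold>+ Ng \<^bold>* emb c = emb b \<^bold>* D \<^bold>+ P \<^bold>* emb c"
    using r abc by (simp add: emb_add emb_mult D_def Ng_def P_def)
  also have "\<dots> = (x \<^bold>* emb c \<^bold>+ emb b) \<^bold>* D \<^bold>+ Ng \<^bold>* emb c"
    unfolding P using c(1-3,7,8) by algebra
  finally have "emb a \<^bold>* D = (x \<^bold>* emb c \<^bold>+ emb b) \<^bold>* D"
    using RF.add_minus_cancel[of "emb a \<^bold>* D" "Ng \<^bold>* emb c"]
      RF.add_minus_cancel[of "(x \<^bold>* emb c \<^bold>+ emb b) \<^bold>* D" "Ng \<^bold>* emb c"] c by simp
  then show ?thesis using RF.mult_cancel[of "emb a" "x \<^bold>* emb c \<^bold>+ emb b" D] c by (simp add: x_def)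
qed

lemma iota_le_iff:
  assumes "val r a b c" "a \<in> SN" "b \<in> SN" "c \<in> SN" "x \<in> carrier RR"
  shows "iota r \<le>\<^sub>R x \<longleftrightarrow> emb a \<le>\<^sub>R x \<^bold>* emb c \<^bold>+ emb b"
    and "x \<le>\<^sub>R iota r \<longleftrightarrow> x \<^bold>* emb c \<^bold>+ emb b \<le>\<^sub>R emb a"
proof -
  have c: "iota r \<in> carrier RR" "emb c \<in> carrier RR" "emb b \<in> carrier RR" "\<not> emb c \<le>\<^sub>R \<^bold>0"
    using iota_R val_SQ[OF assms(1-4)] assms emb_pos val_in[OF assms(1)] by simp_all
  show "iota r \<le>\<^sub>R x \<longleftrightarrow> emb a \<le>\<^sub>R x \<^bold>* emb c \<^bold>+ emb b"
    "x \<le>\<^sub>R iota r \<longleftrightarrow> x \<^bold>* emb c \<^bold>+ emb b \<le>\<^sub>R emb a"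
    unfolding iota_val[OF assms(1-4), symmetric]
    using c assms(5) RF.le_mult_iff[of "iota r" x "emb c"] RF.le_mult_iff[of x "iota r" "emb c"] by simp_all
qed

lemma iota_unique:
  assumes "val r a b c" "a \<in> SN" "b \<in> SN" "c \<in> SN" "x \<in> carrier RR"
    and "x \<^bold>* emb c \<^bold>+ emb b = emb a"
  shows "iota r = x"
  using iota_le_iff[OF assms(1-5)] assms(2,6) RF.le_refl[of "emb a"]
    RF.le_antisym[OF iota_R[OF val_SQ[OF assms(1-4)]] assms(5)] by simp

lemma iota_le_R: assumes "p \<in> SQ" "q \<in> SQ" shows "iota p \<le>\<^sub>R iota q \<longleftrightarrow> p \<le>\<^sub>Q q"
proof -
  obtain a b a' b' c where v: "val p a b c" "val q a' b' c" and
    S: "a \<in> SN" "b \<in> SN" "a' \<in> SN" "b' \<in> SN" "c \<in> SN" by (rule SQ_common[OF assms])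
  have c: "iota p \<in> carrier RR" "iota q \<in> carrier RR" "emb c \<in> carrier RR" "emb b \<in> carrier RR"
    "emb b' \<in> carrier RR" "emb a \<in> carrier RR"
    using iota_R assms S by simp_all
  have "p \<le>\<^sub>Q q \<longleftrightarrow> emb (a \<uplus> b') \<le>\<^sub>R emb (a' \<uplus> b)" using S by (simp add: val_le_common[OF v] emb_le)
  also have "\<dots> \<longleftrightarrow> emb a \<^bold>+ emb b' \<le>\<^sub>R (iota q \<^bold>* emb c \<^bold>+ emb b') \<^bold>+ emb b"
    using S by (simp add: emb_add iota_val[OF v(2)])
  also have "(iota q \<^bold>* emb c \<^bold>+ emb b') \<^bold>+ emb b = (iota q \<^bold>* emb c \<^bold>+ emb b) \<^bold>+ emb b'"
    using c by algebra
  also have "emb a \<^bold>+ emb b' \<le>\<^sub>R \<dots> \<longleftrightarrow> emb a \<le>\<^sub>R iota q \<^bold>* emb c \<^bold>+ emb b"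
    using c by simp
  also have "\<dots> \<longleftrightarrow> iota p \<le>\<^sub>R iota q" using iota_le_iff(1)[OF v(1) S(1,2,5) c(2)] by simp
  finally show ?thesis by simp
qed

lemma iota_qadd: assumes "p \<in> SQ" "q \<in> SQ" shows "qadd p q \<in> SQ" "iota (qadd p q) = iota p \<^bold>+ iota q"
proof -
  obtain a b a' b' c where v: "val p a b c" "val q a' b' c" and
    S: "a \<in> SN" "b \<in> SN" "a' \<in> SN" "b' \<in> SN" "c \<in> SN" by (rule SQ_common[OF assms])
  have c: "iota p \<in> carrier RR" "iota q \<in> carrier RR" "emb c \<in> carrier RR" "emb b \<in> carrier RR"
    "emb b' \<in> carrier RR" using iota_R assms S by simp_all
  note w = val_add_common[OF v]
  show "qadd p q \<in> SQ" using val_SQ[OF w] S by simp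
  have "(iota p \<^bold>+ iota q) \<^bold>* emb c \<^bold>+ (emb b \<^bold>+ emb b') =
    (iota p \<^bold>* emb c \<^bold>+ emb b) \<^bold>+ (iota q \<^bold>* emb c \<^bold>+ emb b')"
    using c by algebra
  also have "\<dots> = emb a \<^bold>+ emb a'" using S by (simp add: iota_val[OF v(1)] iota_val[OF v(2)])
  finally show "iota (qadd p q) = iota p \<^bold>+ iota q"
    using S c by (intro iota_unique[OF w]) (simp_all add: emb_add)
qed

lemma iota_qmul: assumes "p \<in> SQ" "q \<in> SQ" shows "qmul p q \<in> SQ" "iota (qmul p q) = iota p \<^bold>* iota q"
proof -
  obtain a b a' b' c where v: "val p a b c" "val q a' b' c" and
    S: "a \<in> SN" "b \<in> SN" "a' \<in> SN" "b' \<in> SN" "c \<in> SN" by (rule SQ_common[OF assms])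
  have c: "iota p \<in> carrier RR" "iota q \<in> carrier RR" "emb c \<in> carrier RR" "emb b \<in> carrier RR"
    "emb b' \<in> carrier RR" using iota_R assms S by simp_all
  note w = val_mul[OF v]
  show "qmul p q \<in> SQ" using val_SQ[OF w] S by simp
  have ea: "emb a = iota p \<^bold>* emb c \<^bold>+ emb b" "emb a' = iota q \<^bold>* emb c \<^bold>+ emb b'"
    using iota_val[OF v(1)] iota_val[OF v(2)] S by simp_all
  have "(iota p \<^bold>* iota q) \<^bold>* (emb c \<^bold>* emb c) \<^bold>+ (emb a \<^bold>* emb b' \<^bold>+ emb b \<^bold>* emb a') =
    emb a \<^bold>* emb a' \<^bold>+ emb b \<^bold>* emb b'"
    unfolding ea using c by algebra
  then show "iota (qmul p q) = iota p \<^bold>* iota q"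
    using S c by (intro iota_unique[OF w]) (simp_all add: emb_add emb_mult)
qed

lemma qone_SQ: "qone \<in> SQ" and iota_qone: "iota qone = \<^bold>1"
proof -
  show "qone \<in> SQ" using val_SQ[OF val_one] by simp
  show "iota qone = \<^bold>1" by (rule iota_unique[OF val_one]) (simp_all add: emb_suc emb_emp)
qed

lemma a_inv_Qring: assumes "q \<in> Q" shows "\<ominus>\<^bsub>Qring\<^esub> q = qminus q"
  using QF.minus_equality[of "qminus q" q] qadd_minus[OF assms] assms qminus_Q by simp

lemma qminus_SQ: assumes "q \<in> SQ" shows "qminus q \<in> SQ"
  using assms qminus_Q qminus_parts unfolding SQ_iff by simp

text \<open>With \<open>d\<close> the length of the interval and \<open>k d > 1\<close>, the
  interval from \<open>k x\<close> to \<open>k y\<close> is longer than one. A standard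
  \<open>l\<close> with \<open>x + l\<close> nonnegative permits the floor \<open>m\<close> of
  \<open>k (x + l)\<close> to be taken, and \<open>(m + 1)/k - l\<close> lies strictly between
  \<open>x\<close> and \<open>y\<close>.\<close>

lemma SQ_dense:
  assumes x: "x \<in> carrier RR" and y: "y \<in> carrier RR" and lt: "\<not> y \<le>\<^sub>R x"
  shows "\<exists>r\<in>SQ. \<not> iota r \<le>\<^sub>R x \<and> \<not> y \<le>\<^sub>R iota r"
proof -
  define d where "d = y \<ominus>\<^bsub>RR\<^esub> x"
  have d: "d \<in> carrier RR" "d \<^bold>+ x = y"
    using x y by (simp_all add: d_def a_minus_def RF.a_assoc RF.l_neg)
  have dpos: "\<not> d \<le>\<^sub>R \<^bold>0" using lt RF.le_add_iff[of d "\<^bold>0" x] d x by simp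
  obtain k where k: "k \<in> SN" "\<not> emb k \<le>\<^sub>R inv\<^bsub>RR\<^esub> d"
    using archimedean RF.inv_mult(3)[OF d(1) dpos] by blast
  have kd: "\<not> emb k \<^bold>* d \<le>\<^sub>R \<^bold>1"
    using k RF.le_divide_iff(1)[of "emb k" "\<^bold>1" d] d dpos RF.inv_mult(3)[OF d(1) dpos] by simp
  have k0: "k \<noteq> emp"
  proof
    assume "k = emp"
    then have "\<^bold>0 \<le>\<^sub>R \<^bold>1 \<Longrightarrow> False" using kd d by (simp add: emb_emp)
    then show False using RF.zero_le_one by blast
  qed
  obtain l where l: "l \<in> SN" "\<not> emb l \<le>\<^sub>R \<ominus>\<^bsub>RR\<^esub> x"
    using archimedean[OF RF.a_inv_closed[OF x]] by blast
  then have "\<ominus>\<^bsub>RR\<^esub> x \<le>\<^sub>R emb l" using RF.lt_imp_le[of "\<ominus>\<^bsub>RR\<^esub> x" "emb l"] x by simp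
  then have "\<ominus>\<^bsub>RR\<^esub> x \<^bold>+ x \<le>\<^sub>R emb l \<^bold>+ x" using x l by (subst RF.le_add_iff) simp_all
  then have xl: "\<^bold>0 \<le>\<^sub>R x \<^bold>+ emb l"
    using RF.l_neg[OF x] RF.a_comm[OF x emb_R[OF l(1)]] by (simp only:)
  define z where "z = x \<^bold>* emb k \<^bold>+ emb (l \<star> k)"
  have "(x \<^bold>+ emb l) \<^bold>* emb k = z" using x l k by (simp add: z_def emb_mult RF.l_distr)
  moreover have "\<^bold>0 \<le>\<^sub>R (x \<^bold>+ emb l) \<^bold>* emb k" using xl emb_nonneg k l x by (rule_tac RF.le_mult) simp_all
  ultimately have z: "z \<in> carrier RR" "\<^bold>0 \<le>\<^sub>R z" using x k l by (simp_all add: z_def)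
  obtain m where m: "m \<in> SN" "emb m \<le>\<^sub>R z" "\<not> emb (suc m) \<le>\<^sub>R z" using floor_exists[OF z] by blast
  define r where "r = reduce (suc m) (l \<star> k) k"
  have v: "val r (suc m) (l \<star> k) k" unfolding r_def using m k l k0 SN_N by (intro val_reduce) simp_all
  have S: "suc m \<in> SN" "l \<star> k \<in> SN" "k \<in> SN" using m k l by simp_all
  have "\<not> iota r \<le>\<^sub>R x" using iota_le_iff(1)[OF v S x] m(3) by (simp add: z_def)
  moreover have "\<not> y \<le>\<^sub>R iota r"
  proof
    assume "y \<le>\<^sub>R iota r"
    then have h1: "y \<^bold>* emb k \<^bold>+ emb (l \<star> k) \<le>\<^sub>R emb m \<^bold>+ \<^bold>1"
      using iota_le_iff(2)[OF v S y] m(1) by (simp add: emb_suc)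
    have h2: "emb m \<^bold>+ \<^bold>1 \<le>\<^sub>R z \<^bold>+ \<^bold>1" using m z by simp
    have le: "y \<^bold>* emb k \<^bold>+ emb (l \<star> k) \<le>\<^sub>R z \<^bold>+ \<^bold>1"
      by (rule RF.le_trans[OF _ _ _ h1 h2]) (use y z m S in simp_all)
    have c: "emb k \<in> carrier RR" "emb (l \<star> k) \<in> carrier RR" using S by simp_all
    have "y \<^bold>* emb k \<^bold>+ emb (l \<star> k) = emb k \<^bold>* d \<^bold>+ z"
      unfolding d(2)[symmetric] z_def using x d(1) c by algebra
    then have "emb k \<^bold>* d \<^bold>+ z \<le>\<^sub>R \<^bold>1 \<^bold>+ z"
      using le z by (simp add: RF.a_comm[of z "\<^bold>1"])
    then show False using kd c d z RF.le_add_iff[of "emb k \<^bold>* d" "\<^bold>1" z] by simp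
  qed
  ultimately show ?thesis using val_SQ[OF v S] by blast
qed

sublocale SP: std_part Qring "(\<le>\<^sub>Q)" RR rle SQ iota
proof
  show "r \<in> carrier Qring" if "r \<in> SQ" for r using that by (simp add: SQ_def)
  show "\<ominus>\<^bsub>Qring\<^esub> r \<in> SQ" if "r \<in> SQ" for r
    using that qminus_SQ a_inv_Qring[of r] by (simp add: SQ_def)
qed (simp_all add: iota_qadd iota_qmul qone_SQ iota_R iota_qone iota_le_R SQ_dense)

text \<open>Quantification over standard rationals is replaced by quantification over their entries,
  and fractions by cross-multiplied inequalities. In this form the relation is accepted by class
  comprehension.\<close>

lemma cut_iff:
  assumes v: "val q a b c"
  shows "SP.cut q x \<longleftrightarrow> q \<in> SP.bd \<and> x \<in> carrier RR \<and> (\<forall>i\<in>SN. \<forall>j\<in>SN. \<forall>k\<in>SN. k \<noteq> emp \<longrightarrow>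
    (i \<star> c \<uplus> b \<star> k \<le>\<^sub>N a \<star> k \<uplus> j \<star> c \<longrightarrow> emb i \<le>\<^sub>R radd (rmul x (emb k)) (emb j)) \<and>
    (a \<star> k \<uplus> j \<star> c \<le>\<^sub>N i \<star> c \<uplus> b \<star> k \<longrightarrow> radd (rmul x (emb k)) (emb j) \<le>\<^sub>R emb i))"
    (is "_ \<longleftrightarrow> _ \<and> _ \<and> ?P")
proof -
  have "(\<forall>r\<in>SQ. (r \<le>\<^sub>Q q \<longrightarrow> iota r \<le>\<^sub>R x) \<and> (q \<le>\<^sub>Q r \<longrightarrow> x \<le>\<^sub>R iota r)) \<longleftrightarrow> ?P" if x: "x \<in> carrier RR"
  proof -
    have eq: "(r \<le>\<^sub>Q q \<longrightarrow> iota r \<le>\<^sub>R x) \<and> (q \<le>\<^sub>Q r \<longrightarrow> x \<le>\<^sub>R iota r) \<longleftrightarrow>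
      (i \<star> c \<uplus> b \<star> k \<le>\<^sub>N a \<star> k \<uplus> j \<star> c \<longrightarrow> emb i \<le>\<^sub>R radd (rmul x (emb k)) (emb j)) \<and>
      (a \<star> k \<uplus> j \<star> c \<le>\<^sub>N i \<star> c \<uplus> b \<star> k \<longrightarrow> radd (rmul x (emb k)) (emb j) \<le>\<^sub>R emb i)"
      if w: "val r i j k" "i \<in> SN" "j \<in> SN" "k \<in> SN" for r i j k
    proof -
      have "radd (rmul x (emb k)) (emb j) = x \<^bold>* emb k \<^bold>+ emb j"
        using x w by (simp add: radd_eq[symmetric] rmul_eq[symmetric])
      then show ?thesis
        unfolding val_le[OF w(1) v] val_le[OF v w(1)] by (simp only: iota_le_iff[OF w x])
    qed
    show ?thesis
    proof
      assume *: "\<forall>r\<in>SQ. (r \<le>\<^sub>Q q \<longrightarrow> iota r \<le>\<^sub>R x) \<and> (q \<le>\<^sub>Q r \<longrightarrow> x \<le>\<^sub>R iota r)"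
      show ?P
      proof (intro ballI impI)
        fix i j k assume S: "i \<in> SN" "j \<in> SN" "k \<in> SN" "k \<noteq> emp"
        then have w: "val (reduce i j k) i j k" using SN_N by (intro val_reduce) simp_all
        then show "(i \<star> c \<uplus> b \<star> k \<le>\<^sub>N a \<star> k \<uplus> j \<star> c \<longrightarrow> emb i \<le>\<^sub>R radd (rmul x (emb k)) (emb j)) \<and>
          (a \<star> k \<uplus> j \<star> c \<le>\<^sub>N i \<star> c \<uplus> b \<star> k \<longrightarrow> radd (rmul x (emb k)) (emb j) \<le>\<^sub>R emb i)"
          using eq[OF w S(1-3)] * val_SQ[OF w S(1-3)] by blast
      qed
    next
      assume P: ?P
      show "\<forall>r\<in>SQ. (r \<le>\<^sub>Q q \<longrightarrow> iota r \<le>\<^sub>R x) \<and> (q \<le>\<^sub>Q r \<longrightarrow> x \<le>\<^sub>R iota r)"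
      proof
        fix r assume "r \<in> SQ"
        then obtain i j k where w: "i \<in> SN" "j \<in> SN" "k \<in> SN" "val r i j k" using SQ_val by blast
        then have "k \<noteq> emp" using val_in by blast
        then show "(r \<le>\<^sub>Q q \<longrightarrow> iota r \<le>\<^sub>R x) \<and> (q \<le>\<^sub>Q r \<longrightarrow> x \<le>\<^sub>R iota r)"
          unfolding eq[OF w(4,1-3)] using P w(1-3) by blast
      qed
    qed
  qed
  then show ?thesis unfolding SP.cut_def by blast
qed

text \<open>The cut is filled by the supremum of all \<open>iota r\<close> with \<open>r\<close>
  standard and below \<open>q\<close>. Boundedness of \<open>q\<close> makes this class nonempty and
  bounded. The predicate \<open>E\<close> describes it by entries of fractions, for the sake of
  definability.\<close>

lemma cut_ex: assumes "q \<in> SP.bd" shows "\<exists>x. SP.cut q x"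
proof -
  have q: "q \<in> Q" using SP.bd_A[OF assms] by simp
  note v = val_self[OF q]
  have V: "qpos q \<in> V" "qneg q \<in> V" "qden q \<in> V" using Q_parts[OF q] N_V by blast+
  define E where "E y \<longleftrightarrow> y \<in> carrier RR \<and> (\<exists>i\<in>SN. \<exists>j\<in>SN. \<exists>k\<in>SN. k \<noteq> emp \<and>
    i \<star> qden q \<uplus> qneg q \<star> k \<le>\<^sub>N qpos q \<star> k \<uplus> j \<star> qden q \<and> radd (rmul y (emb k)) (emb j) = emb i)" for y
  have "dfn UNIV V (\<lambda>e. E (e 0))" unfolding E_def by (intro real_intros V)
  from is_cls_Collect[where P = E, OF this] have cls: "is_cls {y \<in> V. E y}" .
  have E: "E y \<longleftrightarrow> (\<exists>r\<in>SQ. r \<le>\<^sub>Q q \<and> y = iota r)" for y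
  proof
    assume "E y"
    then obtain i j k where y: "y \<in> carrier RR" and S: "i \<in> SN" "j \<in> SN" "k \<in> SN" "k \<noteq> emp"
      and le: "i \<star> qden q \<uplus> qneg q \<star> k \<le>\<^sub>N qpos q \<star> k \<uplus> j \<star> qden q"
      and eq: "radd (rmul y (emb k)) (emb j) = emb i" unfolding E_def by blast
    have w: "val (reduce i j k) i j k" using S SN_N by (intro val_reduce) simp_all
    have "y \<^bold>* emb k \<^bold>+ emb j = emb i" using eq y S by (simp add: radd_eq[symmetric] rmul_eq[symmetric])
    then have "iota (reduce i j k) = y" using iota_unique[OF w] S y by simp
    moreover have "reduce i j k \<le>\<^sub>Q q" using val_le[OF w v] le by simp
    ultimately show "\<exists>r\<in>SQ. r \<le>\<^sub>Q q \<and> y = iota r" using val_SQ[OF w] S by blast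
  next
    assume "\<exists>r\<in>SQ. r \<le>\<^sub>Q q \<and> y = iota r"
    then obtain r where r: "r \<in> SQ" "r \<le>\<^sub>Q q" "y = iota r" by blast
    obtain i j k where w: "i \<in> SN" "j \<in> SN" "k \<in> SN" "val r i j k" using SQ_val[OF r(1)] by blast
    have k: "k \<noteq> emp" using val_in[OF w(4)] by simp
    have le: "i \<star> qden q \<uplus> qneg q \<star> k \<le>\<^sub>N qpos q \<star> k \<uplus> j \<star> qden q" using val_le[OF w(4) v] r(2) by simp
    have eq: "radd (rmul y (emb k)) (emb j) = emb i"
      using iota_val[OF w(4,1-3)] iota_R[OF r(1)] w(1-3) r(3) by (simp add: radd_eq[symmetric] rmul_eq[symmetric])
    have "y \<in> carrier RR" using r iota_R by simp
    with w(1-3) k le eq show "E y" unfolding E_def by blast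
  qed
  obtain r where r: "r \<in> SQ" "\<ominus>\<^bsub>Qring\<^esub> r \<le>\<^sub>Q q" "q \<le>\<^sub>Q r" using assms unfolding SP.bd_def by blast
  have ub: "y \<le>\<^sub>R iota s" if "E y" "s \<in> SQ" "q \<le>\<^sub>Q s" for y s
  proof -
    from iffD1[OF E that(1)] obtain t where t: "t \<in> SQ" "t \<le>\<^sub>Q q" "y = iota t" by (elim bexE conjE)
    have "t \<le>\<^sub>Q s" using QF.le_trans[of t q s] t(1,2) that(2,3) q SP.T_A by simp
    then show ?thesis using iota_le_R t that(2) by simp
  qed
  have EV: "y \<in> V" if "E y" for y using that carrier_V unfolding E_def by blast
  have "\<exists>s\<in>carrier RR. (\<forall>y\<in>{y \<in> V. E y}. y \<le>\<^sub>R s) \<and> (\<forall>b\<in>carrier RR. (\<forall>y\<in>{y \<in> V. E y}. y \<le>\<^sub>R b) \<longrightarrow> s \<le>\<^sub>R b)"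
  proof (rule R_complete[OF cls _ _ iota_R[OF r(1)]])
    show "{y \<in> V. E y} \<subseteq> carrier RR" unfolding E_def by blast
    have "E (iota (\<ominus>\<^bsub>Qring\<^esub> r))" by (subst E, rule bexI[where x = "\<ominus>\<^bsub>Qring\<^esub> r"], rule conjI[OF r(2) refl], rule SP.T_minus[OF r(1)])
    then show "{y \<in> V. E y} \<noteq> {}" using EV by blast
    show "\<forall>y\<in>{y \<in> V. E y}. y \<le>\<^sub>R iota r" using ub r by blast
  qed
  then obtain s where s0: "s \<in> carrier RR" "\<forall>y\<in>{y \<in> V. E y}. y \<le>\<^sub>R s"
    "\<forall>b\<in>carrier RR. (\<forall>y\<in>{y \<in> V. E y}. y \<le>\<^sub>R b) \<longrightarrow> s \<le>\<^sub>R b" by (elim bexE conjE)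
  have s: "s \<in> carrier RR" "\<And>y. E y \<Longrightarrow> y \<le>\<^sub>R s"
    "\<And>b. b \<in> carrier RR \<Longrightarrow> (\<And>y. E y \<Longrightarrow> y \<le>\<^sub>R b) \<Longrightarrow> s \<le>\<^sub>R b"
  proof -
    show "y \<le>\<^sub>R s" if "E y" for y using that EV[OF that] by (intro bspec[OF s0(2)]) blast
    show "s \<le>\<^sub>R b" if "b \<in> carrier RR" "\<And>y. E y \<Longrightarrow> y \<le>\<^sub>R b" for b
      using that by (intro mp[OF bspec[OF s0(3)]]) auto
  qed (rule s0(1))
  have "SP.cut q s" unfolding SP.cut_def
  proof (intro conjI ballI impI)
    fix t assume t: "t \<in> SQ"
    { assume le: "t \<le>\<^sub>Q q" show "iota t \<le>\<^sub>R s" by (rule s(2), subst E, rule bexI[where x = t], rule conjI[OF le refl], rule t) }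
    { assume "q \<le>\<^sub>Q t" then show "s \<le>\<^sub>R iota t" by (intro s(3)[OF iota_R[OF t]] ub t) }
  qed (use assms s(1) in simp_all)
  then show ?thesis by blast
qed

sublocale SP: complete_std_part Qring "(\<le>\<^sub>Q)" RR rle SQ iota
  by unfold_locales (rule cut_ex)

subsection \<open>Surjectivity of the standard part\<close>

text \<open>Carries estimates of one real number with different denominators back to an inequality
  between numbers: \<open>x\<close> lies above \<open>a/i\<close> and below
  \<open>b/j\<close>.\<close>

lemma floor_cross:
  assumes "a \<in> SN" "b \<in> SN" "i \<in> SN" "j \<in> SN" "x \<in> carrier RR"
    and 1: "emb a \<le>\<^sub>R x \<^bold>* emb i" and 2: "x \<^bold>* emb j \<le>\<^sub>R emb b"
  shows "a \<star> j \<le>\<^sub>N b \<star> i"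
proof -
  have c: "emb a \<in> carrier RR" "emb b \<in> carrier RR" "emb i \<in> carrier RR" "emb j \<in> carrier RR" using assms by simp_all
  have "emb a \<^bold>* emb j \<le>\<^sub>R (x \<^bold>* emb i) \<^bold>* emb j"
    using RF.mult_mono[OF _ _ _ 1 emb_nonneg[OF assms(4)]] c assms(5) by simp
  also have "(x \<^bold>* emb i) \<^bold>* emb j = (x \<^bold>* emb j) \<^bold>* emb i" using c assms(5) by algebra
  finally have h1: "emb a \<^bold>* emb j \<le>\<^sub>R (x \<^bold>* emb j) \<^bold>* emb i" .
  have h2: "(x \<^bold>* emb j) \<^bold>* emb i \<le>\<^sub>R emb b \<^bold>* emb i"
    using RF.mult_mono[OF _ _ _ 2 emb_nonneg[OF assms(3)]] c assms(5) by simp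
  have "emb a \<^bold>* emb j \<le>\<^sub>R emb b \<^bold>* emb i"
    by (rule RF.le_trans[OF _ _ _ h1 h2]) (use c assms(5) in simp_all)
  then show ?thesis using assms by (simp add: emb_mult[symmetric] emb_le)
qed

text \<open>A positive difference, multiplied by a large standard \<open>j\<close>, would exceed the
  constant \<open>w\<close>. This eliminates rounding errors that stay bounded while
  \<open>j\<close> grows.\<close>

lemma le_if_multiples_le:
  assumes "y \<in> carrier RR" "z \<in> carrier RR" "w \<in> carrier RR"
    and le: "\<And>j. j \<in> SN \<Longrightarrow> y \<^bold>* emb j \<le>\<^sub>R z \<^bold>* emb j \<^bold>+ w"
  shows "y \<le>\<^sub>R z"
proof (rule ccontr)
  assume not: "\<not> y \<le>\<^sub>R z"
  define d where "d = y \<ominus>\<^bsub>RR\<^esub> z"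
  have d: "d \<in> carrier RR" "y = d \<^bold>+ z"
    using assms by (simp_all add: d_def a_minus_def RF.a_assoc RF.l_neg)
  have dpos: "\<not> d \<le>\<^sub>R \<^bold>0" using not RF.le_add_iff[of d "\<^bold>0" z] d assms by simp
  have i: "inv\<^bsub>RR\<^esub> d \<in> carrier RR" using RF.inv_mult(3)[OF d(1) dpos] .
  obtain j where j: "j \<in> SN" "\<not> emb j \<le>\<^sub>R w \<^bold>* inv\<^bsub>RR\<^esub> d"
    using archimedean[of "w \<^bold>* inv\<^bsub>RR\<^esub> d"] assms(3) i by auto
  have e: "emb j \<in> carrier RR" using j by simp
  have "y \<^bold>* emb j = (emb j \<^bold>* d) \<^bold>+ z \<^bold>* emb j" unfolding d(2) using d(1) assms(2) e by algebra
  then have "(emb j \<^bold>* d) \<^bold>+ z \<^bold>* emb j \<le>\<^sub>R w \<^bold>+ z \<^bold>* emb j"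
    using le[OF j(1)] assms e by (simp add: RF.a_comm)
  then have "emb j \<^bold>* d \<le>\<^sub>R w"
    using RF.le_add_iff[of "emb j \<^bold>* d" w "z \<^bold>* emb j"] d assms e by simp
  then show False using j(2) RF.le_divide_iff(1)[of "emb j" w d] e assms d dpos by simp
qed

definition is_floor :: "'c \<Rightarrow> 'c \<Rightarrow> bool" where
  "is_floor m z \<longleftrightarrow> m \<in> SN \<and> emb m \<le>\<^sub>R z \<and> \<not> emb (suc m) \<le>\<^sub>R z"

lemma is_floor_unique:
  assumes "is_floor m z" "is_floor m' z" "z \<in> carrier RR" shows "m = m'"
proof -
  have *: "a \<le>\<^sub>N b" if "is_floor a z" "is_floor b z" for a b
  proof (rule ccontr)
    have S: "a \<in> SN" "b \<in> SN" "a \<in> N" "b \<in> N" using that SN_N unfolding is_floor_def by blast+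
    assume "\<not> a \<le>\<^sub>N b"
    then have "suc b \<le>\<^sub>N a" using not_nle mem_iff_suc_nle S by simp
    then have "emb (suc b) \<le>\<^sub>R emb a" using S by (simp add: emb_le)
    then show False using that RF.le_trans[of "emb (suc b)" "emb a" z] S assms(3) unfolding is_floor_def by simp
  qed
  have "m' \<in> N" using assms(2) SN_N unfolding is_floor_def by blast
  then show ?thesis using nle_antisym *[OF assms(1,2)] *[OF assms(2,1)] by blast
qed

text \<open>The index \<open>k\<close> is bad at stage \<open>i\<close> if \<open>k/H\<close> has distance about $1/i$ from \<open>x\<close>. The slack of \<open>H\<close>
  in both inequalities guarantees that finitely many stages do not make every index bad.\<close>

definition bad :: "'c \<Rightarrow> 'c \<Rightarrow> 'c \<Rightarrow> 'c \<Rightarrow> bool" where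
  "bad x H i k \<longleftrightarrow> (\<exists>m\<in>SN. emb m \<le>\<^sub>R rmul x (emb i) \<and> \<not> emb (suc m) \<le>\<^sub>R rmul x (emb i) \<and>
     (k \<star> i \<uplus> H \<le>\<^sub>N m \<star> H \<or> suc (suc m) \<star> H \<le>\<^sub>N k \<star> i))"

lemma bad_iff:
  assumes "x \<in> carrier RR" "i \<in> SN" "is_floor m (x \<^bold>* emb i)"
  shows "bad x H i k \<longleftrightarrow> k \<star> i \<uplus> H \<le>\<^sub>N m \<star> H \<or> suc (suc m) \<star> H \<le>\<^sub>N k \<star> i"
proof -
  have "x \<^bold>* emb i \<in> carrier RR" using assms by simp
  then have u: "m' = m" if "is_floor m' (x \<^bold>* emb i)" for m' using is_floor_unique that assms(3) by blast
  have "bad x H i k \<longleftrightarrow> (\<exists>m. is_floor m (x \<^bold>* emb i) \<and>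
     (k \<star> i \<uplus> H \<le>\<^sub>N m \<star> H \<or> suc (suc m) \<star> H \<le>\<^sub>N k \<star> i))"
    unfolding bad_def is_floor_def Bex_def using assms by (simp add: rmul_eq)
  also have "\<dots> \<longleftrightarrow> k \<star> i \<uplus> H \<le>\<^sub>N m \<star> H \<or> suc (suc m) \<star> H \<le>\<^sub>N k \<star> i" using u assms(3) by blast
  finally show ?thesis .
qed

lemma floor_multiple:
  assumes "x \<in> carrier RR" "\<^bold>0 \<le>\<^sub>R x" "i \<in> SN" shows "\<exists>m. is_floor m (x \<^bold>* emb i)"
proof -
  have "\<^bold>0 \<le>\<^sub>R x \<^bold>* emb i" by (rule RF.le_mult) (use assms emb_nonneg in simp_all)
  then show ?thesis using floor_exists[of "x \<^bold>* emb i"] assms unfolding is_floor_def by auto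
qed

lemma is_floor_le: assumes "is_floor m z" "z \<in> carrier RR" shows "m \<in> SN" "emb m \<le>\<^sub>R z" "z \<le>\<^sub>R emb (suc m)"
  using assms RF.lt_imp_le[of z "emb (suc m)"] unfolding is_floor_def by simp_all

lemma good_index:
  assumes x: "x \<in> carrier RR" "\<^bold>0 \<le>\<^sub>R x" and H: "H \<in> N" "H \<notin> SN"
    and B: "B \<in> SN" "x \<le>\<^sub>R emb B"
  shows "\<exists>k\<in>N. k \<le>\<^sub>N B \<star> H \<and> (\<forall>i\<in>SN. \<not> bad x H i k)"
proof (rule ccontr)
  \<comment> \<open>A number is the set of its predecessors, so the elements of \<open>u\<close> are
    the indices of the grid points from zero up to the bound \<open>B\<close> of
    \<open>x\<close>.\<close>
  define u where "u = suc (B \<star> H)"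
  have MH: "B \<star> H \<in> N" and u: "u \<in> N" using B H SN_N by (simp_all add: u_def)
  have uk: "k \<epsilon> u \<longleftrightarrow> k \<in> N \<and> k \<le>\<^sub>N B \<star> H" for k
    using N_V[OF MH] MH N_elem[OF MH] by (auto simp: u_def nle_def)
  assume "\<not> ?thesis"
  then have cover: "\<exists>i\<in>SN. bad x H i k" if "k \<epsilon> u" for k using that uk by blast
  have "\<exists>n\<in>SN. \<forall>k. k \<epsilon> u \<longrightarrow> (\<exists>i. i \<le>\<^sub>N n \<and> bad x H i k)"
  proof (rule saturation[where G = "bad x H", OF N_V[OF u] _ _ cover])
    show "dfn UNIV V (\<lambda>e. bad x H (e 0) (e (Suc 0)))"
      unfolding bad_def by (intro real_intros carrier_V x N_V H)
    fix i assume i: "i \<in> SN"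
    obtain m where m: "is_floor m (x \<^bold>* emb i)" using floor_multiple[OF x i] by blast
    then have mV: "m \<in> V" using SN_V unfolding is_floor_def by blast
    \<comment> \<open>Once the floor \<open>m\<close> is a fixed parameter, badness at stage
      \<open>i\<close> involves numbers only; it is then a set formula and separation applies,
      although \<open>bad\<close> itself refers to the real field.\<close>
    show "\<exists>z\<in>V. \<forall>k. k \<epsilon> z \<longleftrightarrow> k \<epsilon> u \<and> bad x H i k"
      unfolding bad_iff[OF x(1) i m]
      by (rule separation[where P = "\<lambda>k. k \<star> i \<uplus> H \<le>\<^sub>N m \<star> H \<or> suc (suc m) \<star> H \<le>\<^sub>N k \<star> i"])
        (intro order_intros N_V H u SN_V i mV)+
  qed
  then obtain n where n: "n \<in> SN" "\<And>k. k \<epsilon> u \<Longrightarrow> \<exists>i. i \<le>\<^sub>N n \<and> bad x H i k" by blast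
  have sn: "suc n \<in> SN" using n by simp
  obtain m' where "is_floor m' (x \<^bold>* emb (suc n))" using floor_multiple[OF x sn] by blast
  from is_floor_le[OF this] have m': "m' \<in> SN" "emb m' \<le>\<^sub>R x \<^bold>* emb (suc n)"
    "x \<^bold>* emb (suc n) \<le>\<^sub>R emb (suc m')" using x sn by simp_all
  have NN: "n \<in> N" "suc n \<in> N" "m' \<in> N" "B \<in> N" "suc n \<noteq> emp" using n(1) sn m' B SN_N by simp_all
  \<comment> \<open>The grid point \<open>k/H\<close> is the last one not above
    \<open>m'/(n+1)\<close>. The remainder \<open>r\<close> lies below \<open>suc n\<close> and is
    therefore standard.\<close>
  obtain k r where kr: "k \<in> N" "r \<in> N" "m' \<star> H = k \<star> suc n \<uplus> r" "r \<epsilon> suc n"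
    using division[of "m' \<star> H" "suc n"] NN H by auto
  have r: "r \<in> SN" using SN_elem[OF sn kr(4)] .
  have "m' \<le>\<^sub>N B \<star> suc n"
    using floor_cross[OF m'(1) B(1) sn SN_suc[OF SN_emp] x(1) m'(2)] B(2) x NN by (simp add: emb_suc emb_emp)
  then have "m' \<star> H \<le>\<^sub>N (B \<star> suc n) \<star> H" using NN H by (intro nle_pmul_mono) simp_all
  moreover have "k \<star> suc n \<le>\<^sub>N m' \<star> H" unfolding kr(3) using kr NN by (intro nle_padd) simp_all
  ultimately have "k \<star> suc n \<le>\<^sub>N (B \<star> suc n) \<star> H" using NN H by (rule_tac nle_trans) simp_all
  also have "(B \<star> suc n) \<star> H = (B \<star> H) \<star> suc n" by (simp add: pmul_ac)
  finally have "k \<le>\<^sub>N B \<star> H" using nle_pmul_cancel[of k "B \<star> H" "suc n"] kr NN H by simp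
  then have "k \<epsilon> u" using kr uk by blast
  then obtain i where i: "i \<le>\<^sub>N n" "bad x H i k" using n(2) by blast
  have iS: "i \<in> SN" using SN_nle n(1) i(1) by blast
  obtain m where m: "is_floor m (x \<^bold>* emb i)" using floor_multiple[OF x iS] by blast
  from is_floor_le[OF m] have m1: "m \<in> SN" "emb m \<le>\<^sub>R x \<^bold>* emb i"
    "x \<^bold>* emb i \<le>\<^sub>R emb (suc m)" using x iS by simp_all
  note NN = NN SN_N[OF iS] SN_N[OF m1(1)]
  have H0: "H \<noteq> emp" using H(2) by auto
  have "m \<star> suc n \<le>\<^sub>N suc m' \<star> i" using floor_cross[OF m1(1) SN_suc[OF m'(1)] iS sn x(1) m1(2) m'(3)] .
  \<comment> \<open>Otherwise \<open>H\<close> would be at most the standard number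
    \<open>r \<star> i\<close> and hence standard.\<close>
  then have 1: "\<not> k \<star> i \<uplus> H \<le>\<^sub>N m \<star> H"
    using grid_lower[OF kr(1,2) NN(7,3,1,6) H(1) kr(3) _ i(1)] SN_nle[of "r \<star> i" H] r iS H(2) by auto
  have "m' \<star> i \<le>\<^sub>N suc m \<star> suc n" using floor_cross[OF m'(1) SN_suc[OF m1(1)] sn iS x(1) m'(2) m1(3)] .
  then have 2: "\<not> suc (suc m) \<star> H \<le>\<^sub>N k \<star> i"
    using grid_upper[OF kr(1,2) NN(7,3,1,6) H(1) H0 kr(3)] by blast
  show False using bad_iff[OF x(1) iS m, of H k] i(2) 1 2 by blast
qed

text \<open>A good index puts \<open>k i/H\<close> within a bounded distance of \<open>x i\<close>
  for every standard \<open>i\<close>. To compare \<open>q\<close> with a fraction of denominator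
  \<open>c\<close>, the stages \<open>c \<star> j\<close> are used: the error stays bounded while
  all other terms are multiplied by \<open>j\<close>, so \<open>le_if_multiples_le\<close> removes
  it.\<close>

lemma cut_good_index:
  assumes x: "x \<in> carrier RR" "\<^bold>0 \<le>\<^sub>R x" and H: "H \<in> N" "H \<notin> SN"
    and B: "B \<in> SN" and k: "k \<in> N" "k \<le>\<^sub>N B \<star> H" "\<forall>i\<in>SN. \<not> bad x H i k"
  shows "SP.cut (reduce k emp H) x"
proof -
  define q where "q = reduce k emp H"
  have H0: "H \<noteq> emp" using H(2) by auto
  have v: "val q k emp H" unfolding q_def using k H H0 by (intro val_reduce) simp_all
  have MN: "B \<in> N" using B SN_N by blast
  have vM: "val (rat B emp one\<^sub>N) B emp one\<^sub>N" using val_nat[OF MN] .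
  have "qzero \<le>\<^sub>Q q" using val_nonneg[OF v] k by simp
  moreover have "q \<le>\<^sub>Q rat B emp one\<^sub>N" using val_le[OF v vM] k H MN by simp
  ultimately have qbd: "q \<in> SP.bd"
    using SP.bd_nonneg_le[of q "rat B emp one\<^sub>N"] val_Q[OF v] val_SQ[OF vM] B by simp
  have grid: "\<exists>m\<in>SN. emb m \<le>\<^sub>R x \<^bold>* emb i \<and> x \<^bold>* emb i \<le>\<^sub>R emb (suc m) \<and>
      m \<star> H \<le>\<^sub>N k \<star> i \<uplus> H \<and> k \<star> i \<le>\<^sub>N suc (suc m) \<star> H" if i: "i \<in> SN" for i
  proof -
    obtain m where m: "is_floor m (x \<^bold>* emb i)" using floor_multiple[OF x i] by blast
    note f = is_floor_le[OF m]
    have c: "x \<^bold>* emb i \<in> carrier RR" using x i by simp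
    have "m \<in> N" "i \<in> N" using f(1) c i SN_N by simp_all
    moreover have "\<not> (k \<star> i \<uplus> H \<le>\<^sub>N m \<star> H)" "\<not> suc (suc m) \<star> H \<le>\<^sub>N k \<star> i"
      using k(3) i bad_iff[OF x(1) i m, of H k] by blast+
    ultimately have "m \<star> H \<le>\<^sub>N k \<star> i \<uplus> H" "k \<star> i \<le>\<^sub>N suc (suc m) \<star> H"
      using nle_linear[of "k \<star> i \<uplus> H" "m \<star> H"] nle_linear[of "k \<star> i" "suc (suc m) \<star> H"] k H by simp_all
    then show ?thesis using f c by blast
  qed
  have "SP.cut q x" unfolding SP.cut_def
  proof (intro conjI ballI impI)
    fix r assume r: "r \<in> SQ"
    obtain a b c where S: "a \<in> SN" "b \<in> SN" "c \<in> SN" and w: "val r a b c" using SQ_val[OF r] by blast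
    have NN: "a \<in> N" "b \<in> N" "c \<in> N" using S SN_N by simp_all
    have cc: "emb a \<in> carrier RR" "emb b \<in> carrier RR" "emb c \<in> carrier RR" using S by simp_all
    \<comment> \<open>Two units of error cover both directions: \<open>k i/H\<close> is at most
      \<open>m+2\<close> where \<open>x i\<close> is at least \<open>m\<close>, and
      \<open>k i/H\<close> is at least \<open>m-1\<close> where \<open>x i\<close> is at most
      \<open>m+1\<close>.\<close>
    define t where "t = emb (suc (suc emp))"
    have t: "t \<in> carrier RR" by (simp add: t_def)
    { assume "r \<le>\<^sub>Q q"
      then have le: "a \<star> H \<le>\<^sub>N k \<star> c \<uplus> b \<star> H" using val_le[OF w v] NN H by simp
      have "emb a \<le>\<^sub>R x \<^bold>* emb c \<^bold>+ emb b"
      proof (rule le_if_multiples_le[where w = t])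
        fix j assume j: "j \<in> SN"
        obtain m where m: "m \<in> SN" "emb m \<le>\<^sub>R x \<^bold>* emb (c \<star> j)" "k \<star> (c \<star> j) \<le>\<^sub>N suc (suc m) \<star> H"
          using grid[of "c \<star> j"] S j by auto
        have jN: "j \<in> N" "m \<in> N" using j m SN_N by simp_all
        have "(a \<star> H) \<star> j \<le>\<^sub>N (k \<star> c \<uplus> b \<star> H) \<star> j" using le NN jN k H by (intro nle_pmul_mono) simp_all
        also have "(k \<star> c \<uplus> b \<star> H) \<star> j = k \<star> (c \<star> j) \<uplus> (b \<star> j) \<star> H" by (simp add: N_algebra)
        finally have 1: "(a \<star> H) \<star> j \<le>\<^sub>N k \<star> (c \<star> j) \<uplus> (b \<star> j) \<star> H" .
        have 2: "k \<star> (c \<star> j) \<uplus> (b \<star> j) \<star> H \<le>\<^sub>N suc (suc m) \<star> H \<uplus> (b \<star> j) \<star> H"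
          using m(3) NN jN k H by simp
        have "(a \<star> H) \<star> j \<le>\<^sub>N suc (suc m) \<star> H \<uplus> (b \<star> j) \<star> H" by (rule nle_trans[OF _ 1 2]) (use NN jN H in simp)
        moreover have "(a \<star> H) \<star> j = (a \<star> j) \<star> H" by (simp add: pmul_ac)
        ultimately have "(a \<star> j) \<star> H \<le>\<^sub>N (suc (suc m) \<uplus> b \<star> j) \<star> H" by (simp add: padd_distrib_right)
        then have "a \<star> j \<le>\<^sub>N suc (suc m) \<uplus> b \<star> j"
          using nle_pmul_cancel[of "a \<star> j" "suc (suc m) \<uplus> b \<star> j" H] NN jN H H0 by simp
        then have "emb (a \<star> j) \<le>\<^sub>R emb (m \<uplus> (suc (suc emp) \<uplus> b \<star> j))"
          using S j m jN NN by (subst emb_le) (simp_all add: padd_suc padd_assoc[symmetric])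
        then have h1: "emb a \<^bold>* emb j \<le>\<^sub>R emb m \<^bold>+ (t \<^bold>+ emb b \<^bold>* emb j)"
          using S j m(1) by (simp add: emb_add emb_mult t_def)
        have j': "emb j \<in> carrier RR" "emb m \<in> carrier RR" using j m by simp_all
        have "emb m \<^bold>+ (t \<^bold>+ emb b \<^bold>* emb j) \<le>\<^sub>R
            x \<^bold>* (emb c \<^bold>* emb j) \<^bold>+ (t \<^bold>+ emb b \<^bold>* emb j)"
          using m(2) S j j' t cc x by (simp add: emb_mult)
        also have "x \<^bold>* (emb c \<^bold>* emb j) \<^bold>+ (t \<^bold>+ emb b \<^bold>* emb j) =
            (x \<^bold>* emb c \<^bold>+ emb b) \<^bold>* emb j \<^bold>+ t"
          using j' t cc x(1) by algebra
        finally have h2: "emb m \<^bold>+ (t \<^bold>+ emb b \<^bold>* emb j) \<le>\<^sub>R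
            (x \<^bold>* emb c \<^bold>+ emb b) \<^bold>* emb j \<^bold>+ t" .
        show "emb a \<^bold>* emb j \<le>\<^sub>R (x \<^bold>* emb c \<^bold>+ emb b) \<^bold>* emb j \<^bold>+ t"
          by (rule RF.le_trans[OF _ _ _ h1 h2]) (use j' t cc x(1) in simp_all)
      qed (use cc x t in simp_all)
      then show "iota r \<le>\<^sub>R x" using iota_le_iff(1)[OF w S x(1)] by simp }
    { assume "q \<le>\<^sub>Q r"
      then have le: "k \<star> c \<uplus> b \<star> H \<le>\<^sub>N a \<star> H" using val_le[OF v w] NN H by simp
      have "x \<^bold>* emb c \<^bold>+ emb b \<le>\<^sub>R emb a"
      proof (rule le_if_multiples_le[where w = t])
        fix j assume j: "j \<in> SN"
        obtain m where m: "m \<in> SN" "x \<^bold>* emb (c \<star> j) \<le>\<^sub>R emb (suc m)" "m \<star> H \<le>\<^sub>N k \<star> (c \<star> j) \<uplus> H"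
          using grid[of "c \<star> j"] S j by auto
        have jN: "j \<in> N" "m \<in> N" using j m SN_N by simp_all
        have "(k \<star> c \<uplus> b \<star> H) \<star> j \<le>\<^sub>N (a \<star> H) \<star> j" using le NN jN k H by (intro nle_pmul_mono) simp_all
        then have "(k \<star> c \<uplus> b \<star> H) \<star> j \<uplus> H \<le>\<^sub>N (a \<star> H) \<star> j \<uplus> H" using NN jN k H by simp
        moreover have "(k \<star> c \<uplus> b \<star> H) \<star> j \<uplus> H = (k \<star> (c \<star> j) \<uplus> H) \<uplus> (b \<star> j) \<star> H" by (simp add: N_algebra)
        moreover have "(a \<star> H) \<star> j \<uplus> H = suc (a \<star> j) \<star> H" using NN jN H by (simp add: suc_pmul_N pmul_assoc pmul_commute[of H j])
        ultimately have 2: "(k \<star> (c \<star> j) \<uplus> H) \<uplus> (b \<star> j) \<star> H \<le>\<^sub>N suc (a \<star> j) \<star> H" by simp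
        have 1: "m \<star> H \<uplus> (b \<star> j) \<star> H \<le>\<^sub>N (k \<star> (c \<star> j) \<uplus> H) \<uplus> (b \<star> j) \<star> H"
          using m(3) NN jN k H by simp
        have "m \<star> H \<uplus> (b \<star> j) \<star> H \<le>\<^sub>N suc (a \<star> j) \<star> H" by (rule nle_trans[OF _ 1 2]) (use NN jN H in simp)
        then have "(m \<uplus> b \<star> j) \<star> H \<le>\<^sub>N suc (a \<star> j) \<star> H" by (simp add: padd_distrib_right)
        then have "m \<uplus> b \<star> j \<le>\<^sub>N suc (a \<star> j)"
          using nle_pmul_cancel[of "m \<uplus> b \<star> j" "suc (a \<star> j)" H] NN jN H H0 by simp
        then have "(m \<uplus> b \<star> j) \<uplus> one\<^sub>N \<le>\<^sub>N suc (a \<star> j) \<uplus> one\<^sub>N" using NN jN by simp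
        then have "emb (suc m \<uplus> b \<star> j) \<le>\<^sub>R emb (a \<star> j \<uplus> suc (suc emp))"
          using S j m jN NN by (subst emb_le) (simp_all add: padd_suc suc_padd_N)
        then have h2: "emb (suc m) \<^bold>+ emb b \<^bold>* emb j \<le>\<^sub>R emb a \<^bold>* emb j \<^bold>+ t"
          using S j m(1) by (simp only: emb_add emb_mult t_def SN_pmul SN_suc SN_emp)
        have j': "emb j \<in> carrier RR" "emb (suc m) \<in> carrier RR" using j m by simp_all
        have "(x \<^bold>* emb c \<^bold>+ emb b) \<^bold>* emb j =
            x \<^bold>* (emb c \<^bold>* emb j) \<^bold>+ emb b \<^bold>* emb j"
          using j' cc x(1) by algebra
        also have "\<dots> \<le>\<^sub>R emb (suc m) \<^bold>+ emb b \<^bold>* emb j"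
          using m(2) S j j' t cc x by (simp add: emb_mult)
        finally have h1: "(x \<^bold>* emb c \<^bold>+ emb b) \<^bold>* emb j \<le>\<^sub>R
            emb (suc m) \<^bold>+ emb b \<^bold>* emb j" .
        show "(x \<^bold>* emb c \<^bold>+ emb b) \<^bold>* emb j \<le>\<^sub>R emb a \<^bold>* emb j \<^bold>+ t"
          by (rule RF.le_trans[OF _ _ _ h1 h2]) (use j' t cc x(1) in simp_all)
      qed (use cc x t in simp_all)
      then show "x \<le>\<^sub>R iota r" using iota_le_iff(2)[OF w S x(1)] by simp }
  qed (use qbd x in simp_all)
  then show ?thesis by (simp add: q_def)
qed

lemma cut_surj: assumes x: "x \<in> carrier RR" shows "\<exists>q. SP.cut q x"
proof -
  have nonneg: "\<exists>q. SP.cut q y" if y: "y \<in> carrier RR" "\<^bold>0 \<le>\<^sub>R y" for y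
  proof -
    obtain H where H: "H \<in> N" "H \<notin> SN" using nonstandard_exists by blast
    obtain B where B: "B \<in> SN" "\<not> emb B \<le>\<^sub>R y" using archimedean[OF y(1)] by blast
    then have "y \<le>\<^sub>R emb B" using RF.lt_imp_le[of y "emb B"] y by simp
    then obtain k where "k \<in> N" "k \<le>\<^sub>N B \<star> H" "\<forall>i\<in>SN. \<not> bad y H i k"
      using good_index[OF y H B(1)] by blast
    then show ?thesis using cut_good_index[OF y H B(1)] by blast
  qed
  show ?thesis
  proof (cases "\<^bold>0 \<le>\<^sub>R x")
    case False
    then have "\<^bold>0 \<le>\<^sub>R \<ominus>\<^bsub>RR\<^esub> x" using RF.minus_nonneg[OF x] RF.lt_imp_le[of x "\<^bold>0"] x by simp
    then obtain q where "SP.cut q (\<ominus>\<^bsub>RR\<^esub> x)" using nonneg[of "\<ominus>\<^bsub>RR\<^esub> x"] x by auto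
    from SP.cut_minus[OF this] show ?thesis using x by auto
  qed (use nonneg x in blast)
qed

lemma square_root_exists:
  assumes w: "w \<in> carrier RR" "\<not> w \<le>\<^sub>R \<^bold>0"
  shows "\<exists>y\<in>carrier RR. y \<^bold>* y = w"
proof -
  let ?E = "\<lambda>y. y \<in> carrier RR \<and> \<^bold>0 \<le>\<^sub>R y \<and> rmul y y \<le>\<^sub>R w"
  have w0: "\<^bold>0 \<le>\<^sub>R w" using RF.lt_imp_le[of "\<^bold>0" w] w by simp
  have w1: "\<^bold>1 \<le>\<^sub>R w \<^bold>+ \<^bold>1" "w \<le>\<^sub>R w \<^bold>+ \<^bold>1"
    using w0 w RF.le_add_iff[of "\<^bold>0" w "\<^bold>1"] RF.le_add_iff2[of "\<^bold>0" "\<^bold>1" w] by simp_all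
  \<comment> \<open>An upper bound for all admissible \<open>y\<close>: one beyond \<open>b\<close>
    would be at least one, so its square would be at least \<open>y\<close>, thus at least
    \<open>b\<close>, and exceed \<open>w\<close>.\<close>
  define b where "b = w \<^bold>+ \<^bold>1"
  have b: "b \<in> carrier RR" "\<^bold>1 \<le>\<^sub>R b" "\<not> b \<le>\<^sub>R w"
    using w w1 RF.le_add_iff2[of "\<^bold>1" "\<^bold>0" w] RF.zero_lt_one by (simp_all add: b_def)
  have E: "?E y \<longleftrightarrow> y \<in> carrier RR \<and> \<^bold>0 \<le>\<^sub>R y \<and> y \<^bold>* y \<le>\<^sub>R w" for y by (auto simp: rmul_eq)
  have "dfn UNIV V (\<lambda>e. ?E (e 0))" by (intro real_intros carrier_V w RF.zero_closed)
  from is_cls_Collect[where P = ?E, OF this] have cls: "is_cls {y \<in> V. ?E y}" .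
  have ub: "y \<le>\<^sub>R b" if y: "y \<in> carrier RR" "\<^bold>0 \<le>\<^sub>R y" "y \<^bold>* y \<le>\<^sub>R w" for y
  proof (rule ccontr)
    assume "\<not> y \<le>\<^sub>R b"
    then have by': "b \<le>\<^sub>R y" using RF.lt_imp_le[of b y] b y by simp
    have 1: "\<^bold>1 \<le>\<^sub>R y" using RF.le_trans[of "\<^bold>1" b y] b by' y by simp
    have "y \<le>\<^sub>R y \<^bold>* y" using RF.mult_mono[of "\<^bold>1" y y] 1 y by simp
    then have "b \<le>\<^sub>R y \<^bold>* y" using RF.le_trans[of b y "y \<^bold>* y"] by' b y by simp
    then show False using RF.le_trans[of b "y \<^bold>* y" w] b y w by simp
  qed
  have z: "?E \<^bold>0" unfolding E using w0 RF.le_refl by simp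
  have "\<exists>s\<in>carrier RR. (\<forall>y\<in>{y \<in> V. ?E y}. y \<le>\<^sub>R s) \<and>
      (\<forall>b\<in>carrier RR. (\<forall>y\<in>{y \<in> V. ?E y}. y \<le>\<^sub>R b) \<longrightarrow> s \<le>\<^sub>R b)"
  proof (rule R_complete[OF cls _ _ b(1)])
    show "{y \<in> V. ?E y} \<noteq> {}" using z carrier_V by blast
    show "\<forall>y\<in>{y \<in> V. ?E y}. y \<le>\<^sub>R b" using ub unfolding E by blast
  qed blast
  then obtain s where s: "s \<in> carrier RR" "\<forall>y\<in>{y \<in> V. ?E y}. y \<le>\<^sub>R s"
    "\<forall>b\<in>carrier RR. (\<forall>y\<in>{y \<in> V. ?E y}. y \<le>\<^sub>R b) \<longrightarrow> s \<le>\<^sub>R b" by (elim bexE conjE)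
  have "s \<^bold>* s = w"
  proof (rule RF.square_root[OF w s(1)])
    show "\<exists>z\<in>carrier RR. \<not> z \<le>\<^sub>R x \<and> \<not> y \<le>\<^sub>R z" if "x \<in> carrier RR" "y \<in> carrier RR" "\<not> y \<le>\<^sub>R x" for x y
      using SQ_dense[OF that] iota_R by blast
    show "y \<le>\<^sub>R s" if "y \<in> carrier RR" "\<^bold>0 \<le>\<^sub>R y" "y \<^bold>* y \<le>\<^sub>R w" for y
      using that E carrier_V by (intro bspec[OF s(2)]) blast
    show "s \<le>\<^sub>R b" if "b \<in> carrier RR"
      "\<And>y. y \<in> carrier RR \<Longrightarrow> \<^bold>0 \<le>\<^sub>R y \<Longrightarrow> y \<^bold>* y \<le>\<^sub>R w \<Longrightarrow> y \<le>\<^sub>R b" for b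
      using that E by (intro mp[OF bspec[OF s(3)]]) blast+
  qed
  then show ?thesis using s(1) by blast
qed

subsection \<open>The ring of bounded rational numbers\<close>

lemma qabs_le: assumes "q \<in> Q" "r \<in> Q" shows "qabs q \<le>\<^sub>Q r \<longleftrightarrow> qminus r \<le>\<^sub>Q q \<and> q \<le>\<^sub>Q r"
proof -
  note c = assms qminus_Q[OF assms(1)] qminus_Q[OF assms(2)] qzero_Q
  have m: "qminus r \<le>\<^sub>Q q \<longleftrightarrow> qminus q \<le>\<^sub>Q r"
    using QF.le_minus_iff[of r "qminus q"] c a_inv_Qring[OF assms(2)] a_inv_Qring[OF c(3)]
    by (simp add: qminus_qminus)
  have n: "qzero \<le>\<^sub>Q qminus q \<longleftrightarrow> q \<le>\<^sub>Q qzero" using QF.minus_nonneg[of q] c a_inv_Qring[OF assms(1)] by simp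
  show ?thesis
  proof (cases "qzero \<le>\<^sub>Q q")
    case True
    have "qminus q \<le>\<^sub>Q r" if "q \<le>\<^sub>Q r"
      using QF.le_trans[of "qminus q" q r] QF.le_trans[of "qminus q" qzero q] True that c
        QF.le_minus_iff[of q qzero] a_inv_Qring[OF assms(1)] a_inv_Qring[OF qzero_Q] QF.minus_zero by simp
    then show ?thesis using True m by (auto simp: qabs_def)
  next
    case False
    then have "q \<le>\<^sub>Q qzero" using QF.lt_imp_le[of q qzero] c by simp
    then have "q \<le>\<^sub>Q r" if "qminus q \<le>\<^sub>Q r"
      using QF.le_trans[of q "qminus q" r] QF.le_trans[of q qzero "qminus q"] n that c by simp
    then show ?thesis using False m by (auto simp: qabs_def qminus_def[symmetric])
  qed
qed

lemma qabs_Q: "q \<in> Q \<Longrightarrow> qabs q \<in> Q"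
  using qminus_Q by (simp add: qabs_def qminus_def)

lemma SQ_Q: "r \<in> SQ \<Longrightarrow> r \<in> Q"
  by (simp add: SQ_def)

lemma Qb_eq: "Qb = SP.bd"
proof (rule Set.set_eqI)
  fix q
  have *: "qabs q \<le>\<^sub>Q r \<longleftrightarrow> \<ominus>\<^bsub>Qring\<^esub> r \<le>\<^sub>Q q \<and> q \<le>\<^sub>Q r" if "q \<in> Q" "r \<in> SQ" for r
    using qabs_le[OF that(1) SQ_Q[OF that(2)]] a_inv_Qring[OF SQ_Q[OF that(2)]] by simp
  show "q \<in> Qb \<longleftrightarrow> q \<in> SP.bd"
  proof
    assume "q \<in> Qb"
    then obtain r where "q \<in> Q" "r \<in> SQ" "qabs q \<le>\<^sub>Q r" by (auto simp: Qb_def qless_def)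
    then show "q \<in> SP.bd" using * unfolding SP.bd_def by auto
  next
    assume "q \<in> SP.bd"
    then obtain r where r: "q \<in> Q" "r \<in> SQ" "qabs q \<le>\<^sub>Q r" using * unfolding SP.bd_def by auto
    \<comment> \<open>Membership in \<open>Qb\<close> demands a strict bound, \<open>SP.bd\<close> a
      nonstrict one; adding one makes up the difference.\<close>
    have s: "qadd r qone \<in> SQ" using iota_qadd(1)[OF r(2) qone_SQ] .
    have c: "r \<in> Q" "qabs q \<in> Q" "qadd r qone \<in> Q" "qone \<in> Q" "qzero \<in> Q"
      using r s SQ_Q qabs_Q qone_Q qzero_Q by simp_all
    have 1: "\<not> qadd r qone \<le>\<^sub>Q r" using QF.le_add_iff2[of qone qzero r] QF.zero_lt_one c QF.r_zero[of r] by simp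
    have "qabs q \<le>\<^sub>Q qadd r qone"
      using QF.le_trans[of "qabs q" r "qadd r qone"] QF.lt_imp_le[of r "qadd r qone"] 1 r c by simp
    moreover have "qabs q \<noteq> qadd r qone" using 1 r(3) by metis
    ultimately show "q \<in> Qb" using r s unfolding Qb_def qless_def by blast
  qed
qed

lemma mu0_eq: "mu0 = {q \<in> SP.bd. SP.st q = \<^bold>0}"
proof -
  have "(\<forall>r\<in>SQ. qzero <\<^sub>Q r \<longrightarrow> qabs q <\<^sub>Q r) \<longleftrightarrow> SP.st q = \<^bold>0" if q: "q \<in> SP.bd" for q
  proof -
    have qQ: "q \<in> Q" using SP.bd_A[OF q] by simp
    have lt: "a <\<^sub>Q b \<longleftrightarrow> \<not> b \<le>\<^sub>Q a" if "a \<in> Q" "b \<in> Q" for a b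
      using QF.le_total[of a b] QF.le_antisym[of a b] QF.le_refl[of a] that unfolding qless_def by auto
    have "(qzero <\<^sub>Q r \<longrightarrow> qabs q <\<^sub>Q r) \<longleftrightarrow>
      (\<not> r \<le>\<^sub>Q qzero \<longrightarrow> \<not> r \<le>\<^sub>Q q \<and> \<not> q \<le>\<^sub>Q \<ominus>\<^bsub>Qring\<^esub> r)" if r: "r \<in> SQ" for r
    proof -
      note c = qQ SQ_Q[OF r] qzero_Q qminus_Q[OF qQ] qminus_Q[OF SQ_Q[OF r]] qabs_Q[OF qQ]
      have m: "q \<le>\<^sub>Q qminus r \<longleftrightarrow> r \<le>\<^sub>Q qminus q"
        using QF.le_minus_iff[of "qminus q" r] c a_inv_Qring[OF c(2)] a_inv_Qring[OF c(4)] by (simp add: qminus_qminus)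
      have n: "qzero \<le>\<^sub>Q qminus q \<longleftrightarrow> q \<le>\<^sub>Q qzero" "qminus q \<le>\<^sub>Q qzero \<longleftrightarrow> qzero \<le>\<^sub>Q q"
        using QF.minus_nonneg[of q] QF.minus_nonneg[of "qminus q"] c a_inv_Qring[OF qQ] a_inv_Qring[OF c(4)]
        by (simp_all add: qminus_qminus)
      have a: "r \<le>\<^sub>Q qabs q \<longleftrightarrow> r \<le>\<^sub>Q q \<or> q \<le>\<^sub>Q qminus r" if r0: "\<not> r \<le>\<^sub>Q qzero"
      proof (cases "qzero \<le>\<^sub>Q q")
        case True
        then have "\<not> r \<le>\<^sub>Q qminus q" using QF.le_trans[of r "qminus q" qzero] n r0 c by auto
        then show ?thesis using True m by (simp add: qabs_def)
      next
        case False
        then have "\<not> r \<le>\<^sub>Q q" using QF.le_trans[of r q qzero] QF.lt_imp_le[of q qzero] r0 c by auto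
        then show ?thesis using False m by (simp add: qabs_def qminus_def[symmetric])
      qed
      show ?thesis unfolding lt[OF c(3,2)] lt[OF c(6,2)] a_inv_Qring[OF c(2)] using a by blast
    qed
    then show ?thesis using SP.st_zero_iff[OF q] by (simp cong: ball_cong)
  qed
  then show ?thesis unfolding mu0_def Qb_eq by blast
qed

subsection \<open>The standard part as a class\<close>

lemma bd_iff:
  assumes v: "val q a b c"
  shows "q \<in> SP.bd \<longleftrightarrow> (\<exists>i\<in>SN. \<exists>j\<in>SN. \<exists>k\<in>SN. k \<noteq> emp \<and>
    j \<star> c \<uplus> b \<star> k \<le>\<^sub>N a \<star> k \<uplus> i \<star> c \<and> a \<star> k \<uplus> j \<star> c \<le>\<^sub>N i \<star> c \<uplus> b \<star> k)"
    (is "_ \<longleftrightarrow> ?B")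
proof -
  have *: "\<ominus>\<^bsub>Qring\<^esub> r \<le>\<^sub>Q q \<and> q \<le>\<^sub>Q r \<longleftrightarrow>
    j \<star> c \<uplus> b \<star> k \<le>\<^sub>N a \<star> k \<uplus> i \<star> c \<and> a \<star> k \<uplus> j \<star> c \<le>\<^sub>N i \<star> c \<uplus> b \<star> k"
    if w: "val r i j k" for r i j k
    using val_le[OF val_minus[OF w] v] val_le[OF v w] a_inv_Qring[OF val_Q[OF w]] by simp
  show ?thesis
  proof
    assume "q \<in> SP.bd"
    then obtain r where r: "r \<in> SQ" "\<ominus>\<^bsub>Qring\<^esub> r \<le>\<^sub>Q q \<and> q \<le>\<^sub>Q r" unfolding SP.bd_def by blast
    obtain i j k where w: "i \<in> SN" "j \<in> SN" "k \<in> SN" "val r i j k" using SQ_val[OF r(1)] by blast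
    then show ?B using iffD1[OF *[OF w(4)] r(2)] val_in[OF w(4)] by blast
  next
    assume ?B
    then obtain i j k where S: "i \<in> SN" "j \<in> SN" "k \<in> SN" "k \<noteq> emp" and
      le: "j \<star> c \<uplus> b \<star> k \<le>\<^sub>N a \<star> k \<uplus> i \<star> c \<and> a \<star> k \<uplus> j \<star> c \<le>\<^sub>N i \<star> c \<uplus> b \<star> k" by blast
    then have w: "val (reduce i j k) i j k" using SN_N by (intro val_reduce) simp_all
    show "q \<in> SP.bd" using iffD2[OF *[OF w] le] val_SQ[OF w S(1-3)] val_Q[OF v] unfolding SP.bd_def by auto
  qed
qed

text \<open>Spells out \<open>SP.cut (rat a b c) x\<close> with quantifiers over numbers only, so that class comprehension
  applies to it.\<close>

definition graph_cond :: "'c \<Rightarrow> 'c \<Rightarrow> 'c \<Rightarrow> 'c \<Rightarrow> bool" where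
  "graph_cond a b c x \<longleftrightarrow> (c \<noteq> emp \<and> (a = emp \<or> b = emp) \<and>
      (\<forall>d\<in>N. (\<exists>k\<in>N. d \<star> k = a \<uplus> b) \<and> (\<exists>k\<in>N. d \<star> k = c) \<longrightarrow> d = one\<^sub>N)) \<and>
    (\<exists>i\<in>SN. \<exists>j\<in>SN. \<exists>k\<in>SN. k \<noteq> emp \<and>
      j \<star> c \<uplus> b \<star> k \<le>\<^sub>N a \<star> k \<uplus> i \<star> c \<and> a \<star> k \<uplus> j \<star> c \<le>\<^sub>N i \<star> c \<uplus> b \<star> k) \<and>
    x \<in> carrier RR \<and> (\<forall>i\<in>SN. \<forall>j\<in>SN. \<forall>k\<in>SN. k \<noteq> emp \<longrightarrow>
    (i \<star> c \<uplus> b \<star> k \<le>\<^sub>N a \<star> k \<uplus> j \<star> c \<longrightarrow> emb i \<le>\<^sub>R radd (rmul x (emb k)) (emb j)) \<and>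
    (a \<star> k \<uplus> j \<star> c \<le>\<^sub>N i \<star> c \<uplus> b \<star> k \<longrightarrow> radd (rmul x (emb k)) (emb j) \<le>\<^sub>R emb i))"

lemma graph_cond_iff:
  assumes N: "a \<in> N" "b \<in> N" "c \<in> N"
  shows "graph_cond a b c x \<longleftrightarrow> SP.cut (rat a b c) x"
proof (cases "rat a b c \<in> Q")
  case True
  then have v: "val (rat a b c) a b c" using val_self[OF True] qparts_rat[OF N] by simp
  have 1: "c \<noteq> emp \<and> (a = emp \<or> b = emp) \<and>
      (\<forall>d\<in>N. (\<exists>k\<in>N. d \<star> k = a \<uplus> b) \<and> (\<exists>k\<in>N. d \<star> k = c) \<longrightarrow> d = one\<^sub>N)"
    using True unfolding rat_in_Q[OF N] ncoprime_iff .
  show ?thesis unfolding graph_cond_def cut_iff[OF v] bd_iff[OF v]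
    by (rule iffI, erule conjunct2, erule conjI[OF 1])
next
  case False
  then have 1: "\<not> (c \<noteq> emp \<and> (a = emp \<or> b = emp) \<and>
      (\<forall>d\<in>N. (\<exists>k\<in>N. d \<star> k = a \<uplus> b) \<and> (\<exists>k\<in>N. d \<star> k = c) \<longrightarrow> d = one\<^sub>N))"
    unfolding rat_in_Q[OF N] ncoprime_iff .
  have "\<not> SP.cut (rat a b c) x" using False SP.cut_in(2) by auto
  then show ?thesis unfolding graph_cond_def using 1 by blast
qed

lemma st_class: "\<exists>F. \<forall>p. p \<epsilon> F \<longleftrightarrow> (\<exists>q x. SP.cut q x \<and> p = pair q x)"
proof -
  let ?P = "\<lambda>p. \<exists>a\<in>N. \<exists>b\<in>N. \<exists>c\<in>N. \<exists>x\<in>carrier RR. p = pair (pair (pair a b) c) x \<and> graph_cond a b c x"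
  have "dfn UNIV V (\<lambda>e. ?P (e 0))" unfolding graph_cond_def by (intro real_intros)
  from cls_Collect[where P = ?P, OF this order_refl]
  obtain F where F: "\<And>p. p \<epsilon> F \<longleftrightarrow> p \<in> V \<and> ?P p" by auto
  have "p \<epsilon> F \<longleftrightarrow> (\<exists>q x. SP.cut q x \<and> p = pair q x)" for p
  proof
    assume "p \<epsilon> F"
    then obtain a b c x where "a \<in> N" "b \<in> N" "c \<in> N" "p = pair (rat a b c) x" "graph_cond a b c x"
      unfolding F rat_def by blast
    then show "\<exists>q x. SP.cut q x \<and> p = pair q x" using graph_cond_iff by blast
  next
    assume "\<exists>q x. SP.cut q x \<and> p = pair q x"
    then obtain q x where qx: "SP.cut q x" "p = pair q x" by blast
    have q: "q \<in> Q" using SP.cut_in(2)[OF qx(1)] by simp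
    have r: "q = rat (qpos q) (qneg q) (qden q)" using iffD1[OF Q_iff q] by blast
    note N = Q_parts[OF q]
    have x: "x \<in> carrier RR" using SP.cut_in(3)[OF qx(1)] .
    have "graph_cond (qpos q) (qneg q) (qden q) x" using graph_cond_iff[OF N(1-3)] qx(1) r by simp
    moreover have "p = pair (pair (pair (qpos q) (qneg q)) (qden q)) x" using qx(2) r by (simp add: rat_def)
    moreover from this have "p \<in> V" using N N_V carrier_V[OF x] by simp
    ultimately show "p \<epsilon> F" unfolding F using N(1-3) x by blast
  qed
  then show ?thesis by blast
qed

lemma Q_V: "q \<in> Q \<Longrightarrow> q \<in> V"
  using Q_iff[of q] N_V by (metis rat_def pair_V)

lemma carrier_Qb_ring: "carrier Qb_ring = SP.bd"
  by (simp add: Qb_ring_def Qb_eq)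

lemma Qb_ring_simps: "mult Qb_ring = mult Qring" "add Qb_ring = add Qring" "one Qb_ring = one Qring"
  by (simp_all add: Qb_ring_def)

lemma st_hom_exists: "\<exists>F. surj_ring_hom F Qb_ring RR \<and> (\<forall>q\<in>SP.bd. app F q = SP.st q)"
proof -
  obtain F where F: "\<And>p. p \<epsilon> F \<longleftrightarrow> (\<exists>q x. SP.cut q x \<and> p = pair q x)" using st_class by blast
  have V: "q \<in> V" "x \<in> V" if "SP.cut q x" for q x
    using Q_V SP.cut_in[OF that] carrier_V by simp_all
  have mem: "pair q x \<epsilon> F \<longleftrightarrow> SP.cut q x" if "q \<in> V" "x \<in> V" for q x
    using F[of "pair q x"] that V pair_eq[of q x] by metis
  have bdV: "q \<in> V" if "q \<in> SP.bd" for q using Q_V SP.bd_A[OF that] by simp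
  have on: "fun_on F SP.bd" unfolding fun_on_def
  proof (intro conjI ballI)
    fix p assume "p \<in> elts F"
    then have "\<exists>q x. SP.cut q x \<and> p = pair q x" using F by simp
    then obtain q x where "SP.cut q x" "p = pair q x" by blast
    then show "\<exists>q\<in>SP.bd. \<exists>x\<in>V. p = pair q x" using SP.cut_in(1) V by blast
  next
    fix q assume q: "q \<in> SP.bd"
    note c = SP.cut_st[OF q]
    show "\<exists>!x. x \<in> V \<and> pair q x \<epsilon> F"
      by (rule ex1I[of _ "SP.st q"]) (use mem[OF bdV[OF q]] V[OF c] c SP.cut_unique[OF c] in blast)+
  qed
  have ap: "app F q = SP.st q" if q: "q \<in> SP.bd" for q
    using app_eq_iff[OF on q V(2)[OF SP.cut_st[OF q]]] mem[OF V[OF SP.cut_st[OF q]]] SP.cut_st[OF q] by metis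
  have stR: "SP.st q \<in> carrier RR" if "q \<in> SP.bd" for q using SP.cut_in(3)[OF SP.cut_st[OF that]] .
  have "surj_ring_hom F Qb_ring RR" unfolding surj_ring_hom_def carrier_Qb_ring
  proof (intro conjI)
    show "fun_into F SP.bd (carrier RR)" unfolding fun_into_def using on ap stR by simp
    show "app F \<in> ring_hom Qb_ring RR"
    proof (rule ring_hom_memI, unfold carrier_Qb_ring Qb_ring_simps)
      fix p assume p: "p \<in> SP.bd"
      show "app F p \<in> carrier RR" using ap[OF p] stR[OF p] by simp
      fix q assume q: "q \<in> SP.bd"
      note c = SP.cut_st[OF p] SP.cut_st[OF q]
      show "app F (p \<otimes>\<^bsub>Qring\<^esub> q) = app F p \<^bold>* app F q"
        using SP.st_eq[OF SP.cut_mult[OF c]] ap[OF SP.bd_mult[OF p q]] ap p q by simp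
      show "app F (p \<oplus>\<^bsub>Qring\<^esub> q) = app F p \<^bold>+ app F q"
        using SP.st_eq[OF SP.cut_add[OF c]] ap[OF SP.bd_add[OF p q]] ap p q by simp
    next
      show "app F \<one>\<^bsub>Qring\<^esub> = \<^bold>1"
        using SP.st_eq[OF SP.cut_T[OF qone_SQ]] ap[OF SP.bd_T[OF qone_SQ]] iota_qone by simp
    qed
    show "app F ` SP.bd = carrier RR"
    proof
      show "app F ` SP.bd \<subseteq> carrier RR" using ap stR by auto
      show "carrier RR \<subseteq> app F ` SP.bd"
      proof
        fix x assume "x \<in> carrier RR"
        then obtain q where q: "SP.cut q x" using cut_surj by blast
        then have "x = app F q" using ap SP.st_eq SP.cut_in(1) by simp
        then show "x \<in> app F ` SP.bd" using SP.cut_in(1)[OF q] by blast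
      qed
    qed
  qed
  then show ?thesis using ap by blast
qed

text \<open>It remains to supply the hypotheses of \<open>SP.hom_is_cut\<close>, above all the
  agreement of an arbitrary homomorphism with \<open>iota\<close> on the standard rationals.\<close>

lemma surj_ring_hom_st:
  assumes F: "surj_ring_hom F Qb_ring RR" and q: "q \<in> SP.bd"
  shows "app F q = SP.st q"
proof -
  have on: "fun_on F SP.bd" and hom: "app F \<in> ring_hom Qb_ring RR" and im: "app F ` SP.bd = carrier RR"
    using F unfolding surj_ring_hom_def fun_into_def carrier_Qb_ring by blast+
  have R: "app F p \<in> carrier RR" if "p \<in> SP.bd" for p using im that by blast
  have add: "app F (p \<oplus>\<^bsub>Qring\<^esub> q) = app F p \<^bold>+ app F q" if "p \<in> SP.bd" "q \<in> SP.bd" for p q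
    using ring_hom_add[OF hom] that unfolding carrier_Qb_ring Qb_ring_simps by blast
  have mult: "app F (p \<otimes>\<^bsub>Qring\<^esub> q) = app F p \<^bold>* app F q" if "p \<in> SP.bd" "q \<in> SP.bd" for p q
    using ring_hom_mult[OF hom] that unfolding carrier_Qb_ring Qb_ring_simps by blast
  have one: "app F qone = \<^bold>1" using ring_hom_one[OF hom] unfolding Qb_ring_simps by simp
  define nt where "nt n = rat n emp one\<^sub>N" for n
  have v: "val (nt n) n emp one\<^sub>N" if "n \<in> N" for n using val_nat[OF that] by (simp add: nt_def)
  have nbd: "nt n \<in> SP.bd" if "n \<in> SN" for n
    using SP.bd_T[OF val_SQ[OF v[OF SN_N[OF that]] that]] by simp
  have zero: "app F qzero = \<^bold>0"
  proof -
    have z: "qzero \<in> SP.bd" using SP.bd_T[OF SP.T_zero] by simp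
    have "app F qzero \<^bold>+ app F qzero = app F qzero"
      using add[OF z z] QF.l_zero[of qzero] qzero_Q by simp
    then show ?thesis using R[OF z] by simp
  qed
  have nat: "app F (nt n) = emb n" if n: "n \<in> SN" for n
  proof -
    have mem: "pair (nt n) (emb n) \<epsilon> F \<longleftrightarrow> emb n = app F (nt n)" if "n \<in> SN" for n
      using app_eq_iff[OF on nbd[OF that] emb_V[OF that]] by simp
    \<comment> \<open>Membership in the class \<open>F\<close> is definable as it stands, so the
      induction concerns pairs in \<open>F\<close> and not values of \<open>app F\<close>.\<close>
    have "pair (nt n) (emb n) \<epsilon> F"
    proof (rule SN_induct[where P = "\<lambda>n. pair (nt n) (emb n) \<epsilon> F", OF n])
      show "dfn UNIV V (\<lambda>e. pair (nt (e 0)) (emb (e 0)) \<epsilon> F)"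
        unfolding nt_def rat_def by (intro real_intros suc_V emp_V)
      have "app F (nt emp) = emb emp" using zero by (simp add: nt_def qzero_def emb_emp)
      then show "pair (nt emp) (emb emp) \<epsilon> F" using mem[OF SN_emp] by simp
      fix n assume n: "n \<in> SN" "pair (nt n) (emb n) \<epsilon> F"
      have nN: "n \<in> N" using n SN_N by blast
      have "val (qadd (nt n) qone) (suc n) emp one\<^sub>N"
        using val_add_common[OF v[OF nN] val_one] nN by (simp add: padd_one)
      then have "nt (suc n) = nt n \<oplus>\<^bsub>Qring\<^esub> qone" using val_unique v nN by (metis N_suc Qring_simps(5))
      then have "app F (nt (suc n)) = emb (suc n)"
        using add[OF nbd[OF n(1)] SP.bd_T[OF qone_SQ]] one mem n by (simp add: emb_suc)
      then show "pair (nt (suc n)) (emb (suc n)) \<epsilon> F" using mem[OF SN_suc[OF n(1)]] by simp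
    qed
    then show ?thesis using mem[OF n] by simp
  qed
  have T: "app F r = iota r" if r: "r \<in> SQ" for r
  proof -
    obtain a b c where S: "a \<in> SN" "b \<in> SN" "c \<in> SN" and w: "val r a b c" using SQ_val[OF r] by blast
    have NN: "a \<in> N" "b \<in> N" "c \<in> N" "c \<noteq> emp" using val_in[OF w] by simp_all
    have p: "r \<in> SP.bd" "nt a \<in> SP.bd" "nt b \<in> SP.bd" "nt c \<in> SP.bd" using SP.bd_T[OF r] nbd S by simp_all
    \<comment> \<open>Aims at the equation \<open>r c + b = a\<close> in the rational field.
      Applying the homomorphism to it gives the equation that characterizes
      \<open>iota r\<close>.\<close>
    have 1: "val (qmul r (nt c)) (a \<star> c) (b \<star> c) c" using val_mul[OF w v[OF NN(3)]] NN by simp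
    have 2: "val (nt b) (b \<star> c) emp c" using val_scale[OF v[OF NN(2)] NN(3,4)] NN by simp
    have "val (qadd (qmul r (nt c)) (nt b)) a emp one\<^sub>N"
      by (subst val_iff[OF val_add_common[OF 1 2]]) (use NN in \<open>simp_all add: padd_commute\<close>)
    then have "qadd (qmul r (nt c)) (nt b) = nt a" using val_unique v[OF NN(1)] by blast
    then have "app F r \<^bold>* emb c \<^bold>+ emb b = emb a"
      using mult[OF p(1,4)] add[OF SP.bd_mult[OF p(1,4)] p(3)] nat S by simp
    then show ?thesis using iota_unique[OF w S R[OF p(1)]] by simp
  qed
  have "SP.cut q (app F q)"
  proof (rule SP.hom_is_cut[of "app F"])
    show "\<exists>p\<in>SP.bd. app F p = x" if "x \<in> carrier RR" for x using im that by (metis imageE)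
  qed (use R add mult T square_root_exists q in blast)+
  then show ?thesis using SP.st_eq by simp
qed

text \<open>Uniqueness is meant for classes: two homomorphisms have the same values by
  \<open>surj_ring_hom_st\<close>, and being functions on the same domain they then consist of the
  same pairs.\<close>

lemma standard_part_theorem:
  "(\<exists>!st. surj_ring_hom st Qb_ring RR) \<and>
    (\<forall>st. surj_ring_hom st Qb_ring RR \<longrightarrow> a_kernel Qb_ring RR (app st) = mu0)"
proof (intro conjI allI impI)
  have eq: "F = G" if F: "surj_ring_hom F Qb_ring RR" and G: "surj_ring_hom G Qb_ring RR" for F G
  proof (rule fun_on_eqI)
    show "fun_on F SP.bd" "fun_on G SP.bd"
      using F G unfolding surj_ring_hom_def fun_into_def carrier_Qb_ring by blast+
    show "SP.bd \<subseteq> V" using Q_V SP.bd_A by auto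
    show "app F q = app G q" if "q \<in> SP.bd" for q using surj_ring_hom_st that F G by simp
  qed
  show "\<exists>!st. surj_ring_hom st Qb_ring RR" using st_hom_exists eq by blast
  fix st assume "surj_ring_hom st Qb_ring RR"
  then have "app st q = SP.st q" if "q \<in> SP.bd" for q using surj_ring_hom_st that by blast
  then show "a_kernel Qb_ring RR (app st) = mu0"
    unfolding a_kernel_def' mu0_eq carrier_Qb_ring by auto
qed

end

theorem theorem6:
  fixes mem :: "'c \<Rightarrow> 'c \<Rightarrow> bool"
    and R A M L :: 'c
  assumes "THS mem"
    and "class_structure.real_field mem R A M L"
  shows "(\<exists>!st. class_structure.surj_ring_hom mem st
             (class_structure.Qb_ring mem) (class_structure.op_ring mem R A M)) \<and>
         (\<forall>st. class_structure.surj_ring_hom mem st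
             (class_structure.Qb_ring mem) (class_structure.op_ring mem R A M) \<longrightarrow>
           a_kernel (class_structure.Qb_ring mem) (class_structure.op_ring mem R A M)
             (class_structure.app mem st) = class_structure.mu0 mem)"
  by (rule THS_reals.standard_part_theorem[OF THS_reals.intro[OF assms(1) THS_reals_axioms.intro[OF assms(2)]]])

end
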